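(* Let $T>0$ be fixed and $h_n=T/n$. Let the observations be generated by model $m$ on $[0,T]$ with true parameter $\theta_{m,0}\in\Theta_m$. Assume: (a) each drift $B\in\{B_{1,m},B_{2,m},B_{3,m},B_{4,m}\}$ is globally Lipschitz and belongs to $C^4_{\uparrow}$, and each process $Y\in\{\xi_m,\delta_m,\varepsilon_m,\zeta_m\}$ satisfies $\sup_t \mathbb{E}[|Y_t|^{\ell}]<\infty$ for all $\ell\ge 0$; (b) for all $\theta_m\in\Theta_m$: $\Sigma_{\delta\delta,m}>0$, $\Sigma_{\varepsilon\varepsilon,m}>0$, $\Psi_m$ is non-singular, and $\operatorname{rank}\Lambda_{x_1,m}=k_{1,m}$; (c) for $\theta_m,\tilde\theta_m\in\Theta_m$, $\Sigma_m(\theta_m)=\Sigma_m(\tilde\theta_m)$ implies $\theta_m=\tilde\theta_m$; (d) $\operatorname{rank}\Delta_m=q_m$. Then, as $h_n\to0$ (i.e. $n\to\infty$), $$\hat\theta_{m,n}\longrightarrow\theta_{m,0}\quad\text{in }P_{\theta_{m,0}}\text{-probability}$$ and $$\sqrt n(\hat\theta_{m,n}-\theta_{m,0})\xrightarrow{d}N_{q_m}\Bigl(0,\bigl(\Delta_m^\top W_m(\theta_{m,0})^{-1}\Delta_m\bigr)^{-1}\Bigr).$$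
   Context: Notation. $p=p_1+p_2$, $\bar p=p(p+1)/2$. $|\cdot|$ is the Euclidean norm; $A>0$ means positive definite. For symmetric $A\in\mathbb{R}^{p\times p}$, $\operatorname{vec}A$ and $\operatorname{vech}A$ are the vectorization and half-vectorization, $\mathbb{D}_p$ is the $p^2\times\bar p$ duplication matrix ($\operatorname{vec}A=\mathbb{D}_p\operatorname{vech}A$), and $A^+$ denotes the Moore-Penrose inverse. $C^4_{\uparrow}(\mathbb{R}^d)$ is the set of functions on $\mathbb{R}^d$ that are four times continuously differentiable and which, together with all these derivatives, are of polynomial growth. $N_r(\mu,\Sigma)$ is the $r$-dimensional normal law. Model ($m$ is a model number). $p_1,p_2\ge1$, $k_{1,m}\le p_1$, $k_{2,m}\le p_2$ are fixed integers independent of $n$. The observable process is $X_t=(X_{1,t}^\top,X_{2,t}^\top)^\top\in\mathbb{R}^{p_1+p_2}$ with $$X_{1,t}=\Lambda_{x_1,m}\xi_{m,t}+\delta_{m,t},\quad X_{2,t}=\Lambda_{x_2,m}\eta_{m,t}+\varepsilon_{m,t},\quad \eta_{m,t}=B_{0,m}\eta_{m,t}+\Gamma_m\xi_{m,t}+\zeta_{m,t},$$ where $\Lambda_{x_1,m}\in\mathbb{R}^{p_1\times k_{1,m}}$, $\Lambda_{x_2,m}\in\mathbb{R}^{p_2\times k_{2,m}}$, $\Gamma_m\in\mathbb{R}^{k_{2,m}\times k_{1,m}}$, $B_{0,m}\in\mathbb{R}^{k_{2,m}\times k_{2,m}}$ (zero diagonal) are constant, and $\Psi_m=\mathbb{I}_{k_{2,m}}-B_{0,m}$.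 The latent processes (dimensions $k_{1,m},p_1,p_2,k_{2,m}$) solve $$d\xi_{m,t}=B_{1,m}(\xi_{m,t})dt+S_{1,m}dW_{1,t},\quad d\delta_{m,t}=B_{2,m}(\delta_{m,t})dt+S_{2,m}dW_{2,t},$$ $$d\varepsilon_{m,t}=B_{3,m}(\varepsilon_{m,t})dt+S_{3,m}dW_{3,t},\quad d\zeta_{m,t}=B_{4,m}(\zeta_{m,t})dt+S_{4,m}dW_{4,t},$$ with deterministic initial values, constant matrices $S_{i,m}$, and independent standard Wiener processes $W_1,\dots,W_4$ of dimensions $r_1,\dots,r_4$. Put $\Sigma_{\xi\xi,m}=S_{1,m}S_{1,m}^\top$, $\Sigma_{\delta\delta,m}=S_{2,m}S_{2,m}^\top$, $\Sigma_{\varepsilon\varepsilon,m}=S_{3,m}S_{3,m}^\top$, $\Sigma_{\zeta\zeta,m}=S_{4,m}S_{4,m}^\top$. Parameter. $\theta_m\in\Theta_m$, with $\Theta_m\subset\mathbb{R}^{q_m}$ convex and compact, collects the unknown, non-duplicated entries of $\Lambda_{x_1,m},\Lambda_{x_2,m},\Gamma_m,\Psi_m,\Sigma_{\xi\xi,m},\Sigma_{\delta\delta,m},\Sigma_{\varepsilon\varepsilon,m},\Sigma_{\zeta\zeta,m}$ (all other entries are known constants or equal to other entries), so these matrices are functions of $\theta_m$. $P_{\theta_m}$ is the law under parameter $\theta_m$. The covariance structure is $$\Sigma_m(\theta_m)=\begin{pmatrix}\Sigma_{X_1X_1,m}&\Sigma_{X_1X_2,m}\\ \Sigma_{X_1X_2,m}^\top&\Sigma_{X_2X_2,m}\end{pmatrix},$$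 $\Sigma_{X_1X_1,m}=\Lambda_{x_1,m}\Sigma_{\xi\xi,m}\Lambda_{x_1,m}^\top+\Sigma_{\delta\delta,m}$, $\Sigma_{X_1X_2,m}=\Lambda_{x_1,m}\Sigma_{\xi\xi,m}\Gamma_m^\top\Psi_m^{-1\top}\Lambda_{x_2,m}^\top$, $\Sigma_{X_2X_2,m}=\Lambda_{x_2,m}\Psi_m^{-1}(\Gamma_m\Sigma_{\xi\xi,m}\Gamma_m^\top+\Sigma_{\zeta\zeta,m})\Psi_m^{-1\top}\Lambda_{x_2,m}^\top+\Sigma_{\varepsilon\varepsilon,m}$. Observations. $X_{t_i^n}$ with $t_i^n=ih_n$, $0\le i\le n$, $T=nh_n$, and $Q_{XX}=\frac1T\sum_{i=1}^n(X_{t_i^n}-X_{t_{i-1}^n})(X_{t_i^n}-X_{t_{i-1}^n})^\top$. Further definitions. $W_m(\theta_m)=2\,\mathbb{D}_p^{+}\bigl(\Sigma_m(\theta_m)\otimes\Sigma_m(\theta_m)\bigr)\mathbb{D}_p^{+\top}$. $\Delta_m=\partial\operatorname{vech}\Sigma_m(\theta_m)/\partial\theta_m^\top\big|_{\theta_m=\theta_{m,0}}\in\mathbb{R}^{\bar p\times q_m}$ (Jacobian). For positive definite $X,Y\in\mathbb{R}^{p\times p}$, $$V(X,Y)=\mathbb{D}_p^\top\int_0^1\!\!\int_0^1\lambda_2\,(Y+\lambda_1\lambda_2(X-Y))^{-1}\otimes(Y+\lambda_1\lambda_2(X-Y))^{-1}\,d\lambda_1d\lambda_2\,\mathbb{D}_p.$$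 Set $\tilde V(Q_{XX},\Sigma)=V(Q_{XX},\Sigma)$ if $Q_{XX}$ is non-singular and $\tilde V(Q_{XX},\Sigma)=\mathbb{I}_{\bar p}$ otherwise, and $$\mathbb{F}_{m,n}(\theta_m)=(\operatorname{vech}Q_{XX}-\operatorname{vech}\Sigma_m(\theta_m))^\top\tilde V(Q_{XX},\Sigma_m(\theta_m))(\operatorname{vech}Q_{XX}-\operatorname{vech}\Sigma_m(\theta_m)).$$ (When $Q_{XX}>0$, $\mathbb{F}_{m,n}(\theta_m)=\log\det\Sigma_m(\theta_m)-\log\det Q_{XX}+\operatorname{tr}\{\Sigma_m(\theta_m)^{-1}Q_{XX}\}-p$.) The minimum contrast estimator $\hat\theta_{m,n}\in\Theta_m$ satisfies $\mathbb{F}_{m,n}(\hat\theta_{m,n})=\inf_{\theta_m\in\Theta_m}\mathbb{F}_{m,n}(\theta_m)$.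
   Formalization: Asymptotic normality is stated only for θ_{m,0} in the interior of Θ_m; at any boundary point of the convex set Θ_m the normal limit fails, since the estimator stays on one side of a supporting hyperplane. Consistency is kept for all θ_{m,0} in Θ_m. *)

theory Defs
  imports "HOL-Probability.Probability" "HOL-Library.Uprod"
begin

section \<open>Matrices\<close>

definition pos_def :: "real^'n^'n \<Rightarrow> bool" where
  "pos_def A \<longleftrightarrow> transpose A = A \<and> (\<forall>x. x \<noteq> 0 \<longrightarrow> x \<bullet> (A *v x) > 0)"

definition outer :: "real^'m \<Rightarrow> real^'n \<Rightarrow> real^'n^'m" where
  "outer x y = (\<chi> i j. x $ i * y $ j)"

definition kron :: "real^'n^'m \<Rightarrow> real^'l^'k \<Rightarrow> real^('n \<times> 'l)^('m \<times> 'k)" where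
  "kron A B = (\<chi> r c. A $ fst r $ fst c * B $ snd r $ snd c)"

definition stack :: "real^'m \<Rightarrow> real^'n \<Rightarrow> real^('m + 'n)" where
  "stack x y = (\<chi> i. case i of Inl a \<Rightarrow> x $ a | Inr b \<Rightarrow> y $ b)"

definition block_matrix ::
  "real^'m^'m \<Rightarrow> real^'n^'m \<Rightarrow> real^'m^'n \<Rightarrow> real^'n^'n \<Rightarrow> real^('m + 'n)^('m + 'n)" where
  "block_matrix A B C D = (\<chi> i j.
     case i of
       Inl a \<Rightarrow> (case j of Inl b \<Rightarrow> A $ a $ b | Inr b \<Rightarrow> B $ a $ b)
     | Inr a \<Rightarrow> (case j of Inl b \<Rightarrow> C $ a $ b | Inr b \<Rightarrow> D $ a $ b))"

definition is_moore_penrose :: "real^'n^'m \<Rightarrow> real^'m^'n \<Rightarrow> bool" where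
  "is_moore_penrose A X \<longleftrightarrow>
     A ** X ** A = A \<and> X ** A ** X = X \<and>
     transpose (A ** X) = A ** X \<and> transpose (X ** A) = X ** A"

definition moore_penrose :: "real^'n^'m \<Rightarrow> real^'m^'n" where
  "moore_penrose A = (THE X. is_moore_penrose A X)"

text \<open>
  Coordinates of a half-vectorization are indexed by unordered pairs of row/column indices.
  There are \<open>p (p + 1) / 2\<close> of them (lemma \<open>card_UNIV_uprod\<close>), one for each
  position of the lower triangle once the indices are ordered. For a symmetric
  matrix the entry does not depend on which of the two representatives is chosen.
  A vectorization is indexed by (column, row), as for column stacking.
\<close>

instance uprod :: (finite) finite
proof
  have "(UNIV :: 'a uprod set) = range (\<lambda>(a, b). Upair a b)"
    by (metis (mono_tags, lifting) UNIV_eq_I case_prod_conv range_eqI uprod_exhaust)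
  moreover have "finite (range (\<lambda>(a :: 'a, b). Upair a b))"
    by (rule finite_imageI) simp
  ultimately show "finite (UNIV :: 'a uprod set)"
    by (simp only:)
qed

definition vec_of :: "real^'n^'m \<Rightarrow> real^('n \<times> 'm)" where
  "vec_of A = (\<chi> k. A $ snd k $ fst k)"

definition vech :: "real^('p::finite)^'p \<Rightarrow> real^'p uprod" where
  "vech A = (\<chi> u. let (i, j) = (SOME (i, j). Upair i j = u) in A $ i $ j)"

definition dup :: "real^(('p::finite) uprod)^('p \<times> 'p)" where
  "dup = (\<chi> k u. if u = Upair (fst k) (snd k) then 1 else 0)"

lemma vech_Upair:
  assumes "transpose A = A"
  shows "vech A $ Upair i j = A $ i $ j"
proof -
  obtain a b where ab: "(SOME (a, b). Upair a b = Upair i j) = (a, b)"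
    by (metis surj_pair)
  have "(case (SOME (a, b). Upair a b = Upair i j) of (a, b) \<Rightarrow> Upair a b = Upair i j)"
    by (rule someI[where x = "(i, j)"]) simp
  then have "Upair a b = Upair i j"
    by (simp only: ab prod.case)
  moreover have "A $ j $ i = A $ i $ j"
    by (metis assms transpose_def vec_lambda_beta)
  moreover have "vech A $ Upair i j = A $ a $ b"
    by (simp only: vech_def vec_lambda_beta ab Let_def prod.case)
  ultimately show ?thesis
    by auto
qed

lemma dup_vech:
  assumes "transpose A = A"
  shows "vec_of A = dup *v vech A"
proof -
  have "A $ j $ i = A $ i $ j" for i j
    by (metis assms transpose_def vec_lambda_beta)
  then show ?thesis
    by (auto simp: vec_eq_iff vec_of_def dup_def matrix_vector_mult_def if_distrib if_distribR
        vech_Upair[OF assms] cong: if_cong)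
qed


section \<open>Probability\<close>

definition converges_in_prob ::
  "'w measure \<Rightarrow> (nat \<Rightarrow> 'w \<Rightarrow> 'b::metric_space) \<Rightarrow> 'b \<Rightarrow> bool" where
  "converges_in_prob M Z z \<longleftrightarrow>
     (\<forall>e>0. (\<lambda>n. measure M {\<omega> \<in> space M. dist (Z n \<omega>) z > e}) \<longlonglongrightarrow> 0)"

definition converges_in_dist ::
  "'w measure \<Rightarrow> (nat \<Rightarrow> 'w \<Rightarrow> 'b::euclidean_space) \<Rightarrow> 'b measure \<Rightarrow> bool" where
  "converges_in_dist M Z N \<longleftrightarrow>
     (\<forall>f::'b \<Rightarrow> real. continuous_on UNIV f \<longrightarrow> bounded (range f) \<longrightarrow>
        (\<lambda>n. \<integral>\<omega>. f (Z n \<omega>) \<partial>M) \<longlonglongrightarrow> (\<integral>x. f x \<partial>N))"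

text \<open>The normal law, for positive definite covariance matrices only.\<close>

definition multi_normal :: "real^'r \<Rightarrow> real^'r^'r \<Rightarrow> (real^'r) measure" where
  "multi_normal \<mu> C = density lborel (\<lambda>x. ennreal
     (exp (- ((x - \<mu>) \<bullet> (matrix_inv C *v (x - \<mu>))) / 2) / sqrt ((2 * pi) ^ CARD('r) * det C)))"

definition generated_events ::
  "'w measure \<Rightarrow> (real \<Rightarrow> 'w \<Rightarrow> 'b::topological_space) \<Rightarrow> real set \<Rightarrow> 'w set set" where
  "generated_events M Y I =
     sigma_sets (space M) (\<Union>t\<in>I. {Y t -` A \<inter> space M | A. A \<in> sets borel})"

definition standard_wiener :: "'w measure \<Rightarrow> real \<Rightarrow> (real \<Rightarrow> 'w \<Rightarrow> real^'r) \<Rightarrow> bool" where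
  "standard_wiener M T W \<longleftrightarrow>
     (\<forall>t\<in>{0..T}. W t \<in> borel_measurable M) \<and>
     (AE \<omega> in M. W 0 \<omega> = 0 \<and> continuous_on {0..T} (\<lambda>t. W t \<omega>)) \<and>
     (\<forall>s t. 0 \<le> s \<and> s < t \<and> t \<le> T \<longrightarrow>
        distr M borel (\<lambda>\<omega>. W t \<omega> - W s \<omega>) = multi_normal 0 (mat (t - s)) \<and>
        prob_space.indep_set M (generated_events M W {0..s})
          (generated_events M (\<lambda>u \<omega>. W u \<omega> - W s \<omega>) {t}))"

text \<open>
  Solution on \<open>[0, T]\<close> of \<open>dY = b(Y) dt + S dW\<close>, \<open>Y(0) = y0\<close>. The diffusion matrix is
  constant, so the stochastic integral of \<open>S\<close> up to time \<open>t\<close> is \<open>S W(t)\<close>.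
\<close>

definition sde_solution ::
  "'w measure \<Rightarrow> real \<Rightarrow> (real^'d \<Rightarrow> real^'d) \<Rightarrow> real^'r^'d \<Rightarrow> (real \<Rightarrow> 'w \<Rightarrow> real^'r) \<Rightarrow>
   real^'d \<Rightarrow> (real \<Rightarrow> 'w \<Rightarrow> real^'d) \<Rightarrow> bool" where
  "sde_solution M T b S W y0 Y \<longleftrightarrow>
     (\<forall>t\<in>{0..T}. Y t \<in> borel_measurable M) \<and>
     (AE \<omega> in M. continuous_on {0..T} (\<lambda>t. Y t \<omega>) \<and>
        (\<forall>t\<in>{0..T}. Y t \<omega> = y0 + integral {0..t} (\<lambda>s. b (Y s \<omega>)) + S *v W t \<omega>))"

definition bounded_moments ::
  "'w measure \<Rightarrow> real \<Rightarrow> (real \<Rightarrow> 'w \<Rightarrow> 'b::real_normed_vector) \<Rightarrow> bool" where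
  "bounded_moments M T Y \<longleftrightarrow>
     (\<forall>l\<ge>0. (SUP t\<in>{0..T}. \<integral>\<^sup>+\<omega>. ennreal (norm (Y t \<omega>) powr l) \<partial>M) < \<infinity>)"

definition poly_growth :: "('a::real_normed_vector \<Rightarrow> 'b::real_normed_vector) \<Rightarrow> bool" where
  "poly_growth f \<longleftrightarrow> (\<exists>C k. \<forall>x. norm (f x) \<le> C * (1 + norm x) ^ k)"

text \<open>
  \<open>C_up k f\<close>: all partial derivatives of \<open>f\<close> of order at most \<open>k\<close> exist everywhere,
  are continuous and of polynomial growth.
\<close>

primrec C_up :: "nat \<Rightarrow> (real^'d \<Rightarrow> 'b::real_normed_vector) \<Rightarrow> bool" where
  "C_up 0 f \<longleftrightarrow> continuous_on UNIV f \<and> poly_growth f"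
| "C_up (Suc k) f \<longleftrightarrow> continuous_on UNIV f \<and> poly_growth f \<and>
     (\<forall>i. \<exists>g. C_up k g \<and>
        (\<forall>x. ((\<lambda>s. f (x + s *\<^sub>R axis i 1)) has_vector_derivative g x) (at 0)))"


section \<open>Structural equation model\<close>

text \<open>
  Every entry of \<open>A \<theta>\<close> is either a known constant or a coordinate of \<open>\<theta>\<close>; the same
  coordinate may occur in several places. \<open>free_coords A\<close> is the set of coordinates
  that occur.
\<close>

definition param_matrix :: "(real^'q \<Rightarrow> real^'n^'m) \<Rightarrow> bool" where
  "param_matrix A \<longleftrightarrow>
     (\<forall>i j. (\<exists>c. \<forall>\<theta>. A \<theta> $ i $ j = c) \<or> (\<exists>l. \<forall>\<theta>. A \<theta> $ i $ j = \<theta> $ l))"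

definition free_coords :: "(real^'q \<Rightarrow> real^'n^'m) \<Rightarrow> 'q set" where
  "free_coords A = {l. \<exists>i j. \<forall>\<theta>. A \<theta> $ i $ j = \<theta> $ l}"

definition covariance_structure ::
  "real^'k1^'p1 \<Rightarrow> real^'k2^'p2 \<Rightarrow> real^'k1^'k2 \<Rightarrow> real^'k2^'k2 \<Rightarrow>
   real^'k1^'k1 \<Rightarrow> real^'p1^'p1 \<Rightarrow> real^'p2^'p2 \<Rightarrow> real^'k2^'k2 \<Rightarrow>
   real^('p1 + 'p2)^('p1 + 'p2)" where
  "covariance_structure L1 L2 \<Gamma> \<Psi> Sxi Sdelta Seps Szeta =
    (let S11 = L1 ** Sxi ** transpose L1 + Sdelta;
         S12 = L1 ** Sxi ** transpose \<Gamma> ** transpose (matrix_inv \<Psi>) ** transpose L2;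
         S22 = L2 ** matrix_inv \<Psi> ** (\<Gamma> ** Sxi ** transpose \<Gamma> + Szeta)
                 ** transpose (matrix_inv \<Psi>) ** transpose L2 + Seps
     in block_matrix S11 S12 (transpose S12) S22)"

definition realized_cov ::
  "real \<Rightarrow> nat \<Rightarrow> (real \<Rightarrow> real^'p) \<Rightarrow> real^'p^'p" where
  "realized_cov T n x = (1 / T) *\<^sub>R
     (\<Sum>i=1..n. let h = T / real n; d = x (real i * h) - x (real (i - 1) * h) in outer d d)"

definition V_mat :: "real^('p::finite)^'p \<Rightarrow> real^'p^'p \<Rightarrow> real^('p uprod)^('p uprod)" where
  "V_mat X Y = transpose dup **
     integral {0..1} (\<lambda>l2. integral {0..1} (\<lambda>l1.
       l2 *\<^sub>R kron (matrix_inv (Y + (l1 * l2) *\<^sub>R (X - Y)))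
                  (matrix_inv (Y + (l1 * l2) *\<^sub>R (X - Y))))) ** dup"

definition V_tilde :: "real^('p::finite)^'p \<Rightarrow> real^'p^'p \<Rightarrow> real^('p uprod)^('p uprod)" where
  "V_tilde Q S = (if invertible Q then V_mat Q S else mat 1)"

definition contrast :: "real^'p^'p \<Rightarrow> real^'p^'p \<Rightarrow> real" where
  "contrast Q S = (vech Q - vech S) \<bullet> (V_tilde Q S *v (vech Q - vech S))"

definition W_mat :: "real^('p::finite)^'p \<Rightarrow> real^('p uprod)^('p uprod)" where
  "W_mat S = 2 *\<^sub>R (moore_penrose dup ** kron S S ** transpose (moore_penrose dup))"

end

theory Submission
  imports Defs
begin

text \<open>
  Since the diffusion matrices are constant, \<open>X\<close> is a continuously differentiable drift term plus
  a linear image \<open>G\<close> of the Wiener processes, and the increments of \<open>G\<close> over the grid are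
  independent and normal with covariance \<open>h\<^sub>n \<Sigma>(\<theta>0)\<close>. The drift changes \<open>\<surd>n Q\<^sub>X\<^sub>X\<close> by
  \<open>o(1)\<close> on almost every path: in the cross terms the drift density is replaced by a Lipschitz
  function and one sums by parts against the continuous path \<open>G\<close>, so neither adaptedness nor moments of the latent
  processes play a role. The normal part obeys the central limit theorem for quadratic forms in
  normal vectors with limit covariance \<open>W(\<Sigma>(\<theta>0))\<close>, by Wick's identity and the Levy continuity theorem.

  The weight \<open>V(Q, \<Sigma>)\<close> is squeezed between multiples of \<open>V(\<Sigma>(\<theta>0), \<Sigma>(\<theta>0)) = W(\<Sigma>(\<theta>0))\<^sup>-\<^sup>1\<close> that tend to 1,
  hence the contrast is, up to a small relative error, a fixed quadratic form in
  \<open>vech Q - vech \<Sigma>(\<theta>)\<close>. Compactness and identifiability give consistency, and \<open>\<theta>hat - \<theta>0\<close> is to first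
  order the weighted least squares solution, linear in \<open>vech Q - vech \<Sigma>(\<theta>0)\<close>.
\<close>

subsection \<open>Linear changes of variables\<close>

text \<open>Everything about the estimator is a deterministic statement on a symmetric matrix
  \<open>Q\<close> near \<open>\<Sigma> \<theta>0\<close>. Randomness enters through vectors
  \<open>Z n\<close> on the same space as the data, to which
  \<open>\<surd>n (vech Q - vech \<Sigma>(\<theta>0))\<close> is close in probability; this coupling
  allows remainders to be compared pointwise although the limit is a statement on laws. Limits are
  taken with characteristic functions, because each of the four noise sources may have a singular
  covariance, for which \<open>multi_normal\<close> has no density; only their sum is positive
  definite. The weight in the contrast moves with the parameter as well, so no stationarity equation
  is used: the minimizer is compared with the single competitor \<open>\<theta>0 + J x\<close>. This
  point has to lie in \<open>\<Theta>\<close>, which is what an interior \<theta>0 provides. At a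
  boundary point the estimator cannot move in all directions, and the limit law is in general not
  normal.\<close>

lemma nn_integral_lborel_swap:
  fixes f :: "real^'n \<Rightarrow> ennreal"
  assumes [measurable]: "f \<in> borel_measurable borel"
  shows "(\<integral>\<^sup>+x. f x \<partial>lborel) = (\<integral>\<^sup>+x. f (\<chi> i. x $ Transposition.transpose m n i) \<partial>lborel)"
proof -
  let ?s = "\<lambda>x::real^'n. \<chi> i. x $ Transposition.transpose m n i"
  have [measurable]: "?s \<in> borel_measurable borel"
    by (intro borel_measurable_continuous_onI continuous_intros)
  have "lborel = distr lborel borel ?s"
  proof (rule lborel_eqI)
    fix l u :: "real^'n" assume le: "\<And>b. b \<in> Basis \<Longrightarrow> l \<bullet> b \<le> u \<bullet> b"
    have le': "l $ i \<le> u $ i" for i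
      using le[of "axis i 1"] by (simp add: inner_axis axis_in_Basis_iff)
    have *: "?s -` box l u = box (?s l) (?s u)"
      by (auto simp: mem_box_cart) (metis transpose_involutory)+
    have "bij (Transposition.transpose m n)" by simp
    then have "(\<Prod>i\<in>UNIV. u $ Transposition.transpose m n i - l $ Transposition.transpose m n i) = (\<Prod>i\<in>UNIV. u $ i - l $ i)"
      using prod.reindex_bij_betw[of "Transposition.transpose m n" UNIV UNIV "\<lambda>i. u $ i - l $ i"] by blast
    moreover have "(\<Prod>b\<in>Basis. (v - w) \<bullet> b) = (\<Prod>i\<in>UNIV. v $ i - w $ i)" for v w :: "real^'n"
      by (simp add: Basis_vec_def prod.UNION_disjoint axis_eq_axis inner_axis)
    moreover have "\<forall>b\<in>Basis. ?s l \<bullet> b \<le> ?s u \<bullet> b"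
      by (auto simp: Basis_vec_def inner_axis le')
    ultimately show "emeasure (distr lborel borel ?s) (box l u) = (\<Prod>b\<in>Basis. (u - l) \<bullet> b)"
      by (subst emeasure_distr) (auto simp: * emeasure_lborel_box_eq)
  qed simp
  from arg_cong[OF this, of "\<lambda>M. integral\<^sup>N M f"] show ?thesis
    by (simp add: nn_integral_distr)
qed

text \<open>Fubini in the coordinate \<open>m\<close>: with the other coordinates frozen, the shear
  translates the line by the fixed amount \<open>v $ n\<close>, because \<open>m \<noteq> n\<close>,
  and Lebesgue measure on the line is translation invariant.\<close>

lemma nn_integral_lborel_shear:
  fixes f :: "real^'n \<Rightarrow> ennreal"
  assumes [measurable]: "f \<in> borel_measurable borel" and "m \<noteq> n"
  shows "(\<integral>\<^sup>+x. f x \<partial>lborel) = (\<integral>\<^sup>+x. f (x + (x $ n) *\<^sub>R axis m 1) \<partial>lborel)"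
proof -
  interpret product_sigma_finite "\<lambda>b::real^'n. lborel :: real measure" ..
  let ?e = "axis m 1 :: real^'n"
  let ?B = "Basis - {?e}"
  have ins: "Basis = insert ?e ?B" "finite ?B" "?e \<notin> ?B"
    by (auto simp: axis_in_Basis_iff)
  have ex: "(\<integral>\<^sup>+x. g x \<partial>lborel) =
      (\<integral>\<^sup>+x. (\<integral>\<^sup>+y. g ((\<Sum>b\<in>?B. x b *\<^sub>R b) + y *\<^sub>R ?e) \<partial>lborel) \<partial>(\<Pi>\<^sub>M b\<in>?B. lborel))"
    if [measurable]: "g \<in> borel_measurable borel" for g :: "real^'n \<Rightarrow> ennreal"
  proof -
    have m[measurable]: "(\<lambda>f. \<Sum>b\<in>(Basis :: (real^'n) set). f b *\<^sub>R b) \<in> (\<Pi>\<^sub>M b\<in>Basis. lborel) \<rightarrow>\<^sub>M borel"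
      by measurable
    have "(\<integral>\<^sup>+x. g x \<partial>lborel) = (\<integral>\<^sup>+x. g (\<Sum>b\<in>Basis. x b *\<^sub>R b) \<partial>(\<Pi>\<^sub>M b\<in>Basis. lborel))"
      by (subst lborel_eq, subst nn_integral_distr) auto
    also have "\<dots> = (\<integral>\<^sup>+x. g (\<Sum>b\<in>insert ?e ?B. x b *\<^sub>R b) \<partial>(\<Pi>\<^sub>M b\<in>insert ?e ?B. lborel))"
      using ins(1) by simp
    also have "\<dots> = (\<integral>\<^sup>+x. (\<integral>\<^sup>+y. g (\<Sum>b\<in>insert ?e ?B. (x(?e := y)) b *\<^sub>R b) \<partial>lborel) \<partial>(\<Pi>\<^sub>M b\<in>?B. lborel))"
      using m ins by (intro product_nn_integral_insert) (auto intro: measurable_compose[OF m])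
    also have "\<dots> = (\<integral>\<^sup>+x. (\<integral>\<^sup>+y. g ((\<Sum>b\<in>?B. x b *\<^sub>R b) + y *\<^sub>R ?e) \<partial>lborel) \<partial>(\<Pi>\<^sub>M b\<in>?B. lborel))"
      using ins(2,3) by (intro nn_integral_cong arg_cong[where f=g])
        (subst sum.insert, auto simp: add.commute intro!: sum.cong)
    finally show ?thesis .
  qed
  have me: "(\<lambda>x::real^'n. f (x + (x $ n) *\<^sub>R axis m 1)) \<in> borel_measurable borel"
    by (rule measurable_compose[of _ borel borel], rule borel_measurable_continuous_onI)
      (auto intro!: continuous_intros)
  have tr: "(\<integral>\<^sup>+y. f (v + y *\<^sub>R ?e) \<partial>lborel) =
      (\<integral>\<^sup>+y. f (v + y *\<^sub>R ?e + (v + y *\<^sub>R ?e) $ n *\<^sub>R ?e) \<partial>lborel)" for v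
  proof -
    have mf: "(\<lambda>y. f (v + y *\<^sub>R ?e)) \<in> borel_measurable borel"
      by (rule measurable_compose[of _ borel borel], rule borel_measurable_continuous_onI)
        (auto intro!: continuous_intros)
    have "(\<integral>\<^sup>+y. f (v + y *\<^sub>R ?e) \<partial>lborel) = (\<integral>\<^sup>+y. f (v + (v $ n + 1 * y) *\<^sub>R ?e) \<partial>lborel)"
      using nn_integral_real_affine[OF mf, of 1 "v $ n"] by simp
    then show ?thesis
      using \<open>m \<noteq> n\<close> by (simp add: axis_def scaleR_left_distrib add_ac)
  qed
  show ?thesis
    by (subst ex, simp, subst ex[OF me]) (intro nn_integral_cong tr)
qed

text \<open>Both sides are compatible with matrix products, so it is enough to treat the elementary
  matrices of \<open>induct_matrix_elementary_alt\<close>: diagonal ones, coordinate swaps and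
  shears; a zero row is excluded by the determinant. The induction runs over the claim for all
  \<open>f\<close>, since a product \<open>A ** B\<close> needs the claim for \<open>B\<close> at
  \<open>f\<close> composed with \<open>A\<close>.\<close>

lemma nn_integral_lborel_linear:
  fixes f :: "real^'n \<Rightarrow> ennreal" and A :: "real^'n^'n"
  assumes "f \<in> borel_measurable borel" "det A \<noteq> 0"
  shows "(\<integral>\<^sup>+x. f x \<partial>lborel) = ennreal \<bar>det A\<bar> * (\<integral>\<^sup>+x. f (A *v x) \<partial>lborel)"
proof -
  have mA[measurable]: "(*v) A \<in> borel_measurable borel" for A :: "real^'n^'n"
    by (intro borel_measurable_continuous_onI linear_continuous_on matrix_vector_mul_bounded_linear)
  have "\<forall>f\<in>borel_measurable borel. det A \<noteq> 0 \<longrightarrow>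
    (\<integral>\<^sup>+x. f x \<partial>lborel) = ennreal \<bar>det A\<bar> * (\<integral>\<^sup>+x. f (A *v x) \<partial>lborel)"
  proof (induction A rule: induct_matrix_elementary_alt)
    case (1 A B)
    show ?case
    proof (intro ballI impI)
      fix f :: "real^'n \<Rightarrow> ennreal" assume f[measurable]: "f \<in> borel_measurable borel" and "det (A ** B) \<noteq> 0"
      then have d: "det A \<noteq> 0" "det B \<noteq> 0" by (auto simp: det_mul)
      have "(\<integral>\<^sup>+x. f x \<partial>lborel) = ennreal \<bar>det A\<bar> * (\<integral>\<^sup>+x. f (A *v x) \<partial>lborel)"
        using 1(1) f d by blast
      also have "(\<integral>\<^sup>+x. f (A *v x) \<partial>lborel) = ennreal \<bar>det B\<bar> * (\<integral>\<^sup>+x. f (A *v (B *v x)) \<partial>lborel)"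
        by (rule 1(2)[rule_format]) (use d in auto)
      finally show "(\<integral>\<^sup>+x. f x \<partial>lborel) = ennreal \<bar>det (A ** B)\<bar> * (\<integral>\<^sup>+x. f ((A ** B) *v x) \<partial>lborel)"
        by (simp add: det_mul abs_mult ennreal_mult matrix_vector_mul_assoc mult.assoc)
    qed
  next
    case (2 A i)
    then show ?case by (auto simp: det_zero_row(2))
  next
    case (3 A)
    show ?case
    proof (intro ballI impI)
      fix f :: "real^'n \<Rightarrow> ennreal" assume f[measurable]: "f \<in> borel_measurable borel" and d: "det A \<noteq> 0"
      have dA: "det A = (\<Prod>i\<in>UNIV. A $ i $ i)" using 3 by (rule det_diagonal)
      let ?c = "\<lambda>b. b \<bullet> (A *v b)"
      have Av: "A *v x = (\<chi> i. A $ i $ i * x $ i)" for x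
      proof -
        have "(\<Sum>j\<in>UNIV. A $ i $ j * x $ j) = (\<Sum>j\<in>UNIV. if j = i then A $ i $ i * x $ i else 0)" for i
          by (rule sum.cong) (auto simp: 3)
        then show ?thesis by (simp add: vec_eq_iff matrix_vector_mult_def)
      qed
      have c: "?c (axis i 1) = A $ i $ i" for i
        by (simp add: inner_axis' Av)
      have sb: "(\<Sum>j\<in>Basis. F j) = (\<Sum>i\<in>UNIV. F (axis i 1))" for F :: "real^'n \<Rightarrow> real^'n"
        by (simp add: Basis_vec_def sum.UNION_disjoint axis_eq_axis)
      have T: "(0 + (\<Sum>j\<in>Basis. (?c j * (x \<bullet> j)) *\<^sub>R j)) = A *v x" for x
      proof -
        have "(0 + (\<Sum>j\<in>Basis. (?c j * (x \<bullet> j)) *\<^sub>R j)) = (\<Sum>i\<in>UNIV. (A $ i $ i * x $ i) *\<^sub>R axis i 1)"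
          unfolding sb c by (simp add: inner_axis)
        also have "\<dots> = A *v x"
          by (simp add: Av vec_eq_iff axis_def if_distrib cong: if_cong)
        finally show ?thesis .
      qed
      have p: "(\<Prod>j\<in>(Basis::(real^'n) set). \<bar>?c j\<bar>) = \<bar>det A\<bar>"
        by (simp add: Basis_vec_def prod.UNION_disjoint axis_eq_axis c dA abs_prod)
      have "lborel = density (distr lborel borel (\<lambda>x. 0 + (\<Sum>j\<in>Basis. (?c j * (x \<bullet> j)) *\<^sub>R j)))
          (\<lambda>_. ennreal (\<Prod>j\<in>(Basis::(real^'n) set). \<bar>?c j\<bar>))"
        using d by (intro lborel_affine_euclidean) (auto simp: Basis_vec_def c dA)
      then have *: "lborel = density (distr lborel borel ((*v) A)) (\<lambda>_. ennreal \<bar>det A\<bar>)"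
        unfolding T p by (simp add: eta_contract_eq)
      show "(\<integral>\<^sup>+x. f x \<partial>lborel) = ennreal \<bar>det A\<bar> * (\<integral>\<^sup>+x. f (A *v x) \<partial>lborel)"
        by (subst *) (simp add: nn_integral_density nn_integral_distr nn_integral_cmult)
    qed
  next
    case (4 m n)
    let ?A = "\<chi> i j. (mat 1 :: real^'n^'n) $ i $ Transposition.transpose m n j"
    have A: "?A *v x = (\<chi> i. x $ Transposition.transpose m n i)" for x
    proof -
      have "(\<Sum>j\<in>UNIV. (if i = Transposition.transpose m n j then 1 else 0) * x $ j) =
        (\<Sum>j\<in>UNIV. if j = Transposition.transpose m n i then x $ j else 0)" for i
        by (rule sum.cong) (auto simp: transpose_eq_iff)
      then show ?thesis
        by (simp add: vec_eq_iff matrix_vector_mult_def mat_def)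
    qed
    have "\<bar>det ?A\<bar> = 1"
      using det_permute_columns[OF permutes_swap_id[of m UNIV n], of "mat 1 :: real^'n^'n"]
      by (simp add: sign_swap_id)
    then show ?case unfolding A by (auto simp: nn_integral_lborel_swap[symmetric])
  next
    case (5 m n)
    let ?A = "\<chi> i j. of_bool (i = m \<and> j = n \<or> i = j) :: real^'n^'n"
    have A: "?A *v x = x + (x $ n) *\<^sub>R axis m 1" for x
      using 5 by (auto simp: vec_eq_iff matrix_vector_mult_def axis_def of_bool_def
         if_distrib [of "\<lambda>x. x * y" for y] sum.remove[of _ n] cong: if_cong)
    have "(\<chi> k. if k = m then row m (mat 1) + 1 *s row n (mat 1) else row k (mat 1)) = ?A"
      using 5 by (auto simp: vec_eq_iff row_def mat_def)
    then have "det ?A = 1"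
      using det_row_operation[OF 5, of "mat 1 :: real^'n^'n" 1] by simp
    then show ?case
      unfolding A using 5 by (simp add: nn_integral_lborel_shear[symmetric])
  qed
  with assms show ?thesis by blast
qed

section \<open>Positive definite matrices and inverses\<close>

lemma pos_def_scalar: "0 < c \<Longrightarrow> pos_def (mat c :: real^'n^'n)"
proof -
  assume "0 < c"
  have "mat c *v x = c *\<^sub>R x" for x :: "real^'n"
    by (simp add: vec_eq_iff matrix_vector_mult_def mat_def if_distrib[of "\<lambda>x. x * y" for y] cong: if_cong)
  with \<open>0 < c\<close> show ?thesis
    by (auto simp: pos_def_def transpose_mat inner_gt_zero_iff)
qed

lemma pos_def_invertible: "pos_def A \<Longrightarrow> invertible A"
  unfolding invertible_left_inverse matrix_left_invertible_ker pos_def_def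
  by (metis inner_zero_right less_irrefl)

lemma invertible_matrix_inv:
  fixes A :: "real^'n^'n"
  assumes "invertible A"
  shows "A ** matrix_inv A = mat 1" "matrix_inv A ** A = mat 1"
  using assms unfolding invertible_def matrix_inv_def by (metis (mono_tags, lifting) someI_ex)+

lemma matrix_inv_unique:
  fixes A B :: "real^'n^'n"
  assumes "A ** B = mat 1"
  shows "matrix_inv A = B" "invertible A"
proof -
  show i: "invertible A" using assms invertible_right_inverse by blast
  have "matrix_inv A = matrix_inv A ** (A ** B)" by (simp add: assms)
  also have "\<dots> = B" by (simp add: matrix_mul_assoc invertible_matrix_inv[OF i])
  finally show "matrix_inv A = B" .
qed

lemma inner_matrix_transpose: "x \<bullet> ((A::real^'n^'m) *v y) = (transpose A *v x) \<bullet> y"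
  by (metis dot_lmul_matrix transpose_matrix_vector transpose_transpose)

text \<open>Gram-Schmidt for the inner product \<open>x \<bullet> (C *v y)\<close>: if the rows of
  \<open>V\<close> are orthonormal for it, then \<open>V ** C ** transpose V = mat 1\<close>, and
  \<open>A\<close> is the inverse of \<open>V\<close>.\<close>

lemma pos_def_factorization:
  fixes C :: "real^'n^'n"
  assumes "pos_def C"
  obtains A where "C = A ** transpose A" "det A \<noteq> 0"
proof -
  have symC: "transpose C = C" and pos: "\<And>x. x \<noteq> 0 \<Longrightarrow> x \<bullet> (C *v x) > 0"
    using assms by (auto simp: pos_def_def)
  have sw: "x \<bullet> (C *v y) = y \<bullet> (C *v x)" for x y
    using inner_matrix_transpose[of x C y] by (simp add: symC inner_commute)
  have "finite S \<Longrightarrow> \<exists>v::'n \<Rightarrow> real^'n. \<forall>i\<in>S. \<forall>j\<in>S. v i \<bullet> (C *v v j) = (if i = j then 1 else 0)" for S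
  proof (induction S rule: finite_induct)
    case (insert k S)
    then obtain v :: "'n \<Rightarrow> real^'n" where v: "\<And>i j. i \<in> S \<Longrightarrow> j \<in> S \<Longrightarrow> v i \<bullet> (C *v v j) = (if i = j then 1 else 0)"
      by blast
    \<comment> \<open>Fewer than \<open>CARD('n)\<close> vectors \<open>C *v v i\<close> do not span
      the space, so some nonzero \<open>x\<close> is orthogonal to all of them; normalized, it
      extends the system.\<close>
    let ?B = "(\<lambda>i. C *v v i) ` S"
    have "dim (span ?B) \<le> card ?B"
      by (metis dim_span dim_le_card' finite_imageI insert.hyps(1))
    also have "\<dots> \<le> card S" by (rule card_image_le) fact
    also have "\<dots> < card (UNIV :: 'n set)"
      using insert.hyps by (intro psubset_card_mono) auto
    finally have "dim (span ?B) < DIM(real^'n)" by simp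
    then have "span ?B \<subset> UNIV" 
      by (metis dim_UNIV less_irrefl top.not_eq_extremum)
    then have "span ?B \<subset> span UNIV" by simp
    then obtain x where x: "x \<noteq> 0" "\<And>y. y \<in> span ?B \<Longrightarrow> orthogonal x y"
      using orthogonal_to_subspace_exists_gen by metis
    define w where "w = (1 / sqrt (x \<bullet> (C *v x))) *\<^sub>R x"
    have ww: "w \<bullet> (C *v w) = 1"
      using pos[OF x(1)] by (simp add: w_def matrix_vector_mult_scaleR)
    have wv: "w \<bullet> (C *v v i) = 0" if "i \<in> S" for i
      using x(2)[OF span_base, of "C *v v i"] that by (auto simp: orthogonal_def w_def)
    show ?case
    proof (intro exI ballI)
      fix i j assume "i \<in> insert k S" "j \<in> insert k S"
      then show "(v(k := w)) i \<bullet> (C *v (v(k := w)) j) = (if i = j then 1 else 0)"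
        using insert.hyps(2) v ww wv sw[of "v i" w] by (cases "i = k"; cases "j = k") auto
    qed
  qed auto
  from this[of UNIV] obtain v :: "'n \<Rightarrow> real^'n" where
    v: "\<And>i j. v i \<bullet> (C *v v j) = (if i = j then 1 else 0)" by auto
  define V where "V = (\<chi> i j. v i $ j)"
  have Vrow: "V $ i = v i" for i by (simp add: V_def vec_eq_iff)
  have VCV: "V ** C ** transpose V = mat 1"
  proof -
    have "(V ** (C ** transpose V)) $ i $ j = v i \<bullet> (C *v v j)" for i j
      by (simp add: matrix_matrix_mult_def matrix_vector_mult_def inner_vec_def transpose_def V_def)
    then show ?thesis by (simp add: vec_eq_iff mat_def v matrix_mul_assoc)
  qed
  have iV: "invertible V"
    using VCV unfolding invertible_right_inverse by (metis matrix_mul_assoc)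
  let ?A = "matrix_inv V"
  have "transpose V ** transpose ?A = mat 1"
    by (metis invertible_matrix_inv(2)[OF iV] matrix_transpose_mul transpose_mat)
  then have "C = (?A ** V) ** C ** (transpose V ** transpose ?A)"
    by (simp add: invertible_matrix_inv[OF iV])
  also have "\<dots> = ?A ** (V ** C ** transpose V) ** transpose ?A"
    by (simp add: matrix_mul_assoc)
  also have "\<dots> = ?A ** transpose ?A" by (simp add: VCV)
  finally have "C = ?A ** transpose ?A" .
  moreover have "det ?A \<noteq> 0"
    by (metis invertible_matrix_inv(1)[OF iV] det_I det_mul mult_zero_right zero_neq_one)
  ultimately show ?thesis using that by blast
qed

subsection \<open>The normal law\<close>

lemma sets_multi_normal [simp, measurable_cong]: "sets (multi_normal \<mu> C) = sets borel"
  and space_multi_normal [simp]: "space (multi_normal \<mu> C) = UNIV"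
  by (simp_all add: multi_normal_def)

lemma matrix_inv_mat_1 [simp]: "matrix_inv (mat 1 :: real^'n^'n) = mat 1"
  by (rule matrix_inv_unique) simp

lemma multi_normal_std:
  "multi_normal 0 (mat 1 :: real^'n^'n) =
     density lborel (\<lambda>x. ennreal (\<Prod>b\<in>Basis. std_normal_density (x \<bullet> b)))"
proof -
  have "(\<Prod>b\<in>Basis. std_normal_density (x \<bullet> b)) = exp (- (x \<bullet> x) / 2) / sqrt ((2 * pi) ^ CARD('n))" for x :: "real^'n"
    unfolding real_sqrt_power
    by (simp add: std_normal_density_def prod.distrib prod_dividef exp_sum[symmetric]
        euclidean_inner[of x x] power2_eq_square sum_negf sum_divide_distrib power_one_over del: real_sqrt_mult)
  then show ?thesis by (simp add: multi_normal_def)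
qed

lemma prob_space_multi_normal_std: "prob_space (multi_normal 0 (mat 1 :: real^'n^'n))"
proof
  have "(\<integral>\<^sup>+x. ennreal (std_normal_density x) \<partial>lborel) = 1"
    using prob_space.emeasure_space_1[OF real_distribution.axioms(1)[OF real_dist_normal_dist]]
    by (simp add: emeasure_density)
  then show "emeasure (multi_normal 0 (mat 1 :: real^'n^'n)) (space (multi_normal 0 (mat 1 :: real^'n^'n))) = 1"
    unfolding multi_normal_std
    by (simp add: emeasure_density prod_ennreal[symmetric]
        nn_integral_lborel_prod[where f="\<lambda>b y. ennreal (std_normal_density y)"])
qed

text \<open>The density and the exponential both factor over the coordinates, so the integral is a
  product of one-dimensional characteristic functions.\<close>

lemma char_multi_normal_std:
  fixes t :: "real^'n"
  shows "(CLINT x|multi_normal 0 (mat 1). iexp (t \<bullet> x)) = exp (- (t \<bullet> t) / 2)"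
proof -
  interpret product_sigma_finite "\<lambda>b::real^'n. lborel :: real measure" ..
  let ?h = "\<lambda>(b::real^'n) y. std_normal_density y *\<^sub>R iexp ((t \<bullet> b) * y)"
  have int: "integrable lborel (?h b)" for b
  proof -
    have "integrable std_normal_distribution (\<lambda>y. iexp ((t \<bullet> b) * y))"
      by (rule finite_measure.integrable_const_bound[where B=1])
        (auto intro!: prob_space.finite_measure real_distribution.axioms(1)[OF real_dist_normal_dist])
    then show ?thesis by (subst (asm) integrable_density) (auto simp: normal_density_nonneg)
  qed
  have sp: "(\<Sum>b\<in>Basis. f b *\<^sub>R b) \<bullet> b = f b" if "b \<in> Basis" for f and b :: "real^'n"
    using that by simp
  have ie: "iexp (t \<bullet> x) = (\<Prod>b\<in>Basis. iexp ((t \<bullet> b) * (x \<bullet> b)))" for x :: "real^'n"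
    by (simp add: exp_sum[symmetric] euclidean_inner[of t x] sum_distrib_left)
  have "(CLINT x|multi_normal 0 (mat 1). iexp (t \<bullet> x)) =
      (CLINT x|lborel. (\<Prod>b\<in>Basis. std_normal_density (x \<bullet> b)) *\<^sub>R iexp (t \<bullet> x))"
    unfolding multi_normal_std by (subst integral_density) (auto intro!: prod_nonneg normal_density_nonneg)
  also have "\<dots> = (CLINT x|lborel. (\<Prod>b\<in>Basis. ?h b (x \<bullet> b)))"
    by (simp add: ie prod.distrib scaleR_conv_of_real)
  also have "\<dots> = (CLINT f|(\<Pi>\<^sub>M b\<in>Basis. lborel). (\<Prod>b\<in>Basis. ?h b ((\<Sum>b\<in>Basis. f b *\<^sub>R b) \<bullet> b)))"
    by (subst lborel_eq, subst integral_distr) auto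
  also have "\<dots> = (CLINT f|(\<Pi>\<^sub>M b\<in>Basis. lborel). (\<Prod>b\<in>Basis. ?h b (f b)))"
    by (intro Bochner_Integration.integral_cong prod.cong refl) (simp only: sp)
  also have "\<dots> = (\<Prod>b\<in>Basis. (CLINT y|lborel. ?h b y))"
    by (rule product_integral_prod[OF finite_Basis int])
  also have "\<dots> = (\<Prod>b\<in>Basis. char std_normal_distribution (t \<bullet> b))"
    unfolding char_def by (subst integral_density) (auto simp: normal_density_nonneg)
  also have "\<dots> = exp (- (t \<bullet> t) / 2)"
    by (simp add: char_std_normal_distribution exp_sum[symmetric] euclidean_inner[of t t] power2_eq_square
       sum_negf sum_divide_distrib flip: of_real_prod)
  finally show ?thesis .
qed

lemma borel_measurable_matrix_vector_mult [measurable]: "(*v) (A :: real^'n^'m) \<in> borel_measurable borel"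
  by (intro borel_measurable_continuous_onI linear_continuous_on matrix_vector_mul_bounded_linear)

text \<open>Change of variables by \<open>A\<close>: the quadratic form of the inverse of
  \<open>A ** transpose A\<close> at \<open>A *v x\<close> is \<open>x \<bullet> x\<close>, and the
  Jacobian \<open>\<bar>det A\<bar>\<close> cancels the square root of the determinant of the
  covariance. Total mass and characteristic function are transported from the standard case in this
  way.\<close>

lemma multi_normal_factor:
  fixes A :: "real^'n^'n"
  assumes "det A \<noteq> 0"
  shows "multi_normal 0 (A ** transpose A) = distr (multi_normal 0 (mat 1)) borel ((*v) A)"
proof (rule measure_eqI)
  fix S assume "S \<in> sets (multi_normal 0 (A ** transpose A))"
  then have S[measurable]: "S \<in> sets borel" by simp
  let ?C = "A ** transpose A"
  have iA: "invertible A" using assms invertible_det_nz by blast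
  have tt: "transpose (matrix_inv A) ** matrix_inv A ** (A ** transpose A) = mat 1"
  proof -
    have "transpose (matrix_inv A) ** matrix_inv A ** (A ** transpose A) =
      transpose (matrix_inv A) ** (matrix_inv A ** A) ** transpose A" by (simp add: matrix_mul_assoc)
    also have "\<dots> = transpose (matrix_inv A) ** transpose A"
      by (simp add: invertible_matrix_inv[OF iA])
    also have "\<dots> = transpose (A ** matrix_inv A)" 
      by (simp only: matrix_transpose_mul)
    finally show ?thesis by (simp add: invertible_matrix_inv[OF iA] transpose_mat)
  qed
  then have iC: "matrix_inv ?C = transpose (matrix_inv A) ** matrix_inv A"
    using matrix_inv_unique(1) matrix_left_right_inverse by blast
  have q: "(A *v x) \<bullet> (matrix_inv ?C *v (A *v x)) = x \<bullet> x" for x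
  proof -
    have "matrix_inv ?C *v (A *v x) = transpose (matrix_inv A) *v ((matrix_inv A ** A) *v x)"
      by (simp add: iC matrix_vector_mul_assoc matrix_mul_assoc)
    then have "matrix_inv ?C *v (A *v x) = transpose (matrix_inv A) *v x"
      by (simp add: invertible_matrix_inv[OF iA])
    then have "(A *v x) \<bullet> (matrix_inv ?C *v (A *v x)) = x \<bullet> (matrix_inv A *v (A *v x))"
      by (simp add: dot_lmul_matrix inner_commute[of "A *v x"])
    then show ?thesis by (simp add: matrix_vector_mul_assoc invertible_matrix_inv[OF iA])
  qed
  let ?d = "\<lambda>x. exp (- ((x - 0) \<bullet> (matrix_inv ?C *v (x - 0))) / 2) / sqrt ((2 * pi) ^ CARD('n) * det ?C)"
  let ?e = "\<lambda>x. exp (- (x \<bullet> x) / 2) / sqrt ((2 * pi) ^ CARD('n))"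
  have de: "\<bar>det A\<bar> * ?d (A *v x) = ?e x" for x
    using assms by (simp add: q det_mul real_sqrt_mult real_sqrt_abs2 power2_eq_square[symmetric])
  have md[measurable]: "?d \<in> borel_measurable borel"
    by measurable
  have "emeasure (multi_normal 0 ?C) S = (\<integral>\<^sup>+x. ennreal (?d x) * indicator S x \<partial>lborel)"
    unfolding multi_normal_def by (rule emeasure_density) (use S md in auto)
  also have "\<dots> = ennreal \<bar>det A\<bar> * (\<integral>\<^sup>+x. ennreal (?d (A *v x)) * indicator S (A *v x) \<partial>lborel)"
    using assms by (intro nn_integral_lborel_linear) measurable
  also have "\<dots> = (\<integral>\<^sup>+x. ennreal \<bar>det A\<bar> * (ennreal (?d (A *v x)) * indicator S (A *v x)) \<partial>lborel)"
    by (rule nn_integral_cmult[symmetric]) measurable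
  also have "\<dots> = (\<integral>\<^sup>+x. ennreal (?e x) * indicator S (A *v x) \<partial>lborel)"
  proof (rule nn_integral_cong)
    fix x
    have "ennreal \<bar>det A\<bar> * (ennreal (?d (A *v x)) * indicator S (A *v x)) =
        ennreal (\<bar>det A\<bar> * ?d (A *v x)) * indicator S (A *v x)"
      by (simp only: ennreal_mult'[OF abs_ge_zero] mult.assoc)
    then show "ennreal \<bar>det A\<bar> * (ennreal (?d (A *v x)) * indicator S (A *v x)) = ennreal (?e x) * indicator S (A *v x)"
      by (simp only: de)
  qed
  also have "\<dots> = emeasure (multi_normal 0 (mat 1)) ((*v) A -` S)"
    unfolding multi_normal_def
    by (subst emeasure_density) (auto intro!: nn_integral_cong simp: indicator_def measurable_sets_borel[OF borel_measurable_matrix_vector_mult S])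
  also have "\<dots> = emeasure (distr (multi_normal 0 (mat 1)) borel ((*v) A)) S"
    by (subst emeasure_distr) auto
  finally show "emeasure (multi_normal 0 ?C) S = emeasure (distr (multi_normal 0 (mat 1)) borel ((*v) A)) S" .
qed simp

lemma prob_space_multi_normal:
  assumes "pos_def C" shows "prob_space (multi_normal 0 C)"
  by (rule pos_def_factorization[OF assms])
    (simp add: multi_normal_factor prob_space.prob_space_distr[OF prob_space_multi_normal_std])

lemma char_multi_normal:
  fixes C :: "real^'n^'n"
  assumes "pos_def C"
  shows "(CLINT x|multi_normal 0 C. iexp (t \<bullet> x)) = exp (- (t \<bullet> (C *v t)) / 2)"
proof -
  obtain A where A: "C = A ** transpose A" "det A \<noteq> 0"
    using pos_def_factorization[OF assms] .
  have "(CLINT x|multi_normal 0 C. iexp (t \<bullet> x)) = (CLINT x|multi_normal 0 (mat 1). iexp ((transpose A *v t) \<bullet> x))"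
    using A by (simp add: multi_normal_factor integral_distr dot_lmul_matrix)
  also have "\<dots> = exp (- (t \<bullet> (C *v t)) / 2)"
    unfolding char_multi_normal_std
    by (simp add: A(1) matrix_vector_mul_assoc[symmetric] dot_lmul_matrix)
  finally show ?thesis .
qed

subsection \<open>Convergence of characteristic functions\<close>

text \<open>Fourier inversion made absolutely convergent by smoothing: the standard normal density
  is, up to a constant, its own characteristic function, so Fubini rewrites a Gaussian average of
  \<open>f\<close> around \<open>x\<close> in terms of the Fourier transform \<open>g\<close> of
  \<open>f\<close>. On the right, \<open>x\<close> occurs only in an exponential.\<close>

lemma gaussian_smoothing:
  fixes f :: "real^'n \<Rightarrow> real"
  assumes cf: "continuous_on UNIV f" and fint: "integrable lborel f" and s: "\<sigma> > 0"
  defines "g \<equiv> \<lambda>u. CLINT y|lborel. f y *\<^sub>R iexp (- (u \<bullet> y) / \<sigma>)"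
    and "K \<equiv> 1 / (\<sigma> ^ CARD('n) * sqrt ((2 * pi) ^ CARD('n)))"
  shows "complex_of_real (\<integral>u. f (x + \<sigma> *\<^sub>R u) \<partial>multi_normal 0 (mat 1)) =
    K * (CLINT u|multi_normal 0 (mat 1). iexp (u \<bullet> x / \<sigma>) * g u)"
proof -
  let ?\<gamma> = "multi_normal 0 (mat 1 :: real^'n^'n)"
  interpret \<gamma>: prob_space ?\<gamma> by (rule prob_space_multi_normal_std)
  interpret pair_sigma_finite ?\<gamma> "lborel :: (real^'n) measure" ..
  have [measurable]: "f \<in> borel_measurable borel" by (rule borel_measurable_continuous_onI[OF cf])
  let ?c = "1 / sqrt ((2 * pi) ^ CARD('n))"
  define p where "p v = ?c * exp (- (v \<bullet> v) / 2)" for v :: "real^'n"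
  have c0: "?c > 0" by simp
  have \<gamma>: "?\<gamma> = density lborel (\<lambda>v. ennreal (p v))"
    by (simp add: multi_normal_def p_def)
  have mp[measurable]: "p \<in> borel_measurable borel"
    unfolding p_def[abs_def] by measurable
  have pm: "p (- v) = p v" for v by (simp add: p_def)
  \<comment> \<open>The factor \<open>1 / \<sigma> ^ CARD('n)\<close> is the Jacobian of
    \<open>u = (y - x) / \<sigma>\<close>; together with the normalizer of the density it makes up
    \<open>K\<close>.\<close>
  define h where "h y = (1 / \<sigma> ^ CARD('n)) * (p ((1 / \<sigma>) *\<^sub>R (x - y)) * f y)" for y
  have [measurable]: "h \<in> borel_measurable borel"
    unfolding h_def
    by (intro borel_measurable_times borel_measurable_const measurable_compose[OF _ mp]) simp_all
  have "(\<integral>u. f (x + \<sigma> *\<^sub>R u) \<partial>?\<gamma>) = (\<integral>u. p u * f (x + \<sigma> *\<^sub>R u) \<partial>lborel)"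
    unfolding \<gamma> by (subst integral_density) (auto simp: p_def)
  also have "\<dots> = (\<integral>u. \<sigma> ^ CARD('n) * h (x + \<sigma> *\<^sub>R u) \<partial>lborel)"
    using s by (intro Bochner_Integration.integral_cong) (auto simp: h_def pm)
  also have "\<dots> = (\<integral>y. h y \<partial>lborel)"
  proof -
    have "lborel = density (distr lborel borel (\<lambda>u::real^'n. x + \<sigma> *\<^sub>R u)) (\<lambda>_. ennreal (\<sigma> ^ CARD('n)))"
      using lborel_affine[of \<sigma> x] s by simp
    from arg_cong[OF this, of "\<lambda>M. integral\<^sup>L M h"] show ?thesis
      using s by (simp add: integral_density integral_distr)
  qed
  finally have 1: "(\<integral>u. f (x + \<sigma> *\<^sub>R u) \<partial>?\<gamma>) = (\<integral>y. h y \<partial>lborel)" .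
  have pc: "complex_of_real (p v) = ?c * (CLINT w|?\<gamma>. iexp (v \<bullet> w))" for v
    by (simp only: char_multi_normal_std of_real_mult p_def)
  have hc: "complex_of_real (h y) = K * (CLINT w|?\<gamma>. f y *\<^sub>R (iexp (w \<bullet> x / \<sigma>) * iexp (- (w \<bullet> y) / \<sigma>)))" for y
  proof -
    have "(CLINT w|?\<gamma>. f y *\<^sub>R (iexp (w \<bullet> x / \<sigma>) * iexp (- (w \<bullet> y) / \<sigma>))) =
       f y *\<^sub>R (CLINT w|?\<gamma>. iexp (((1 / \<sigma>) *\<^sub>R (x - y)) \<bullet> w))"
    proof -
      have "iexp (w \<bullet> x / \<sigma>) * iexp (- (w \<bullet> y) / \<sigma>) = iexp (((1 / \<sigma>) *\<^sub>R (x - y)) \<bullet> w)" for w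
        by (simp add: exp_add[symmetric] inner_diff_left inner_commute[of w] diff_divide_distrib algebra_simps)
      then show ?thesis by (simp add: scaleR_conv_of_real)
    qed
    then show ?thesis
      unfolding h_def of_real_mult pc K_def by (simp only: of_real_mult of_real_divide of_real_1 scaleR_conv_of_real times_divide_eq_left times_divide_eq_right divide_divide_eq_left mult_1_left mult_ac)
  qed
  have int: "integrable (?\<gamma> \<Otimes>\<^sub>M lborel) (\<lambda>(w, y). f y *\<^sub>R (iexp (w \<bullet> x / \<sigma>) * iexp (- (w \<bullet> y) / \<sigma>)))"
  proof (rule Fubini_integrable)
    show "integrable ?\<gamma> (\<lambda>w. LINT y|lborel. cmod (case (w, y) of (w, y) \<Rightarrow> f y *\<^sub>R (iexp (w \<bullet> x / \<sigma>) * iexp (- (w \<bullet> y) / \<sigma>))))"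
      by (simp add: norm_mult)
    show "AE w in ?\<gamma>. integrable lborel (\<lambda>y. case (w, y) of (w, y) \<Rightarrow> f y *\<^sub>R (iexp (w \<bullet> x / \<sigma>) * iexp (- (w \<bullet> y) / \<sigma>)))"
      by (intro AE_I2) (simp, rule Bochner_Integration.integrable_bound[OF fint], auto simp: norm_mult)
  qed measurable
  have "complex_of_real (\<integral>y. h y \<partial>lborel) = (CLINT y|lborel. complex_of_real (h y))"
    by simp
  also have "\<dots> = K * (CLINT y|lborel. (CLINT w|?\<gamma>. f y *\<^sub>R (iexp (w \<bullet> x / \<sigma>) * iexp (- (w \<bullet> y) / \<sigma>))))"
    unfolding hc by (rule integral_mult_right_zero)
  also have "(CLINT y|lborel. (CLINT w|?\<gamma>. f y *\<^sub>R (iexp (w \<bullet> x / \<sigma>) * iexp (- (w \<bullet> y) / \<sigma>)))) =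
      (CLINT w|?\<gamma>. (CLINT y|lborel. f y *\<^sub>R (iexp (w \<bullet> x / \<sigma>) * iexp (- (w \<bullet> y) / \<sigma>))))"
    using Fubini_integral[OF int] by simp
  also have "\<dots> = (CLINT w|?\<gamma>. iexp (w \<bullet> x / \<sigma>) * g w)"
    unfolding g_def by (simp only: mult_scaleR_right[symmetric] integral_mult_right_zero)
  finally show ?thesis using 1 by simp
qed

text \<open>Integrating the previous identity over the law of \<open>Z\<close> turns the exponential
  into the characteristic function of \<open>Z\<close>. The last two claims supply measurability and
  a bound of \<open>g\<close> for dominated convergence.\<close>

lemma expectation_gaussian_smoothing:
  fixes f :: "real^'n \<Rightarrow> real"
  assumes cf: "continuous_on UNIV f" and fint: "integrable lborel f" and s: "\<sigma> > 0"
    and "prob_space M" and Z[measurable]: "Z \<in> borel_measurable M"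
  defines "g \<equiv> \<lambda>u. CLINT y|lborel. f y *\<^sub>R iexp (- (u \<bullet> y) / \<sigma>)"
    and "K \<equiv> 1 / (\<sigma> ^ CARD('n) * sqrt ((2 * pi) ^ CARD('n)))"
  shows "complex_of_real (\<integral>\<omega>. (\<integral>u. f (Z \<omega> + \<sigma> *\<^sub>R u) \<partial>multi_normal 0 (mat 1)) \<partial>M) =
    K * (CLINT u|multi_normal 0 (mat 1). (CLINT \<omega>|M. iexp ((1 / \<sigma>) *\<^sub>R u \<bullet> Z \<omega>)) * g u)"
    and "g \<in> borel_measurable borel" and "\<And>u. cmod (g u) \<le> (\<integral>y. \<bar>f y\<bar> \<partial>lborel)"
proof -
  let ?\<gamma> = "multi_normal 0 (mat 1 :: real^'n^'n)"
  interpret \<gamma>: prob_space ?\<gamma> by (rule prob_space_multi_normal_std)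
  interpret M: prob_space M by fact
  interpret pair_prob_space M ?\<gamma> ..
  have [measurable]: "f \<in> borel_measurable borel" by (rule borel_measurable_continuous_onI[OF cf])
  have "(\<lambda>u. CLINT y|lborel. f y *\<^sub>R iexp (- (u \<bullet> y) / \<sigma>)) \<in> borel_measurable borel"
    by (rule sigma_finite_measure.borel_measurable_lebesgue_integral) (auto simp: split_beta' intro: sigma_finite_lborel)
  then show mg[measurable]: "g \<in> borel_measurable borel" by (simp add: g_def)
  show bg: "cmod (g u) \<le> (\<integral>y. \<bar>f y\<bar> \<partial>lborel)" for u
    unfolding g_def by (rule order_trans[OF integral_norm_bound]) simp
  have int: "integrable (M \<Otimes>\<^sub>M ?\<gamma>) (\<lambda>(\<omega>, u). iexp (u \<bullet> Z \<omega> / \<sigma>) * g u)"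
    by (rule integrable_const_bound[where B="\<integral>y. \<bar>f y\<bar> \<partial>lborel"])
      (auto simp: norm_mult intro!: AE_I2 bg)
  have "complex_of_real (\<integral>\<omega>. (\<integral>u. f (Z \<omega> + \<sigma> *\<^sub>R u) \<partial>?\<gamma>) \<partial>M) =
     (CLINT \<omega>|M. complex_of_real (\<integral>u. f (Z \<omega> + \<sigma> *\<^sub>R u) \<partial>?\<gamma>))"
    by (rule integral_complex_of_real[symmetric])
  also have "\<dots> = K * (CLINT \<omega>|M. (CLINT u|?\<gamma>. iexp (u \<bullet> Z \<omega> / \<sigma>) * g u))"
    unfolding gaussian_smoothing[OF cf fint s] K_def g_def by simp
  also have "(CLINT \<omega>|M. (CLINT u|?\<gamma>. iexp (u \<bullet> Z \<omega> / \<sigma>) * g u)) =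
     (CLINT u|?\<gamma>. (CLINT \<omega>|M. iexp (u \<bullet> Z \<omega> / \<sigma>) * g u))"
    using Fubini_integral[OF int] by simp
  also have "\<dots> = (CLINT u|?\<gamma>. (CLINT \<omega>|M. iexp ((1 / \<sigma>) *\<^sub>R u \<bullet> Z \<omega>)) * g u)"
    by simp
  finally show "complex_of_real (\<integral>\<omega>. (\<integral>u. f (Z \<omega> + \<sigma> *\<^sub>R u) \<partial>?\<gamma>) \<partial>M) =
    K * (CLINT u|?\<gamma>. (CLINT \<omega>|M. iexp ((1 / \<sigma>) *\<^sub>R u \<bullet> Z \<omega>)) * g u)" .
qed

lemma prob_space_tail_tendsto_0:
  fixes N :: "'a::euclidean_space measure"
  assumes "prob_space N" "sets N = sets borel"
  shows "(\<lambda>k. measure N {u. norm u > real k}) \<longlonglongrightarrow> 0"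
proof -
  interpret prob_space N by fact
  have "(\<lambda>k. measure N {u. norm u > real k}) \<longlonglongrightarrow> measure N (\<Inter>k. {u. norm u > real k})"
  proof (rule finite_Lim_measure_decseq)
    show "range (\<lambda>k. {u. norm u > real k}) \<subseteq> sets N" by (auto simp: assms(2) intro!: borel_open open_Collect_less continuous_intros)
    show "decseq (\<lambda>k. {u::'a. norm u > real k})" by (auto simp: decseq_def)
  qed
  moreover have "(\<Inter>k. {u::'a. norm u > real k}) = {}"
  proof -
    { fix u :: 'a obtain k where "norm u < real k" using reals_Archimedean2 by blast
      then have "\<exists>k. \<not> norm u > real k" by (intro exI[of _ k]) simp }
    then show ?thesis by blast
  qed
  ultimately show ?thesis by simp
qed

lemma gaussian_smoothing_uniform:
  fixes f :: "real^'n \<Rightarrow> real"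
  assumes uc: "uniformly_continuous_on UNIV f" and bd: "\<And>x. \<bar>f x\<bar> \<le> B" and e: "e > 0"
  obtains \<sigma> where "\<sigma> > 0" "\<And>x. \<bar>(\<integral>u. f (x + \<sigma> *\<^sub>R u) \<partial>multi_normal 0 (mat 1)) - f x\<bar> \<le> e"
proof -
  let ?\<gamma> = "multi_normal 0 (mat 1 :: real^'n^'n)"
  interpret \<gamma>: prob_space ?\<gamma> by (rule prob_space_multi_normal_std)
  have cf: "continuous_on UNIV f" by (rule uniformly_continuous_imp_continuous[OF uc])
  have [measurable]: "f \<in> borel_measurable borel" by (rule borel_measurable_continuous_onI[OF cf])
  have B0: "0 \<le> B" using bd[of 0] by simp
  obtain d where d: "d > 0" "\<And>x y. dist x y < d \<Longrightarrow> dist (f x) (f y) < e / 2"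
    using uc e unfolding uniformly_continuous_on_def by (metis UNIV_I half_gt_zero)
  \<comment> \<open>For \<open>norm u \<le> real k\<close> the choice of \<open>\<sigma>\<close>
    keeps the shift below \<open>d\<close>, which costs \<open>e / 2\<close>; outside, the
    oscillation \<open>2 * B\<close> times the tail mass costs at most \<open>e / 2\<close>. The
    denominator is \<open>4 * B + 4\<close> and not \<open>4 * B\<close> because \<open>B\<close>
    may be 0.\<close>
  have "eventually (\<lambda>k. measure ?\<gamma> {u. norm u > real k} < e / (4 * B + 4)) sequentially"
    by (rule order_tendstoD(2)[OF prob_space_tail_tendsto_0]) (use e B0 in \<open>auto intro: \<gamma>.prob_space_axioms\<close>)
  then obtain k where k: "measure ?\<gamma> {u. norm u > real k} < e / (4 * B + 4)"
    by (meson eventually_happens' sequentially_bot)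
  define \<sigma> where "\<sigma> = d / (real k + 1)"
  have s: "\<sigma> > 0" using d by (simp add: \<sigma>_def)
  have ms[measurable]: "{u::real^'n. norm u > real k} \<in> sets borel"
    by (intro borel_open open_Collect_less continuous_intros)
  have "\<bar>(\<integral>u. f (x + \<sigma> *\<^sub>R u) \<partial>?\<gamma>) - f x\<bar> \<le> e" for x
  proof -
    have i1: "integrable ?\<gamma> (\<lambda>u. f (x + \<sigma> *\<^sub>R u))"
      by (rule \<gamma>.integrable_const_bound[where B=B]) (auto simp: bd)
    have "(\<integral>u. f (x + \<sigma> *\<^sub>R u) \<partial>?\<gamma>) - f x = (\<integral>u. f (x + \<sigma> *\<^sub>R u) - f x \<partial>?\<gamma>)"
      using i1 \<gamma>.prob_space by simp
    also have "\<bar>\<dots>\<bar> \<le> (\<integral>u. \<bar>f (x + \<sigma> *\<^sub>R u) - f x\<bar> \<partial>?\<gamma>)"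
      by (rule integral_abs_bound)
    also have "\<dots> \<le> (\<integral>u. e / 2 + 2 * B * indicator {u. norm u > real k} u \<partial>?\<gamma>)"
    proof (rule integral_mono)
      show "integrable ?\<gamma> (\<lambda>u. \<bar>f (x + \<sigma> *\<^sub>R u) - f x\<bar>)" using i1 by auto
      show "integrable ?\<gamma> (\<lambda>u. e / 2 + 2 * B * indicator {u. norm u > real k} u)"
        by (auto intro!: integrable_real_indicator simp: \<gamma>.emeasure_eq_measure)
      fix u :: "real^'n"
      show "\<bar>f (x + \<sigma> *\<^sub>R u) - f x\<bar> \<le> e / 2 + 2 * B * indicator {u. norm u > real k} u"
      proof (cases "norm u > real k")
        case True
        then show ?thesis using bd[of "x + \<sigma> *\<^sub>R u"] bd[of x] e by (simp add: indicator_def abs_le_iff)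
      next
        case False
        have "\<sigma> * norm u \<le> \<sigma> * real k" using False s by simp
        also have "\<dots> < d" using d by (simp add: \<sigma>_def field_simps)
        finally have "dist (x + \<sigma> *\<^sub>R u) x < d" using s by (simp add: dist_norm)
        from d(2)[OF this] show ?thesis using False by (simp add: dist_real_def)
      qed
    qed
    also have "\<dots> = e / 2 + 2 * B * measure ?\<gamma> {u. norm u > real k}"
      using \<gamma>.prob_space by (subst Bochner_Integration.integral_add) (auto intro!: integrable_real_indicator simp: \<gamma>.emeasure_eq_measure)
    also have "2 * B * measure ?\<gamma> {u. norm u > real k} \<le> 2 * B * (e / (4 * B + 4))"
      using k B0 by (intro mult_left_mono) auto
    also have "\<dots> \<le> e / 2" using B0 e by (simp add: field_simps)
    finally show ?thesis by simp
  qed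
  with s show ?thesis using that by blast
qed

text \<open>Compact support makes \<open>f\<close> integrable and uniformly continuous, so smoothing
  changes each expectation by at most \<open>e / 3\<close>, uniformly in \<open>n\<close>. The
  smoothed expectations converge because they are Gaussian integrals of the characteristic functions
  times \<open>g\<close>, which converge pointwise under a common bound.\<close>

lemma char_tendsto_imp_compact_support:
  fixes Z :: "nat \<Rightarrow> 'w \<Rightarrow> real^'n" and f :: "real^'n \<Rightarrow> real"
  assumes M: "prob_space M" and Z: "\<And>n. Z n \<in> borel_measurable M"
    and N: "prob_space N" and sN: "sets N = sets borel"
    and ch: "\<And>t. (\<lambda>n. CLINT \<omega>|M. iexp (t \<bullet> Z n \<omega>)) \<longlonglongrightarrow> (CLINT x|N. iexp (t \<bullet> x))"
    and cf: "continuous_on UNIV f" and supp: "\<And>x. norm x > R \<Longrightarrow> f x = 0"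
  shows "(\<lambda>n. \<integral>\<omega>. f (Z n \<omega>) \<partial>M) \<longlonglongrightarrow> (\<integral>x. f x \<partial>N)"
proof -
  let ?\<gamma> = "multi_normal 0 (mat 1 :: real^'n^'n)"
  interpret M: prob_space M by fact
  interpret N: prob_space N by fact
  interpret \<gamma>: prob_space ?\<gamma> by (rule prob_space_multi_normal_std)
  note Z[measurable] sN[measurable_cong]
  have [measurable]: "f \<in> borel_measurable borel" by (rule borel_measurable_continuous_onI[OF cf])
  have "compact (f ` cball 0 R)" by (intro compact_continuous_image continuous_on_subset[OF cf]) auto
  then have "bounded (f ` cball 0 R)" by (rule compact_imp_bounded)
  then obtain B0 where B0: "\<And>y. y \<in> f ` cball 0 R \<Longrightarrow> norm y \<le> B0"
    unfolding bounded_iff by blast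
  define B where "B = max 0 B0"
  have bd: "\<bar>f x\<bar> \<le> B" for x
  proof (cases "norm x > R")
    case False then have "f x \<in> f ` cball 0 R" by auto
    with B0 show ?thesis by (force simp: B_def)
  qed (simp add: supp B_def)
  have ucf: "uniformly_continuous_on UNIV f"
  proof -
    have u: "uniformly_continuous_on (cball 0 (R + 1)) f"
      by (intro compact_uniformly_continuous continuous_on_subset[OF cf]) auto
    show ?thesis unfolding uniformly_continuous_on_def
    proof (intro allI impI)
      fix e :: real assume "e > 0"
      then obtain d where d: "d > 0" "\<And>x y. x \<in> cball 0 (R+1) \<Longrightarrow> y \<in> cball 0 (R+1) \<Longrightarrow> dist y x < d \<Longrightarrow> dist (f y) (f x) < e"
        using u unfolding uniformly_continuous_on_def by metis
      show "\<exists>d>0. \<forall>x\<in>UNIV. \<forall>x'\<in>UNIV. dist x' x < d \<longrightarrow> dist (f x') (f x) < e"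
      proof (intro exI[of _ "min d 1"] conjI ballI impI)
        fix x y :: "real^'n" assume xy: "dist y x < min d 1"
        have "norm y \<le> norm x + dist y x" "norm x \<le> norm y + dist y x"
          by (metis dist_norm norm_triangle_sub add.commute, metis dist_commute dist_norm norm_triangle_sub add.commute)
        then show "dist (f y) (f x) < e"
          using d(2)[of x y] xy supp[of x] supp[of y] \<open>e > 0\<close>
          by (cases "norm x \<le> R + 1"; cases "norm y \<le> R + 1") auto
      qed (use d in auto)
    qed
  qed
  have fint: "integrable lborel f"
  proof -
    have "integrable lborel (\<lambda>x. indicator (cball 0 R) x *\<^sub>R f x)"
      by (rule borel_integrable_compact) (auto intro: continuous_on_subset[OF cf])
    also have "(\<lambda>x. indicator (cball 0 R) x *\<^sub>R f x) = f"
      using supp by (auto simp: indicator_def fun_eq_iff)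
    finally show ?thesis .
  qed
  show ?thesis
  proof (rule LIMSEQ_I)
    fix e :: real assume e: "e > 0"
    obtain \<sigma> where s: "\<sigma> > 0" and ap: "\<And>x. \<bar>(\<integral>u. f (x + \<sigma> *\<^sub>R u) \<partial>?\<gamma>) - f x\<bar> \<le> e / 3"
      using gaussian_smoothing_uniform[OF ucf bd, of "e/3"] e by auto
    define T where "T x = (\<integral>u. f (x + \<sigma> *\<^sub>R u) \<partial>?\<gamma>)" for x
    define g where "g = (\<lambda>u. CLINT y|lborel. f y *\<^sub>R iexp (- (u \<bullet> y) / \<sigma>))"
    define K where "K = 1 / (\<sigma> ^ CARD('n) * sqrt ((2 * pi) ^ CARD('n)))"
    note eg = expectation_gaussian_smoothing[OF cf fint s, folded g_def K_def T_def]
    have mg[measurable]: "g \<in> borel_measurable borel" by (rule eg(2)[OF M Z[of 0]])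
    have idm: "(\<lambda>x. x) \<in> borel_measurable N" by simp
    have mT[measurable]: "T \<in> borel_measurable borel"
    proof -
      have "(\<lambda>x. \<integral>u. f (x + \<sigma> *\<^sub>R u) \<partial>?\<gamma>) \<in> borel_measurable borel"
        by (rule \<gamma>.borel_measurable_lebesgue_integral) measurable
      then show ?thesis by (simp add: T_def[abs_def])
    qed
    have "(\<lambda>n. CLINT u|?\<gamma>. (CLINT \<omega>|M. iexp ((1 / \<sigma>) *\<^sub>R u \<bullet> Z n \<omega>)) * g u) \<longlonglongrightarrow>
       (CLINT u|?\<gamma>. (CLINT x|N. iexp ((1 / \<sigma>) *\<^sub>R u \<bullet> x)) * g u)"
    proof (rule integral_dominated_convergence[where w="\<lambda>u. \<integral>y. \<bar>f y\<bar> \<partial>lborel"])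
      have "(\<lambda>u. CLINT \<omega>|M. iexp ((1 / \<sigma>) *\<^sub>R u \<bullet> Z n \<omega>)) \<in> borel_measurable borel" for n
        by (rule M.borel_measurable_lebesgue_integral) measurable
      then show "(\<lambda>u. (CLINT \<omega>|M. iexp ((1 / \<sigma>) *\<^sub>R u \<bullet> Z n \<omega>)) * g u) \<in> borel_measurable ?\<gamma>" for n
        by simp
      have "(\<lambda>u. CLINT x|N. iexp ((1 / \<sigma>) *\<^sub>R u \<bullet> x)) \<in> borel_measurable borel"
        by (rule N.borel_measurable_lebesgue_integral) measurable
      then show "(\<lambda>u. (CLINT x|N. iexp ((1 / \<sigma>) *\<^sub>R u \<bullet> x)) * g u) \<in> borel_measurable ?\<gamma>"
        by simp
      show "AE u in ?\<gamma>. cmod ((CLINT \<omega>|M. iexp ((1 / \<sigma>) *\<^sub>R u \<bullet> Z n \<omega>)) * g u) \<le> (\<integral>y. \<bar>f y\<bar> \<partial>lborel)" for n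
      proof (rule AE_I2)
        fix u
        have "cmod (CLINT \<omega>|M. iexp ((1 / \<sigma>) *\<^sub>R u \<bullet> Z n \<omega>)) \<le> 1"
          by (rule order_trans[OF integral_norm_bound]) (simp add: M.prob_space)
        then show "cmod ((CLINT \<omega>|M. iexp ((1 / \<sigma>) *\<^sub>R u \<bullet> Z n \<omega>)) * g u) \<le> (\<integral>y. \<bar>f y\<bar> \<partial>lborel)"
          using mult_mono[OF _ eg(3)[OF M Z[of 0], of u], of "cmod (CLINT \<omega>|M. iexp ((1 / \<sigma>) *\<^sub>R u \<bullet> Z n \<omega>))" 1]
          by (simp add: norm_mult g_def)
      qed
      show "AE u in ?\<gamma>. (\<lambda>n. (CLINT \<omega>|M. iexp ((1 / \<sigma>) *\<^sub>R u \<bullet> Z n \<omega>)) * g u) \<longlonglongrightarrow> (CLINT x|N. iexp ((1 / \<sigma>) *\<^sub>R u \<bullet> x)) * g u"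
        by (intro AE_I2 tendsto_mult ch tendsto_const)
    qed simp
    then have "(\<lambda>n. complex_of_real (\<integral>\<omega>. T (Z n \<omega>) \<partial>M)) \<longlonglongrightarrow> complex_of_real (\<integral>x. T x \<partial>N)"
      unfolding eg(1)[OF M Z] eg(1)[OF N idm] g_def by (intro tendsto_mult tendsto_const)
    then have "(\<lambda>n. \<integral>\<omega>. T (Z n \<omega>) \<partial>M) \<longlonglongrightarrow> (\<integral>x. T x \<partial>N)"
      by (rule tendsto_of_real_iff[THEN iffD1])
    then obtain n0 where n0: "\<And>n. n \<ge> n0 \<Longrightarrow> \<bar>(\<integral>\<omega>. T (Z n \<omega>) \<partial>M) - (\<integral>x. T x \<partial>N)\<bar> < e / 3"
      using LIMSEQ_D[of _ _ "e/3"] e by (metis divide_pos_pos real_norm_def zero_less_numeral)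
    have Tb: "\<bar>T x\<bar> \<le> B + e / 3" for x using ap[of x] bd[of x] unfolding T_def by linarith
    have apT: "\<bar>T x - f x\<bar> \<le> e / 3" for x using ap by (simp add: T_def)
    have dif: "\<bar>(\<integral>\<omega>. T (Y \<omega>) \<partial>P) - (\<integral>\<omega>. f (Y \<omega>) \<partial>P)\<bar> \<le> e / 3"
      if P: "prob_space P" and [measurable]: "Y \<in> borel_measurable P" for P :: "'a measure" and Y
    proof -
      interpret P: prob_space P by fact
      have i: "integrable P (\<lambda>\<omega>. T (Y \<omega>))" "integrable P (\<lambda>\<omega>. f (Y \<omega>))"
        by (rule P.integrable_const_bound[where B="B + e/3"] P.integrable_const_bound[where B=B]; auto simp: bd Tb)+
      have "\<bar>(\<integral>\<omega>. T (Y \<omega>) \<partial>P) - (\<integral>\<omega>. f (Y \<omega>) \<partial>P)\<bar> = \<bar>\<integral>\<omega>. T (Y \<omega>) - f (Y \<omega>) \<partial>P\<bar>"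
        using i by simp
      also have "\<dots> \<le> (\<integral>\<omega>. \<bar>T (Y \<omega>) - f (Y \<omega>)\<bar> \<partial>P)" by (rule integral_abs_bound)
      also have "\<dots> \<le> (\<integral>\<omega>. e / 3 \<partial>P)"
        using i by (intro integral_mono apT) simp_all
      finally show ?thesis by (simp add: P.prob_space)
    qed
    show "\<exists>n0. \<forall>n\<ge>n0. norm ((\<integral>\<omega>. f (Z n \<omega>) \<partial>M) - (\<integral>x. f x \<partial>N)) < e"
    proof (intro exI[of _ n0] allI impI)
      fix n assume "n \<ge> n0"
      from n0[OF this] dif[OF M Z[of n]] dif[OF N idm]
      show "norm ((\<integral>\<omega>. f (Z n \<omega>) \<partial>M) - (\<integral>x. f x \<partial>N)) < e"
        unfolding real_norm_def by linarith
    qed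
  qed
qed

text \<open>Tightness is extracted from the compactly supported case: the cut-off \<open>h\<close>
  is itself such a function, and its expectation is close to 1 under the limit law, hence for all
  large \<open>n\<close>. A bounded continuous \<open>f\<close> may then be replaced by
  \<open>f\<close> times \<open>h\<close>.\<close>

theorem levy_continuity_vec:
  fixes Z :: "nat \<Rightarrow> 'w \<Rightarrow> real^'n"
  assumes M: "prob_space M" and Z: "\<And>n. n > 0 \<Longrightarrow> Z n \<in> borel_measurable M"
    and N: "prob_space N" and sN: "sets N = sets borel"
    and ch: "\<And>t. (\<lambda>n. CLINT \<omega>|M. iexp (t \<bullet> Z n \<omega>)) \<longlonglongrightarrow> (CLINT x|N. iexp (t \<bullet> x))"
  shows "converges_in_dist M Z N"
  unfolding converges_in_dist_def
proof (intro allI impI)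
  fix f :: "real^'n \<Rightarrow> real" assume cf: "continuous_on UNIV f" and "bounded (range f)"
  then obtain B where B: "B > 0" "\<And>x. \<bar>f x\<bar> \<le> B" unfolding bounded_pos by auto
  interpret M: prob_space M by fact
  interpret N: prob_space N by fact
  \<comment> \<open>Measurability is available for positive indices only, as there is no grid with 0
    steps; index 0 is overwritten by a constant.\<close>
  define Z' where "Z' n = (if n = 0 then (\<lambda>_. 0) else Z n)" for n
  have Z'[measurable]: "Z' n \<in> borel_measurable M" for n using Z by (simp add: Z'_def)
  note sN[measurable_cong]
  have [measurable]: "f \<in> borel_measurable borel" by (rule borel_measurable_continuous_onI[OF cf])
  have ev: "eventually (\<lambda>n. Z' n = Z n) sequentially"
    using eventually_gt_at_top[of 0] by eventually_elim (simp add: Z'_def)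
  have ch': "(\<lambda>n. CLINT \<omega>|M. iexp (t \<bullet> Z' n \<omega>)) \<longlonglongrightarrow> (CLINT x|N. iexp (t \<bullet> x))" for t
    by (rule Lim_transform_eventually[OF ch]) (use ev in eventually_elim, simp)
  note cs = char_tendsto_imp_compact_support[OF M Z' N sN ch']
  have "(\<lambda>n. \<integral>\<omega>. f (Z' n \<omega>) \<partial>M) \<longlonglongrightarrow> (\<integral>x. f x \<partial>N)"
  proof (rule LIMSEQ_I)
    fix e :: real assume e: "e > 0"
    have "eventually (\<lambda>k. measure N {u. norm u > real k} < e / (4 * B)) sequentially"
      by (rule order_tendstoD(2)[OF prob_space_tail_tendsto_0[OF N sN]]) (use e B in auto)
    then obtain k where k: "measure N {u. norm u > real k} < e / (4 * B)"
      by (meson eventually_happens' sequentially_bot)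
    define h where "h x = max 0 (min 1 (real k + 1 - norm x))" for x :: "real^'n"
    have ch: "continuous_on UNIV h" unfolding h_def by (intro continuous_intros)
    then have [measurable]: "h \<in> borel_measurable borel" by (rule borel_measurable_continuous_onI)
    have h01: "0 \<le> h x" "h x \<le> 1" for x by (auto simp: h_def)
    have hs: "h x = 0" if "norm x > real k + 1" for x using that by (simp add: h_def)
    have c1: "(\<lambda>n. \<integral>\<omega>. h (Z' n \<omega>) \<partial>M) \<longlonglongrightarrow> (\<integral>x. h x \<partial>N)"
      by (rule cs[OF ch hs])
    have c2: "(\<lambda>n. \<integral>\<omega>. f (Z' n \<omega>) * h (Z' n \<omega>) \<partial>M) \<longlonglongrightarrow> (\<integral>x. f x * h x \<partial>N)"
      by (rule cs[of "\<lambda>x. f x * h x" "real k + 1"]) (auto intro!: continuous_intros cf ch simp: hs)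
    have ms[measurable]: "{u::real^'n. norm u > real k} \<in> sets borel"
      by (intro borel_open open_Collect_less continuous_intros)
    have Nh: "1 - (\<integral>x. h x \<partial>N) < e / (4 * B)"
    proof -
      have ih: "integrable N h" by (rule N.integrable_const_bound[where B=1]) (auto simp: h01)
      have "1 - (\<integral>x. h x \<partial>N) = (\<integral>x. 1 - h x \<partial>N)" using ih N.prob_space by simp
      also have "\<dots> \<le> (\<integral>x. indicator {u. norm u > real k} x \<partial>N)"
      proof (rule integral_mono)
        show "integrable N (\<lambda>x. 1 - h x)" using ih by simp
        show "integrable N (indicat_real {u. norm u > real k})"
          by (intro integrable_real_indicator) (auto simp: N.emeasure_eq_measure)
        show "1 - h x \<le> indicat_real {u. norm u > real k} x" for x
          using h01[of x] by (auto simp: indicator_def) (simp add: h_def)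
      qed
      also have "\<dots> = measure N {u. norm u > real k}" by (simp add: sN)
      finally show ?thesis using k by simp
    qed
    have e3: "e / (4 * B) > 0" using e B by simp
    obtain n1 where n1: "\<And>n. n \<ge> n1 \<Longrightarrow> \<bar>(\<integral>\<omega>. h (Z' n \<omega>) \<partial>M) - (\<integral>x. h x \<partial>N)\<bar> < e / (4 * B)"
      using LIMSEQ_D[OF c1 e3] by (metis real_norm_def)
    obtain n2 where n2: "\<And>n. n \<ge> n2 \<Longrightarrow> \<bar>(\<integral>\<omega>. f (Z' n \<omega>) * h (Z' n \<omega>) \<partial>M) - (\<integral>x. f x * h x \<partial>N)\<bar> < e / 4"
      using LIMSEQ_D[OF c2, of "e/4"] e by (metis real_norm_def divide_pos_pos zero_less_numeral)
    have dif: "\<bar>(\<integral>\<omega>. f (Y \<omega>) \<partial>P) - (\<integral>\<omega>. f (Y \<omega>) * h (Y \<omega>) \<partial>P)\<bar> \<le> B * (1 - (\<integral>\<omega>. h (Y \<omega>) \<partial>P))"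
      if P: "prob_space P" and [measurable]: "Y \<in> borel_measurable P" for P :: "'a measure" and Y
    proof -
      interpret P: prob_space P by fact
      have i: "integrable P (\<lambda>\<omega>. h (Y \<omega>))" "integrable P (\<lambda>\<omega>. f (Y \<omega>))"
        by (rule P.integrable_const_bound[where B=1] P.integrable_const_bound[where B=B]; auto simp: B h01)+
      have i2: "integrable P (\<lambda>\<omega>. f (Y \<omega>) * h (Y \<omega>))"
      proof (rule P.integrable_const_bound[where B=B])
        show "AE \<omega> in P. norm (f (Y \<omega>) * h (Y \<omega>)) \<le> B"
          using mult_mono[OF B(2) h01(2)] B h01 by (auto simp: abs_mult)
      qed simp
      have "\<bar>(\<integral>\<omega>. f (Y \<omega>) \<partial>P) - (\<integral>\<omega>. f (Y \<omega>) * h (Y \<omega>) \<partial>P)\<bar> = \<bar>\<integral>\<omega>. f (Y \<omega>) - f (Y \<omega>) * h (Y \<omega>) \<partial>P\<bar>"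
        using i i2 by simp
      also have "\<dots> \<le> (\<integral>\<omega>. \<bar>f (Y \<omega>) - f (Y \<omega>) * h (Y \<omega>)\<bar> \<partial>P)" by (rule integral_abs_bound)
      also have "\<dots> \<le> (\<integral>\<omega>. B * (1 - h (Y \<omega>)) \<partial>P)"
      proof (rule integral_mono)
        fix \<omega>
        have "\<bar>f (Y \<omega>) - f (Y \<omega>) * h (Y \<omega>)\<bar> = \<bar>f (Y \<omega>)\<bar> * (1 - h (Y \<omega>))"
        proof -
          have "f (Y \<omega>) - f (Y \<omega>) * h (Y \<omega>) = f (Y \<omega>) * (1 - h (Y \<omega>))"
            by (simp add: algebra_simps)
          then show ?thesis using h01[of "Y \<omega>"] by (simp add: abs_mult)
        qed
        then show "\<bar>f (Y \<omega>) - f (Y \<omega>) * h (Y \<omega>)\<bar> \<le> B * (1 - h (Y \<omega>))"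
          using B(2)[of "Y \<omega>"] h01(2)[of "Y \<omega>"] by (simp add: mult_right_mono)
      qed (use i i2 in auto)
      finally show ?thesis using i by (simp add: P.prob_space)
    qed
    show "\<exists>n0. \<forall>n\<ge>n0. norm ((\<integral>\<omega>. f (Z' n \<omega>) \<partial>M) - (\<integral>x. f x \<partial>N)) < e"
    proof (intro exI[of _ "max n1 n2"] allI impI)
      fix n assume "n \<ge> max n1 n2"
      then have a: "\<bar>(\<integral>\<omega>. h (Z' n \<omega>) \<partial>M) - (\<integral>x. h x \<partial>N)\<bar> < e / (4 * B)"
        "\<bar>(\<integral>\<omega>. f (Z' n \<omega>) * h (Z' n \<omega>) \<partial>M) - (\<integral>x. f x * h x \<partial>N)\<bar> < e / 4"
        using n1 n2 by auto
      have idm: "(\<lambda>x. x) \<in> borel_measurable N" by simp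
      have "B * (1 - (\<integral>\<omega>. h (Z' n \<omega>) \<partial>M)) < B * (2 * (e / (4 * B)))"
        using a(1) Nh B(1) by (intro mult_strict_left_mono) linarith+
      then have b1: "B * (1 - (\<integral>\<omega>. h (Z' n \<omega>) \<partial>M)) < e / 2" using B(1) by (simp add: field_simps)
      have "B * (1 - (\<integral>x. h x \<partial>N)) < B * (e / (4 * B))"
        using Nh B(1) by (intro mult_strict_left_mono)
      then have b2: "B * (1 - (\<integral>x. h x \<partial>N)) < e / 4" using B(1) by simp
      from a(2) b1 b2 dif[OF M Z'[of n]] dif[OF N idm]
      show "norm ((\<integral>\<omega>. f (Z' n \<omega>) \<partial>M) - (\<integral>x. f x \<partial>N)) < e"
        unfolding real_norm_def by linarith
    qed
  qed
  then show "(\<lambda>n. \<integral>\<omega>. f (Z n \<omega>) \<partial>M) \<longlonglongrightarrow> (\<integral>x. f x \<partial>N)"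
    by (rule Lim_transform_eventually) (use ev in eventually_elim, simp)
qed

subsection \<open>Quadratic forms in normal vectors\<close>

lemma multi_normal_linear_functional:
  fixes C :: "real^'n^'n"
  assumes C: "pos_def C" and v: "v \<noteq> 0"
  shows "distr (multi_normal 0 C) borel (\<lambda>x. (v \<bullet> x) / sqrt (v \<bullet> (C *v v))) = std_normal_distribution"
proof (rule Levy_uniqueness)
  let ?N = "multi_normal 0 C" and ?s = "sqrt (v \<bullet> (C *v v))"
  interpret N: prob_space ?N by (rule prob_space_multi_normal[OF C])
  have s: "v \<bullet> (C *v v) > 0" using C v by (auto simp: pos_def_def)
  show "real_distribution (distr ?N borel (\<lambda>x. (v \<bullet> x) / ?s))"
    by (rule N.real_distribution_distr) simp
  show "real_distribution std_normal_distribution" by (rule real_dist_normal_dist)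
  show "char (distr ?N borel (\<lambda>x. (v \<bullet> x) / ?s)) = char std_normal_distribution"
  proof
    fix t
    have "char (distr ?N borel (\<lambda>x. (v \<bullet> x) / ?s)) t = (CLINT x|?N. iexp (((t / ?s) *\<^sub>R v) \<bullet> x))"
      unfolding char_def by (subst integral_distr) simp_all
    also have "\<dots> = exp (- (((t / ?s) *\<^sub>R v) \<bullet> (C *v ((t / ?s) *\<^sub>R v))) / 2)"
      by (rule char_multi_normal[OF C])
    also have "((t / ?s) *\<^sub>R v) \<bullet> (C *v ((t / ?s) *\<^sub>R v)) = t\<^sup>2"
      using s by (simp add: matrix_vector_mult_scaleR power2_eq_square)
    finally show "char (distr ?N borel (\<lambda>x. (v \<bullet> x) / ?s)) t = char std_normal_distribution t"
      by (simp add: char_std_normal_distribution)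
  qed
qed

text \<open>Divided by its standard deviation, \<open>v \<bullet> x\<close> is standard normal, with
  second moment 1 and fourth moment 3; \<open>v = 0\<close> cannot be normalized and is treated
  apart.\<close>

lemma multi_normal_inner_moments:
  fixes C :: "real^'n^'n"
  assumes C: "pos_def C"
  shows "integrable (multi_normal 0 C) (\<lambda>x. (v \<bullet> x) ^ k)"
    and "(\<integral>x. (v \<bullet> x) ^ 2 \<partial>multi_normal 0 C) = v \<bullet> (C *v v)"
    and "(\<integral>x. (v \<bullet> x) ^ 4 \<partial>multi_normal 0 C) = 3 * (v \<bullet> (C *v v))\<^sup>2"
proof -
  let ?N = "multi_normal 0 C" and ?s = "sqrt (v \<bullet> (C *v v))"
  interpret N: prob_space ?N by (rule prob_space_multi_normal[OF C])
  have "integrable ?N (\<lambda>x. (v \<bullet> x) ^ k) \<and> (\<integral>x. (v \<bullet> x) ^ 2 \<partial>?N) = v \<bullet> (C *v v) \<and>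
     (\<integral>x. (v \<bullet> x) ^ 4 \<partial>?N) = 3 * (v \<bullet> (C *v v))\<^sup>2"
  proof (cases "v = 0")
    case False
    note D = multi_normal_linear_functional[OF C False]
    have s: "v \<bullet> (C *v v) > 0" using C False by (auto simp: pos_def_def)
    have e: "(v \<bullet> x) ^ j = ?s ^ j * ((v \<bullet> x) / ?s) ^ j" for x j using s by (simp add: power_divide)
    have i: "integrable ?N (\<lambda>x. ((v \<bullet> x) / ?s) ^ j)" for j
      using integrable_std_normal_distribution_moment[of j] unfolding D[symmetric]
      by (subst (asm) integrable_distr_eq) simp_all
    have m: "(\<integral>x. ((v \<bullet> x) / ?s) ^ (2 * j) \<partial>?N) = fact (2 * j) / (2 ^ j * fact j)" for j
      using std_normal_distribution_even_moments(1)[of j] unfolding D[symmetric]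
      by (subst (asm) integral_distr) simp_all
    have "integrable ?N (\<lambda>x. (v \<bullet> x) ^ k)" unfolding e[of _ k] using i by simp
    moreover have "(\<integral>x. (v \<bullet> x) ^ 2 \<partial>?N) = v \<bullet> (C *v v)"
      unfolding e[of _ 2] using m[of 1] s by (simp del: power_divide times_divide_eq_right)
    moreover have "(\<integral>x. (v \<bullet> x) ^ 4 \<partial>?N) = 3 * (v \<bullet> (C *v v))\<^sup>2"
    proof -
      have "?s ^ 4 = (v \<bullet> (C *v v))\<^sup>2" using s by (simp add: power4_eq_xxxx power2_eq_square)
      moreover have "fact 4 / (2 ^ 2 * fact 2) = (3 :: real)" by (simp add: fact_numeral)
      ultimately show ?thesis
        unfolding e[of _ 4] using m[of 2] by (simp del: power_divide times_divide_eq_right)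
    qed
    ultimately show ?thesis by blast
  qed (simp add: power_0_left N.prob_space)
  then show "integrable (multi_normal 0 C) (\<lambda>x. (v \<bullet> x) ^ k)"
    and "(\<integral>x. (v \<bullet> x) ^ 2 \<partial>multi_normal 0 C) = v \<bullet> (C *v v)"
    and "(\<integral>x. (v \<bullet> x) ^ 4 \<partial>multi_normal 0 C) = 3 * (v \<bullet> (C *v v))\<^sup>2"
    by blast+
qed

text \<open>Polarization of the fourth power: multiplied by the product of its signs, each of the
  eight sign patterns contributes \<open>24 * a * b * c * d\<close>, all other monomials cancel, and
  \<open>192 = 8 * 24\<close>.\<close>

lemma polarization_4:
  fixes a b c d :: real
  shows "a * b * c * d = ((a+b+c+d)^4 - (a-b+c+d)^4 - (a+b-c+d)^4 - (a+b+c-d)^4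
    + (a-b-c+d)^4 + (a-b+c-d)^4 + (a+b-c-d)^4 - (a-b-c-d)^4) / 192"
  by (simp add: power4_eq_xxxx) algebra

text \<open>Wick's formula as a polynomial identity: \<open>xy\<close> stands for
  \<open>x \<bullet> (C *v y)\<close> and so on, and each squared bracket times 3 is the fourth
  moment of one of the eight signed sums in \<open>polarization_4\<close>.\<close>

lemma wick_identity:
  fixes xx :: real
  shows "(3*(xx+yy+zz+ww + 2*xy + 2*xz + 2*xw + 2*yz + 2*yw + 2*zw)\<^sup>2
    - 3*(xx+yy+zz+ww - 2*xy + 2*xz + 2*xw - 2*yz - 2*yw + 2*zw)\<^sup>2
    - 3*(xx+yy+zz+ww + 2*xy - 2*xz + 2*xw - 2*yz + 2*yw - 2*zw)\<^sup>2
    - 3*(xx+yy+zz+ww + 2*xy + 2*xz - 2*xw + 2*yz - 2*yw - 2*zw)\<^sup>2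
    + 3*(xx+yy+zz+ww - 2*xy - 2*xz + 2*xw + 2*yz - 2*yw - 2*zw)\<^sup>2
    + 3*(xx+yy+zz+ww - 2*xy + 2*xz - 2*xw - 2*yz + 2*yw - 2*zw)\<^sup>2
    + 3*(xx+yy+zz+ww + 2*xy - 2*xz - 2*xw - 2*yz - 2*yw + 2*zw)\<^sup>2
    - 3*(xx+yy+zz+ww - 2*xy - 2*xz - 2*xw + 2*yz + 2*yw + 2*zw)\<^sup>2) / 192
    = xy * zw + xz * yw + xw * yz"
  by (simp add: power2_eq_square algebra_simps)

lemma pos_def_inner_sym:
  assumes "pos_def C" shows "x \<bullet> (C *v y) = y \<bullet> (C *v x)"
  using assms inner_matrix_transpose[of x C y] by (simp add: pos_def_def inner_commute)

lemma multi_normal_product_moments: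
  fixes C :: "real^'n^'n"
  assumes C: "pos_def C"
  shows "integrable (multi_normal 0 C) (\<lambda>g. (x \<bullet> g) * (y \<bullet> g))"
    and "(\<integral>g. (x \<bullet> g) * (y \<bullet> g) \<partial>multi_normal 0 C) = x \<bullet> (C *v y)"
    and "integrable (multi_normal 0 C) (\<lambda>g. (x \<bullet> g) * (y \<bullet> g) * (z \<bullet> g) * (w \<bullet> g))"
    and "(\<integral>g. (x \<bullet> g) * (y \<bullet> g) * (z \<bullet> g) * (w \<bullet> g) \<partial>multi_normal 0 C) =
      (x \<bullet> (C *v y)) * (z \<bullet> (C *v w)) + (x \<bullet> (C *v z)) * (y \<bullet> (C *v w)) + (x \<bullet> (C *v w)) * (y \<bullet> (C *v z))"
proof -
  let ?N = "multi_normal 0 C"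
  note m = multi_normal_inner_moments[OF C]
  have e2: "(x \<bullet> g) * (y \<bullet> g) = (((x + y) \<bullet> g) ^ 2 - ((x - y) \<bullet> g) ^ 2) / 4" for g
    by (simp add: inner_diff_left inner_add_left power2_eq_square field_simps)
  show "integrable ?N (\<lambda>g. (x \<bullet> g) * (y \<bullet> g))" unfolding e2 using m(1) by auto
  have sw: "y \<bullet> (C *v x) = x \<bullet> (C *v y)" for x y by (rule pos_def_inner_sym[OF C])
  have "(\<integral>g. (x \<bullet> g) * (y \<bullet> g) \<partial>?N) = ((x + y) \<bullet> (C *v (x + y)) - (x - y) \<bullet> (C *v (x - y))) / 4"
    unfolding e2 using m(1) by (simp add: m(2))
  then show "(\<integral>g. (x \<bullet> g) * (y \<bullet> g) \<partial>?N) = x \<bullet> (C *v y)"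
    by (simp add: matrix_vector_right_distrib matrix_vector_mult_diff_distrib inner_simps sw[of y x])
  let ?q = "\<lambda>v. v \<bullet> (C *v v)"
  have e4: "(x \<bullet> g) * (y \<bullet> g) * (z \<bullet> g) * (w \<bullet> g) = (((x+y+z+w) \<bullet> g)^4 - ((x-y+z+w) \<bullet> g)^4 - ((x+y-z+w) \<bullet> g)^4 - ((x+y+z-w) \<bullet> g)^4
    + ((x-y-z+w) \<bullet> g)^4 + ((x-y+z-w) \<bullet> g)^4 + ((x+y-z-w) \<bullet> g)^4 - ((x-y-z-w) \<bullet> g)^4) / 192" for g
    unfolding inner_diff_left inner_add_left by (rule polarization_4)
  show "integrable ?N (\<lambda>g. (x \<bullet> g) * (y \<bullet> g) * (z \<bullet> g) * (w \<bullet> g))" unfolding e4 using m(1) by auto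
  define xx where "xx = x \<bullet> (C *v x)" define yy where "yy = y \<bullet> (C *v y)"
  define zz where "zz = z \<bullet> (C *v z)" define ww where "ww = w \<bullet> (C *v w)"
  define xy where "xy = x \<bullet> (C *v y)" define xz where "xz = x \<bullet> (C *v z)" define xw where "xw = x \<bullet> (C *v w)"
  define yz where "yz = y \<bullet> (C *v z)" define yw where "yw = y \<bullet> (C *v w)" define zw where "zw = z \<bullet> (C *v w)"
  note ds = xx_def yy_def zz_def ww_def xy_def xz_def xw_def yz_def yw_def zw_def
  have ex: "?q (x + r *\<^sub>R y + t *\<^sub>R z + u *\<^sub>R w) = xx + r*r*yy + t*t*zz + u*u*ww + 2*r*xy + 2*t*xz + 2*u*xw
      + 2*r*t*yz + 2*r*u*yw + 2*t*u*zw" for r t u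
    unfolding ds
    by (simp add: matrix_vector_right_distrib matrix_vector_mult_scaleR inner_simps sw[of y x] sw[of z x] sw[of w x] sw[of z y] sw[of w y] sw[of w z] algebra_simps)
  have "(\<integral>g. (x \<bullet> g) * (y \<bullet> g) * (z \<bullet> g) * (w \<bullet> g) \<partial>?N) = (3*(?q (x+y+z+w))\<^sup>2 - 3*(?q (x-y+z+w))\<^sup>2 - 3*(?q (x+y-z+w))\<^sup>2 - 3*(?q (x+y+z-w))\<^sup>2
    + 3*(?q (x-y-z+w))\<^sup>2 + 3*(?q (x-y+z-w))\<^sup>2 + 3*(?q (x+y-z-w))\<^sup>2 - 3*(?q (x-y-z-w))\<^sup>2) / 192"
    unfolding e4 using m(1) by (simp add: m(3))
  also have "\<dots> = xy * zw + xz * yw + xw * yz"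
  proof -
    have q: "?q (x+y+z+w) = xx + yy + zz + ww + 2*xy + 2*xz + 2*xw + 2*yz + 2*yw + 2*zw"
      "?q (x-y+z+w) = xx + yy + zz + ww - 2*xy + 2*xz + 2*xw - 2*yz - 2*yw + 2*zw"
      "?q (x+y-z+w) = xx + yy + zz + ww + 2*xy - 2*xz + 2*xw - 2*yz + 2*yw - 2*zw"
      "?q (x+y+z-w) = xx + yy + zz + ww + 2*xy + 2*xz - 2*xw + 2*yz - 2*yw - 2*zw"
      "?q (x-y-z+w) = xx + yy + zz + ww - 2*xy - 2*xz + 2*xw + 2*yz - 2*yw - 2*zw"
      "?q (x-y+z-w) = xx + yy + zz + ww - 2*xy + 2*xz - 2*xw - 2*yz + 2*yw - 2*zw"
      "?q (x+y-z-w) = xx + yy + zz + ww + 2*xy - 2*xz - 2*xw - 2*yz - 2*yw + 2*zw"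
      "?q (x-y-z-w) = xx + yy + zz + ww - 2*xy - 2*xz - 2*xw + 2*yz + 2*yw + 2*zw"
      using ex[of 1 1 1] ex[of "-1" 1 1] ex[of 1 "-1" 1] ex[of 1 1 "-1"] ex[of "-1" "-1" 1] ex[of "-1" 1 "-1"] ex[of 1 "-1" "-1"] ex[of "-1" "-1" "-1"]
      by simp_all
    show ?thesis unfolding q by (rule wick_identity)
  qed
  finally show "(\<integral>g. (x \<bullet> g) * (y \<bullet> g) * (z \<bullet> g) * (w \<bullet> g) \<partial>multi_normal 0 C) =
      (x \<bullet> (C *v y)) * (z \<bullet> (C *v w)) + (x \<bullet> (C *v z)) * (y \<bullet> (C *v w)) + (x \<bullet> (C *v w)) * (y \<bullet> (C *v z))"
    unfolding ds .
qed

text \<open>Of the three pairings in Wick's formula, the one that joins \<open>a\<close> with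
  \<open>b\<close> sums to \<open>m\<^sup>2\<close> and is removed by centring; the other two agree
  because \<open>c\<close> is symmetric, which gives the factor 2.\<close>

lemma multi_normal_quadratic_form:
  fixes C :: "real^'n^'n" and c :: "'n \<Rightarrow> 'n \<Rightarrow> real"
  assumes C: "pos_def C" and sym: "\<And>a b. c a b = c b a"
  defines "U \<equiv> \<lambda>g::real^'n. \<Sum>a\<in>UNIV. \<Sum>b\<in>UNIV. c a b * (g $ a * g $ b)"
    and "m \<equiv> \<Sum>a\<in>UNIV. \<Sum>b\<in>UNIV. c a b * C $ a $ b"
  shows "integrable (multi_normal 0 C) U" "(\<integral>g. U g \<partial>multi_normal 0 C) = m"
    and "integrable (multi_normal 0 C) (\<lambda>g. (U g - m)\<^sup>2)"
    and "(\<integral>g. (U g - m)\<^sup>2 \<partial>multi_normal 0 C) =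
      2 * (\<Sum>a\<in>UNIV. \<Sum>b\<in>UNIV. \<Sum>d\<in>UNIV. \<Sum>e\<in>UNIV. c a b * c d e * (C $ a $ d * C $ b $ e))"
proof -
  let ?N = "multi_normal 0 C"
  interpret N: prob_space ?N by (rule prob_space_multi_normal[OF C])
  have comp: "g $ a = axis a 1 \<bullet> g" for g :: "real^'n" and a by (simp add: inner_axis')
  have i2: "integrable ?N (\<lambda>g. g $ a * g $ b)" for a b
    using multi_normal_product_moments(1)[OF C, of "axis a 1" "axis b 1"] by (simp add: inner_axis')
  have m2: "(\<integral>g. g $ a * g $ b \<partial>?N) = C $ a $ b" for a b
    using multi_normal_product_moments(2)[OF C, of "axis a 1" "axis b 1"] by (simp add: inner_axis' matrix_vector_mult_basis column_def)
  have i4: "integrable ?N (\<lambda>g. g $ a * g $ b * g $ d * g $ e)" for a b d e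
    using multi_normal_product_moments(3)[OF C, of "axis a 1" "axis b 1" "axis d 1" "axis e 1"] by (simp add: inner_axis')
  have m4: "(\<integral>g. g $ a * g $ b * g $ d * g $ e \<partial>?N) = C $ a $ b * C $ d $ e + C $ a $ d * C $ b $ e + C $ a $ e * C $ b $ d" for a b d e
    using multi_normal_product_moments(4)[OF C, of "axis a 1" "axis b 1" "axis d 1" "axis e 1"] by (simp add: inner_axis' matrix_vector_mult_basis column_def)
  show iU: "integrable ?N U" unfolding U_def by (intro Bochner_Integration.integrable_sum integrable_mult_right i2)
  show mU: "(\<integral>g. U g \<partial>?N) = m"
    unfolding U_def m_def by (simp add: i2 m2)
  have U2: "(U g)\<^sup>2 = (\<Sum>a\<in>UNIV. \<Sum>b\<in>UNIV. \<Sum>d\<in>UNIV. \<Sum>e\<in>UNIV. c a b * c d e * (g $ a * g $ b * g $ d * g $ e))" for g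
    unfolding U_def power2_eq_square sum_distrib_right sum_distrib_left by (simp add: mult_ac)
  have iU2: "integrable ?N (\<lambda>g. (U g)\<^sup>2)"
    unfolding U2 by (intro Bochner_Integration.integrable_sum integrable_mult_right i4)
  have sq: "(U g - m)\<^sup>2 = (U g)\<^sup>2 - 2 * m * U g + m\<^sup>2" for g by (simp add: power2_diff)
  show "integrable ?N (\<lambda>g. (U g - m)\<^sup>2)" unfolding sq using iU iU2 by simp
  have "(\<integral>g. (U g)\<^sup>2 \<partial>?N) = (\<Sum>a\<in>UNIV. \<Sum>b\<in>UNIV. \<Sum>d\<in>UNIV. \<Sum>e\<in>UNIV. c a b * c d e * (C $ a $ b * C $ d $ e + C $ a $ d * C $ b $ e + C $ a $ e * C $ b $ d))"
    unfolding U2 by (simp add: i4 m4)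
  also have "\<dots> = (\<Sum>a\<in>UNIV. \<Sum>b\<in>UNIV. \<Sum>d\<in>UNIV. \<Sum>e\<in>UNIV. (c a b * C $ a $ b) * (c d e * C $ d $ e))
     + (\<Sum>a\<in>UNIV. \<Sum>b\<in>UNIV. \<Sum>d\<in>UNIV. \<Sum>e\<in>UNIV. c a b * c d e * (C $ a $ d * C $ b $ e))
     + (\<Sum>a\<in>UNIV. \<Sum>b\<in>UNIV. \<Sum>d\<in>UNIV. \<Sum>e\<in>UNIV. c a b * c d e * (C $ a $ e * C $ b $ d))"
    by (simp add: sum.distrib[symmetric] algebra_simps)
  also have "(\<Sum>a\<in>UNIV. \<Sum>b\<in>UNIV. \<Sum>d\<in>UNIV. \<Sum>e\<in>UNIV. (c a b * C $ a $ b) * (c d e * C $ d $ e)) = m\<^sup>2"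
  proof -
    have 1: "m * K = (\<Sum>a\<in>UNIV. \<Sum>b\<in>UNIV. (c a b * C $ a $ b) * K)" for K by (simp only: m_def sum_distrib_right)
    have 2: "K * m = (\<Sum>a\<in>UNIV. \<Sum>b\<in>UNIV. K * (c a b * C $ a $ b))" for K by (simp only: m_def sum_distrib_left)
    have "m\<^sup>2 = m * m" by (rule power2_eq_square)
    also have "\<dots> = (\<Sum>a\<in>UNIV. \<Sum>b\<in>UNIV. (c a b * C $ a $ b) * m)" by (rule 1)
    finally show ?thesis by (simp only: 2)
  qed
  also have "(\<Sum>a\<in>UNIV. \<Sum>b\<in>UNIV. \<Sum>d\<in>UNIV. \<Sum>e\<in>UNIV. c a b * c d e * (C $ a $ e * C $ b $ d)) =
     (\<Sum>a\<in>UNIV. \<Sum>b\<in>UNIV. \<Sum>d\<in>UNIV. \<Sum>e\<in>UNIV. c a b * c d e * (C $ a $ d * C $ b $ e))"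
    by (subst (3) sum.swap) (simp add: sym)
  finally have "(\<integral>g. (U g)\<^sup>2 \<partial>?N) = m\<^sup>2 + 2 * (\<Sum>a\<in>UNIV. \<Sum>b\<in>UNIV. \<Sum>d\<in>UNIV. \<Sum>e\<in>UNIV. c a b * c d e * (C $ a $ d * C $ b $ e))"
    by simp
  moreover have "(\<integral>g. (U g - m)\<^sup>2 \<partial>?N) = (\<integral>g. (U g)\<^sup>2 \<partial>?N) - 2 * m * m + m\<^sup>2"
    unfolding sq using iU iU2 mU N.prob_space by simp
  ultimately show "(\<integral>g. (U g - m)\<^sup>2 \<partial>?N) =
      2 * (\<Sum>a\<in>UNIV. \<Sum>b\<in>UNIV. \<Sum>d\<in>UNIV. \<Sum>e\<in>UNIV. c a b * c d e * (C $ a $ d * C $ b $ e))"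
    by (simp add: power2_eq_square)
qed

text \<open>Equality of characteristic functions gives equality of laws: a constant sequence is fed
  into \<open>levy_continuity_vec\<close>, so bounded continuous functions, here the cosine and the
  sine of \<open>U\<close>, have the same mean on both sides.\<close>

lemma converges_in_dist_const_iexp:
  fixes Y :: "'w \<Rightarrow> real^'n"
  assumes M: "prob_space M" and Y: "Y \<in> borel_measurable M" and N: "prob_space N" and sN: "sets N = sets borel"
    and ch: "\<And>t. (CLINT \<omega>|M. iexp (t \<bullet> Y \<omega>)) = (CLINT x|N. iexp (t \<bullet> x))"
    and U: "continuous_on UNIV U"
  shows "(CLINT \<omega>|M. iexp (U (Y \<omega>))) = (CLINT x|N. iexp (U x))"
proof -
  interpret M: prob_space M by fact
  interpret N: prob_space N by fact
  note Y[measurable] sN[measurable_cong]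
  have [measurable]: "U \<in> borel_measurable borel" by (rule borel_measurable_continuous_onI[OF U])
  have "converges_in_dist M (\<lambda>n. Y) N"
    by (rule levy_continuity_vec[OF M Y N sN]) (simp add: ch)
  then have eq: "(\<integral>\<omega>. f (Y \<omega>) \<partial>M) = (\<integral>x. f x \<partial>N)" if "continuous_on UNIV f" "bounded (range f)" for f :: "real^'n \<Rightarrow> real"
    using that unfolding converges_in_dist_def by (metis LIMSEQ_const_iff)
  have c: "(\<integral>\<omega>. cos (U (Y \<omega>)) \<partial>M) = (\<integral>x. cos (U x) \<partial>N)"
    by (rule eq[of "\<lambda>x. cos (U x)"]) (auto intro!: continuous_intros U boundedI[where B=1])
  have s: "(\<integral>\<omega>. sin (U (Y \<omega>)) \<partial>M) = (\<integral>x. sin (U x) \<partial>N)"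
    by (rule eq[of "\<lambda>x. sin (U x)"]) (auto intro!: continuous_intros U boundedI[where B=1])
  have i1: "integrable M (\<lambda>\<omega>. iexp (U (Y \<omega>)))" "integrable N (\<lambda>x. iexp (U x))"
    by (rule M.integrable_iexp N.integrable_iexp; simp)+
  show ?thesis
    by (rule complex_eqI)
      (simp_all only: integral_Re[OF i1(1), symmetric] integral_Re[OF i1(2), symmetric] integral_Im[OF i1(1), symmetric] integral_Im[OF i1(2), symmetric] Re_exp Im_exp,
       simp_all add: c s)
qed

text \<open>Second order expansion of the characteristic function at 0, raised to the power
  \<open>n\<close>. The remainder \<open>?I\<close> is an integral dominated by
  \<open>6 * x\<^sup>2\<close>, so second moments suffice for it to vanish.\<close>

lemma char_power_tendsto:
  fixes \<nu> :: "real measure"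
  assumes "real_distribution \<nu>" and i1: "integrable \<nu> (\<lambda>x. x)" and m: "(\<integral>x. x \<partial>\<nu>) = 0"
    and i2: "integrable \<nu> (\<lambda>x. x\<^sup>2)" and v: "(\<integral>x. x\<^sup>2 \<partial>\<nu>) = s2"
  shows "(\<lambda>n. char \<nu> (t / sqrt (real n)) ^ n) \<longlonglongrightarrow> exp (- (t\<^sup>2 * s2) / 2)"
proof -
  interpret \<nu>: real_distribution \<nu> by fact
  have s2: "0 \<le> s2" unfolding v[symmetric] by simp
  let ?w = "\<lambda>n. 1 + (- (t\<^sup>2 * s2) / 2) / real n"
  let ?I = "\<lambda>n. LINT x|\<nu>. min (6 * x\<^sup>2) (\<bar>t / sqrt (real n)\<bar> * \<bar>x\<bar> ^ 3)"
  have "eventually (\<lambda>n. cmod (char \<nu> (t / sqrt (real n)) ^ n - complex_of_real (?w n ^ n)) \<le> t\<^sup>2 / 6 * ?I n) sequentially"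
  proof (rule eventually_sequentiallyI)
    \<comment> \<open>The threshold gives \<open>t\<^sup>2 * s2 \<le> real n\<close>, hence
      \<open>\<bar>?w n\<bar> \<le> 1\<close>; the \<open>n\<close>-th powers of two numbers in the
      unit disc differ by at most \<open>n\<close> times their distance.\<close>
    fix n :: nat assume "n \<ge> nat (ceiling (t\<^sup>2 * s2)) + 1"
    then have n: "real n > 0" "t\<^sup>2 * s2 \<le> real n" by linarith+
    have "norm (char \<nu> (t / sqrt (real n)) - (1 - (t / sqrt (real n))\<^sup>2 * s2 / 2)) \<le> (t / sqrt (real n))\<^sup>2 / 6 * ?I n"
      by (rule \<nu>.char_approx3[OF i1 m i2]) (simp add: m v)
    also have "1 - (t / sqrt (real n))\<^sup>2 * s2 / 2 = ?w n" using n by (simp add: power_divide)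
    finally have *: "norm (char \<nu> (t / sqrt (real n)) - complex_of_real (?w n)) \<le> (t / sqrt (real n))\<^sup>2 / 6 * ?I n"
      using n by (simp add: power_divide)
    have "\<bar>?w n\<bar> \<le> 1" using n s2 by (auto simp: abs_le_iff field_simps)
    then have "norm (char \<nu> (t / sqrt (real n)) ^ n - complex_of_real (?w n) ^ n) \<le>
        n * norm (char \<nu> (t / sqrt (real n)) - complex_of_real (?w n))"
      by (intro norm_power_diff \<nu>.cmod_char_le_1) (simp only: norm_of_real)
    also have "\<dots> \<le> n * ((t / sqrt (real n))\<^sup>2 / 6 * ?I n)" by (intro mult_left_mono *) simp
    also have "\<dots> = t\<^sup>2 / 6 * ?I n" using n by (simp add: power_divide)
    finally show "cmod (char \<nu> (t / sqrt (real n)) ^ n - complex_of_real (?w n ^ n)) \<le> t\<^sup>2 / 6 * ?I n" by simp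
  qed
  moreover have "(\<lambda>n. t\<^sup>2 / 6 * ?I n) \<longlonglongrightarrow> 0"
  proof -
    have "(\<lambda>n. min (6 * x\<^sup>2) (\<bar>t / sqrt (real n)\<bar> * \<bar>x\<bar> ^ 3)) \<longlonglongrightarrow> 0" for x
    proof -
      have "(\<lambda>n. \<bar>t / sqrt (real n)\<bar> * \<bar>x\<bar> ^ 3) \<longlonglongrightarrow> 0"
      proof -
        have "(\<lambda>n. \<bar>t\<bar> * \<bar>x\<bar> ^ 3 / sqrt (real n)) \<longlonglongrightarrow> 0"
          by (auto intro!: tendsto_divide_0 filterlim_at_top_imp_at_infinity
              sqrt_at_top[THEN filterlim_compose] filterlim_real_sequentially)
        then show ?thesis by (simp add: abs_divide)
      qed
      from tendsto_min[OF tendsto_const[of "6 * x\<^sup>2"] this] show ?thesis by (simp add: min_absorb2)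
    qed
    then have "?I \<longlonglongrightarrow> (LINT x|\<nu>. 0)"
      using i2 by (intro integral_dominated_convergence[where w = "\<lambda>x. 6 * x\<^sup>2"]) auto
    from tendsto_mult_left[OF this, of "t\<^sup>2 / 6"] show ?thesis by simp
  qed
  ultimately have "(\<lambda>n. char \<nu> (t / sqrt (real n)) ^ n - complex_of_real (?w n ^ n)) \<longlonglongrightarrow> 0"
    by (rule Lim_null_comparison)
  moreover have "(\<lambda>n. complex_of_real (?w n ^ n)) \<longlonglongrightarrow> complex_of_real (exp (- (t\<^sup>2 * s2) / 2))"
    by (intro tendsto_of_real tendsto_exp_limit_sequentially)
  ultimately show ?thesis by (rule Lim_transform[rotated])
qed

text \<open>The grid changes with \<open>n\<close>, so the rows are not linked to each other. Within
  row \<open>n\<close> the summands are independent with the law of \<open>U - m\<close> under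
  \<open>N\<close>, and the characteristic function of the row sum is a power of one fixed
  function.\<close>

lemma triangular_array_clt:
  fixes g :: "nat \<Rightarrow> nat \<Rightarrow> 'w \<Rightarrow> real^'n" and U :: "real^'n \<Rightarrow> real"
  assumes M: "prob_space M" and N: "prob_space N" and sN: "sets N = sets borel"
    and ind: "\<And>n. n > 0 \<Longrightarrow> prob_space.indep_vars M (\<lambda>_. borel) (g n) {..<n}"
    and ch: "\<And>n i t. i < n \<Longrightarrow> (CLINT \<omega>|M. iexp (t \<bullet> g n i \<omega>)) = (CLINT x|N. iexp (t \<bullet> x))"
    and U: "continuous_on UNIV U" and iU: "integrable N U" and mU: "(\<integral>x. U x \<partial>N) = m"
    and iU2: "integrable N (\<lambda>x. (U x - m)\<^sup>2)" and vU: "(\<integral>x. (U x - m)\<^sup>2 \<partial>N) = s2"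
  shows "(\<lambda>n. CLINT \<omega>|M. iexp ((\<Sum>i<n. U (g n i \<omega>) - m) / sqrt (real n))) \<longlonglongrightarrow> exp (- s2 / 2)"
proof -
  interpret M: prob_space M by fact
  interpret N: prob_space N by fact
  note sN[measurable_cong]
  have mU': "U \<in> borel_measurable borel" by (rule borel_measurable_continuous_onI[OF U])
  note mU'[measurable]
  define \<nu> where "\<nu> = distr N borel (\<lambda>x. U x - m)"
  have \<nu>: "real_distribution \<nu>" unfolding \<nu>_def by (rule N.real_distribution_distr) simp
  have lim: "(\<lambda>n. char \<nu> (1 / sqrt (real n)) ^ n) \<longlonglongrightarrow> exp (- (1\<^sup>2 * s2) / 2)"
    by (rule char_power_tendsto[OF \<nu>]) (use iU iU2 mU vU in \<open>simp_all add: \<nu>_def integrable_distr_eq integral_distr N.prob_space\<close>)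
  have eq: "(CLINT \<omega>|M. iexp ((\<Sum>i<n. U (g n i \<omega>) - m) / sqrt (real n))) = char \<nu> (1 / sqrt (real n)) ^ n"
    if n: "n > 0" for n
  proof -
    have gm[measurable]: "i < n \<Longrightarrow> g n i \<in> borel_measurable M" for i
      using ind[OF n] unfolding M.indep_vars_def by simp
    have ind': "M.indep_vars (\<lambda>_. borel) (\<lambda>i \<omega>. U (g n i \<omega>) - m) {..<n}"
      by (rule M.indep_vars_compose2[OF ind[OF n], of "\<lambda>_ x. U x - m"]) simp
    have sm: "(\<lambda>\<omega>. \<Sum>i<n. U (g n i \<omega>) - m) \<in> borel_measurable M"
      by (intro borel_measurable_sum) simp
    have "(CLINT \<omega>|M. iexp ((\<Sum>i<n. U (g n i \<omega>) - m) / sqrt (real n))) =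
        char (distr M borel (\<lambda>\<omega>. \<Sum>i<n. U (g n i \<omega>) - m)) (1 / sqrt (real n))"
      unfolding char_def by (subst integral_distr[OF sm]) simp_all
    also have "\<dots> = (\<Prod>i<n. char (distr M borel (\<lambda>\<omega>. U (g n i \<omega>) - m)) (1 / sqrt (real n)))"
      by (rule M.char_distr_sum[OF ind'])
    also have "\<dots> = (\<Prod>i<n. char \<nu> (1 / sqrt (real n)))"
    proof (rule prod.cong[OF refl])
      fix i assume "i \<in> {..<n}"
      then have i: "i < n" by simp
      have "(CLINT \<omega>|M. iexp ((1 / sqrt (real n)) * (U (g n i \<omega>) - m))) = (CLINT x|N. iexp ((1 / sqrt (real n)) * (U x - m)))"
        by (rule converges_in_dist_const_iexp[OF M gm[OF i] N sN ch[OF i], where U="\<lambda>x. (1 / sqrt (real n)) * (U x - m)"])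
          (intro continuous_intros U)
      then show "char (distr M borel (\<lambda>\<omega>. U (g n i \<omega>) - m)) (1 / sqrt (real n)) = char \<nu> (1 / sqrt (real n))"
        using gm[OF i] by (simp add: char_def \<nu>_def integral_distr)
    qed
    finally show ?thesis by simp
  qed
  have "eventually (\<lambda>n. char \<nu> (1 / sqrt (real n)) ^ n = (CLINT \<omega>|M. iexp ((\<Sum>i<n. U (g n i \<omega>) - m) / sqrt (real n)))) sequentially"
    by (intro eventually_mono[OF eventually_gt_at_top[of 0]]) (simp only: eq)
  from Lim_transform_eventually[OF lim this] show ?thesis by simp
qed

subsection \<open>Gaussian increments\<close>

text \<open>What the limit theorem uses of a matrix image of a Wiener process. The grid events are
  placed in a family \<open>G\<close>, so that several sources can be combined through independence
  of their families. The normal law is expressed by its characteristic function because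
  \<open>C\<close> may be singular.\<close>

definition gaussian_increments ::
  "'w measure \<Rightarrow> real \<Rightarrow> 'w set set \<Rightarrow> (real \<Rightarrow> 'w \<Rightarrow> real^'p) \<Rightarrow> real^'p^'p \<Rightarrow> bool" where
  "gaussian_increments M T G V C \<longleftrightarrow>
     (\<forall>t\<in>{0..T}. V t \<in> borel_measurable M) \<and>
     (\<forall>n>0. \<forall>A. (\<forall>i. A i \<in> sets borel) \<longrightarrow>
        (\<Inter>i<n. {\<omega>\<in>space M. V (real (Suc i) * (T / real n)) \<omega> - V (real i * (T / real n)) \<omega> \<in> A i}) \<in> G \<and>
        measure M (\<Inter>i<n. {\<omega>\<in>space M. V (real (Suc i) * (T / real n)) \<omega> - V (real i * (T / real n)) \<omega> \<in> A i}) =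
        (\<Prod>i<n. measure M {\<omega>\<in>space M. V (real (Suc i) * (T / real n)) \<omega> - V (real i * (T / real n)) \<omega> \<in> A i})) \<and>
     (\<forall>s t u. 0 \<le> s \<and> s < t \<and> t \<le> T \<longrightarrow>
        (CLINT \<omega>|M. iexp (u \<bullet> (V t \<omega> - V s \<omega>))) = exp (- ((t - s) * (u \<bullet> (C *v u))) / 2))"

lemma grid_le:
  assumes "0 < T" "0 < n" "k \<le> n" shows "real k * (T / real n) \<le> T"
proof -
  have "real k * (T / real n) \<le> real n * (T / real n)"
    using assms by (intro mult_right_mono) auto
  then show ?thesis using assms by simp
qed

lemma generated_increment:
  fixes W :: "real \<Rightarrow> 'w \<Rightarrow> real^'r"
  assumes "A \<in> sets borel" "s \<in> I" "t \<in> I"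
  shows "{\<omega>\<in>space M. W t \<omega> - W s \<omega> \<in> A} \<in> generated_events M W I"
proof -
  let ?G = "\<Union>t\<in>I. {W t -` A \<inter> space M | A. A \<in> sets borel}"
  let ?S = "sigma (space M) ?G"
  have G: "?G \<subseteq> Pow (space M)" by auto
  have m: "W t \<in> borel_measurable ?S" if "t \<in> I" for t
    by (rule measurableI) (use that G in \<open>auto simp: sets_measure_of space_measure_of intro!: sigma_sets.Basic\<close>)
  have "(\<lambda>\<omega>. W t \<omega> - W s \<omega>) -` A \<inter> space ?S \<in> sets ?S"
    by (intro measurable_sets[of _ _ borel] borel_measurable_diff m assms)
  then show ?thesis
    using G by (simp add: sets_measure_of space_measure_of generated_events_def vimage_def Int_def conj_commute)
qed

lemma generated_events_mono: "I \<subseteq> J \<Longrightarrow> generated_events M W I \<subseteq> generated_events M W J"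
  unfolding generated_events_def by (rule sigma_sets_mono') auto

lemma sigma_algebra_generated_events: "sigma_algebra (space M) (generated_events M W I)"
  unfolding generated_events_def by (rule sigma_algebra_sigma_sets) auto

text \<open>Induction on \<open>k\<close>: the event of the first \<open>k\<close> increments is
  determined by the path up to grid time \<open>k\<close>, and the next increment is independent of
  that past. Intersecting with \<open>space M\<close> gives the empty intersection at
  \<open>k = 0\<close> its right meaning.\<close>

lemma wiener_increments_indep:
  fixes W :: "real \<Rightarrow> 'w \<Rightarrow> real^'r"
  assumes M: "prob_space M" and W: "standard_wiener M T W" and T: "T > 0" and n: "n > 0"
    and A: "\<And>i. A i \<in> sets borel"
  defines "E \<equiv> \<lambda>i. {\<omega>\<in>space M. W (real (Suc i) * (T / real n)) \<omega> - W (real i * (T / real n)) \<omega> \<in> A i}"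
  assumes k: "k \<le> n"
  shows "space M \<inter> (\<Inter>i<k. E i) \<in> generated_events M W {0..real k * (T / real n)}"
    and "measure M (space M \<inter> (\<Inter>i<k. E i)) = (\<Prod>i<k. measure M (E i))"
proof -
  interpret prob_space M by fact
  have h: "T / real n > 0" using T n by simp
  have "space M \<inter> (\<Inter>i<k. E i) \<in> generated_events M W {0..real k * (T / real n)} \<and>
      measure M (space M \<inter> (\<Inter>i<k. E i)) = (\<Prod>i<k. measure M (E i))"
    using k
  proof (induction k)
    case 0
    interpret S: sigma_algebra "space M" "generated_events M W {0..0}" by (rule sigma_algebra_generated_events)
    show ?case using S.top by (simp add: prob_space)
  next
    case (Suc k)
    let ?s = "real k * (T / real n)" and ?t = "real (Suc k) * (T / real n)"
    interpret S: sigma_algebra "space M" "generated_events M W {0..?t}" by (rule sigma_algebra_generated_events)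
    let ?D = "space M \<inter> (\<Inter>i<k. E i)"
    have st: "0 \<le> ?s" "?s < ?t" "?t \<le> T"
    proof -
      show "0 \<le> ?s" using h by (intro mult_nonneg_nonneg) auto
      show "?s < ?t" using h by (intro mult_strict_right_mono) auto
      show "?t \<le> T" by (rule grid_le[OF T n Suc.prems])
    qed
    have D: "?D \<in> generated_events M W {0..?s}" "measure M ?D = (\<Prod>i<k. measure M (E i))"
      using Suc by auto
    have E: "E k \<in> generated_events M W {0..?t}"
      unfolding E_def by (rule generated_increment[OF A]) (use st in auto)
    have E2: "E k \<in> generated_events M (\<lambda>u \<omega>. W u \<omega> - W ?s \<omega>) {?t}"
      unfolding generated_events_def E_def
      by (rule sigma_sets.Basic) (auto intro!: exI[of _ "A k"] A)
    have eq: "space M \<inter> (\<Inter>i<Suc k. E i) = ?D \<inter> E k"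
      by (auto simp: lessThan_Suc)
    have "indep_set (generated_events M W {0..?s}) (generated_events M (\<lambda>u \<omega>. W u \<omega> - W ?s \<omega>) {?t})"
      using W st unfolding standard_wiener_def by blast
    from indep_setD[OF this D(1) E2] have "measure M (?D \<inter> E k) = measure M ?D * measure M (E k)" .
    moreover have "?D \<inter> E k \<in> generated_events M W {0..?t}"
    proof (rule S.Int)
      have "{0..?s} \<subseteq> {0..?t}" using st by auto
      from generated_events_mono[OF this] D(1) show "?D \<in> generated_events M W {0..?t}" by (rule subsetD)
    qed (rule E)
    ultimately show ?case
      unfolding eq using D(2) by (simp add: mult.commute)
  qed
  then show "space M \<inter> (\<Inter>i<k. E i) \<in> generated_events M W {0..real k * (T / real n)}"
    and "measure M (space M \<inter> (\<Inter>i<k. E i)) = (\<Prod>i<k. measure M (E i))" by blast+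
qed

lemma wiener_gaussian_increments:
  fixes W :: "real \<Rightarrow> 'w \<Rightarrow> real^'r" and L :: "real^'r^'p"
  assumes M: "prob_space M" and W: "standard_wiener M T W" and T: "T > 0"
  shows "gaussian_increments M T (generated_events M W {0..T}) (\<lambda>t \<omega>. L *v W t \<omega>) (L ** transpose L)"
  unfolding gaussian_increments_def
proof (intro conjI ballI allI impI)
  interpret prob_space M by fact
  have mW: "W t \<in> borel_measurable M" if "t \<in> {0..T}" for t using W that by (auto simp: standard_wiener_def)
  show "(\<lambda>\<omega>. L *v W t \<omega>) \<in> borel_measurable M" if "t \<in> {0..T}" for t
    by (rule measurable_compose[OF mW[OF that] borel_measurable_matrix_vector_mult])
  show "(CLINT \<omega>|M. iexp (u \<bullet> (L *v W t \<omega> - L *v W s \<omega>))) = exp (- ((t - s) * (u \<bullet> ((L ** transpose L) *v u))) / 2)"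
    if st: "0 \<le> s \<and> s < t \<and> t \<le> T" for s t u
  proof -
    have mt: "(\<lambda>\<omega>. W t \<omega> - W s \<omega>) \<in> borel_measurable M"
      using st by (intro borel_measurable_diff mW) auto
    have d: "distr M borel (\<lambda>\<omega>. W t \<omega> - W s \<omega>) = multi_normal 0 (mat (t - s))"
      using W st unfolding standard_wiener_def by blast
    have sc: "(mat (t - s) :: real^'r^'r) *v x = (t - s) *\<^sub>R x" for x
      by (simp add: vec_eq_iff matrix_vector_mult_def mat_def if_distrib[of "\<lambda>x. x * y" for y] cong: if_cong)
    have "(CLINT \<omega>|M. iexp (u \<bullet> (L *v W t \<omega> - L *v W s \<omega>))) =
       (CLINT \<omega>|M. iexp ((transpose L *v u) \<bullet> (W t \<omega> - W s \<omega>)))"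
      by (simp add: dot_lmul_matrix matrix_vector_mult_diff_distrib)
    also have "\<dots> = (CLINT x|multi_normal 0 (mat (t - s)). iexp ((transpose L *v u) \<bullet> x))"
      unfolding d[symmetric] by (rule integral_distr[symmetric, OF mt]) simp
    also have "\<dots> = exp (- ((transpose L *v u) \<bullet> (mat (t - s) *v (transpose L *v u))) / 2)"
      using st by (intro char_multi_normal pos_def_scalar) simp
    also have "(transpose L *v u) \<bullet> (mat (t - s) *v (transpose L *v u)) = (t - s) * (u \<bullet> ((L ** transpose L) *v u))"
      by (simp add: sc matrix_vector_mul_assoc[symmetric] dot_lmul_matrix)
    finally show ?thesis .
  qed
next
  fix n :: nat and A :: "nat \<Rightarrow> (real^'p) set"
  assume n: "n > 0" and A: "\<forall>i. A i \<in> sets borel"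
  let ?A = "\<lambda>i. (*v) L -` A i"
  have A': "?A i \<in> sets borel" for i
    by (rule measurable_sets_borel[OF borel_measurable_matrix_vector_mult]) (use A in auto)
  have e: "{\<omega>\<in>space M. L *v W (real (Suc i) * (T / real n)) \<omega> - L *v W (real i * (T / real n)) \<omega> \<in> A i} =
     {\<omega>\<in>space M. W (real (Suc i) * (T / real n)) \<omega> - W (real i * (T / real n)) \<omega> \<in> ?A i}" for i
    by (simp add: matrix_vector_mult_diff_distrib)
  have i: "space M \<inter> (\<Inter>i<n. {\<omega>\<in>space M. B i \<omega>}) = (\<Inter>i<n. {\<omega>\<in>space M. B i \<omega>})" for B
    using n by auto
  have T1: "real n * (T / real n) = T" using n by simp
  note w = wiener_increments_indep[OF M W T n A' order_refl]
  show "(\<Inter>i<n. {\<omega>\<in>space M. L *v W (real (Suc i) * (T / real n)) \<omega> - L *v W (real i * (T / real n)) \<omega> \<in> A i}) \<in> generated_events M W {0..T}"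
    using w(1) unfolding e i T1 .
  show "measure M (\<Inter>i<n. {\<omega>\<in>space M. L *v W (real (Suc i) * (T / real n)) \<omega> - L *v W (real i * (T / real n)) \<omega> \<in> A i}) =
    (\<Prod>i<n. measure M {\<omega>\<in>space M. L *v W (real (Suc i) * (T / real n)) \<omega> - L *v W (real i * (T / real n)) \<omega> \<in> A i})"
    using w(2) unfolding e i .
qed

text \<open>All increments \<open>D (i, j)\<close> are jointly independent: across the sources
  \<open>j\<close> by the families \<open>G j\<close>, within a source by the product rule. Grouping
  them by grid step makes the \<open>g i\<close> independent; adding over the sources multiplies
  characteristic functions and thus adds covariances.\<close>

lemma sum_gaussian_increments:
  fixes V :: "nat \<Rightarrow> real \<Rightarrow> 'w \<Rightarrow> real^'p"
  assumes M: "prob_space M" and T: "T > 0" and k: "k > 0"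
    and V: "\<And>j. j < k \<Longrightarrow> gaussian_increments M T (G j) (V j) (C j)"
    and ind: "prob_space.indep_sets M G {..<k}" and n: "n > 0"
  defines "h \<equiv> T / real n"
  defines "g \<equiv> \<lambda>i \<omega>. (1 / sqrt h) *\<^sub>R (\<Sum>j<k. V j (real (Suc i) * h) \<omega> - V j (real i * h) \<omega>)"
  shows "prob_space.indep_vars M (\<lambda>_. borel) g {..<n}"
    and "\<And>i t. i < n \<Longrightarrow> (CLINT \<omega>|M. iexp (t \<bullet> g i \<omega>)) = exp (- (t \<bullet> ((\<Sum>j<k. C j) *v t)) / 2)"
proof -
  interpret prob_space M by fact
  have h: "h > 0" using T n by (simp add: h_def)
  have st: "0 \<le> real i * h" "real i * h < real (Suc i) * h" "real (Suc i) * h \<le> T" if "i < n" for i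
    using h grid_le[OF T n, of "Suc i"] that by (auto simp: h_def[symmetric])
  define D where "D = (\<lambda>(i, j) \<omega>. V j (real (Suc i) * h) \<omega> - V j (real i * h) \<omega>)"
  let ?I = "{..<n} \<times> {..<k}"
  have mD: "D p \<in> borel_measurable M" if pI: "p \<in> ?I" for p
  proof -
    obtain i j where p: "p = (i, j)" "i < n" "j < k" using pI by auto
    have "V j t \<in> borel_measurable M" if "t \<in> {0..T}" for t
      using V[OF p(3)] that by (auto simp: gaussian_increments_def)
    then show ?thesis unfolding p(1) D_def using st[OF p(2)] by (auto intro!: borel_measurable_diff)
  qed
  have iD: "indep_vars (\<lambda>_. borel) D ?I"
    unfolding indep_vars_def2
  proof (intro conjI ballI mD)
    let ?F = "\<lambda>p. {D p -` A \<inter> space M |A. A \<in> sets borel}"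
    \<comment> \<open>Each family contains \<open>space M\<close>, so the product rule has to be
      checked only for intersections over all of \<open>?I\<close>.\<close>
    show "indep_sets ?F ?I"
    proof (subst indep_sets_finite)
      show "?I \<noteq> {}" using n k by auto
      show "?F p \<subseteq> events" if "p \<in> ?I" for p using measurable_sets[OF mD[OF that]] by auto
      show "space M \<in> ?F p" if "p \<in> ?I" for p by (auto intro!: exI[of _ UNIV])
      show "\<forall>A\<in>Pi ?I ?F. prob (\<Inter>p\<in>?I. A p) = (\<Prod>p\<in>?I. prob (A p))"
      proof
        fix A assume "A \<in> Pi ?I ?F"
        then have "\<forall>p\<in>?I. \<exists>B. A p = D p -` B \<inter> space M \<and> B \<in> sets borel" by auto
        then obtain B0 where B0: "\<And>p. p \<in> ?I \<Longrightarrow> A p = D p -` B0 p \<inter> space M \<and> B0 p \<in> sets borel" by metis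
        \<comment> \<open>The value \<open>{}\<close> outside \<open>?I\<close> makes every
          \<open>B p\<close> a Borel set, as the product rule in \<open>gaussian_increments\<close>
          quantifies over sets for all indices.\<close>
        define B where "B p = (if p \<in> ?I then B0 p else {})" for p
        have Bb: "B p \<in> sets borel" for p using B0 by (auto simp: B_def)
        have A: "A (i, j) = {\<omega>\<in>space M. V j (real (Suc i) * h) \<omega> - V j (real i * h) \<omega> \<in> B (i, j)}" if "i < n" "j < k" for i j
          using B0[of "(i,j)"] that by (auto simp: D_def B_def)
        have V2: "(\<Inter>i<n. {\<omega>\<in>space M. V j (real (Suc i) * h) \<omega> - V j (real i * h) \<omega> \<in> B (i, j)}) \<in> G j \<and>
          prob (\<Inter>i<n. {\<omega>\<in>space M. V j (real (Suc i) * h) \<omega> - V j (real i * h) \<omega> \<in> B (i, j)}) =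
          (\<Prod>i<n. prob {\<omega>\<in>space M. V j (real (Suc i) * h) \<omega> - V j (real i * h) \<omega> \<in> B (i, j)})" if "j < k" for j
          unfolding h_def
          using V[OF that, unfolded gaussian_increments_def, THEN conjunct2, THEN conjunct1, rule_format, OF n, of "\<lambda>i. B (i, j)"] Bb
          by simp
        have V2': "(\<Inter>i<n. A (i, j)) \<in> G j" "prob (\<Inter>i<n. A (i, j)) = (\<Prod>i<n. prob (A (i, j)))" if "j < k" for j
        proof -
          have "(\<Inter>i<n. A (i, j)) = (\<Inter>i<n. {\<omega>\<in>space M. V j (real (Suc i) * h) \<omega> - V j (real i * h) \<omega> \<in> B (i, j)})"
            using A[OF _ that] by auto
          then show "(\<Inter>i<n. A (i, j)) \<in> G j" "prob (\<Inter>i<n. A (i, j)) = (\<Prod>i<n. prob (A (i, j)))"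
            using V2[OF that] A[OF _ that] by simp_all
        qed
        have "(\<Inter>p\<in>?I. A p) = (\<Inter>j<k. \<Inter>i<n. A (i, j))" by auto
        also have "prob \<dots> = (\<Prod>j<k. prob (\<Inter>i<n. A (i, j)))"
          by (rule indep_setsD[OF ind]) (use k V2' in auto)
        also have "\<dots> = (\<Prod>j<k. \<Prod>i<n. prob (A (i, j)))" using V2' by simp
        also have "\<dots> = (\<Prod>i<n. \<Prod>j<k. prob (A (i, j)))" by (rule prod.swap)
        also have "\<dots> = (\<Prod>p\<in>?I. prob (A p))" by (simp add: prod.cartesian_product)
        finally show "prob (\<Inter>p\<in>?I. A p) = (\<Prod>p\<in>?I. prob (A p))" .
      qed
    qed simp
  qed
  have "indep_vars (\<lambda>i. PiM ({i} \<times> {..<k}) (\<lambda>_. borel)) (\<lambda>i \<omega>. restrict (\<lambda>p. D p \<omega>) ({i} \<times> {..<k})) {..<n}"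
    by (rule indep_vars_restrict[OF iD]) (auto simp: disjoint_family_on_def)
  then have "indep_vars (\<lambda>_. borel) (\<lambda>i \<omega>. (1 / sqrt h) *\<^sub>R (\<Sum>j<k. (restrict (\<lambda>p. D p \<omega>) ({i} \<times> {..<k})) (i, j))) {..<n}"
    by (rule indep_vars_compose2[where Y="\<lambda>i x. (1 / sqrt h) *\<^sub>R (\<Sum>j<k. x (i, j))"])
      (intro borel_measurable_scaleR borel_measurable_sum borel_measurable_const measurable_component_singleton, auto)
  then show "indep_vars (\<lambda>_. borel) g {..<n}"
    by (simp add: g_def D_def)
  fix i :: nat and t :: "real^'p" assume i: "i < n"
  let ?u = "(1 / sqrt h) *\<^sub>R t"
  have iDi: "indep_vars (\<lambda>_. borel) (\<lambda>p \<omega>. ?u \<bullet> D p \<omega>) ({i} \<times> {..<k})"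
    by (rule indep_vars_compose2[OF indep_vars_subset[OF iD], where Y="\<lambda>_ x. ?u \<bullet> x"]) (use i in auto)
  have mu: "(\<lambda>\<omega>. ?u \<bullet> D p \<omega>) \<in> borel_measurable M" if "p \<in> {i} \<times> {..<k}" for p
    by (rule borel_measurable_inner) (use mD that i in auto)
  have "(CLINT \<omega>|M. iexp (t \<bullet> g i \<omega>)) = (CLINT \<omega>|M. iexp (1 * (\<Sum>p\<in>{i} \<times> {..<k}. ?u \<bullet> D p \<omega>)))"
  proof -
    have "(\<Sum>p\<in>{i} \<times> {..<k}. F p) = (\<Sum>j<k. F (i, j))" for F :: "nat \<times> nat \<Rightarrow> real"
      using sum.cartesian_product[of "\<lambda>i j. F (i, j)" "{..<k}" "{i}"] by simp
    then show ?thesis by (simp add: g_def D_def inner_sum_right sum_divide_distrib)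
  qed
  also have "\<dots> = char (distr M borel (\<lambda>\<omega>. \<Sum>p\<in>{i} \<times> {..<k}. ?u \<bullet> D p \<omega>)) 1"
    unfolding char_def by (subst integral_distr) (use mu in \<open>auto intro!: borel_measurable_sum\<close>)
  also have "\<dots> = (\<Prod>p\<in>{i} \<times> {..<k}. char (distr M borel (\<lambda>\<omega>. ?u \<bullet> D p \<omega>)) 1)"
    by (rule char_distr_sum[OF iDi])
  also have "\<dots> = (\<Prod>j<k. char (distr M borel (\<lambda>\<omega>. ?u \<bullet> D (i, j) \<omega>)) 1)"
    using prod.cartesian_product[of "\<lambda>i j. char (distr M borel (\<lambda>\<omega>. ?u \<bullet> D (i, j) \<omega>)) 1" "{..<k}" "{i}"] by simp
  also have "\<dots> = (\<Prod>j<k. complex_of_real (exp (- (t \<bullet> (C j *v t)) / 2)))"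
  proof (rule prod.cong[OF refl])
    fix j assume "j \<in> {..<k}"
    then have j: "j < k" by simp
    have "char (distr M borel (\<lambda>\<omega>. ?u \<bullet> D (i, j) \<omega>)) 1 = (CLINT \<omega>|M. iexp (1 * (?u \<bullet> D (i, j) \<omega>)))"
      unfolding char_def by (rule integral_distr[OF mu]) (use j in auto)
    also have "\<dots> = (CLINT \<omega>|M. iexp (?u \<bullet> (V j (real (Suc i) * h) \<omega> - V j (real i * h) \<omega>)))"
      by (simp add: D_def)
    also have "\<dots> = exp (- ((real (Suc i) * h - real i * h) * (?u \<bullet> (C j *v ?u))) / 2)"
      using V[OF j] st[OF i] unfolding gaussian_increments_def by blast
    also have "(real (Suc i) * h - real i * h) * (?u \<bullet> (C j *v ?u)) = t \<bullet> (C j *v t)"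
      using h by (simp add: matrix_vector_mult_scaleR algebra_simps)
    finally show "char (distr M borel (\<lambda>\<omega>. ?u \<bullet> D (i, j) \<omega>)) 1 = complex_of_real (exp (- (t \<bullet> (C j *v t)) / 2))" .
  qed
  also have "\<dots> = exp (\<Sum>j<k. - (t \<bullet> (C j *v t)) / 2)"
    by (simp add: exp_sum)
  also have "(\<Sum>j<k. - (t \<bullet> (C j *v t)) / 2) = - (t \<bullet> ((\<Sum>j<k. C j) *v t)) / 2"
  proof -
    have "(\<Sum>j<k. C j) *v t = (\<Sum>j<k. C j *v t)"
      by (induction k) (simp_all add: matrix_vector_mult_add_rdistrib)
    then show ?thesis by (simp add: inner_sum_right sum_negf sum_divide_distrib)
  qed
  finally show "(CLINT \<omega>|M. iexp (t \<bullet> g i \<omega>)) = exp (- (t \<bullet> ((\<Sum>j<k. C j) *v t)) / 2)" .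
qed

subsection \<open>Events of asymptotically full probability\<close>

text \<open>"With high probability". The exceptional event is some measurable set and not the
  failure set of \<open>P n\<close>, because \<open>P n\<close> will be a statement on the estimator
  or on an approximation whose failure set is not shown to be measurable.\<close>

definition whp :: "'w measure \<Rightarrow> (nat \<Rightarrow> 'w \<Rightarrow> bool) \<Rightarrow> bool" where
  "whp M P \<longleftrightarrow> (\<forall>e>0. \<forall>\<^sub>F n in sequentially. \<exists>A\<in>sets M. measure M A < e \<and> (\<forall>\<omega>\<in>space M - A. P n \<omega>))"

text \<open>Boundedness in probability in the same encoding. The two notions combine as usual: what
  lies below every small multiple of a tight sequence tends to 0 in probability.\<close>

definition tight_seq :: "'w measure \<Rightarrow> (nat \<Rightarrow> 'w \<Rightarrow> real) \<Rightarrow> bool" where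
  "tight_seq M Y \<longleftrightarrow> (\<forall>e>0. \<exists>K>0. \<forall>\<^sub>F n in sequentially.
     \<exists>A\<in>sets M. measure M A < e \<and> (\<forall>\<omega>\<in>space M - A. \<bar>Y n \<omega>\<bar> \<le> K))"

lemma whpD:
  "whp M P \<Longrightarrow> e > 0 \<Longrightarrow> \<forall>\<^sub>F n in sequentially. \<exists>A\<in>sets M. measure M A < e \<and> (\<forall>\<omega>\<in>space M - A. P n \<omega>)"
  by (simp add: whp_def)

lemma whp_mono:
  assumes "whp M P" "\<forall>\<^sub>F n in sequentially. \<forall>\<omega>\<in>space M. P n \<omega> \<longrightarrow> Q n \<omega>"
  shows "whp M Q"
  unfolding whp_def
proof (intro allI impI)
  fix e :: real assume "e > 0"
  then have "\<forall>\<^sub>F n in sequentially. \<exists>A\<in>sets M. measure M A < e \<and> (\<forall>\<omega>\<in>space M - A. P n \<omega>)"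
    using assms(1) by (simp add: whp_def)
  with assms(2) show "\<forall>\<^sub>F n in sequentially. \<exists>A\<in>sets M. measure M A < e \<and> (\<forall>\<omega>\<in>space M - A. Q n \<omega>)"
    by eventually_elim blast
qed

lemma whp_conj:
  assumes M: "prob_space M" and "whp M P" "whp M Q"
  shows "whp M (\<lambda>n \<omega>. P n \<omega> \<and> Q n \<omega>)"
  unfolding whp_def
proof (intro allI impI)
  interpret prob_space M by fact
  fix e :: real assume "e > 0"
  then have e: "e / 2 > 0" by simp
  from assms(2,3) e have "\<forall>\<^sub>F n in sequentially. \<exists>A\<in>sets M. measure M A < e / 2 \<and> (\<forall>\<omega>\<in>space M - A. P n \<omega>)"
    "\<forall>\<^sub>F n in sequentially. \<exists>A\<in>sets M. measure M A < e / 2 \<and> (\<forall>\<omega>\<in>space M - A. Q n \<omega>)"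
    unfolding whp_def by blast+
  then show "\<forall>\<^sub>F n in sequentially. \<exists>A\<in>sets M. measure M A < e \<and> (\<forall>\<omega>\<in>space M - A. P n \<omega> \<and> Q n \<omega>)"
  proof eventually_elim
    case (elim n)
    then obtain A B where AB: "A \<in> sets M" "B \<in> sets M" "measure M A < e / 2" "measure M B < e / 2"
      "\<forall>\<omega>\<in>space M - A. P n \<omega>" "\<forall>\<omega>\<in>space M - B. Q n \<omega>" by blast
    have "measure M (A \<union> B) \<le> measure M A + measure M B" by (rule measure_Un_le) fact+
    with AB show ?case by (intro bexI[of _ "A \<union> B"]) auto
  qed
qed

lemma whp_finite_all:
  assumes M: "prob_space M" and "finite I" "\<And>i. i \<in> I \<Longrightarrow> whp M (P i)"
  shows "whp M (\<lambda>n \<omega>. \<forall>i\<in>I. P i n \<omega>)"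
  using assms(2,3)
proof (induction I rule: finite_induct)
  case empty
  show ?case unfolding whp_def by (auto intro!: bexI[of _ "{}"])
next
  case (insert i I)
  have "whp M (\<lambda>n \<omega>. P i n \<omega> \<and> (\<forall>i\<in>I. P i n \<omega>))"
    using insert by (intro whp_conj[OF M]) auto
  then show ?case by (rule whp_mono) auto
qed

text \<open>A set that is not measurable has \<open>measure\<close> 0, so comparison with the
  measurable exceptional event is valid for every failure set.\<close>

lemma whp_imp_measure_tendsto:
  assumes M: "prob_space M" and w: "whp M P"
  shows "(\<lambda>n. measure M {\<omega>\<in>space M. \<not> P n \<omega>}) \<longlonglongrightarrow> 0"
proof (rule LIMSEQ_I)
  interpret prob_space M by fact
  fix e :: real assume "e > 0"
  then have "\<forall>\<^sub>F n in sequentially. \<exists>A\<in>sets M. measure M A < e \<and> (\<forall>\<omega>\<in>space M - A. P n \<omega>)"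
    using w by (simp add: whp_def)
  then have "\<forall>\<^sub>F n in sequentially. norm (measure M {\<omega>\<in>space M. \<not> P n \<omega>} - 0) < e"
  proof eventually_elim
    case (elim n)
    then obtain A where A: "A \<in> sets M" "measure M A < e" "\<forall>\<omega>\<in>space M - A. P n \<omega>" by blast
    have "measure M {\<omega>\<in>space M. \<not> P n \<omega>} \<le> measure M A"
      using A by (intro finite_measure_mono) auto
    with A show ?case by simp
  qed
  then show "\<exists>n0. \<forall>n\<ge>n0. norm (measure M {\<omega>\<in>space M. \<not> P n \<omega>} - 0) < e"
    by (simp add: eventually_sequentially)
qed

text \<open>Dominated convergence for the indicators of the exceedance events.\<close>

lemma whp_of_AE_tendsto:
  fixes R :: "nat \<Rightarrow> 'w \<Rightarrow> real"
  assumes M: "prob_space M" and m: "\<And>n. n > 0 \<Longrightarrow> R n \<in> borel_measurable M"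
    and ae: "AE \<omega> in M. (\<lambda>n. R n \<omega>) \<longlonglongrightarrow> 0" and e: "e > 0"
  shows "whp M (\<lambda>n \<omega>. \<bar>R n \<omega>\<bar> \<le> e)"
proof -
  interpret prob_space M by fact
  define R' where "R' n = (if n = 0 then (\<lambda>_. 0) else R n)" for n
  have m'[measurable]: "R' n \<in> borel_measurable M" for n using m by (simp add: R'_def)
  have "(\<lambda>n. \<integral>\<omega>. indicator {\<omega>\<in>space M. \<bar>R' n \<omega>\<bar> > e} \<omega> \<partial>M) \<longlonglongrightarrow> (\<integral>\<omega>. 0 \<partial>M :: real)"
  proof (rule integral_dominated_convergence[where w="\<lambda>_. 1"])
    show "AE \<omega> in M. (\<lambda>n. indicator {\<omega>\<in>space M. \<bar>R' n \<omega>\<bar> > e} \<omega>) \<longlonglongrightarrow> (0::real)"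
      using ae
    proof eventually_elim
      case (elim \<omega>)
      have "\<forall>\<^sub>F n in sequentially. \<bar>R n \<omega>\<bar> < e" using order_tendstoD(2)[OF tendsto_rabs_zero[OF elim] e] .
      then have "\<forall>\<^sub>F n in sequentially. indicator {\<omega>\<in>space M. \<bar>R' n \<omega>\<bar> > e} \<omega> = (0::real)"
        using eventually_gt_at_top[of 0] by eventually_elim (simp add: R'_def)
      then show ?case by (rule tendsto_eventually)
    qed
  qed (auto simp: indicator_def)
  then have lim: "(\<lambda>n. measure M {\<omega>\<in>space M. \<bar>R' n \<omega>\<bar> > e}) \<longlonglongrightarrow> 0" by simp
  show ?thesis unfolding whp_def
  proof (intro allI impI)
    fix d :: real assume "d > 0"
    from order_tendstoD(2)[OF lim this] eventually_gt_at_top[of 0]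
    show "\<forall>\<^sub>F n in sequentially. \<exists>A\<in>sets M. measure M A < d \<and> (\<forall>\<omega>\<in>space M - A. \<bar>R n \<omega>\<bar> \<le> e)"
    proof eventually_elim
      case (elim n)
      have "{\<omega>\<in>space M. \<bar>R' n \<omega>\<bar> > e} \<in> sets M" by measurable
      with elim show ?case
        by (intro bexI[of _ "{\<omega>\<in>space M. \<bar>R' n \<omega>\<bar> > e}"]) (auto simp: R'_def)
    qed
  qed
qed

text \<open>The continuous function \<open>h\<close> lies between the indicators of
  \<open>norm x > real k + 1\<close> and \<open>norm x > real k\<close>, so a small tail of the
  limit law is inherited by \<open>Z n\<close> for large \<open>n\<close>.\<close>

lemma tight_seq_of_dist:
  fixes Z :: "nat \<Rightarrow> 'w \<Rightarrow> real^'n"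
  assumes M: "prob_space M" and m: "\<And>n. n > 0 \<Longrightarrow> Z n \<in> borel_measurable M"
    and N: "prob_space N" "sets N = sets borel" and c: "converges_in_dist M Z N"
  shows "tight_seq M (\<lambda>n \<omega>. norm (Z n \<omega>))"
  unfolding tight_seq_def
proof (intro allI impI)
  interpret M: prob_space M by fact
  interpret N: prob_space N by fact
  note N(2)[measurable_cong]
  fix e :: real assume e: "e > 0"
  have "eventually (\<lambda>k. measure N {u. norm u > real k} < e) sequentially"
    by (rule order_tendstoD(2)[OF prob_space_tail_tendsto_0[OF N]]) (use e in auto)
  then obtain k where k: "measure N {u. norm u > real k} < e"
    by (meson eventually_happens' sequentially_bot)
  define h where "h x = max 0 (min 1 (norm x - real k))" for x :: "real^'n"
  have ch: "continuous_on UNIV h" unfolding h_def by (intro continuous_intros)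
  then have mh[measurable]: "h \<in> borel_measurable borel" by (rule borel_measurable_continuous_onI)
  have h01: "0 \<le> h x" "h x \<le> 1" for x by (auto simp: h_def)
  have ih: "integrable N h" by (rule N.integrable_const_bound[where B=1]) (auto simp: h01)
  have "(\<lambda>n. \<integral>\<omega>. h (Z n \<omega>) \<partial>M) \<longlonglongrightarrow> (\<integral>x. h x \<partial>N)"
    using c ch h01 unfolding converges_in_dist_def by (auto intro!: boundedI[where B=1])
  moreover have "(\<integral>x. h x \<partial>N) < e"
  proof -
    have "(\<integral>x. h x \<partial>N) \<le> (\<integral>x. indicator {u. norm u > real k} x \<partial>N)"
    proof (rule integral_mono[OF ih])
      show "integrable N (indicat_real {u. norm u > real k})"
        by (intro integrable_real_indicator) (auto simp: N.emeasure_eq_measure N(2) intro!: borel_open open_Collect_less continuous_intros)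
      show "h x \<le> indicat_real {u. norm u > real k} x" for x
        using h01[of x] by (auto simp: indicator_def) (simp add: h_def)
    qed
    also have "\<dots> = measure N {u. norm u > real k}" by (simp add: sets_eq_imp_space_eq[OF N(2)])
    finally show ?thesis using k by simp
  qed
  ultimately have ev: "\<forall>\<^sub>F n in sequentially. (\<integral>\<omega>. h (Z n \<omega>) \<partial>M) < e" by (rule order_tendstoD(2))
  show "\<exists>K>0. \<forall>\<^sub>F n in sequentially. \<exists>A\<in>sets M. measure M A < e \<and> (\<forall>\<omega>\<in>space M - A. \<bar>norm (Z n \<omega>)\<bar> \<le> K)"
  proof (intro exI[of _ "real k + 1"] conjI)
    show "\<forall>\<^sub>F n in sequentially. \<exists>A\<in>sets M. measure M A < e \<and> (\<forall>\<omega>\<in>space M - A. \<bar>norm (Z n \<omega>)\<bar> \<le> real k + 1)"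
      using ev eventually_gt_at_top[of 0]
    proof eventually_elim
      case (elim n)
      have Zm[measurable]: "Z n \<in> borel_measurable M" using m elim by simp
      let ?A = "{\<omega>\<in>space M. norm (Z n \<omega>) > real k + 1}"
      have A: "?A \<in> sets M" by measurable
      have "measure M ?A = (\<integral>\<omega>. indicator ?A \<omega> \<partial>M)" using A by simp
      also have "\<dots> \<le> (\<integral>\<omega>. h (Z n \<omega>) \<partial>M)"
      proof (rule integral_mono)
        show "integrable M (\<lambda>\<omega>. h (Z n \<omega>))" by (rule M.integrable_const_bound[where B=1]) (auto simp: h01)
        show "integrable M (indicat_real ?A)" using A by (intro integrable_real_indicator) (auto simp: M.emeasure_eq_measure)
        show "indicat_real ?A \<omega> \<le> h (Z n \<omega>)" for \<omega>
          using h01[of "Z n \<omega>"] by (auto simp: indicator_def) (simp add: h_def)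
      qed
      finally show ?case using A elim by (intro bexI[of _ ?A]) auto
    qed
  qed simp
qed

text \<open>The exponentials differ by at most
  \<open>\<bar>A n \<omega> - B n \<omega>\<bar>\<close> and by at most 2. The first bound serves
  off the exceptional event, the second on it, and \<open>e / 4 + 2 * (e / 4) < e\<close>.\<close>

lemma iexp_slutsky:
  fixes A B :: "nat \<Rightarrow> 'w \<Rightarrow> real"
  assumes M: "prob_space M" and m: "\<And>n. n > 0 \<Longrightarrow> A n \<in> borel_measurable M" "\<And>n. n > 0 \<Longrightarrow> B n \<in> borel_measurable M"
    and d: "\<And>e. e > 0 \<Longrightarrow> whp M (\<lambda>n \<omega>. \<bar>A n \<omega> - B n \<omega>\<bar> \<le> e)"
    and l: "(\<lambda>n. CLINT \<omega>|M. iexp (B n \<omega>)) \<longlonglongrightarrow> L"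
  shows "(\<lambda>n. CLINT \<omega>|M. iexp (A n \<omega>)) \<longlonglongrightarrow> L"
proof -
  interpret prob_space M by fact
  have "(\<lambda>n. (CLINT \<omega>|M. iexp (A n \<omega>)) - (CLINT \<omega>|M. iexp (B n \<omega>))) \<longlonglongrightarrow> 0"
  proof (rule tendstoI)
    fix e :: real assume e: "e > 0"
    have "\<forall>\<^sub>F n in sequentially. \<exists>S\<in>sets M. measure M S < e / 4 \<and> (\<forall>\<omega>\<in>space M - S. \<bar>A n \<omega> - B n \<omega>\<bar> \<le> e / 4)"
      by (rule whpD[OF d]) (use e in simp_all)
    then show "\<forall>\<^sub>F n in sequentially. dist ((CLINT \<omega>|M. iexp (A n \<omega>)) - (CLINT \<omega>|M. iexp (B n \<omega>))) 0 < e"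
      using eventually_gt_at_top[of 0]
    proof eventually_elim
      case (elim n)
      then obtain S where S: "S \<in> sets M" "measure M S < e / 4" "\<forall>\<omega>\<in>space M - S. \<bar>A n \<omega> - B n \<omega>\<bar> \<le> e / 4" by blast
      have mm[measurable]: "A n \<in> borel_measurable M" "B n \<in> borel_measurable M" using m elim by auto
      have i: "integrable M (\<lambda>\<omega>. iexp (A n \<omega>))" "integrable M (\<lambda>\<omega>. iexp (B n \<omega>))"
        by (rule integrable_iexp; simp)+
      have iS: "integrable M (indicat_real S)" using S by (intro integrable_real_indicator) (auto simp: emeasure_eq_measure)
      have "norm ((CLINT \<omega>|M. iexp (A n \<omega>)) - (CLINT \<omega>|M. iexp (B n \<omega>))) = norm (CLINT \<omega>|M. iexp (A n \<omega>) - iexp (B n \<omega>))"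
        using i by simp
      also have "\<dots> \<le> (\<integral>\<omega>. norm (iexp (A n \<omega>) - iexp (B n \<omega>)) \<partial>M)" by (rule integral_norm_bound)
      also have "\<dots> \<le> (\<integral>\<omega>. e / 4 + 2 * indicator S \<omega> \<partial>M)"
      proof (rule integral_mono)
        show "integrable M (\<lambda>\<omega>. norm (iexp (A n \<omega>) - iexp (B n \<omega>)))" using i by auto
        show "integrable M (\<lambda>\<omega>. e / 4 + 2 * indicator S \<omega>)" using iS by simp
        fix \<omega> assume w: "\<omega> \<in> space M"
        have "norm (iexp (A n \<omega>) - iexp (B n \<omega>)) \<le> 2"
          using norm_triangle_ineq4[of "iexp (A n \<omega>)" "iexp (B n \<omega>)"] by simp
        moreover have "norm (iexp (A n \<omega>) - iexp (B n \<omega>)) \<le> \<bar>A n \<omega> - B n \<omega>\<bar>"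
        proof -
          have "iexp (A n \<omega>) - iexp (B n \<omega>) = iexp (B n \<omega>) * (iexp (A n \<omega> - B n \<omega>) - 1)"
            by (simp add: algebra_simps exp_add[symmetric])
          then have "norm (iexp (A n \<omega>) - iexp (B n \<omega>)) = norm (iexp (A n \<omega> - B n \<omega>) - 1)"
            by (simp add: norm_mult del: of_real_diff)
          also have "\<dots> \<le> \<bar>A n \<omega> - B n \<omega>\<bar>"
            using iexp_approx1[of "A n \<omega> - B n \<omega>" 0] by (simp del: of_real_diff)
          finally show ?thesis .
        qed
        ultimately show "norm (iexp (A n \<omega>) - iexp (B n \<omega>)) \<le> e / 4 + 2 * indicator S \<omega>"
        proof (cases "\<omega> \<in> S")
          case True
          then show ?thesis using \<open>norm _ \<le> 2\<close> e by (simp only: indicator_simps)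
        next
          case False
          then have "\<bar>A n \<omega> - B n \<omega>\<bar> \<le> e / 4" using S(3) w by blast
          with False \<open>norm _ \<le> \<bar>A n \<omega> - B n \<omega>\<bar>\<close> show ?thesis by simp
        qed
      qed
      also have "\<dots> = e / 4 + 2 * measure M S" using iS S prob_space by simp
      also have "\<dots> < e" using S e by simp
      finally show ?case by simp
    qed
  qed
  from tendsto_add[OF this l] show ?thesis by simp
qed

subsection \<open>Negligibility of the drift\<close>

lemma summation_by_parts:
  fixes c w :: "nat \<Rightarrow> real"
  shows "(\<Sum>i<n. c i * (w (Suc i) - w i)) = c n * w n - c 0 * w 0 - (\<Sum>i<n. w (Suc i) * (c (Suc i) - c i))"
  by (induction n) (simp_all add: algebra_simps)

lemma Cauchy_Schwarz_sum_abs: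
  fixes d :: "nat \<Rightarrow> real"
  shows "(\<Sum>i<n. \<bar>d i\<bar>) \<le> sqrt (real n) * sqrt (\<Sum>i<n. (d i)\<^sup>2)"
proof -
  have "(\<Sum>i<n. \<bar>d i\<bar> * 1)\<^sup>2 \<le> (\<Sum>i<n. \<bar>d i\<bar>\<^sup>2) * (\<Sum>i<n. 1\<^sup>2)"
    by (rule Cauchy_Schwarz_ineq_sum)
  then have "(\<Sum>i<n. \<bar>d i\<bar>)\<^sup>2 \<le> real n * (\<Sum>i<n. (d i)\<^sup>2)" by (simp add: mult.commute)
  then have "(\<Sum>i<n. \<bar>d i\<bar>) \<le> sqrt (real n * (\<Sum>i<n. (d i)\<^sup>2))" by (rule real_le_rsqrt)
  then show ?thesis by (simp only: real_sqrt_mult)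
qed

text \<open>The drift density along a path is continuous but in general as rough as a Wiener path.
  Summation by parts calls for increments of the order of the mesh, and a Weierstrass polynomial has
  them.\<close>

lemma lipschitz_approx:
  fixes b :: "real \<Rightarrow> real"
  assumes "continuous_on {0..T} b" "e > 0"
  obtains p L B where "\<And>s. s \<in> {0..T} \<Longrightarrow> \<bar>b s - p s\<bar> \<le> e" "0 \<le> L" "0 \<le> B"
    "\<And>s t. s \<in> {0..T} \<Longrightarrow> t \<in> {0..T} \<Longrightarrow> \<bar>p s - p t\<bar> \<le> L * \<bar>s - t\<bar>"
    "\<And>s. s \<in> {0..T} \<Longrightarrow> \<bar>p s\<bar> \<le> B"
proof -
  obtain p where p: "polynomial_function p" "\<And>s. s \<in> {0..T} \<Longrightarrow> norm (b s - p s) < e"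
    using Stone_Weierstrass_polynomial_function[OF _ assms] by auto
  obtain p' where p': "polynomial_function p'" "\<And>x. (p has_vector_derivative p' x) (at x)"
    using has_vector_derivative_polynomial_function[OF p(1)] by metis
  have "bounded (p' ` {0..T})" "bounded (p ` {0..T})"
    by (intro compact_imp_bounded compact_continuous_image continuous_on_polymonial_function p p' compact_Icc)+
  then obtain L B where LB: "L > 0" "B > 0" "\<And>s. s \<in> {0..T} \<Longrightarrow> \<bar>p' s\<bar> \<le> L" "\<And>s. s \<in> {0..T} \<Longrightarrow> \<bar>p s\<bar> \<le> B"
    unfolding bounded_pos by (metis image_eqI real_norm_def)
  have lip: "\<bar>p s - p t\<bar> \<le> L * \<bar>s - t\<bar>" if "s \<in> {0..T}" "t \<in> {0..T}" for s t
  proof -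
    have "norm (p s - p t) \<le> L * norm (s - t)"
      by (rule field_differentiable_bound[of "{0..T}" p p'])
        (use p' LB that in \<open>auto simp: has_real_derivative_iff_has_vector_derivative intro: has_vector_derivative_at_within\<close>)
    then show ?thesis by simp
  qed
  show ?thesis
    by (rule that[of p L B]) (use p(2) LB lip in \<open>auto intro: less_imp_le\<close>)
qed

text \<open>Cauchy-Schwarz with \<open>dF\<close> of order \<open>1 / n\<close> would only show that
  the expression stays bounded. Replacing the drift density by a Lipschitz \<open>p\<close> at
  uniform distance \<open>e\<close> costs \<open>T * e\<close> in the limit, and the remaining sum
  of \<open>h * p * dw\<close> is of order \<open>h\<close> by summation by parts. The denominator
  keeps the statement pathwise: the quadratic variation of the path over the grids is later bounded
  in probability only.\<close>

lemma drift_cross_variation_tendsto_0: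
  fixes b w F :: "real \<Rightarrow> real"
  assumes T: "T > 0" and b: "continuous_on {0..T} b" and w: "continuous_on {0..T} w"
    and F: "\<And>t. t \<in> {0..T} \<Longrightarrow> F t = F0 + integral {0..t} b"
  defines "dF \<equiv> \<lambda>n i. F (real (Suc i) * (T / real n)) - F (real i * (T / real n))"
    and "dw \<equiv> \<lambda>n i. w (real (Suc i) * (T / real n)) - w (real i * (T / real n))"
  shows "(\<lambda>n. sqrt (real n) * (\<Sum>i<n. dF n i * dw n i) / (1 + sqrt (\<Sum>i<n. (dw n i)\<^sup>2))) \<longlonglongrightarrow> 0"
proof (rule LIMSEQ_I)
  fix r :: real assume r: "r > 0"
  \<comment> \<open>The term \<open>T * e = r / 4\<close> is the part of the final bound that does
    not vanish with \<open>n\<close>.\<close>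
  define e where "e = r / (4 * T)"
  have e: "e > 0" using r T by (simp add: e_def)
  obtain p L B where p: "\<And>s. s \<in> {0..T} \<Longrightarrow> \<bar>b s - p s\<bar> \<le> e" "0 \<le> L" "0 \<le> B"
    "\<And>s t. s \<in> {0..T} \<Longrightarrow> t \<in> {0..T} \<Longrightarrow> \<bar>p s - p t\<bar> \<le> L * \<bar>s - t\<bar>"
    "\<And>s. s \<in> {0..T} \<Longrightarrow> \<bar>p s\<bar> \<le> B"
    using lipschitz_approx[OF b e] by metis
  have "bounded (w ` {0..T})" by (intro compact_imp_bounded compact_continuous_image w compact_Icc)
  then obtain K where K: "K > 0" "\<And>s. s \<in> {0..T} \<Longrightarrow> \<bar>w s\<bar> \<le> K"
    unfolding bounded_pos by (metis image_eqI real_norm_def)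
  \<comment> \<open>Bound for the sum of \<open>p * dw\<close> after summation by parts:
    \<open>2 * B * K\<close> from the two boundary terms, \<open>K * L * T\<close> from the
    transformed sum.\<close>
  define C where "C = 2 * B * K + K * L * T"
  have C0: "0 \<le> C" using p K T by (simp add: C_def)
  have main: "\<bar>sqrt (real n) * (\<Sum>i<n. dF n i * dw n i) / (1 + sqrt (\<Sum>i<n. (dw n i)\<^sup>2))\<bar> \<le> T * e + T * L * T / real n + T * C / sqrt (real n)"
    if n: "n > 0" for n
  proof -
    define h where "h = T / real n"
    have h: "h > 0" using T n by (simp add: h_def)
    have st: "0 \<le> real i * h" "real i * h \<le> real (Suc i) * h" "real (Suc i) * h \<le> T" if "i < n" for i
      using h grid_le[OF T n, of "Suc i"] that by (auto simp: h_def[symmetric])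
    have nh: "real n * h = T" using n by (simp add: h_def)
    have d: "\<bar>dF n i - h * p (real i * h)\<bar> \<le> h * (e + L * h)" if i: "i < n" for i
    proof -
      let ?s = "real i * h" and ?t = "real (Suc i) * h"
      have tsh: "?t - ?s = h" by (simp add: algebra_simps)
      have cb: "continuous_on {?s..?t} b" by (rule continuous_on_subset[OF b]) (use st[OF i] in auto)
      have "integral {0..?s} b + integral {?s..?t} b = integral {0..?t} b"
        using st[OF i] by (intro Henstock_Kurzweil_Integration.integral_combine integrable_continuous_real continuous_on_subset[OF b]) auto
      moreover have "F ?s = F0 + integral {0..?s} b" "F ?t = F0 + integral {0..?t} b"
        by (rule F; use st[OF i] in simp)+
      moreover have "dF n i = F ?t - F ?s" by (simp only: dF_def h_def)
      ultimately have "dF n i = integral {?s..?t} b" by linarith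
      moreover have "integral {?s..?t} (\<lambda>x. b x - p ?s) = integral {?s..?t} b - h * p ?s"
        using integrable_continuous_real[OF cb] st(2)[OF i] tsh
        by (subst Henstock_Kurzweil_Integration.integral_diff) auto
      moreover have "norm (integral {?s..?t} (\<lambda>x. b x - p ?s)) \<le> (e + L * h) * (?t - ?s)"
      proof (rule integral_bound)
        show "continuous_on {?s..?t} (\<lambda>x. b x - p ?s)" by (intro continuous_intros cb)
        show "norm (b x - p ?s) \<le> e + L * h" if x: "x \<in> {?s..?t}" for x
        proof -
          have xT: "x \<in> {0..T}" "?s \<in> {0..T}" using x st[OF i] by auto
          have "\<bar>p x - p ?s\<bar> \<le> L * \<bar>x - ?s\<bar>" using p(4) xT .
          also have "\<dots> \<le> L * h" using x tsh p(2) by (intro mult_left_mono) auto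
          finally show ?thesis using p(1)[OF xT(1)] by simp
        qed
      qed (use st[OF i] in auto)
      ultimately show ?thesis unfolding tsh real_norm_def by (simp only: mult.commute)
    qed
    let ?q = "sqrt (\<Sum>i<n. (dw n i)\<^sup>2)"
    have q0: "?q \<ge> 0" by (simp add: sum_nonneg)
    have "\<bar>\<Sum>i<n. p (real i * h) * dw n i\<bar> \<le> C"
    proof -
      let ?c = "\<lambda>i. p (real i * h)" and ?w = "\<lambda>i. w (real i * h)"
      have i0: "real i * h \<in> {0..T}" if "i \<le> n" for i
        using grid_le[OF T n that] h by (auto simp: h_def[symmetric])
      have "(\<Sum>i<n. p (real i * h) * dw n i) = ?c n * ?w n - ?c 0 * ?w 0 - (\<Sum>i<n. ?w (Suc i) * (?c (Suc i) - ?c i))"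
        unfolding summation_by_parts[of ?c ?w n, symmetric] by (simp add: dw_def h_def)
      moreover have "\<bar>?c n * ?w n\<bar> \<le> B * K" "\<bar>?c 0 * ?w 0\<bar> \<le> B * K"
        unfolding abs_mult by (intro mult_mono p(5) K(2) i0; use p(3) K in simp)+
      moreover have "\<bar>\<Sum>i<n. ?w (Suc i) * (?c (Suc i) - ?c i)\<bar> \<le> K * L * T"
      proof -
        have "\<bar>\<Sum>i<n. ?w (Suc i) * (?c (Suc i) - ?c i)\<bar> \<le> (\<Sum>i<n. \<bar>?w (Suc i) * (?c (Suc i) - ?c i)\<bar>)" by (rule sum_abs)
        also have "\<dots> \<le> (\<Sum>i<n. K * (L * h))"
        proof (rule sum_mono)
          fix i assume "i \<in> {..<n}"
          then have "i < n" by simp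
          have "\<bar>?c (Suc i) - ?c i\<bar> \<le> L * \<bar>real (Suc i) * h - real i * h\<bar>" using \<open>i < n\<close> by (intro p(4) i0) auto
          also have "\<bar>real (Suc i) * h - real i * h\<bar> = h" using h by (simp add: algebra_simps)
          finally show "\<bar>?w (Suc i) * (?c (Suc i) - ?c i)\<bar> \<le> K * (L * h)"
            unfolding abs_mult using \<open>i < n\<close> K p(2) h by (intro mult_mono K(2) i0) auto
        qed
        also have "\<dots> = K * L * (real n * h)" by simp
        finally show ?thesis by (simp only: nh)
      qed
      ultimately show ?thesis unfolding C_def abs_le_iff by linarith
    qed
    then have s1: "\<bar>\<Sum>i<n. h * p (real i * h) * dw n i\<bar> \<le> h * C"
      using h by (simp add: sum_distrib_left[symmetric] mult.assoc abs_mult)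
    have "\<bar>\<Sum>i<n. (dF n i - h * p (real i * h)) * dw n i\<bar> \<le> (\<Sum>i<n. \<bar>(dF n i - h * p (real i * h)) * dw n i\<bar>)" by (rule sum_abs)
    also have "\<dots> \<le> (\<Sum>i<n. h * (e + L * h) * \<bar>dw n i\<bar>)"
      by (rule sum_mono) (auto simp: abs_mult intro!: mult_right_mono d)
    also have "\<dots> = h * (e + L * h) * (\<Sum>i<n. \<bar>dw n i\<bar>)" by (simp add: sum_distrib_left)
    also have "\<dots> \<le> h * (e + L * h) * (sqrt (real n) * ?q)"
      using h e p(2) by (intro mult_left_mono Cauchy_Schwarz_sum_abs) simp
    finally have s2: "\<bar>\<Sum>i<n. (dF n i - h * p (real i * h)) * dw n i\<bar> \<le> h * (e + L * h) * (sqrt (real n) * ?q)" .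
    have "(\<Sum>i<n. dF n i * dw n i) = (\<Sum>i<n. (dF n i - h * p (real i * h)) * dw n i) + (\<Sum>i<n. h * p (real i * h) * dw n i)"
      by (simp add: sum.distrib[symmetric] algebra_simps)
    then have "\<bar>\<Sum>i<n. dF n i * dw n i\<bar> \<le> h * (e + L * h) * (sqrt (real n) * ?q) + h * C"
      using s1 s2 by linarith
    also have "\<dots> \<le> (h * (e + L * h) * sqrt (real n) + h * C) * (1 + ?q)"
      using h e p(2) q0 C0 by (simp add: algebra_simps)
    finally have "sqrt (real n) * \<bar>\<Sum>i<n. dF n i * dw n i\<bar> \<le> sqrt (real n) * ((h * (e + L * h) * sqrt (real n) + h * C) * (1 + ?q))"
      by (intro mult_left_mono) auto
    then have "sqrt (real n) * \<bar>\<Sum>i<n. dF n i * dw n i\<bar> / (1 + ?q) \<le> sqrt (real n) * (h * (e + L * h) * sqrt (real n) + h * C)"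
    proof -
      have q1: "1 + ?q > 0" using q0 by linarith
      then show ?thesis using \<open>sqrt (real n) * \<bar>_\<bar> \<le> _\<close> by (simp only: pos_divide_le_eq[OF q1] mult.assoc)
    qed
    also have "\<dots> = (real n * h) * (e + L * h) + (real n * h) * C / sqrt (real n)"
    proof -
      have "sqrt (real n) * (h * (e + L * h) * sqrt (real n) + h * C) = (sqrt (real n) * sqrt (real n)) * h * (e + L * h) + sqrt (real n) * h * C"
        by (simp add: algebra_simps)
      moreover have "real n * h * C / sqrt (real n) = sqrt (real n) * h * C"
      proof -
        have "real n / sqrt (real n) = sqrt (real n)" by (rule real_div_sqrt) simp
        then show ?thesis by (metis times_divide_eq_left)
      qed
      ultimately show ?thesis by simp
    qed
    also have "\<dots> = T * e + T * L * T / real n + T * C / sqrt (real n)"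
      unfolding nh by (simp add: h_def algebra_simps)
    finally show ?thesis using q0 by (simp add: abs_mult abs_divide)
  qed
  have "(\<lambda>n. T * e + T * L * T / real n + T * C / sqrt (real n)) \<longlonglongrightarrow> T * e + 0 + 0"
    by (intro tendsto_add tendsto_const lim_const_over_n tendsto_divide_0[OF tendsto_const]
      filterlim_at_top_imp_at_infinity sqrt_at_top[THEN filterlim_compose] filterlim_real_sequentially)
  moreover have "T * e + 0 + 0 < r" using r T by (simp add: e_def)
  ultimately have "\<forall>\<^sub>F n in sequentially. T * e + T * L * T / real n + T * C / sqrt (real n) < r"
    by (rule order_tendstoD(2))
  then have "\<forall>\<^sub>F n in sequentially. norm (sqrt (real n) * (\<Sum>i<n. dF n i * dw n i) / (1 + sqrt (\<Sum>i<n. (dw n i)\<^sup>2)) - 0) < r"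
    using eventually_gt_at_top[of 0]
  proof eventually_elim
    case (elim n)
    from order_le_less_trans[OF main[OF elim(2)] elim(1)] show ?case by (simp only: diff_zero real_norm_def)
  qed
  then show "\<exists>n0. \<forall>n\<ge>n0. norm (sqrt (real n) * (\<Sum>i<n. dF n i * dw n i) / (1 + sqrt (\<Sum>i<n. (dw n i)\<^sup>2)) - 0) < r"
    by (simp add: eventually_sequentially)
qed

text \<open>Both factors have increments of order \<open>1 / n\<close>, so the sum is of order
  \<open>1 / n\<close> and beats the factor \<open>sqrt (real n)\<close>.\<close>

lemma drift_variation_tendsto_0:
  fixes a b F G :: "real \<Rightarrow> real"
  assumes T: "T > 0" and a: "continuous_on {0..T} a" and b: "continuous_on {0..T} b"
    and F: "\<And>t. t \<in> {0..T} \<Longrightarrow> F t = F0 + integral {0..t} a"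
    and G: "\<And>t. t \<in> {0..T} \<Longrightarrow> G t = G0 + integral {0..t} b"
  defines "dF \<equiv> \<lambda>n i. F (real (Suc i) * (T / real n)) - F (real i * (T / real n))"
    and "dG \<equiv> \<lambda>n i. G (real (Suc i) * (T / real n)) - G (real i * (T / real n))"
  shows "(\<lambda>n. sqrt (real n) * (\<Sum>i<n. dF n i * dG n i)) \<longlonglongrightarrow> 0"
proof -
  have bnd: "\<exists>K>0. \<forall>n>0. \<forall>i<n. \<bar>H (real (Suc i) * (T / real n)) - H (real i * (T / real n))\<bar> \<le> K * (T / real n)"
    if c: "continuous_on {0..T} c" and H: "\<And>t. t \<in> {0..T} \<Longrightarrow> H t = H0 + integral {0..t} c" for c H :: "real \<Rightarrow> real" and H0
  proof -
    have "bounded (c ` {0..T})" by (intro compact_imp_bounded compact_continuous_image c compact_Icc)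
    then obtain K where K: "K > 0" "\<And>s. s \<in> {0..T} \<Longrightarrow> \<bar>c s\<bar> \<le> K"
      unfolding bounded_pos by (metis image_eqI real_norm_def)
    show ?thesis
    proof (intro exI[of _ K] conjI allI impI K)
      fix n i :: nat assume n: "n > 0" and i: "i < n"
      let ?s = "real i * (T / real n)" and ?t = "real (Suc i) * (T / real n)"
      have st: "0 \<le> ?s" "?s \<le> ?t" "?t \<le> T"
      proof -
        show "0 \<le> ?s" using T by simp
        show "?s \<le> ?t" by (rule mult_right_mono) (use T in auto)
        show "?t \<le> T" by (rule grid_le[OF T n]) (use i in simp)
      qed
      have tsh: "?t - ?s = T / real n" by (simp add: algebra_simps add_divide_distrib)
      have "integral {0..?s} c + integral {?s..?t} c = integral {0..?t} c"
        using st by (intro Henstock_Kurzweil_Integration.integral_combine integrable_continuous_real continuous_on_subset[OF c]) auto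
      then have "H ?t - H ?s = integral {?s..?t} c"
        using H[of ?s] H[of ?t] st by simp
      moreover have "norm (integral {?s..?t} c) \<le> K * (?t - ?s)"
        using st by (intro integral_bound continuous_on_subset[OF c]) (auto intro!: K)
      ultimately show "\<bar>H ?t - H ?s\<bar> \<le> K * (T / real n)" by (simp only: tsh real_norm_def)
    qed
  qed
  obtain K where K: "K > 0" "\<And>n i. n > 0 \<Longrightarrow> i < n \<Longrightarrow> \<bar>dF n i\<bar> \<le> K * (T / real n)"
    using bnd[OF a F] unfolding dF_def by metis
  obtain J where J: "J > 0" "\<And>n i. n > 0 \<Longrightarrow> i < n \<Longrightarrow> \<bar>dG n i\<bar> \<le> J * (T / real n)"
    using bnd[OF b G] unfolding dG_def by metis
  have "\<forall>\<^sub>F n in sequentially. norm (sqrt (real n) * (\<Sum>i<n. dF n i * dG n i)) \<le> K * J * T\<^sup>2 / sqrt (real n)"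
    using eventually_gt_at_top[of 0]
  proof eventually_elim
    case (elim n)
    have "\<bar>\<Sum>i<n. dF n i * dG n i\<bar> \<le> (\<Sum>i<n. \<bar>dF n i * dG n i\<bar>)" by (rule sum_abs)
    also have "\<dots> \<le> (\<Sum>i<n. (K * (T / real n)) * (J * (T / real n)))"
      unfolding abs_mult using elim K J T by (intro sum_mono mult_mono) auto
    also have "\<dots> = K * J * T\<^sup>2 / real n" using elim by (simp add: power2_eq_square)
    finally have "sqrt (real n) * \<bar>\<Sum>i<n. dF n i * dG n i\<bar> \<le> sqrt (real n) * (K * J * T\<^sup>2 / real n)"
      by (rule mult_left_mono) simp
    also have "\<dots> = K * J * T\<^sup>2 * (sqrt (real n) / real n)" by simp
    also have "sqrt (real n) / real n = 1 / sqrt (real n)"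
      using elim by (simp add: field_simps)
    finally show ?case by (simp add: abs_mult)
  qed
  moreover have "(\<lambda>n. K * J * T\<^sup>2 / sqrt (real n)) \<longlonglongrightarrow> 0"
    by (intro tendsto_divide_0[OF tendsto_const]
      filterlim_at_top_imp_at_infinity sqrt_at_top[THEN filterlim_compose] filterlim_real_sequentially)
  ultimately show ?thesis by (rule Lim_null_comparison)
qed

subsection \<open>Duplication matrix and Kronecker products\<close>

lemma transpose_sym_nth:
  assumes "transpose A = A" shows "A $ i $ j = A $ j $ i"
proof -
  have "transpose A $ j $ i = A $ i $ j" by (simp add: transpose_def)
  then show ?thesis by (simp only: assms)
qed

lemma dup_mult_vec: "(dup *v u) $ (a, b) = u $ Upair a b"
  by (simp add: dup_def matrix_vector_mult_def if_distrib[of "\<lambda>x. x * y" for y] cong: if_cong)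

lemma is_moore_penrose_unique:
  fixes A :: "real^'n^'m"
  assumes X: "is_moore_penrose A X" and Y: "is_moore_penrose A Y"
  shows "X = Y"
proof -
  note x = X[unfolded is_moore_penrose_def] and y = Y[unfolded is_moore_penrose_def]
  have y1: "A ** Y ** A = A" "A ** (Y ** A) = A" using y by (simp_all only: matrix_mul_assoc)
  have 1: "A ** X = A ** Y"
  proof -
    have "A ** X = (A ** Y) ** (A ** X)" by (simp only: matrix_mul_assoc y1)
    then have "transpose (A ** X) = transpose (A ** X) ** transpose (A ** Y)"
      by (metis matrix_transpose_mul)
    then have "A ** X = (A ** X) ** (A ** Y)" by (simp only: x y)
    also have "\<dots> = A ** X ** A ** Y" by (simp add: matrix_mul_assoc)
    finally show ?thesis by (simp only: x)
  qed
  have 2: "X ** A = Y ** A"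
  proof -
    have "X ** A = (X ** A) ** (Y ** A)" by (simp only: matrix_mul_assoc[symmetric] y1)
    then have "transpose (X ** A) = transpose (Y ** A) ** transpose (X ** A)"
      by (metis matrix_transpose_mul)
    then have "X ** A = (Y ** A) ** (X ** A)" by (simp only: x y)
    also have "\<dots> = Y ** (A ** X ** A)" by (simp add: matrix_mul_assoc)
    finally show ?thesis by (simp only: x)
  qed
  have "X = X ** A ** X" by (simp only: x)
  also have "\<dots> = Y ** A ** Y" by (metis 1 2 matrix_mul_assoc)
  finally show ?thesis by (simp only: y)
qed

text \<open>The Moore-Penrose inverse of \<open>dup\<close>, see \<open>moore_penrose_dup\<close>.
  It averages the entries at \<open>(a, b)\<close> and \<open>(b, a)\<close>, hence the weight
  \<open>1 / 2\<close> off the diagonal, where an unordered pair has two representatives.\<close>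

definition dup_inv :: "real^(('p::finite) \<times> 'p)^('p uprod)" where
  "dup_inv = (\<chi> u k. if u = Upair (fst k) (snd k) then (if fst k = snd k then 1 else 1 / 2) else 0)"

lemma dup_inv_mult_vec: "(dup_inv *v x) $ Upair a b = (x $ (a, b) + x $ (b, a)) / 2"
proof -
  let ?g = "\<lambda>k. (if fst k = snd k then 1 else 1 / 2) * x $ k"
  have "(dup_inv *v x) $ Upair a b = (\<Sum>k\<in>UNIV. if k \<in> {(a, b), (b, a)} then ?g k else 0)"
    unfolding matrix_vector_mult_def dup_inv_def vec_lambda_beta by (rule sum.cong) auto
  also have "\<dots> = sum ?g {(a, b), (b, a)}"
    by (subst sum.If_cases) (auto intro!: sum.cong)
  finally show ?thesis by (cases "a = b") (simp_all add: add_divide_distrib)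
qed

lemma matrix_eqI: "(\<And>x. (A::real^'n^'m) *v x = B *v x) \<Longrightarrow> A = B"
  by (metis matrix_eq)

lemma dup_inv_dup: "dup_inv ** dup = (mat 1 :: real^('p::finite uprod)^('p uprod))"
proof (rule matrix_eqI)
  fix x :: "real^('p uprod)"
  have "((dup_inv ** dup) *v x) $ u = x $ u" for u
  proof -
    obtain a b where u: "u = Upair a b" by (rule uprod_exhaust)
    have "Upair b a = Upair a b" by auto
    then show ?thesis unfolding u by (simp only: matrix_vector_mul_assoc[symmetric] dup_inv_mult_vec dup_mult_vec) simp
  qed
  then show "(dup_inv ** dup) *v x = mat 1 *v x" by (simp add: vec_eq_iff)
qed

text \<open>The symmetrizer: orthogonal projection onto the vectorized symmetric matrices.\<close>

definition dup_proj :: "real^(('p::finite) \<times> 'p)^('p \<times> 'p)" where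
  "dup_proj = dup ** dup_inv"

lemma dup_proj_mult: "(dup_proj *v x) $ (a, b) = (x $ (a, b) + x $ (b, a)) / 2"
  unfolding dup_proj_def by (simp only: matrix_vector_mul_assoc[symmetric] dup_inv_mult_vec dup_mult_vec)

lemma transpose_dup_proj: "transpose dup_proj = (dup_proj :: real^(('p::finite) \<times> 'p)^('p \<times> 'p))"
proof (rule matrix_eqI)
  fix x :: "real^('p \<times> 'p)"
  have sw: "(\<Sum>k\<in>UNIV. f (snd k, fst k)) = (\<Sum>k\<in>UNIV. f k)" for f :: "'p \<times> 'p \<Rightarrow> real"
    by (rule sum.reindex_bij_witness[of _ prod.swap prod.swap]) auto
  have ip: "(dup_proj *v x) \<bullet> y = x \<bullet> (dup_proj *v y)" for x y :: "real^('p \<times> 'p)"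
  proof -
    have "(dup_proj *v x) $ k = (x $ k + x $ (snd k, fst k)) / 2" for x :: "real^('p \<times> 'p)" and k
      using dup_proj_mult[of x "fst k" "snd k"] by simp
    then have e: "(dup_proj *v x) \<bullet> y = (\<Sum>k\<in>UNIV. x $ k * y $ k / 2) + (\<Sum>k\<in>UNIV. x $ (snd k, fst k) * y $ k / 2)" for x y :: "real^('p \<times> 'p)"
      by (simp add: inner_vec_def sum.distrib[symmetric] algebra_simps add_divide_distrib)
    have "(\<Sum>k\<in>UNIV. x $ (snd k, fst k) * y $ k / 2) = (\<Sum>k\<in>UNIV. y $ (snd k, fst k) * x $ k / 2)"
      using sw[of "\<lambda>k. y $ (snd k, fst k) * x $ k / 2"] by (simp add: mult.commute)
    then show ?thesis using e[of x y] e[of y x] by (simp add: inner_commute[of x] mult.commute)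
  qed
  have "y \<bullet> (transpose dup_proj *v x) = y \<bullet> (dup_proj *v x)" for y
    using ip[of y x] inner_matrix_transpose[of y "transpose dup_proj" x] by (simp add: transpose_transpose)
  then show "transpose dup_proj *v x = dup_proj *v x" by (metis vector_eq_rdot inner_commute)
qed

text \<open>\<open>dup_inv ** dup\<close> is the identity and \<open>dup ** dup_inv\<close> the
  symmetrizer; both are symmetric, and the Penrose equations follow.\<close>

lemma moore_penrose_dup: "moore_penrose dup = (dup_inv :: real^(('p::finite) \<times> 'p)^('p uprod))"
proof -
  have mp: "is_moore_penrose dup (dup_inv :: real^('p \<times> 'p)^('p uprod))"
    unfolding is_moore_penrose_def
    using transpose_dup_proj[where 'p='p] unfolding dup_proj_def
    by (simp add: dup_inv_dup transpose_mat) (simp add: dup_inv_dup matrix_mul_assoc[symmetric])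
  show ?thesis
    unfolding moore_penrose_def by (rule the_equality, rule mp, erule is_moore_penrose_unique[OF _ mp])
qed

lemma kron_mult_vec: "(kron A B *v x) $ (i, j) = (\<Sum>k\<in>UNIV. \<Sum>l\<in>UNIV. A $ i $ k * B $ j $ l * x $ (k, l))"
proof -
  have "(kron A B *v x) $ (i, j) = (\<Sum>(k, l)\<in>UNIV \<times> UNIV. A $ i $ k * B $ j $ l * x $ (k, l))"
    unfolding matrix_vector_mult_def kron_def by (simp add: split_beta)
  then show ?thesis by (simp only: sum.cartesian_product)
qed

lemma kron_mult:
  fixes A :: "real^'n^'m" and C :: "real^'s^'n" and B :: "real^'l^'k" and D :: "real^'t^'l"
  shows "kron A B ** kron C D = kron (A ** C) (B ** D)"
proof -
  have "(kron A B ** kron C D) $ (i, j) $ (k, l) = kron (A ** C) (B ** D) $ (i, j) $ (k, l)" for i j k l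
  proof -
    have "(kron A B ** kron C D) $ (i, j) $ (k, l) = (\<Sum>(r, s)\<in>UNIV \<times> UNIV. (A $ i $ r * C $ r $ k) * (B $ j $ s * D $ s $ l))"
      unfolding matrix_matrix_mult_def kron_def by (simp add: split_beta mult_ac)
    also have "\<dots> = (\<Sum>r\<in>UNIV. \<Sum>s\<in>UNIV. (A $ i $ r * C $ r $ k) * (B $ j $ s * D $ s $ l))"
      by (simp only: sum.cartesian_product)
    also have "\<dots> = (\<Sum>r\<in>UNIV. A $ i $ r * C $ r $ k) * (\<Sum>s\<in>UNIV. B $ j $ s * D $ s $ l)"
      by (simp only: sum_product)
    finally show ?thesis by (simp add: matrix_matrix_mult_def kron_def)
  qed
  then show ?thesis by (simp add: vec_eq_iff)
qed

lemma kron_mat_1: "kron (mat 1 :: real^'n^'n) (mat 1 :: real^'m^'m) = mat 1"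
  by (auto simp: kron_def mat_def vec_eq_iff)

text \<open>\<open>kron S S\<close> acts on a vectorized matrix as
  \<open>S ** X ** transpose S\<close>, which is compatible with transposing \<open>X\<close> and
  therefore with symmetrization.\<close>

lemma kron_dup_proj: "kron S S *v (dup_proj *v x) = dup_proj *v (kron S S *v x)"
proof -
  have "(kron S S *v (dup_proj *v x)) $ (i, j) = (dup_proj *v (kron S S *v x)) $ (i, j)" for i j
  proof -
    have "(\<Sum>k\<in>UNIV. \<Sum>l\<in>UNIV. S $ i $ k * S $ j $ l * x $ (l, k)) = (\<Sum>k\<in>UNIV. \<Sum>l\<in>UNIV. S $ j $ k * S $ i $ l * x $ (k, l))"
      by (subst sum.swap) (simp add: mult.commute)
    moreover have "(\<Sum>k\<in>UNIV. \<Sum>l\<in>UNIV. S $ i $ k * S $ j $ l * ((x $ (k, l) + x $ (l, k)) / 2)) =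
       (\<Sum>k\<in>UNIV. \<Sum>l\<in>UNIV. S $ i $ k * S $ j $ l * x $ (k, l)) / 2 + (\<Sum>k\<in>UNIV. \<Sum>l\<in>UNIV. S $ i $ k * S $ j $ l * x $ (l, k)) / 2"
      by (simp add: sum_divide_distrib sum.distrib[symmetric] algebra_simps add_divide_distrib)
    ultimately show ?thesis by (simp add: kron_mult_vec dup_proj_mult)
  qed
  then show ?thesis by (simp add: vec_eq_iff)
qed

text \<open>The value of \<open>V_mat S S\<close>: for equal arguments the integrand does not depend
  on \<open>l1\<close>, and \<open>l2\<close> integrates to \<open>1 / 2\<close>.\<close>

definition V0_mat :: "real^('p::finite)^'p \<Rightarrow> real^('p uprod)^('p uprod)" where
  "V0_mat S = (1 / 2) *\<^sub>R (transpose dup ** kron (matrix_inv S) (matrix_inv S) ** dup)"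

text \<open>The inner factors \<open>transpose dup_inv ** transpose dup\<close> form the
  symmetrizer. It commutes with \<open>kron S S\<close>, so the Kronecker products cancel, and it
  fixes the range of \<open>dup\<close>; the scalars 2 and \<open>1 / 2\<close> cancel as
  well.\<close>

lemma W_mat_V0_mat:
  fixes S :: "real^('p::finite)^'p"
  assumes "invertible S"
  shows "W_mat S ** V0_mat S = mat 1"
proof (rule matrix_eqI)
  fix x :: "real^('p uprod)"
  let ?K = "kron S S" and ?L = "kron (matrix_inv S) (matrix_inv S)"
  have KL: "?K *v (?L *v y) = y" for y
    by (simp add: matrix_vector_mul_assoc kron_mult invertible_matrix_inv[OF assms] kron_mat_1)
  have t: "transpose dup_inv *v (transpose dup *v y) = dup_proj *v y" for y :: "real^('p \<times> 'p)"
    using transpose_dup_proj[where 'p='p] unfolding dup_proj_def matrix_transpose_mul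
    by (simp only: matrix_vector_mul_assoc)
  have pd: "dup_inv *v (dup *v y) = y" for y :: "real^('p uprod)"
    by (simp add: matrix_vector_mul_assoc dup_inv_dup)
  have "(W_mat S ** V0_mat S) *v x = dup_inv *v (?K *v (transpose dup_inv *v (transpose dup *v (?L *v (dup *v x)))))"
    unfolding W_mat_def V0_mat_def moore_penrose_dup
    by (simp only: matrix_vector_mul_assoc[symmetric] scaleR_matrix_vector_assoc[symmetric] matrix_vector_mult_scaleR scaleR_scaleR) simp
  also have "\<dots> = dup_inv *v (dup_proj *v (dup *v x))"
    by (simp only: t kron_dup_proj KL)
  also have "\<dots> = x"
    unfolding dup_proj_def by (simp only: matrix_vector_mul_assoc[symmetric] pd)
  finally show "(W_mat S ** V0_mat S) *v x = mat 1 *v x" by simp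
qed

lemma vech_inner:
  fixes A :: "real^('p::finite)^'p"
  assumes "transpose A = A"
  shows "u \<bullet> vech A = (\<Sum>a\<in>UNIV. \<Sum>b\<in>UNIV. (transpose dup_inv *v u) $ (a, b) * A $ a $ b)"
proof -
  have "vech A = dup_inv *v vec_of A"
    by (simp add: dup_vech[OF assms] matrix_vector_mul_assoc dup_inv_dup)
  then have "u \<bullet> vech A = (transpose dup_inv *v u) \<bullet> vec_of A"
    by (simp only: inner_matrix_transpose)
  also have "\<dots> = (\<Sum>(a, b)\<in>UNIV \<times> UNIV. (transpose dup_inv *v u) $ (a, b) * A $ a $ b)"
  proof -
    have "A $ b $ a = A $ a $ b" for a b by (rule transpose_sym_nth[OF assms])
    then show ?thesis by (simp add: inner_vec_def vec_of_def split_beta)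
  qed
  finally show ?thesis by (simp only: sum.cartesian_product)
qed

lemma transpose_dup_inv_sym: "(transpose dup_inv *v u) $ (a, b) = (transpose dup_inv *v u) $ (b, a)"
proof -
  have U: "Upair a b = Upair b a" by auto
  have "dup_inv $ v $ (a, b) = dup_inv $ v $ (b, a)" for v
    unfolding dup_inv_def by (simp add: U)
  then show ?thesis unfolding matrix_vector_mult_def transpose_def by simp
qed

text \<open>The right-hand side is the variance found in \<open>multi_normal_quadratic_form\<close>.
  This identifies \<open>W_mat S\<close> as the covariance of the half-vectorized outer square of a
  centred normal vector with covariance \<open>S\<close>.\<close>

lemma W_mat_quadratic:
  fixes S :: "real^('p::finite)^'p"
  defines "c \<equiv> \<lambda>u a b. (transpose dup_inv *v u) $ (a, b)"
  shows "u \<bullet> (W_mat S *v u) = 2 * (\<Sum>a\<in>UNIV. \<Sum>b\<in>UNIV. \<Sum>d\<in>UNIV. \<Sum>e\<in>UNIV. c u a b * c u d e * (S $ a $ d * S $ b $ e))"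
proof -
  let ?y = "transpose dup_inv *v u"
  have "u \<bullet> (W_mat S *v u) = 2 * (u \<bullet> (dup_inv *v (kron S S *v ?y)))"
    unfolding W_mat_def moore_penrose_dup
    by (simp only: matrix_vector_mul_assoc[symmetric] scaleR_matrix_vector_assoc[symmetric] inner_scaleR_right)
  also have "u \<bullet> (dup_inv *v (kron S S *v ?y)) = ?y \<bullet> (kron S S *v ?y)"
    by (simp only: inner_matrix_transpose[of u])
  also have "\<dots> = (\<Sum>(a, b)\<in>UNIV \<times> UNIV. ?y $ (a, b) * (kron S S *v ?y) $ (a, b))"
    by (simp add: inner_vec_def split_beta)
  also have "\<dots> = (\<Sum>a\<in>UNIV. \<Sum>b\<in>UNIV. ?y $ (a, b) * (kron S S *v ?y) $ (a, b))"
    by (simp only: sum.cartesian_product)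
  also have "\<dots> = (\<Sum>a\<in>UNIV. \<Sum>b\<in>UNIV. \<Sum>d\<in>UNIV. \<Sum>e\<in>UNIV. c u a b * c u d e * (S $ a $ d * S $ b $ e))"
    unfolding kron_mult_vec c_def by (simp add: sum_distrib_left mult_ac)
  finally show ?thesis .
qed

text \<open>Writing \<open>A = B ** transpose B\<close> makes \<open>kron A A\<close> the Gram
  matrix of \<open>kron B B\<close>, which is invertible together with \<open>B\<close>.\<close>

lemma kron_pos:
  fixes A :: "real^'p^'p"
  assumes A: "pos_def A" and x: "x \<noteq> 0"
  shows "x \<bullet> (kron A A *v x) > 0"
proof -
  obtain B where B: "A = B ** transpose B" "det B \<noteq> 0" using pos_def_factorization[OF A] .
  have kt: "transpose (kron B B) = kron (transpose B) (transpose B)"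
    by (simp add: transpose_def kron_def vec_eq_iff)
  have "x \<bullet> (kron A A *v x) = x \<bullet> (kron B B *v (transpose (kron B B) *v x))"
    unfolding B(1) kron_mult[symmetric] kt by (simp only: matrix_vector_mul_assoc)
  also have "\<dots> = (transpose (kron B B) *v x) \<bullet> (transpose (kron B B) *v x)"
    by (simp only: inner_matrix_transpose[of x])
  finally have e: "x \<bullet> (kron A A *v x) = (transpose (kron B B) *v x) \<bullet> (transpose (kron B B) *v x)" .
  have "invertible B" using B(2) invertible_det_nz by blast
  then have i: "matrix_inv B ** B = mat 1" by (rule invertible_matrix_inv)
  have "transpose (kron (matrix_inv B) (matrix_inv B)) *v (transpose (kron B B) *v x) = transpose (kron B B ** kron (matrix_inv B) (matrix_inv B)) *v x"
    by (simp only: matrix_transpose_mul matrix_vector_mul_assoc)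
  also have "\<dots> = x"
    unfolding kron_mult invertible_matrix_inv[OF \<open>invertible B\<close>] kron_mat_1 transpose_mat by simp
  finally have "transpose (kron B B) *v x \<noteq> 0" using x by (metis matrix_vector_mult_0_right)
  then show ?thesis unfolding e by simp
qed

lemma pos_def_matrix_inv:
  assumes A: "pos_def A" shows "pos_def (matrix_inv A)"
proof -
  have i: "invertible A" by (rule pos_def_invertible[OF A])
  have s: "transpose A = A" using A by (simp add: pos_def_def)
  have "A ** transpose (matrix_inv A) = transpose (matrix_inv A ** A)" by (simp only: matrix_transpose_mul s)
  then have "A ** transpose (matrix_inv A) = mat 1" by (simp only: invertible_matrix_inv[OF i] transpose_mat)
  then have t: "transpose (matrix_inv A) = matrix_inv A" by (metis matrix_inv_unique(1))
  show ?thesis unfolding pos_def_def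
  proof (intro conjI allI impI t)
    fix x :: "real^'a" assume x: "x \<noteq> 0"
    let ?y = "matrix_inv A *v x"
    have xy: "A *v ?y = x" by (simp add: matrix_vector_mul_assoc invertible_matrix_inv[OF i])
    then have "?y \<noteq> 0" using x by (metis matrix_vector_mult_0_right)
    then have "?y \<bullet> (A *v ?y) > 0" using A by (simp add: pos_def_def)
    then show "x \<bullet> ?y > 0" unfolding xy by (simp add: inner_commute)
  qed
qed

lemma dup_injective: "dup *v u = 0 \<Longrightarrow> u = 0"
  by (metis dup_inv_dup matrix_vector_mul_assoc matrix_vector_mul_lid matrix_vector_mult_0_right)

lemma pos_def_V0_mat:
  fixes S :: "real^('p::finite)^'p"
  assumes S: "pos_def S" shows "pos_def (V0_mat S)"
proof -
  let ?L = "kron (matrix_inv S) (matrix_inv S)"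
  note pS = pos_def_matrix_inv[OF S]
  have tS: "transpose (matrix_inv S) = matrix_inv S" using pS by (simp add: pos_def_def)
  have tL: "transpose ?L = ?L"
  proof -
    have "matrix_inv S $ a $ b = matrix_inv S $ b $ a" for a b
      by (rule transpose_sym_nth[OF tS])
    then show ?thesis by (simp add: transpose_def kron_def vec_eq_iff)
  qed
  have sc: "transpose (c *\<^sub>R A) = c *\<^sub>R transpose A" for c and A :: "real^'n^'m" by (simp add: transpose_def vec_eq_iff)
  show ?thesis unfolding pos_def_def
  proof (intro conjI allI impI)
    show "transpose (V0_mat S) = V0_mat S"
      unfolding V0_mat_def sc matrix_transpose_mul tL transpose_transpose by (simp add: matrix_mul_assoc)
    fix x :: "real^('p uprod)" assume "x \<noteq> 0"
    then have "dup *v x \<noteq> 0" using dup_injective by blast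
    from kron_pos[OF pS this] have "(dup *v x) \<bullet> (?L *v (dup *v x)) > 0" .
    moreover have "x \<bullet> (V0_mat S *v x) = (1 / 2) * ((dup *v x) \<bullet> (?L *v (dup *v x)))"
    proof -
      have "x \<bullet> (V0_mat S *v x) = (1 / 2) * (x \<bullet> (transpose dup *v (?L *v (dup *v x))))"
        unfolding V0_mat_def
        by (simp only: matrix_vector_mul_assoc[symmetric] scaleR_matrix_vector_assoc[symmetric] inner_scaleR_right)
      then show ?thesis by (simp only: inner_matrix_transpose[of x "transpose dup"] transpose_transpose)
    qed
    ultimately show "x \<bullet> (V0_mat S *v x) > 0" by simp
  qed
qed

lemma W_mat_inverse:
  fixes S :: "real^('p::finite)^'p"
  assumes S: "pos_def S"
  shows "matrix_inv (W_mat S) = V0_mat S" "pos_def (W_mat S)" "matrix_inv (V0_mat S) = W_mat S"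
proof -
  have WV: "W_mat S ** V0_mat S = mat 1" by (rule W_mat_V0_mat[OF pos_def_invertible[OF S]])
  show "matrix_inv (W_mat S) = V0_mat S" by (rule matrix_inv_unique[OF WV])
  have VW: "V0_mat S ** W_mat S = mat 1" using WV matrix_left_right_inverse by blast
  show e: "matrix_inv (V0_mat S) = W_mat S" by (rule matrix_inv_unique[OF VW])
  show "pos_def (W_mat S)" using pos_def_matrix_inv[OF pos_def_V0_mat[OF S]] unfolding e .
qed

subsection \<open>Continuity of the weight matrix\<close>

lemma continuous_on_det [continuous_intros]:
  fixes f :: "'a::topological_space \<Rightarrow> real^'n^'n"
  shows "continuous_on S f \<Longrightarrow> continuous_on S (\<lambda>x. det (f x))"
  unfolding det_def by (intro continuous_intros)

text \<open>Cramer's rule for the columns of the inverse. Its entries are thus quotients of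
  polynomials in the entries of \<open>A\<close>, which is the source of both continuity and
  differentiability of inversion.\<close>

lemma matrix_inv_nth:
  fixes A :: "real^'n^'n"
  assumes "invertible A"
  shows "matrix_inv A $ i $ j = det (\<chi> r c. if c = i then (if r = j then 1 else 0) else A $ r $ c) / det A"
proof -
  have d: "det A \<noteq> 0" using assms invertible_det_nz by blast
  have "A *v (matrix_inv A *v axis j 1) = axis j 1"
    by (simp add: matrix_vector_mul_assoc invertible_matrix_inv[OF assms])
  then have "matrix_inv A *v axis j 1 = (\<chi> k. det (\<chi> r c. if c = k then axis j 1 $ r else A $ r $ c) / det A)"
    by (simp only: cramer[OF d])
  then have "(matrix_inv A *v axis j 1) $ i = (\<chi> k. det (\<chi> r c. if c = k then axis j 1 $ r else A $ r $ c) / det A) $ i"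
    by (simp only:)
  moreover have "(matrix_inv A *v axis j 1) $ i = matrix_inv A $ i $ j"
    by (simp add: matrix_vector_mult_basis column_def)
  moreover have "axis j 1 $ r = (if r = j then 1 else 0 :: real)" for r by (simp add: axis_def)
  ultimately show ?thesis by (simp only: vec_lambda_beta)
qed

lemma continuous_on_matrix_inv [continuous_intros]:
  fixes f :: "'a::topological_space \<Rightarrow> real^'n^'n"
  assumes f: "continuous_on S f" and inv: "\<And>x. x \<in> S \<Longrightarrow> invertible (f x)"
  shows "continuous_on S (\<lambda>x. matrix_inv (f x))"
proof -
  have "continuous_on S (\<lambda>x. \<chi> i j. det (\<chi> r c. if c = i then (if r = j then 1 else 0) else f x $ r $ c) / det (f x))"
  proof (intro continuous_on_vec_lambda continuous_on_divide continuous_on_det f ballI)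
    show "continuous_on S (\<lambda>x. if c = i then (if r = j then 1 else 0) else f x $ r $ c)" for i j r c
      by (cases "c = i") (auto intro!: continuous_intros f)
    show "det (f x) \<noteq> 0" if "x \<in> S" for x using inv[OF that] invertible_det_nz by blast
  qed
  then show ?thesis
    by (rule continuous_on_eq) (simp add: vec_eq_iff matrix_inv_nth inv)
qed

lemma continuous_on_kron [continuous_intros]:
  fixes f :: "'a::topological_space \<Rightarrow> real^'n^'m" and g :: "'a \<Rightarrow> real^'l^'k"
  shows "continuous_on S f \<Longrightarrow> continuous_on S g \<Longrightarrow> continuous_on S (\<lambda>x. kron (f x) (g x))"
  unfolding kron_def by (intro continuous_intros)

lemma bounded_bilinear_matrix_vector_mult: "bounded_bilinear (\<lambda>(A::real^'n^'m) x. A *v x)"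
proof -
  have "bilinear (\<lambda>(A::real^'n^'m) x. A *v x)"
    unfolding bilinear_def
    by (auto intro!: linearI simp: matrix_vector_right_distrib matrix_vector_mult_add_rdistrib
        matrix_vector_mult_scaleR scaleR_matrix_vector_assoc)
  then show ?thesis by (simp add: bilinear_conv_bounded_bilinear)
qed

lemmas continuous_on_matrix_vector_mult [continuous_intros] =
  bounded_bilinear.continuous_on[OF bounded_bilinear_matrix_vector_mult]

lemma matrix_quadratic_bound:
  obtains K where "K > 0" "\<And>(A::real^'n^'m) x y. \<bar>x \<bullet> (A *v y)\<bar> \<le> K * norm A * norm x * norm y"
proof -
  obtain K where K: "K > 0" "\<And>(A::real^'n^'m) x. norm (A *v x) \<le> norm A * norm x * K"
    using bounded_bilinear.pos_bounded[OF bounded_bilinear_matrix_vector_mult] by metis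
  have "\<bar>x \<bullet> (A *v y)\<bar> \<le> K * norm A * norm x * norm y" for A :: "real^'n^'m" and x y
  proof -
    have "\<bar>x \<bullet> (A *v y)\<bar> \<le> norm x * norm (A *v y)" by (rule Cauchy_Schwarz_ineq2)
    also have "\<dots> \<le> norm x * (norm A * norm y * K)" by (intro mult_left_mono K) simp
    finally show ?thesis by (simp add: mult_ac)
  qed
  with K(1) show ?thesis using that by blast
qed

text \<open>For symmetric invertible \<open>A\<close> and \<open>v = vech Z\<close> with
  \<open>Z\<close> symmetric this is the trace of
  \<open>matrix_inv A ** Z ** matrix_inv A ** Z\<close>.\<close>

definition kron_form :: "real^('p::finite)^'p \<Rightarrow> real^'p uprod \<Rightarrow> real" where
  "kron_form A v = (dup *v v) \<bullet> (kron (matrix_inv A) (matrix_inv A) *v (dup *v v))"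

text \<open>The integrand of \<open>V_mat X Y\<close> is \<open>l2\<close> times the Kronecker
  square of an inverse taken on the segment from \<open>Y\<close> to \<open>X\<close>, which stays
  in the convex set \<open>K\<close>. Bounds valid on \<open>K\<close> pass through the integral,
  and \<open>1 / 2\<close> is the integral of \<open>l2\<close>.\<close>

lemma V_mat_sandwich:
  fixes X Y :: "real^('p::finite)^'p"
  assumes K: "convex K" "X \<in> K" "Y \<in> K" and inv: "\<And>A. A \<in> K \<Longrightarrow> invertible A"
    and lo: "\<And>A. A \<in> K \<Longrightarrow> lo \<le> kron_form A v" and hi: "\<And>A. A \<in> K \<Longrightarrow> kron_form A v \<le> hi"
  shows "lo / 2 \<le> v \<bullet> (V_mat X Y *v v)" "v \<bullet> (V_mat X Y *v v) \<le> hi / 2"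
proof -
  define P where "P l1 l2 = Y + (l1 * l2) *\<^sub>R (X - Y)" for l1 l2 :: real
  define G where "G l1 l2 = kron (matrix_inv (P l1 l2)) (matrix_inv (P l1 l2))" for l1 l2
  have PK: "P l1 l2 \<in> K" if "l1 \<in> {0..1}" "l2 \<in> {0..1}" for l1 l2
  proof -
    have "l1 * l2 \<le> 1" using that by (simp add: mult_le_one)
    then have "(1 - l1 * l2) *\<^sub>R Y + (l1 * l2) *\<^sub>R X \<in> K"
      using K that by (intro convexD) auto
    then show ?thesis by (simp add: P_def algebra_simps)
  qed
  have cG: "continuous_on ({0..1} \<times> {0..1}) (\<lambda>(l2, l1). l2 *\<^sub>R G l1 l2)"
    unfolding G_def split_beta
    by (intro continuous_intros continuous_on_matrix_inv) (auto simp: P_def intro!: continuous_intros inv PK[unfolded P_def])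
  define I where "I l2 = integral {0..1} (\<lambda>l1. l2 *\<^sub>R G l1 l2)" for l2
  have cI: "continuous_on {0..1} I"
    unfolding I_def using integral_continuous_on_param[of "{0..1}" 0 1 "\<lambda>l2 l1. l2 *\<^sub>R G l1 l2"] cG by simp
  define L where "L A = (dup *v v) \<bullet> (A *v (dup *v v))" for A :: "real^('p \<times> 'p)^('p \<times> 'p)"
  have bL: "bounded_linear L" unfolding L_def
    by (intro bounded_linear_inner_right_comp bounded_bilinear.bounded_linear_left bounded_bilinear_matrix_vector_mult)
  have V: "v \<bullet> (V_mat X Y *v v) = L (integral {0..1} I)"
    unfolding V_mat_def I_def G_def P_def L_def
    by (simp only: matrix_vector_mul_assoc[symmetric] inner_matrix_transpose[of v "transpose dup"] transpose_transpose)
  also have "\<dots> = integral {0..1} (\<lambda>l2. L (I l2))"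
    using integral_linear[OF integrable_continuous_real[OF cI] bL] by (simp add: o_def)
  finally have VL: "v \<bullet> (V_mat X Y *v v) = integral {0..1} (\<lambda>l2. L (I l2))" .
  have LI: "l2 * lo \<le> L (I l2) \<and> L (I l2) \<le> l2 * hi" if l2: "l2 \<in> {0..1}" for l2
  proof -
    have c: "continuous_on {0..1} (\<lambda>l1. l2 *\<^sub>R G l1 l2)"
    proof -
      have "continuous_on {0..1} (\<lambda>l1::real. (l2, l1))"
        by (intro continuous_on_Pair continuous_on_const continuous_on_id)
      moreover have "(\<lambda>l1. (l2, l1)) ` {0..1} \<subseteq> {0..1} \<times> {0..1::real}" using l2 by auto
      ultimately have "continuous_on {0..1} (\<lambda>l1. case (l2, l1) of (l2, l1) \<Rightarrow> l2 *\<^sub>R G l1 l2)"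
        by (rule continuous_on_compose2[OF cG])
      then show ?thesis by (simp only: prod.case)
    qed
    have e: "L (I l2) = integral {0..1} (\<lambda>l1. l2 * kron_form (P l1 l2) v)"
    proof -
      have "L (I l2) = integral {0..1} (L \<circ> (\<lambda>l1. l2 *\<^sub>R G l1 l2))"
        unfolding I_def by (rule integral_linear[OF integrable_continuous_real[OF c] bL, symmetric])
      also have "L \<circ> (\<lambda>l1. l2 *\<^sub>R G l1 l2) = (\<lambda>l1. l2 * kron_form (P l1 l2) v)"
        by (rule ext) (simp add: L_def kron_form_def G_def scaleR_matrix_vector_assoc[symmetric])
      finally show ?thesis .
    qed
    have i: "(\<lambda>l1. l2 * kron_form (P l1 l2) v) integrable_on {0..1}"
    proof -
      have "continuous_on {0..1} (\<lambda>l1. L (l2 *\<^sub>R G l1 l2))"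
        by (rule bounded_linear.continuous_on[OF bL c])
      moreover have "(\<lambda>l1. L (l2 *\<^sub>R G l1 l2)) = (\<lambda>l1. l2 * kron_form (P l1 l2) v)"
        by (rule ext) (simp add: L_def kron_form_def G_def scaleR_matrix_vector_assoc[symmetric])
      ultimately have "continuous_on {0..1} (\<lambda>l1. l2 * kron_form (P l1 l2) v)" by (simp only:)
      then show ?thesis by (rule integrable_continuous_real)
    qed
    have "integral {0..1} (\<lambda>l1::real. l2 * lo) \<le> integral {0..1} (\<lambda>l1. l2 * kron_form (P l1 l2) v)"
      using l2 by (intro integral_le i) (auto intro!: mult_left_mono lo PK)
    moreover have "integral {0..1} (\<lambda>l1. l2 * kron_form (P l1 l2) v) \<le> integral {0..1} (\<lambda>l1::real. l2 * hi)"
      using l2 by (intro integral_le i) (auto intro!: mult_left_mono hi PK)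
    ultimately show ?thesis unfolding e by simp
  qed
  have iL: "(\<lambda>l2. L (I l2)) integrable_on {0..1}"
    by (intro integrable_continuous_real bounded_linear.continuous_on[OF bL cI])
  have il: "((\<lambda>l2::real. l2 * c) has_integral c / 2) {0..1}" for c :: real
    using has_integral_mult_left[OF ident_has_integral[of 0 "1::real"], of c] by simp
  show "lo / 2 \<le> v \<bullet> (V_mat X Y *v v)"
    unfolding VL by (rule has_integral_le[OF il integrable_integral[OF iL]]) (use LI in auto)
  show "v \<bullet> (V_mat X Y *v v) \<le> hi / 2"
    unfolding VL by (rule has_integral_le[OF integrable_integral[OF iL] il]) (use LI in auto)
qed

lemma kron_form_V0: "v \<bullet> (V0_mat S *v v) = kron_form S v / 2"
  unfolding V0_mat_def kron_form_def
  by (simp only: matrix_vector_mul_assoc[symmetric] scaleR_matrix_vector_assoc[symmetric] inner_scaleR_right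
     inner_matrix_transpose[of v "transpose dup"] transpose_transpose)

lemma quadratic_scaling_bounds:
  fixes q :: "real^'n \<Rightarrow> real"
  assumes s: "\<And>c x. q (c *\<^sub>R x) = c\<^sup>2 * q x" and b: "\<And>x. norm x = 1 \<Longrightarrow> a \<le> q x \<and> q x \<le> b"
  shows "a * (norm x)\<^sup>2 \<le> q x" "q x \<le> b * (norm x)\<^sup>2"
proof -
  have "a * (norm x)\<^sup>2 \<le> q x \<and> q x \<le> b * (norm x)\<^sup>2"
  proof (cases "x = 0")
    case True then show ?thesis using s[of 0 x] by simp
  next
    case False
    have e: "q x = (norm x)\<^sup>2 * q ((1 / norm x) *\<^sub>R x)" using s[of "norm x" "(1 / norm x) *\<^sub>R x"] False by simp
    have "a \<le> q ((1 / norm x) *\<^sub>R x) \<and> q ((1 / norm x) *\<^sub>R x) \<le> b" by (rule b) (use False in simp)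
    then show ?thesis unfolding e by (auto simp: mult.commute[of _ "(norm x)\<^sup>2"] intro!: mult_left_mono)
  qed
  then show "a * (norm x)\<^sup>2 \<le> q x" "q x \<le> b * (norm x)\<^sup>2" by blast+
qed

text \<open>By homogeneity only unit vectors matter, and the product of \<open>K\<close> with the
  sphere is compact.\<close>

lemma compact_quadratic_bounds:
  fixes q :: "'a::metric_space \<Rightarrow> real^'n \<Rightarrow> real"
  assumes K: "compact K" and c: "continuous_on (K \<times> sphere 0 1) (\<lambda>(A, x). q A x)"
    and pos: "\<And>A x. A \<in> K \<Longrightarrow> x \<noteq> 0 \<Longrightarrow> q A x > 0"
    and s: "\<And>A c x. q A (c *\<^sub>R x) = c\<^sup>2 * q A x"
  obtains a b where "a > 0" "b > 0" "\<And>A x. A \<in> K \<Longrightarrow> a * (norm x)\<^sup>2 \<le> q A x" "\<And>A x. A \<in> K \<Longrightarrow> q A x \<le> b * (norm x)\<^sup>2"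
proof (cases "K = {}")
  case True then show ?thesis using that[of 1 1] by simp
next
  case False
  let ?D = "K \<times> sphere (0::real^'n) 1"
  have cD: "compact ?D" by (intro compact_Times K compact_sphere)
  have "axis undefined 1 \<in> sphere (0::real^'n) 1" by (simp add: norm_axis_1)
  then have ne: "?D \<noteq> {}" using False by blast
  obtain p where p: "p \<in> ?D" "\<forall>z\<in>?D. (\<lambda>(A, x). q A x) p \<le> (\<lambda>(A, x). q A x) z"
    using continuous_attains_inf[OF cD ne c] by blast
  obtain r where r: "r \<in> ?D" "\<forall>z\<in>?D. (\<lambda>(A, x). q A x) z \<le> (\<lambda>(A, x). q A x) r"
    using continuous_attains_sup[OF cD ne c] by blast
  define a where "a = (\<lambda>(A, x). q A x) p"
  define b where "b = (\<lambda>(A, x). q A x) r"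
  have a: "a > 0" using p(1) unfolding a_def by (cases p) (auto intro!: pos)
  have b: "b > 0" using r(1) unfolding b_def by (cases r) (auto intro!: pos)
  have ab: "a \<le> q A x \<and> q A x \<le> b" if "A \<in> K" "norm x = 1" for A x
    using p(2) r(2) that unfolding a_def b_def by (auto dest!: bspec[of _ _ "(A, x)"])
  show ?thesis
    by (rule that[OF a b]) (use quadratic_scaling_bounds[of "q _", OF s ab] in blast)+
qed

lemma quadratic_form_scaleR: "(c *\<^sub>R x) \<bullet> ((A::real^'n^'n) *v (c *\<^sub>R x)) = c\<^sup>2 * (x \<bullet> (A *v x))"
  by (simp add: matrix_vector_mult_scaleR power2_eq_square)

text \<open>The constants have to be uniform over all \<open>S\<close>, since at this stage the
  estimator is not known to be near the true parameter. All \<open>S\<close> and all admissible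
  \<open>Q\<close> are placed in one convex compact set of positive definite matrices, on which
  \<open>kron_form\<close> is bounded from both sides.\<close>

lemma V_mat_bounds:
  fixes \<S> :: "(real^('p::finite)^'p) set"
  assumes S: "compact \<S>" and pd: "\<And>S. S \<in> \<S> \<Longrightarrow> pos_def S" and S0: "S0 \<in> \<S>"
  obtains c C d where "c > 0" "C > 0" "d > 0"
    "\<And>Q. transpose Q = Q \<Longrightarrow> norm (Q - S0) < d \<Longrightarrow> pos_def Q"
    "\<And>Q S v. transpose Q = Q \<Longrightarrow> norm (Q - S0) < d \<Longrightarrow> S \<in> \<S> \<Longrightarrow> c * (norm v)\<^sup>2 \<le> v \<bullet> (V_mat Q S *v v)"
    "\<And>Q S v. transpose Q = Q \<Longrightarrow> norm (Q - S0) < d \<Longrightarrow> S \<in> \<S> \<Longrightarrow> v \<bullet> (V_mat Q S *v v) \<le> C * (norm v)\<^sup>2"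
proof -
  have cq: "continuous_on (\<S> \<times> sphere 0 1) (\<lambda>(A, x). x \<bullet> (A *v x))"
    unfolding split_beta by (intro continuous_intros)
  have posq: "\<And>A x. A \<in> \<S> \<Longrightarrow> x \<noteq> 0 \<Longrightarrow> x \<bullet> (A *v x) > 0" using pd by (auto simp: pos_def_def)
  obtain a b where ab: "a > 0" "b > 0" "\<And>A x. A \<in> \<S> \<Longrightarrow> a * (norm x)\<^sup>2 \<le> x \<bullet> (A *v x)" "\<And>A x. A \<in> \<S> \<Longrightarrow> x \<bullet> (A *v x) \<le> b * (norm x)\<^sup>2"
    using compact_quadratic_bounds[where q="\<lambda>A x. x \<bullet> (A *v x)", OF S cq posq quadratic_form_scaleR] by metis
  obtain K where K: "K > 0" "\<And>(A::real^'p^'p) x y. \<bar>x \<bullet> (A *v y)\<bar> \<le> K * norm A * norm x * norm y"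
    using matrix_quadratic_bound by blast
  obtain R0 where R0: "\<And>A. A \<in> \<S> \<Longrightarrow> norm A \<le> R0" using compact_imp_bounded[OF S] unfolding bounded_iff by blast
  \<comment> \<open>A perturbation of norm below \<open>d\<close> changes the form
    \<open>x \<bullet> (S0 *v x)\<close> by at most \<open>(a / 2) * (norm x)\<^sup>2\<close>, half
    of its lower bound.\<close>
  define d where "d = a / (2 * K)"
  have d: "d > 0" using ab K by (simp add: d_def)
  \<comment> \<open>The lower bound \<open>a / 2\<close> is a family of closed linear inequalities
    in \<open>A\<close>: it makes the set convex and closed and keeps it away from singular
    matrices. The ball makes it compact.\<close>
  define \<K> where "\<K> = {A::real^'p^'p. transpose A = A} \<inter> {A. \<forall>x. (a / 2) * (norm x)\<^sup>2 \<le> x \<bullet> (A *v x)} \<inter> cball 0 (R0 + d)"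
  have pdK: "pos_def A" if "A \<in> \<K>" for A
  proof -
    have "x \<bullet> (A *v x) > 0" if "x \<noteq> 0" for x
    proof -
      have "0 < (a / 2) * (norm x)\<^sup>2" using ab(1) that by simp
      also have "\<dots> \<le> x \<bullet> (A *v x)" using \<open>A \<in> \<K>\<close> by (simp add: \<K>_def)
      finally show ?thesis .
    qed
    then show ?thesis using that by (simp add: pos_def_def \<K>_def)
  qed
  have SK: "S \<in> \<K>" if "S \<in> \<S>" for S
  proof -
    have "(a / 2) * (norm x)\<^sup>2 \<le> x \<bullet> (S *v x)" for x
    proof -
      have "(a / 2) * (norm x)\<^sup>2 \<le> a * (norm x)\<^sup>2" by (rule mult_right_mono) (use ab(1) in auto)
      with ab(3)[OF that, of x] show ?thesis by (rule order_trans[rotated])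
    qed
    then show ?thesis using pd[OF that] R0[OF that] d by (simp add: \<K>_def pos_def_def)
  qed
  have QK: "Q \<in> \<K>" if "transpose Q = Q" "norm (Q - S0) < d" for Q
  proof -
    have "(a / 2) * (norm x)\<^sup>2 \<le> x \<bullet> (Q *v x)" for x
    proof -
      have "\<bar>x \<bullet> ((Q - S0) *v x)\<bar> \<le> K * norm (Q - S0) * norm x * norm x" by (rule K(2))
      also have "\<dots> \<le> K * d * norm x * norm x" using that K(1) by (intro mult_right_mono mult_left_mono) auto
      also have "\<dots> = (a / 2) * (norm x)\<^sup>2" using K(1) by (simp add: d_def power2_eq_square)
      finally have "\<bar>x \<bullet> ((Q - S0) *v x)\<bar> \<le> (a / 2) * (norm x)\<^sup>2" .
      moreover have "x \<bullet> (Q *v x) = x \<bullet> (S0 *v x) + x \<bullet> ((Q - S0) *v x)"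
        by (simp add: matrix_vector_mult_diff_rdistrib inner_diff_right)
      ultimately show ?thesis using ab(3)[OF S0, of x] by (simp add: abs_le_iff)
    qed
    moreover have "norm Q \<le> R0 + d"
      using norm_triangle_sub[of Q S0] R0[OF S0] that by linarith
    ultimately show ?thesis using that by (simp add: \<K>_def)
  qed
  have convK: "convex \<K>"
  proof -
    have "convex {A::real^'p^'p. transpose A = A}"
      by (rule convexI) (simp add: transpose_def vec_eq_iff)
    moreover have "convex {A::real^'p^'p. \<forall>x. (a / 2) * (norm x)\<^sup>2 \<le> x \<bullet> (A *v x)}"
    proof (rule convexI, clarify)
      fix A B :: "real^'p^'p" and u v :: real and x :: "real^'p"
      assume AB: "\<forall>x. (a / 2) * (norm x)\<^sup>2 \<le> x \<bullet> (A *v x)" "\<forall>x. (a / 2) * (norm x)\<^sup>2 \<le> x \<bullet> (B *v x)"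
        and uv: "0 \<le> u" "0 \<le> v" "u + v = 1"
      have "(a / 2) * (norm x)\<^sup>2 = u * ((a / 2) * (norm x)\<^sup>2) + v * ((a / 2) * (norm x)\<^sup>2)"
        using uv by (simp add: distrib_right[symmetric])
      also have "\<dots> \<le> u * (x \<bullet> (A *v x)) + v * (x \<bullet> (B *v x))"
        using AB uv by (intro add_mono mult_left_mono) auto
      finally show "(a / 2) * (norm x)\<^sup>2 \<le> x \<bullet> ((u *\<^sub>R A + v *\<^sub>R B) *v x)"
        by (simp add: matrix_vector_mult_add_rdistrib inner_add_right scaleR_matrix_vector_assoc[symmetric])
    qed
    ultimately show ?thesis unfolding \<K>_def by (intro convex_Int convex_cball)
  qed
  have compK: "compact \<K>"
  proof -
    have "closed {A::real^'p^'p. transpose A = A}"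
      unfolding transpose_def by (intro closed_Collect_eq continuous_intros)
    moreover have "closed {A::real^'p^'p. \<forall>x. (a / 2) * (norm x)\<^sup>2 \<le> x \<bullet> (A *v x)}"
      by (intro closed_Collect_all closed_Collect_le continuous_intros)
    ultimately show ?thesis unfolding \<K>_def by (intro closed_Int_compact closed_Int compact_cball)
  qed
  have invK: "invertible A" if "A \<in> \<K>" for A by (rule pos_def_invertible[OF pdK[OF that]])
  have ck: "continuous_on (\<K> \<times> sphere 0 1) (\<lambda>(A, v). kron_form A v)"
    unfolding kron_form_def split_beta
    by (intro continuous_intros) (auto intro: invK)
  have posk: "kron_form A v > 0" if "A \<in> \<K>" "v \<noteq> 0" for A v
    unfolding kron_form_def using that dup_injective by (intro kron_pos pos_def_matrix_inv pdK) auto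
  have sk: "kron_form A (c *\<^sub>R v) = c\<^sup>2 * kron_form A v" for A c v
    unfolding kron_form_def by (simp add: matrix_vector_mult_scaleR power2_eq_square)
  obtain e f where ef: "e > 0" "f > 0" "\<And>A v. A \<in> \<K> \<Longrightarrow> e * (norm v)\<^sup>2 \<le> kron_form A v" "\<And>A v. A \<in> \<K> \<Longrightarrow> kron_form A v \<le> f * (norm v)\<^sup>2"
    using compact_quadratic_bounds[where q=kron_form, OF compK ck posk sk] by metis
  show ?thesis
  proof (rule that[of "e / 2" "f / 2" d])
    show "pos_def Q" if "transpose Q = Q" "norm (Q - S0) < d" for Q by (rule pdK[OF QK[OF that]])
    fix Q S v assume Q: "transpose Q = Q" "norm (Q - S0) < d" and S: "S \<in> \<S>"
    note sw = V_mat_sandwich[OF convK QK[OF Q] SK[OF S] invK ef(3) ef(4), of v]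
    show "e / 2 * (norm v)\<^sup>2 \<le> v \<bullet> (V_mat Q S *v v)" using sw(1) by simp
    show "v \<bullet> (V_mat Q S *v v) \<le> f / 2 * (norm v)\<^sup>2" using sw(2) by simp
  qed (use ef d in auto)
qed

text \<open>Near \<open>S0\<close> the whole segment from \<open>S\<close> to \<open>Q\<close> lies
  in a small ball, where \<open>kron_form\<close> is uniformly close to its value at
  \<open>S0\<close>; \<open>V_mat_sandwich\<close> transfers this to \<open>V_mat\<close>.\<close>

lemma V_mat_continuity:
  fixes S0 :: "real^('p::finite)^'p"
  assumes S0: "pos_def S0" and e: "e > 0"
  obtains d where "d > 0"
    "\<And>Q S v. norm (Q - S0) < d \<Longrightarrow> norm (S - S0) < d \<Longrightarrow>
       \<bar>v \<bullet> (V_mat Q S *v v) - v \<bullet> (V0_mat S0 *v v)\<bar> \<le> e * (norm v)\<^sup>2"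
proof -
  let ?U = "{A::real^'p^'p. det A \<noteq> 0}"
  let ?k = "\<lambda>A::real^'p^'p. kron (matrix_inv A) (matrix_inv A)"
  have U: "open ?U"
    by (intro open_Collect_neq continuous_intros)
  have S0U: "S0 \<in> ?U" using pos_def_invertible[OF S0] invertible_det_nz by auto
  have ck: "continuous_on ?U ?k"
    by (intro continuous_intros) (auto simp: invertible_det_nz)
  obtain K where K: "K > 0" "\<And>(A::real^('p \<times> 'p)^('p \<times> 'p)) x y. \<bar>x \<bullet> (A *v y)\<bar> \<le> K * norm A * norm x * norm y"
    using matrix_quadratic_bound by blast
  obtain B where B: "B > 0" "\<And>v. norm ((dup :: real^('p uprod)^('p \<times> 'p)) *v v) \<le> B * norm v"
    using linear_bounded_pos[OF matrix_vector_mul_linear] by blast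
  \<comment> \<open>\<open>B\<close> bounds \<open>dup\<close> and \<open>K\<close> the bilinear
    form, so an error \<open>e'\<close> in the Kronecker square becomes
    \<open>K * e' * B\<^sup>2 = e\<close>.\<close>
  define e' where "e' = e / (K * B\<^sup>2)"
  have e': "e' > 0" using e K B by (simp add: e'_def)
  have "continuous (at S0) ?k" using ck U S0U by (simp add: continuous_on_eq_continuous_at)
  then obtain d1 where d1: "d1 > 0" "\<And>A. dist A S0 < d1 \<Longrightarrow> dist (?k A) (?k S0) < e'"
    using e' unfolding continuous_at_eps_delta by blast
  obtain d2 where d2: "d2 > 0" "ball S0 d2 \<subseteq> ?U" using U S0U open_contains_ball by blast
  define d where "d = min d1 d2"
  let ?\<K> = "ball S0 d"
  have inv: "invertible A" if "A \<in> ?\<K>" for A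
    using d2 that by (auto simp: d_def invertible_det_nz subset_eq)
  have kf: "\<bar>kron_form A v - kron_form S0 v\<bar> \<le> e * (norm v)\<^sup>2" if "A \<in> ?\<K>" for A v
  proof -
    have n: "norm (?k A - ?k S0) \<le> e'" using d1(2)[of A] that by (simp add: d_def dist_norm norm_minus_commute)
    have "kron_form A v - kron_form S0 v = (dup *v v) \<bullet> ((?k A - ?k S0) *v (dup *v v))"
      by (simp add: kron_form_def matrix_vector_mult_diff_rdistrib inner_diff_right)
    also have "\<bar>\<dots>\<bar> \<le> K * norm (?k A - ?k S0) * norm (dup *v v) * norm (dup *v v)" by (rule K(2))
    also have "\<dots> \<le> K * e' * (B * norm v) * (B * norm v)"
      using K B n e' by (intro mult_mono B(2)) auto
    also have "\<dots> = e * (norm v)\<^sup>2" using K B by (simp add: e'_def power2_eq_square)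
    finally show ?thesis .
  qed
  show ?thesis
  proof (rule that[of d])
    show "d > 0" using d1 d2 by (simp add: d_def)
    fix Q S v assume "norm (Q - S0) < d" "norm (S - S0) < d"
    then have QS: "Q \<in> ?\<K>" "S \<in> ?\<K>" by (simp_all add: dist_norm norm_minus_commute)
    have lo: "kron_form S0 v - e * (norm v)\<^sup>2 \<le> kron_form A v" and hi: "kron_form A v \<le> kron_form S0 v + e * (norm v)\<^sup>2"
      if "A \<in> ?\<K>" for A using kf[OF that, of v] by (auto simp: abs_le_iff)
    have "0 \<le> e * (norm v)\<^sup>2" using e by simp
    with V_mat_sandwich[OF convex_ball QS inv lo hi]
    show "\<bar>v \<bullet> (V_mat Q S *v v) - v \<bullet> (V0_mat S0 *v v)\<bar> \<le> e * (norm v)\<^sup>2"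
      unfolding kron_form_V0 by (auto simp: abs_le_iff field_simps)
  qed
qed

subsection \<open>Perturbation of minimizers\<close>

text \<open>The minimizer of the quadratic form \<open>V0\<close> at \<open>x - \<Delta> \<delta>\<close> is \<open>\<delta> = J x\<close>, and by Pythagoras the
  excess at any other \<open>\<delta>\<close> is the form at \<open>\<Delta> (\<delta> - J x)\<close>. A relative error \<open>o(|x|\<^sup>2)\<close> in the
  objective therefore moves the minimizer by \<open>o(|x|)\<close> only, so first derivatives suffice.\<close>

lemma weighted_least_squares:
  fixes \<Delta> :: "real^'q^'m" and V0 :: "real^'m^'m"
  assumes V0: "pos_def V0" and inj: "inj ((*v) \<Delta>)"
  defines "G \<equiv> transpose \<Delta> ** V0 ** \<Delta>"
  defines "J \<equiv> matrix_inv G ** transpose \<Delta> ** V0"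
  shows "pos_def G"
    and "(x - \<Delta> *v d) \<bullet> (V0 *v (x - \<Delta> *v d)) =
      (x - \<Delta> *v (J *v x)) \<bullet> (V0 *v (x - \<Delta> *v (J *v x))) + (\<Delta> *v (d - J *v x)) \<bullet> (V0 *v (\<Delta> *v (d - J *v x)))"
    and "J ** matrix_inv V0 ** transpose J = matrix_inv G"
proof -
  have tV: "transpose V0 = V0" and pV: "\<And>x. x \<noteq> 0 \<Longrightarrow> x \<bullet> (V0 *v x) > 0" using V0 by (auto simp: pos_def_def)
  have Gq: "x \<bullet> (G *v y) = (\<Delta> *v x) \<bullet> (V0 *v (\<Delta> *v y))" for x y
    unfolding G_def by (simp only: matrix_vector_mul_assoc[symmetric] inner_matrix_transpose[of x "transpose \<Delta>"] transpose_transpose)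
  show pG: "pos_def G" unfolding pos_def_def
  proof (intro conjI allI impI)
    show "transpose G = G" unfolding G_def by (simp only: matrix_transpose_mul tV transpose_transpose matrix_mul_assoc)
    fix x :: "real^'q" assume "x \<noteq> 0"
    then have "\<Delta> *v x \<noteq> 0" using inj by (metis injD matrix_vector_mult_0_right)
    then show "x \<bullet> (G *v x) > 0" unfolding Gq by (rule pV)
  qed
  have iG: "invertible G" by (rule pos_def_invertible[OF pG])
  have GJ: "G *v (J *v x) = transpose \<Delta> *v (V0 *v x)" for x
  proof -
    have "G *v (J *v x) = (G ** matrix_inv G) *v (transpose \<Delta> *v (V0 *v x))"
      unfolding J_def by (simp only: matrix_vector_mul_assoc[symmetric])
    then show ?thesis by (simp only: invertible_matrix_inv[OF iG] matrix_vector_mul_lid)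
  qed
  let ?r = "x - \<Delta> *v (J *v x)" and ?e = "d - J *v x"
  \<comment> \<open>By the normal equations \<open>GJ\<close> the residual \<open>?r\<close> is
    orthogonal to the range of \<open>\<Delta>\<close> for the inner product given by
    \<open>V0\<close>, so the mixed terms vanish.\<close>
  have "(\<Delta> *v ?e) \<bullet> (V0 *v ?r) = ?e \<bullet> (transpose \<Delta> *v (V0 *v ?r))"
    by (simp only: inner_matrix_transpose[of ?e "transpose \<Delta>"] transpose_transpose)
  also have "transpose \<Delta> *v (V0 *v ?r) = transpose \<Delta> *v (V0 *v x) - G *v (J *v x)"
    unfolding G_def by (simp only: matrix_vector_mult_diff_distrib matrix_vector_mul_assoc[symmetric])
  finally have o1: "(\<Delta> *v ?e) \<bullet> (V0 *v ?r) = 0" by (simp only: GJ) simp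
  then have o2: "?r \<bullet> (V0 *v (\<Delta> *v ?e)) = 0" by (metis V0 pos_def_inner_sym)
  define rr ee where "rr = ?r" and "ee = \<Delta> *v ?e"
  have "x - \<Delta> *v d = rr - ee" by (simp add: rr_def ee_def matrix_vector_mult_diff_distrib)
  then have "(x - \<Delta> *v d) \<bullet> (V0 *v (x - \<Delta> *v d)) = rr \<bullet> (V0 *v rr) + ee \<bullet> (V0 *v ee)"
    using o1 o2 unfolding rr_def[symmetric] ee_def[symmetric]
    by (simp add: matrix_vector_mult_diff_distrib inner_diff_left inner_diff_right)
  then show "(x - \<Delta> *v d) \<bullet> (V0 *v (x - \<Delta> *v d)) = ?r \<bullet> (V0 *v ?r) + (\<Delta> *v ?e) \<bullet> (V0 *v (\<Delta> *v ?e))"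
    unfolding rr_def ee_def .
  have iV: "invertible V0" by (rule pos_def_invertible[OF V0])
  have tiG: "transpose (matrix_inv G) = matrix_inv G" using pos_def_matrix_inv[OF pG] by (simp add: pos_def_def)
  have tJ: "transpose J = V0 ** \<Delta> ** matrix_inv G"
    unfolding J_def by (simp only: matrix_transpose_mul tV tiG transpose_transpose matrix_mul_assoc)
  \<comment> \<open>The weight is the inverse of the covariance \<open>matrix_inv V0\<close> that is
    propagated, so the sandwich collapses to a single inverse.\<close>
  have "J ** matrix_inv V0 ** transpose J = matrix_inv G ** transpose \<Delta> ** (V0 ** matrix_inv V0) ** V0 ** \<Delta> ** matrix_inv G"
    unfolding tJ unfolding J_def by (simp only: matrix_mul_assoc)
  also have "\<dots> = matrix_inv G ** G ** matrix_inv G"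
    unfolding invertible_matrix_inv[OF iV] matrix_mul_rid G_def by (simp only: matrix_mul_assoc)
  also have "\<dots> = matrix_inv G" by (simp add: invertible_matrix_inv[OF iG])
  finally show "J ** matrix_inv V0 ** transpose J = matrix_inv G" .
qed

lemma le_mult_mono_trans: "a \<le> c * b \<Longrightarrow> b \<le> d \<Longrightarrow> 0 \<le> c \<Longrightarrow> a \<le> c * (d::real)"
  by (meson mult_left_mono order_trans)

lemma quadratic_form_diff:
  fixes V :: "real^'m^'m"
  assumes V: "pos_def V" and B: "\<And>x y. \<bar>x \<bullet> (V *v y)\<bar> \<le> B * norm x * norm y"
  shows "\<bar>a \<bullet> (V *v a) - b \<bullet> (V *v b)\<bar> \<le> B * norm (a - b) * (norm a + norm b)"
proof -
  have "a \<bullet> (V *v a) - b \<bullet> (V *v b) = (a - b) \<bullet> (V *v a) + (a - b) \<bullet> (V *v b)"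
    using pos_def_inner_sym[OF V, of a b] by (simp add: inner_diff_left)
  also have "\<bar>\<dots>\<bar> \<le> B * norm (a - b) * norm a + B * norm (a - b) * norm b"
    by (rule order_trans[OF abs_triangle_ineq add_mono[OF B B]])
  finally show ?thesis by (simp add: distrib_left)
qed

text \<open>\<open>A\<close> and \<open>A'\<close> are the weights at \<open>\<theta>\<close> and at
  the competitor \<open>\<theta>0 + J *v x\<close>. They differ because the weight depends on the
  parameter, but both are within \<open>\<epsilon>\<close> of \<open>V0\<close>. The rate
  \<open>R\<close> makes all residuals of order \<open>norm x\<close>, so every error is a small
  multiple of \<open>(norm x)\<^sup>2\<close>.\<close>

lemma quadratic_minimizer_expansion:
  fixes f :: "real^'q \<Rightarrow> real^'m" and \<Delta> :: "real^'q^'m" and V0 :: "real^'m^'m"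
  assumes V0: "pos_def V0" and inj: "inj ((*v) \<Delta>)"
    and f: "(f has_derivative ((*v) \<Delta>)) (at \<theta>0)" and R: "R \<ge> 0" and e: "e > 0"
  defines "J \<equiv> matrix_inv (transpose \<Delta> ** V0 ** \<Delta>) ** transpose \<Delta> ** V0"
  obtains \<epsilon> r where "\<epsilon> > 0" "r > 0"
    "\<And>x A A' \<theta>. norm x < r \<Longrightarrow> norm (\<theta> - \<theta>0) < r \<Longrightarrow> norm (f \<theta> - f \<theta>0) \<le> R * norm x \<Longrightarrow>
       (\<And>v. \<bar>v \<bullet> (A *v v) - v \<bullet> (V0 *v v)\<bar> \<le> \<epsilon> * (norm v)\<^sup>2) \<Longrightarrow>
       (\<And>v. \<bar>v \<bullet> (A' *v v) - v \<bullet> (V0 *v v)\<bar> \<le> \<epsilon> * (norm v)\<^sup>2) \<Longrightarrow>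
       (x - (f \<theta> - f \<theta>0)) \<bullet> (A *v (x - (f \<theta> - f \<theta>0))) \<le>
         (x - (f (\<theta>0 + J *v x) - f \<theta>0)) \<bullet> (A' *v (x - (f (\<theta>0 + J *v x) - f \<theta>0))) \<Longrightarrow>
       norm (\<theta> - \<theta>0 - J *v x) \<le> e * norm x"
proof -
  note wls = weighted_least_squares[OF V0 inj, folded J_def]
  obtain B1 where B1: "B1 > 0" "\<And>v. norm (\<Delta> *v v) \<le> B1 * norm v"
    using linear_bounded_pos[OF matrix_vector_mul_linear[of \<Delta>]] by blast
  obtain BJ where BJ: "BJ > 0" "\<And>v. norm (J *v v) \<le> BJ * norm v"
    using linear_bounded_pos[OF matrix_vector_mul_linear[of J]] by blast
  obtain k where k: "k > 0" "\<And>v. k * norm v \<le> norm (\<Delta> *v v)"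
    using linear_inj_bounded_below_pos[OF matrix_vector_mul_linear[of \<Delta>]] inj by (metis)
  obtain K where K: "K > 0" "\<And>(A::real^'m^'m) x y. \<bar>x \<bullet> (A *v y)\<bar> \<le> K * norm A * norm x * norm y"
    using matrix_quadratic_bound by blast
  define BV where "BV = K * norm V0 + 1"
  have BV: "BV > 0" using K by (simp add: BV_def add_nonneg_pos)
  have BV2: "\<bar>x \<bullet> (V0 *v y)\<bar> \<le> BV * norm x * norm y" for x y
  proof -
    have "K * norm V0 * (norm x * norm y) \<le> BV * (norm x * norm y)"
      unfolding BV_def by (intro mult_right_mono) auto
    with K(2)[of x V0 y] show ?thesis by (simp add: mult.assoc)
  qed
  note qd = quadratic_form_diff[OF V0 BV2]
  have cq: "continuous_on ({V0} \<times> sphere 0 1) (\<lambda>(A, x). x \<bullet> (A *v x))"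
    unfolding split_beta by (intro continuous_intros)
  obtain c0 b where c0: "c0 > 0" "\<And>A x. A \<in> {V0} \<Longrightarrow> c0 * (norm x)\<^sup>2 \<le> x \<bullet> (A *v x)"
    using compact_quadratic_bounds[where q="\<lambda>A x. x \<bullet> (A *v x)", OF compact_sing cq _ quadratic_form_scaleR] V0
    unfolding pos_def_def by (metis singletonD)
  \<comment> \<open>From \<open>k * norm d \<le> norm (\<Delta> *v d) \<le> R * norm x + (k / 2) *
    norm d\<close> for \<open>d = \<theta> - \<theta>0\<close>; this is the reason for the bound
    \<open>k / 2\<close> on \<open>\<eta>\<close>.\<close>
  define D where "D = 2 * R / k"
  have D: "D \<ge> 0" using R k by (simp add: D_def)
  \<comment> \<open>A common bound, per unit of \<open>norm x\<close>, for the four residuals below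
    and for \<open>norm d\<close> and \<open>norm (J *v x)\<close>.\<close>
  define H where "H = 1 + R + B1 * D + B1 * BJ + k * BJ + D + BJ"
  have H: "H > 0" "1 + R \<le> H" "1 + B1 * D \<le> H" "1 + B1 * BJ \<le> H" "1 + B1 * BJ + k * BJ \<le> H" "D \<le> H" "BJ \<le> H"
    using R B1 BJ k D by (auto simp: H_def add_pos_nonneg)
  \<comment> \<open>The two weight errors and the two linearization errors add up to at most
    \<open>c0 * k\<^sup>2 * e\<^sup>2 * (norm x)\<^sup>2 / 2\<close> each.\<close>
  define \<epsilon> where "\<epsilon> = c0 * k\<^sup>2 * e\<^sup>2 / (4 * H\<^sup>2)"
  define \<eta> where "\<eta> = min (k / 2) (c0 * k\<^sup>2 * e\<^sup>2 / (8 * BV * H\<^sup>2))"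
  have \<epsilon>: "\<epsilon> > 0" and \<eta>: "\<eta> > 0" "\<eta> \<le> k / 2" "\<eta> \<le> c0 * k\<^sup>2 * e\<^sup>2 / (8 * BV * H\<^sup>2)"
    using c0 k e H BV by (auto simp: \<epsilon>_def \<eta>_def)
  obtain r' where r': "r' > 0" "\<And>y. norm (y - \<theta>0) < r' \<Longrightarrow> norm (f y - f \<theta>0 - \<Delta> *v (y - \<theta>0)) \<le> \<eta> * norm (y - \<theta>0)"
    using f \<eta>(1) unfolding has_derivative_at_alt by blast
  \<comment> \<open>The entry \<open>r' / BJ\<close> keeps \<open>J *v x\<close> inside the range
    \<open>r'\<close> of the linearization.\<close>
  define r where "r = min r' (r' / BJ)"
  show ?thesis
  proof (rule that[of \<epsilon> r])
    show "\<epsilon> > 0" by fact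
    show "r > 0" using r' BJ by (simp add: r_def)
    fix x :: "real^'m" and A A' :: "real^'m^'m" and \<theta>
    assume x: "norm x < r" and t: "norm (\<theta> - \<theta>0) < r" and Rx: "norm (f \<theta> - f \<theta>0) \<le> R * norm x"
      and A: "\<And>v. \<bar>v \<bullet> (A *v v) - v \<bullet> (V0 *v v)\<bar> \<le> \<epsilon> * (norm v)\<^sup>2"
      and A': "\<And>v. \<bar>v \<bullet> (A' *v v) - v \<bullet> (V0 *v v)\<bar> \<le> \<epsilon> * (norm v)\<^sup>2"
      and le: "(x - (f \<theta> - f \<theta>0)) \<bullet> (A *v (x - (f \<theta> - f \<theta>0))) \<le>
         (x - (f (\<theta>0 + J *v x) - f \<theta>0)) \<bullet> (A' *v (x - (f (\<theta>0 + J *v x) - f \<theta>0)))"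
    define d where "d = \<theta> - \<theta>0"
    define s where "s = f \<theta> - f \<theta>0"
    define s' where "s' = f (\<theta>0 + J *v x) - f \<theta>0"
    let ?n = "norm x"
    have sd: "norm (s - \<Delta> *v d) \<le> \<eta> * norm d" unfolding s_def d_def by (rule r') (use t in \<open>simp add: r_def\<close>)
    have Jx: "norm (J *v x) < r'"
    proof -
      have "norm (J *v x) \<le> BJ * norm x" by (rule BJ)
      also have "\<dots> < BJ * (r' / BJ)" using x BJ by (intro mult_strict_left_mono) (auto simp: r_def)
      finally show ?thesis using BJ by simp
    qed
    have sd': "norm (s' - \<Delta> *v (J *v x)) \<le> \<eta> * (BJ * ?n)"
    proof -
      have "norm (s' - \<Delta> *v (J *v x)) \<le> \<eta> * norm (J *v x)"
        using r'(2)[of "\<theta>0 + J *v x"] Jx unfolding s'_def by simp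
      also have "\<dots> \<le> \<eta> * (BJ * ?n)" using \<eta> BJ by (intro mult_left_mono BJ) auto
      finally show ?thesis .
    qed
    have dD: "norm d \<le> D * ?n"
    proof -
      have "k * norm d \<le> norm (\<Delta> *v d)" by (rule k)
      also have "\<dots> \<le> norm s + norm (s - \<Delta> *v d)" by (metis norm_minus_commute norm_triangle_sub add.commute)
      also have "\<dots> \<le> R * ?n + (k / 2) * norm d"
        using Rx sd mult_right_mono[OF \<eta>(2), of "norm d"] by (simp add: s_def)
      finally have "k * norm d \<le> 2 * (R * ?n)" by simp
      then show ?thesis using k by (simp add: D_def field_simps)
    qed
    have sd2: "norm (s - \<Delta> *v d) \<le> \<eta> * (D * ?n)"
      by (rule le_mult_mono_trans[OF sd dD]) (use \<eta> in simp)
    let ?u = "x - s" and ?w = "x - \<Delta> *v d" and ?u' = "x - s'" and ?w' = "x - \<Delta> *v (J *v x)"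
    have up: "a * ?n \<le> H * ?n" if "a \<le> H" for a using that by (intro mult_right_mono) auto
    have nu: "norm ?u \<le> H * ?n"
      using norm_triangle_ineq4[of x s] Rx up[OF H(2)] by (simp add: s_def algebra_simps)
    have nw: "norm ?w \<le> H * ?n"
    proof -
      have "norm (\<Delta> *v d) \<le> B1 * (D * ?n)" by (rule le_mult_mono_trans[OF B1(2) dD]) (use B1(1) in simp)
      then show ?thesis using norm_triangle_ineq4[of x "\<Delta> *v d"] up[OF H(3)] by (simp add: algebra_simps)
    qed
    have nDJ: "norm (\<Delta> *v (J *v x)) \<le> B1 * (BJ * ?n)"
      by (rule le_mult_mono_trans[OF B1(2) BJ(2)]) (use B1(1) in simp)
    have nw': "norm ?w' \<le> H * ?n"
      using norm_triangle_ineq4[of x "\<Delta> *v (J *v x)"] nDJ up[OF H(4)] by (simp add: algebra_simps)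
    have nu': "norm ?u' \<le> H * ?n"
    proof -
      have "?u' = ?w' - (s' - \<Delta> *v (J *v x))" by simp
      then have "norm ?u' \<le> norm ?w' + norm (s' - \<Delta> *v (J *v x))" by (metis norm_triangle_ineq4)
      moreover have "\<eta> * (BJ * ?n) \<le> k * (BJ * ?n)" using \<eta> k BJ by (intro mult_right_mono) auto
      ultimately show ?thesis
        using norm_triangle_ineq4[of x "\<Delta> *v (J *v x)"] nDJ sd' up[OF H(5)] by (simp add: algebra_simps)
    qed
    have nuw: "norm (?u - ?w) \<le> \<eta> * (H * ?n)" 
    proof -
      have "norm (?u - ?w) = norm (s - \<Delta> *v d)" by (simp add: norm_minus_commute)
      also have "\<dots> \<le> \<eta> * (H * ?n)" by (rule le_mult_mono_trans[OF sd2 up[OF H(6)]]) (use \<eta> in simp)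
      finally show ?thesis .
    qed
    have nuw': "norm (?u' - ?w') \<le> \<eta> * (H * ?n)" 
    proof -
      have "norm (?u' - ?w') = norm (s' - \<Delta> *v (J *v x))" by (simp add: norm_minus_commute)
      also have "\<dots> \<le> \<eta> * (H * ?n)" by (rule le_mult_mono_trans[OF sd' up[OF H(7)]]) (use \<eta> in simp)
      finally show ?thesis .
    qed
    define q where "q v = v \<bullet> (V0 *v v)" for v
    have qdd: "\<bar>q a - q b\<bar> \<le> 2 * BV * \<eta> * H\<^sup>2 * ?n\<^sup>2"
      if "norm (a - b) \<le> \<eta> * (H * ?n)" "norm a \<le> H * ?n" "norm b \<le> H * ?n" for a b
    proof -
      have "\<bar>q a - q b\<bar> \<le> BV * norm (a - b) * (norm a + norm b)" unfolding q_def by (rule qd)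
      also have "\<dots> \<le> BV * (\<eta> * (H * ?n)) * (H * ?n + H * ?n)"
        using that BV \<eta> H by (intro mult_mono add_mono) auto
      also have "\<dots> = 2 * BV * \<eta> * H\<^sup>2 * ?n\<^sup>2" by (simp add: power2_eq_square)
      finally show ?thesis .
    qed
    have eps: "\<epsilon> * (norm v)\<^sup>2 \<le> \<epsilon> * H\<^sup>2 * ?n\<^sup>2" if "norm v \<le> H * ?n" for v :: "real^'m"
    proof -
      have "(norm v)\<^sup>2 \<le> (H * ?n)\<^sup>2" using that by (intro power_mono) auto
      then show ?thesis using \<epsilon> by (simp add: power_mult_distrib)
    qed
    \<comment> \<open>The chain leads from the linearized form at \<open>d\<close> to the true
      objective at \<open>\<theta>\<close>, by minimality to the objective at the competitor, and
      back to the linearized form at \<open>J *v x\<close>.\<close>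
    have "q ?w \<le> q ?u + 2 * BV * \<eta> * H\<^sup>2 * ?n\<^sup>2" using qdd[OF nuw nu nw] by linarith
    moreover have "q ?u \<le> ?u \<bullet> (A *v ?u) + \<epsilon> * H\<^sup>2 * ?n\<^sup>2"
      using A[of ?u] eps[OF nu] unfolding q_def by linarith
    moreover have "?u \<bullet> (A *v ?u) \<le> ?u' \<bullet> (A' *v ?u')" using le unfolding s_def s'_def .
    moreover have "?u' \<bullet> (A' *v ?u') \<le> q ?u' + \<epsilon> * H\<^sup>2 * ?n\<^sup>2"
      using A'[of ?u'] eps[OF nu'] unfolding q_def by linarith
    moreover have "q ?u' \<le> q ?w' + 2 * BV * \<eta> * H\<^sup>2 * ?n\<^sup>2" using qdd[OF nuw' nu' nw'] by linarith
    moreover have "q ?w = q ?w' + q (\<Delta> *v (d - J *v x))" unfolding q_def by (rule wls(2))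
    ultimately have m: "q (\<Delta> *v (d - J *v x)) \<le> 2 * (\<epsilon> * H\<^sup>2 * ?n\<^sup>2) + 2 * (2 * BV * \<eta> * H\<^sup>2 * ?n\<^sup>2)" by linarith
    have "2 * (\<epsilon> * H\<^sup>2 * ?n\<^sup>2) = c0 * k\<^sup>2 * e\<^sup>2 * ?n\<^sup>2 / 2" using H by (simp add: \<epsilon>_def)
    moreover have "2 * (2 * BV * \<eta> * H\<^sup>2 * ?n\<^sup>2) \<le> c0 * k\<^sup>2 * e\<^sup>2 * ?n\<^sup>2 / 2"
    proof -
      have "2 * (2 * BV * \<eta> * H\<^sup>2 * ?n\<^sup>2) = (4 * BV * H\<^sup>2 * ?n\<^sup>2) * \<eta>" by simp
      also have "\<dots> \<le> (4 * BV * H\<^sup>2 * ?n\<^sup>2) * (c0 * k\<^sup>2 * e\<^sup>2 / (8 * BV * H\<^sup>2))"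
        using BV by (intro mult_left_mono \<eta>) auto
      also have "\<dots> = c0 * k\<^sup>2 * e\<^sup>2 * ?n\<^sup>2 / 2" using BV H by (simp add: field_simps)
      finally show ?thesis .
    qed
    ultimately have "q (\<Delta> *v (d - J *v x)) \<le> c0 * k\<^sup>2 * e\<^sup>2 * ?n\<^sup>2" using m by linarith
    moreover have "c0 * (k * norm (d - J *v x))\<^sup>2 \<le> q (\<Delta> *v (d - J *v x))"
    proof -
      have "c0 * (k * norm (d - J *v x))\<^sup>2 \<le> c0 * (norm (\<Delta> *v (d - J *v x)))\<^sup>2"
        using c0(1) k by (intro mult_left_mono power_mono) auto
      also have "\<dots> \<le> q (\<Delta> *v (d - J *v x))" unfolding q_def by (rule c0(2)) simp
      finally show ?thesis .
    qed
    ultimately have "c0 * (k * norm (d - J *v x))\<^sup>2 \<le> c0 * (k * (e * ?n))\<^sup>2"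
      by (simp add: power_mult_distrib mult_ac)
    then have "(k * norm (d - J *v x))\<^sup>2 \<le> (k * (e * ?n))\<^sup>2" by (simp only: mult_le_cancel_left_pos[OF c0(1)])
    then have "k * norm (d - J *v x) \<le> k * (e * ?n)" by (rule power2_le_imp_le) (use k(1) e in simp)
    then have "norm (d - J *v x) \<le> e * ?n" by (simp only: mult_le_cancel_left_pos[OF k(1)])
    then show "norm (\<theta> - \<theta>0 - J *v x) \<le> e * norm x" by (simp add: d_def)
  qed
qed

section \<open>The contrast and its minimizers for a fixed matrix near the truth\<close>

lemma linear_vech: "linear (vech :: real^('p::finite)^'p \<Rightarrow> _)"
  by (rule linearI) (auto simp: vech_def vec_eq_iff Let_def split: prod.splits)

lemma pos_def_sym: "pos_def A \<Longrightarrow> transpose A = A"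
  by (simp add: pos_def_def)

lemma vech_eq_imp_eq:
  assumes "transpose A = A" "transpose B = B" "vech A = vech B" shows "A = B"
proof -
  have "vec_of A = vec_of B" by (simp only: dup_vech assms)
  then have "vec_of A $ (j, i) = vec_of B $ (j, i)" for i j by simp
  then show ?thesis by (simp add: vec_of_def vec_eq_iff)
qed

text \<open>For \<open>Q\<close> near \<open>\<Sigma> \<theta>0\<close> the contrast lies between
  \<open>c\<close> and \<open>C\<close> times the squared distance of the half-vectorizations. A
  parameter that does at least as well as \<open>\<theta>0\<close> is then at distance at most
  \<open>sqrt (C / c)\<close> times that of \<open>\<theta>0\<close>, and the triangle inequality
  adds 1 to the constant.\<close>

lemma contrast_minimizer_rate:
  fixes \<Sigma> :: "real^'q \<Rightarrow> real^('p::finite)^'p"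
  assumes \<Theta>: "compact \<Theta>" "\<theta>0 \<in> \<Theta>" and c\<Sigma>: "continuous_on \<Theta> \<Sigma>" and pd: "\<And>\<theta>. \<theta> \<in> \<Theta> \<Longrightarrow> pos_def (\<Sigma> \<theta>)"
  obtains R d where "R \<ge> 0" "d > 0"
    "\<And>Q. transpose Q = Q \<Longrightarrow> norm (Q - \<Sigma> \<theta>0) < d \<Longrightarrow> pos_def Q"
    "\<And>Q \<theta>. transpose Q = Q \<Longrightarrow> norm (Q - \<Sigma> \<theta>0) < d \<Longrightarrow> \<theta> \<in> \<Theta> \<Longrightarrow> contrast Q (\<Sigma> \<theta>) \<ge> 0"
    "\<And>Q \<theta>. transpose Q = Q \<Longrightarrow> norm (Q - \<Sigma> \<theta>0) < d \<Longrightarrow> \<theta> \<in> \<Theta> \<Longrightarrow> contrast Q (\<Sigma> \<theta>) \<le> contrast Q (\<Sigma> \<theta>0) \<Longrightarrow>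
       norm (vech (\<Sigma> \<theta>) - vech (\<Sigma> \<theta>0)) \<le> R * norm (vech Q - vech (\<Sigma> \<theta>0))"
proof -
  have S: "compact (\<Sigma> ` \<Theta>)" by (intro compact_continuous_image c\<Sigma> \<Theta>)
  obtain c C d where V: "c > 0" "C > 0" "d > 0"
    "\<And>Q. transpose Q = Q \<Longrightarrow> norm (Q - \<Sigma> \<theta>0) < d \<Longrightarrow> pos_def Q"
    "\<And>Q S v. transpose Q = Q \<Longrightarrow> norm (Q - \<Sigma> \<theta>0) < d \<Longrightarrow> S \<in> \<Sigma> ` \<Theta> \<Longrightarrow> c * (norm v)\<^sup>2 \<le> v \<bullet> (V_mat Q S *v v)"
    "\<And>Q S v. transpose Q = Q \<Longrightarrow> norm (Q - \<Sigma> \<theta>0) < d \<Longrightarrow> S \<in> \<Sigma> ` \<Theta> \<Longrightarrow> v \<bullet> (V_mat Q S *v v) \<le> C * (norm v)\<^sup>2"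
    using V_mat_bounds[OF S, of "\<Sigma> \<theta>0"] pd \<Theta>(2) by blast
  have con: "contrast Q S = (vech Q - vech S) \<bullet> (V_mat Q S *v (vech Q - vech S))" if "transpose Q = Q" "norm (Q - \<Sigma> \<theta>0) < d" for Q S
    using pos_def_invertible[OF V(4)[OF that]] by (simp add: contrast_def V_tilde_def)
  show ?thesis
  proof (rule that[of "1 + sqrt (C / c)" d])
    show "0 \<le> 1 + sqrt (C / c)" using V(1,2) by simp
    show "d > 0" by fact
    show "pos_def Q" if "transpose Q = Q" "norm (Q - \<Sigma> \<theta>0) < d" for Q by (rule V(4)[OF that])
    fix Q \<theta> assume Q: "transpose Q = Q" "norm (Q - \<Sigma> \<theta>0) < d" and t: "\<theta> \<in> \<Theta>"
    have lo: "c * (norm (vech Q - vech (\<Sigma> \<theta>)))\<^sup>2 \<le> contrast Q (\<Sigma> \<theta>)"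
      unfolding con[OF Q] by (rule V(5)[OF Q]) (use t in simp)
    have "0 \<le> c * (norm (vech Q - vech (\<Sigma> \<theta>)))\<^sup>2" using V(1,2) by simp
    with lo show "contrast Q (\<Sigma> \<theta>) \<ge> 0" by linarith
    assume le: "contrast Q (\<Sigma> \<theta>) \<le> contrast Q (\<Sigma> \<theta>0)"
    have hi: "contrast Q (\<Sigma> \<theta>0) \<le> C * (norm (vech Q - vech (\<Sigma> \<theta>0)))\<^sup>2"
      unfolding con[OF Q] by (rule V(6)[OF Q]) (use \<Theta> in simp)
    let ?x = "norm (vech Q - vech (\<Sigma> \<theta>0))"
    have "c * (norm (vech Q - vech (\<Sigma> \<theta>)))\<^sup>2 \<le> C * ?x\<^sup>2" using lo hi le by linarith
    then have "(norm (vech Q - vech (\<Sigma> \<theta>)))\<^sup>2 \<le> (sqrt (C / c) * ?x)\<^sup>2"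
    proof -
      have "(sqrt (C / c) * ?x)\<^sup>2 = C * ?x\<^sup>2 / c"
        using V(1,2) by (simp add: power_mult_distrib)
      moreover have "(norm (vech Q - vech (\<Sigma> \<theta>)))\<^sup>2 \<le> C * ?x\<^sup>2 / c"
        using \<open>c * _ \<le> C * _\<close> by (simp only: pos_le_divide_eq[OF V(1)] mult.commute[of c])
      ultimately show ?thesis by (simp only:)
    qed
    then have "norm (vech Q - vech (\<Sigma> \<theta>)) \<le> sqrt (C / c) * ?x"
      by (rule power2_le_imp_le) (use V(1,2) in simp)
    moreover have "norm (vech (\<Sigma> \<theta>) - vech (\<Sigma> \<theta>0)) \<le> norm (vech Q - vech (\<Sigma> \<theta>)) + ?x"
      using norm_triangle_ineq4[of "vech Q - vech (\<Sigma> \<theta>0)" "vech Q - vech (\<Sigma> \<theta>)"] by simp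
    ultimately show "norm (vech (\<Sigma> \<theta>) - vech (\<Sigma> \<theta>0)) \<le> (1 + sqrt (C / c)) * ?x"
      by (simp add: algebra_simps)
  qed
qed

text \<open>Outside a ball around \<open>\<theta>0\<close> the continuous distance \<open>?g\<close>
  has a positive minimum on the compact parameter set, by identifiability; the rate bound forces
  \<open>?g \<theta>\<close> below it once \<open>Q\<close> is close enough.\<close>

lemma contrast_minimizer_consistent:
  fixes \<Sigma> :: "real^'q \<Rightarrow> real^('p::finite)^'p"
  assumes \<Theta>: "compact \<Theta>" "\<theta>0 \<in> \<Theta>" and c\<Sigma>: "continuous_on \<Theta> \<Sigma>" and pd: "\<And>\<theta>. \<theta> \<in> \<Theta> \<Longrightarrow> pos_def (\<Sigma> \<theta>)"
    and inj: "inj_on \<Sigma> \<Theta>" and e: "e > 0"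
  obtains d where "d > 0"
    "\<And>Q \<theta>. transpose Q = Q \<Longrightarrow> norm (Q - \<Sigma> \<theta>0) < d \<Longrightarrow> \<theta> \<in> \<Theta> \<Longrightarrow> contrast Q (\<Sigma> \<theta>) \<le> contrast Q (\<Sigma> \<theta>0) \<Longrightarrow>
       norm (\<theta> - \<theta>0) < e"
proof -
  obtain R d where Rd: "R \<ge> 0" "d > 0"
    "\<And>Q. transpose Q = Q \<Longrightarrow> norm (Q - \<Sigma> \<theta>0) < d \<Longrightarrow> pos_def Q"
    "\<And>Q \<theta>. transpose Q = Q \<Longrightarrow> norm (Q - \<Sigma> \<theta>0) < d \<Longrightarrow> \<theta> \<in> \<Theta> \<Longrightarrow> contrast Q (\<Sigma> \<theta>) \<ge> 0"
    "\<And>Q \<theta>. transpose Q = Q \<Longrightarrow> norm (Q - \<Sigma> \<theta>0) < d \<Longrightarrow> \<theta> \<in> \<Theta> \<Longrightarrow> contrast Q (\<Sigma> \<theta>) \<le> contrast Q (\<Sigma> \<theta>0) \<Longrightarrow>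
       norm (vech (\<Sigma> \<theta>) - vech (\<Sigma> \<theta>0)) \<le> R * norm (vech Q - vech (\<Sigma> \<theta>0))"
    using contrast_minimizer_rate[OF \<Theta> c\<Sigma> pd] by blast
  let ?g = "\<lambda>\<theta>. norm (vech (\<Sigma> \<theta>) - vech (\<Sigma> \<theta>0))"
  obtain m where m: "m > 0" "\<And>\<theta>. \<theta> \<in> \<Theta> \<Longrightarrow> ?g \<theta> < m \<Longrightarrow> norm (\<theta> - \<theta>0) < e"
  proof (cases "\<Theta> - ball \<theta>0 e = {}")
    case True
    then have "norm (\<theta> - \<theta>0) < e" if "\<theta> \<in> \<Theta>" for \<theta> using that by (auto simp: dist_norm norm_minus_commute)
    then show ?thesis using that[of 1] by simp
  next
    case False
    have cg: "continuous_on (\<Theta> - ball \<theta>0 e) ?g"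
      by (intro continuous_intros linear_continuous_on_compose[OF _ linear_vech] continuous_on_subset[OF c\<Sigma>]) auto
    have "compact (\<Theta> - ball \<theta>0 e)" by (intro compact_diff \<Theta> open_ball)
    from continuous_attains_inf[OF this False cg] obtain p where
      p: "p \<in> \<Theta> - ball \<theta>0 e" "\<And>\<theta>. \<theta> \<in> \<Theta> - ball \<theta>0 e \<Longrightarrow> ?g p \<le> ?g \<theta>" by blast
    have "?g p > 0"
    proof (rule ccontr)
      assume "\<not> ?g p > 0"
      then have veq: "vech (\<Sigma> p) = vech (\<Sigma> \<theta>0)" by simp
      have pT: "p \<in> \<Theta>" using p(1) by simp
      have "\<Sigma> p = \<Sigma> \<theta>0"
        by (rule vech_eq_imp_eq[OF pos_def_sym[OF pd[OF pT]] pos_def_sym[OF pd[OF \<Theta>(2)]] veq])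
      then have "p = \<theta>0" using inj p(1) \<Theta> by (auto dest: inj_onD)
      then show False using p(1) e by simp
    qed
    moreover have "norm (\<theta> - \<theta>0) < e" if "\<theta> \<in> \<Theta>" "?g \<theta> < ?g p" for \<theta>
    proof (rule ccontr)
      assume "\<not> norm (\<theta> - \<theta>0) < e"
      then have "\<theta> \<in> \<Theta> - ball \<theta>0 e" using that(1) by (simp add: dist_norm norm_minus_commute)
      from p(2)[OF this] that(2) show False by linarith
    qed
    ultimately show ?thesis using that by blast
  qed
  obtain B where B: "B > 0" "\<And>A. norm (vech A :: real^'p uprod) \<le> B * norm A"
    using linear_bounded_pos[OF linear_vech] by blast
  \<comment> \<open>The radius is built with \<open>R + 1\<close> since \<open>R\<close> may be
    0.\<close>
  show ?thesis
  proof (rule that[of "min d (m / (B * (R + 1)))"])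
    show "0 < min d (m / (B * (R + 1)))" using Rd m B by simp
    fix Q \<theta> assume Q: "transpose Q = Q" "norm (Q - \<Sigma> \<theta>0) < min d (m / (B * (R + 1)))" and t: "\<theta> \<in> \<Theta>"
      and le: "contrast Q (\<Sigma> \<theta>) \<le> contrast Q (\<Sigma> \<theta>0)"
    have "?g \<theta> \<le> R * norm (vech Q - vech (\<Sigma> \<theta>0))" using Q by (intro Rd(5) t le) auto
    also have "\<dots> \<le> (R + 1) * norm (vech Q - vech (\<Sigma> \<theta>0))" by (intro mult_right_mono) auto
    also have "vech Q - vech (\<Sigma> \<theta>0) = vech (Q - \<Sigma> \<theta>0)" by (simp add: linear_diff[OF linear_vech])
    also have "(R + 1) * norm (vech (Q - \<Sigma> \<theta>0)) \<le> (R + 1) * (B * norm (Q - \<Sigma> \<theta>0))"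
      using Rd by (intro mult_left_mono B) auto
    also have "\<dots> < m"
    proof -
      have K: "B * (R + 1) > 0" using B(1) Rd(1) by simp
      have "norm (Q - \<Sigma> \<theta>0) < m / (B * (R + 1))" using Q by simp
      then have "norm (Q - \<Sigma> \<theta>0) * (B * (R + 1)) < m" by (simp only: pos_less_divide_eq[OF K])
      then show ?thesis by (simp only: mult_ac)
    qed
    finally show "norm (\<theta> - \<theta>0) < e" by (rule m(2)[OF t])
  qed
qed

text \<open>\<open>Q\<close> is taken so close to \<open>\<Sigma> \<theta>0\<close> that the weights
  \<open>V_mat Q S\<close> at the minimizer and at the competitor are within
  \<open>\<epsilon>\<close> of \<open>V0_mat (\<Sigma> \<theta>0)\<close>, that the minimizer is in
  the range of the linearization, and that the competitor \<open>\<theta>0 + J *v x\<close> stays in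
  \<open>\<Theta>\<close>. The last point rests on \<theta>0 being interior.\<close>

lemma contrast_minimizer_expansion:
  fixes \<Sigma> :: "real^'q \<Rightarrow> real^('p::finite)^'p" and \<Delta> :: "real^'q^('p uprod)"
  assumes \<Theta>: "compact \<Theta>" "\<theta>0 \<in> interior \<Theta>" and c\<Sigma>: "continuous_on \<Theta> \<Sigma>" and pd: "\<And>\<theta>. \<theta> \<in> \<Theta> \<Longrightarrow> pos_def (\<Sigma> \<theta>)"
    and inj: "inj_on \<Sigma> \<Theta>" and D: "((\<lambda>\<theta>. vech (\<Sigma> \<theta>)) has_derivative ((*v) \<Delta>)) (at \<theta>0)"
    and injD: "inj ((*v) \<Delta>)" and e: "e > 0"
  defines "J \<equiv> matrix_inv (transpose \<Delta> ** V0_mat (\<Sigma> \<theta>0) ** \<Delta>) ** transpose \<Delta> ** V0_mat (\<Sigma> \<theta>0)"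
  obtains d where "d > 0"
    "\<And>Q \<theta>. transpose Q = Q \<Longrightarrow> norm (Q - \<Sigma> \<theta>0) < d \<Longrightarrow> \<theta> \<in> \<Theta> \<Longrightarrow>
       (\<And>\<theta>'. \<theta>' \<in> \<Theta> \<Longrightarrow> contrast Q (\<Sigma> \<theta>) \<le> contrast Q (\<Sigma> \<theta>')) \<Longrightarrow>
       norm (\<theta> - \<theta>0 - J *v (vech Q - vech (\<Sigma> \<theta>0))) \<le> e * norm (vech Q - vech (\<Sigma> \<theta>0))"
proof -
  have t0: "\<theta>0 \<in> \<Theta>" using \<Theta>(2) interior_subset by blast
  have pd0: "pos_def (\<Sigma> \<theta>0)" by (rule pd[OF t0])
  obtain R d1 where Rd: "R \<ge> 0" "d1 > 0"
    "\<And>Q. transpose Q = Q \<Longrightarrow> norm (Q - \<Sigma> \<theta>0) < d1 \<Longrightarrow> pos_def Q"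
    "\<And>Q \<theta>. transpose Q = Q \<Longrightarrow> norm (Q - \<Sigma> \<theta>0) < d1 \<Longrightarrow> \<theta> \<in> \<Theta> \<Longrightarrow> contrast Q (\<Sigma> \<theta>) \<ge> 0"
    "\<And>Q \<theta>. transpose Q = Q \<Longrightarrow> norm (Q - \<Sigma> \<theta>0) < d1 \<Longrightarrow> \<theta> \<in> \<Theta> \<Longrightarrow> contrast Q (\<Sigma> \<theta>) \<le> contrast Q (\<Sigma> \<theta>0) \<Longrightarrow>
       norm (vech (\<Sigma> \<theta>) - vech (\<Sigma> \<theta>0)) \<le> R * norm (vech Q - vech (\<Sigma> \<theta>0))"
    using contrast_minimizer_rate[OF \<Theta>(1) t0 c\<Sigma> pd] by blast
  show ?thesis
  proof (rule quadratic_minimizer_expansion[OF pos_def_V0_mat[OF pd0] injD D Rd(1) e, folded J_def])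
  fix \<epsilon> r assume er: "\<epsilon> > 0" "r > 0"
    "\<And>x A A' \<theta>. norm x < r \<Longrightarrow> norm (\<theta> - \<theta>0) < r \<Longrightarrow> norm (vech (\<Sigma> \<theta>) - vech (\<Sigma> \<theta>0)) \<le> R * norm x \<Longrightarrow>
       (\<And>v. \<bar>v \<bullet> (A *v v) - v \<bullet> (V0_mat (\<Sigma> \<theta>0) *v v)\<bar> \<le> \<epsilon> * (norm v)\<^sup>2) \<Longrightarrow>
       (\<And>v. \<bar>v \<bullet> (A' *v v) - v \<bullet> (V0_mat (\<Sigma> \<theta>0) *v v)\<bar> \<le> \<epsilon> * (norm v)\<^sup>2) \<Longrightarrow>
       (x - (vech (\<Sigma> \<theta>) - vech (\<Sigma> \<theta>0))) \<bullet> (A *v (x - (vech (\<Sigma> \<theta>) - vech (\<Sigma> \<theta>0)))) \<le>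
         (x - (vech (\<Sigma> (\<theta>0 + J *v x)) - vech (\<Sigma> \<theta>0))) \<bullet> (A' *v (x - (vech (\<Sigma> (\<theta>0 + J *v x)) - vech (\<Sigma> \<theta>0)))) \<Longrightarrow>
       norm (\<theta> - \<theta>0 - J *v x) \<le> e * norm x"
  obtain d2 where d2: "d2 > 0" "\<And>Q S v. norm (Q - \<Sigma> \<theta>0) < d2 \<Longrightarrow> norm (S - \<Sigma> \<theta>0) < d2 \<Longrightarrow>
       \<bar>v \<bullet> (V_mat Q S *v v) - v \<bullet> (V0_mat (\<Sigma> \<theta>0) *v v)\<bar> \<le> \<epsilon> * (norm v)\<^sup>2"
    using V_mat_continuity[OF pd0 er(1)] by blast
  obtain d3 where d3: "d3 > 0" "\<And>\<theta>. \<theta> \<in> \<Theta> \<Longrightarrow> norm (\<theta> - \<theta>0) < d3 \<Longrightarrow> norm (\<Sigma> \<theta> - \<Sigma> \<theta>0) < d2"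
    using c\<Sigma>[unfolded continuous_on_iff dist_norm, rule_format, OF t0 d2(1)] by blast
  obtain d4 where d4: "d4 > 0" "ball \<theta>0 d4 \<subseteq> \<Theta>" using \<Theta>(2) mem_interior by blast
  \<comment> \<open>\<open>r\<close> is the range of the linearization, \<open>d3\<close> ensures
    closeness of \<open>\<Sigma> \<theta>\<close> to \<open>\<Sigma> \<theta>0\<close>, and
    \<open>d4\<close> keeps the competitor in \<open>\<Theta>\<close>.\<close>
  define m where "m = Min {r, d3, d4}"
  have m: "m > 0" "m \<le> r" "m \<le> d3" "m \<le> d4" using er d3 d4 by (auto simp: m_def)
  obtain d5 where d5: "d5 > 0"
    "\<And>Q \<theta>. transpose Q = Q \<Longrightarrow> norm (Q - \<Sigma> \<theta>0) < d5 \<Longrightarrow> \<theta> \<in> \<Theta> \<Longrightarrow> contrast Q (\<Sigma> \<theta>) \<le> contrast Q (\<Sigma> \<theta>0) \<Longrightarrow>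
       norm (\<theta> - \<theta>0) < m"
    using contrast_minimizer_consistent[OF \<Theta>(1) t0 c\<Sigma> pd inj m(1)] by blast
  obtain B where B: "B > 0" "\<And>A. norm (vech A :: real^'p uprod) \<le> B * norm A"
    using linear_bounded_pos[OF linear_vech] by blast
  obtain BJ where BJ: "BJ > 0" "\<And>v. norm (J *v v) \<le> BJ * norm v"
    using linear_bounded_pos[OF matrix_vector_mul_linear[of J]] by blast
  define d where "d = Min {d1, d2, d5, r / B, m / (BJ * B)}"
  have d: "d > 0" "d \<le> d1" "d \<le> d2" "d \<le> d5" "d \<le> r / B" "d \<le> m / (BJ * B)"
    using Rd d2 d5 er m B BJ by (auto simp: d_def)
  show ?thesis
  proof (rule that[of d])
    show "d > 0" by fact
    fix Q \<theta> assume Q: "transpose Q = Q" "norm (Q - \<Sigma> \<theta>0) < d" and t: "\<theta> \<in> \<Theta>"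
      and min: "\<And>\<theta>'. \<theta>' \<in> \<Theta> \<Longrightarrow> contrast Q (\<Sigma> \<theta>) \<le> contrast Q (\<Sigma> \<theta>')"
    define x where "x = vech Q - vech (\<Sigma> \<theta>0)"
    have "x = vech (Q - \<Sigma> \<theta>0)" by (simp add: x_def linear_diff[OF linear_vech])
    then have nx: "norm x \<le> B * norm (Q - \<Sigma> \<theta>0)" using B(2) by simp
    have xr: "norm x < r"
    proof -
      have "B * norm (Q - \<Sigma> \<theta>0) < B * (r / B)" using Q(2) d(5) B(1) by (intro mult_strict_left_mono) auto
      also have "\<dots> = r" using B(1) by simp
      finally show ?thesis using nx by linarith
    qed
    have xm: "norm (J *v x) < m"
    proof -
      have "norm (J *v x) \<le> BJ * (B * norm (Q - \<Sigma> \<theta>0))"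
        by (rule le_mult_mono_trans[OF BJ(2) nx]) (use BJ(1) in simp)
      also have "\<dots> < BJ * (B * (m / (BJ * B)))"
        using Q(2) d(6) BJ B by (intro mult_strict_left_mono) auto
      also have "\<dots> = m" using BJ B by simp
      finally show ?thesis .
    qed
    have Q1: "norm (Q - \<Sigma> \<theta>0) < d1" "norm (Q - \<Sigma> \<theta>0) < d2" "norm (Q - \<Sigma> \<theta>0) < d5" using Q(2) d by linarith+
    have tm: "norm (\<theta> - \<theta>0) < m" by (rule d5(2)[OF Q(1) Q1(3) t min[OF t0]])
    let ?t = "\<theta>0 + J *v x"
    have tT: "?t \<in> \<Theta>" using d4(2) xm m by (auto simp: subset_eq dist_norm)
    have con: "contrast Q S = (vech Q - vech S) \<bullet> (V_mat Q S *v (vech Q - vech S))" for S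
      using pos_def_invertible[OF Rd(3)[OF Q(1) Q1(1)]] by (simp add: contrast_def V_tilde_def)
    have xs: "x - (vech S - vech (\<Sigma> \<theta>0)) = vech Q - vech S" for S by (simp add: x_def)
    have "norm (\<theta> - \<theta>0 - J *v x) \<le> e * norm x"
    proof (rule er(3)[OF xr, of \<theta> "V_mat Q (\<Sigma> \<theta>)" "V_mat Q (\<Sigma> ?t)"])
      show "norm (\<theta> - \<theta>0) < r" using tm m by linarith
      show "norm (vech (\<Sigma> \<theta>) - vech (\<Sigma> \<theta>0)) \<le> R * norm x"
        unfolding x_def by (rule Rd(5)[OF Q(1) Q1(1) t min[OF t0]])
      show "\<bar>v \<bullet> (V_mat Q (\<Sigma> \<theta>) *v v) - v \<bullet> (V0_mat (\<Sigma> \<theta>0) *v v)\<bar> \<le> \<epsilon> * (norm v)\<^sup>2" for v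
        by (rule d2(2)[OF Q1(2) d3(2)[OF t]]) (use tm m in linarith)
      show "\<bar>v \<bullet> (V_mat Q (\<Sigma> ?t) *v v) - v \<bullet> (V0_mat (\<Sigma> \<theta>0) *v v)\<bar> \<le> \<epsilon> * (norm v)\<^sup>2" for v
        by (rule d2(2)[OF Q1(2) d3(2)[OF tT]]) (use xm m in simp)
      show "(x - (vech (\<Sigma> \<theta>) - vech (\<Sigma> \<theta>0))) \<bullet> (V_mat Q (\<Sigma> \<theta>) *v (x - (vech (\<Sigma> \<theta>) - vech (\<Sigma> \<theta>0)))) \<le>
         (x - (vech (\<Sigma> ?t) - vech (\<Sigma> \<theta>0))) \<bullet> (V_mat Q (\<Sigma> ?t) *v (x - (vech (\<Sigma> ?t) - vech (\<Sigma> \<theta>0))))"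
        unfolding xs con[symmetric] by (rule min[OF tT])
    qed
    then show "norm (\<theta> - \<theta>0 - J *v (vech Q - vech (\<Sigma> \<theta>0))) \<le> e * norm (vech Q - vech (\<Sigma> \<theta>0))"
      by (simp add: x_def)
  qed
  qed
qed

section \<open>Calculus of bounds in probability\<close>

lemma whp_tight_scale:
  assumes M: "prob_space M" and Z: "\<And>e. e > 0 \<Longrightarrow> whp M (\<lambda>n \<omega>. \<bar>Z n \<omega>\<bar> \<le> e * \<bar>Y n \<omega>\<bar>)" and Y: "tight_seq M Y" and e: "e > 0"
  shows "whp M (\<lambda>n \<omega>. \<bar>Z n \<omega>\<bar> \<le> e)"
  unfolding whp_def
proof (intro allI impI)
  interpret prob_space M by fact
  fix d :: real assume "d > 0"
  then have d: "d / 2 > 0" by simp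
  obtain K where K: "K > 0" "\<forall>\<^sub>F n in sequentially. \<exists>A\<in>sets M. measure M A < d / 2 \<and> (\<forall>\<omega>\<in>space M - A. \<bar>Y n \<omega>\<bar> \<le> K)"
    using Y d unfolding tight_seq_def by blast
  have "\<forall>\<^sub>F n in sequentially. \<exists>A\<in>sets M. measure M A < d / 2 \<and> (\<forall>\<omega>\<in>space M - A. \<bar>Z n \<omega>\<bar> \<le> e / K * \<bar>Y n \<omega>\<bar>)"
    by (rule whpD[OF Z d]) (use e K in simp)
  with K(2) show "\<forall>\<^sub>F n in sequentially. \<exists>A\<in>sets M. measure M A < d \<and> (\<forall>\<omega>\<in>space M - A. \<bar>Z n \<omega>\<bar> \<le> e)"
  proof eventually_elim
    case (elim n)
    then obtain A B where AB: "A \<in> sets M" "B \<in> sets M" "measure M A < d / 2" "measure M B < d / 2"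
      "\<forall>\<omega>\<in>space M - A. \<bar>Y n \<omega>\<bar> \<le> K" "\<forall>\<omega>\<in>space M - B. \<bar>Z n \<omega>\<bar> \<le> e / K * \<bar>Y n \<omega>\<bar>" by blast
    have "measure M (A \<union> B) \<le> measure M A + measure M B" by (rule measure_Un_le) fact+
    moreover have "\<bar>Z n \<omega>\<bar> \<le> e" if w: "\<omega> \<in> space M - (A \<union> B)" for \<omega>
    proof -
      have "\<bar>Z n \<omega>\<bar> \<le> e / K * \<bar>Y n \<omega>\<bar>" using AB(6) w by blast
      also have "\<dots> \<le> e / K * K" using AB(5) w e K(1) by (intro mult_left_mono) auto
      finally show ?thesis using K(1) by simp
    qed
    ultimately show ?case using AB by (intro bexI[of _ "A \<union> B"]) auto
  qed
qed

lemma tight_seq_mono: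
  assumes Y: "tight_seq M Y" and b: "\<And>K. K > 0 \<Longrightarrow> \<exists>K'>0. \<forall>\<^sub>F n in sequentially. \<forall>\<omega>\<in>space M. \<bar>Y n \<omega>\<bar> \<le> K \<longrightarrow> \<bar>Z n \<omega>\<bar> \<le> K'"
  shows "tight_seq M Z"
  unfolding tight_seq_def
proof (intro allI impI)
  fix e :: real assume "e > 0"
  then obtain K where K: "K > 0" "\<forall>\<^sub>F n in sequentially. \<exists>A\<in>sets M. measure M A < e \<and> (\<forall>\<omega>\<in>space M - A. \<bar>Y n \<omega>\<bar> \<le> K)"
    using Y unfolding tight_seq_def by blast
  obtain K' where K': "K' > 0" "\<forall>\<^sub>F n in sequentially. \<forall>\<omega>\<in>space M. \<bar>Y n \<omega>\<bar> \<le> K \<longrightarrow> \<bar>Z n \<omega>\<bar> \<le> K'"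
    using b[OF K(1)] by blast
  from K(2) K'(2) have "\<forall>\<^sub>F n in sequentially. \<exists>A\<in>sets M. measure M A < e \<and> (\<forall>\<omega>\<in>space M - A. \<bar>Z n \<omega>\<bar> \<le> K')"
    by eventually_elim blast
  with K'(1) show "\<exists>K>0. \<forall>\<^sub>F n in sequentially. \<exists>A\<in>sets M. measure M A < e \<and> (\<forall>\<omega>\<in>space M - A. \<bar>Z n \<omega>\<bar> \<le> K)" by blast
qed

lemma tight_seq_add_whp:
  assumes M: "prob_space M" and Y: "tight_seq M Y" and w: "whp M (\<lambda>n \<omega>. \<bar>Z n \<omega>\<bar> \<le> \<bar>Y n \<omega>\<bar> + 1)"
  shows "tight_seq M Z"
  unfolding tight_seq_def
proof (intro allI impI)
  fix e :: real assume "e > 0"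
  then have e: "e / 2 > 0" by simp
  obtain K where K: "K > 0" "\<forall>\<^sub>F n in sequentially. \<exists>A\<in>sets M. measure M A < e / 2 \<and> (\<forall>\<omega>\<in>space M - A. \<bar>Y n \<omega>\<bar> \<le> K)"
    using Y e unfolding tight_seq_def by blast
  from K(2) whpD[OF w e] have "\<forall>\<^sub>F n in sequentially. \<exists>A\<in>sets M. measure M A < e \<and> (\<forall>\<omega>\<in>space M - A. \<bar>Z n \<omega>\<bar> \<le> K + 1)"
  proof eventually_elim
    case (elim n)
    then obtain A B where AB: "A \<in> sets M" "B \<in> sets M" "measure M A < e / 2" "measure M B < e / 2"
      "\<forall>\<omega>\<in>space M - A. \<bar>Y n \<omega>\<bar> \<le> K" "\<forall>\<omega>\<in>space M - B. \<bar>Z n \<omega>\<bar> \<le> \<bar>Y n \<omega>\<bar> + 1" by blast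
    interpret prob_space M by fact
    have "measure M (A \<union> B) \<le> measure M A + measure M B" by (rule measure_Un_le) fact+
    moreover have "\<forall>\<omega>\<in>space M - (A \<union> B). \<bar>Z n \<omega>\<bar> \<le> K + 1"
    proof
      fix \<omega> assume "\<omega> \<in> space M - (A \<union> B)"
      then have "\<bar>Y n \<omega>\<bar> \<le> K" "\<bar>Z n \<omega>\<bar> \<le> \<bar>Y n \<omega>\<bar> + 1" using AB(5,6) by blast+
      then show "\<bar>Z n \<omega>\<bar> \<le> K + 1" by linarith
    qed
    ultimately show ?case using AB(1-4) by (intro bexI[of _ "A \<union> B"]) auto
  qed
  then show "\<exists>K>0. \<forall>\<^sub>F n in sequentially. \<exists>A\<in>sets M. measure M A < e \<and> (\<forall>\<omega>\<in>space M - A. \<bar>Z n \<omega>\<bar> \<le> K)"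
    using K(1) by (intro exI[of _ "K + 1"]) auto
qed

section \<open>Norms of matrices and of their half-vectorizations\<close>

lemma abs_vech_nth_le:
  assumes "\<And>a b. \<bar>A $ a $ b\<bar> \<le> e" shows "\<bar>vech A $ u\<bar> \<le> e"
  using assms by (auto simp: vech_def Let_def split: prod.splits)

lemma norm_vech_le:
  fixes A :: "real^('p::finite)^'p"
  assumes "\<And>a b. \<bar>A $ a $ b\<bar> \<le> e" shows "norm (vech A) \<le> real CARD('p uprod) * e"
proof -
  have "norm (vech A) \<le> (\<Sum>u\<in>UNIV. \<bar>vech A $ u\<bar>)" by (rule norm_le_l1_cart)
  also have "\<dots> \<le> (\<Sum>u\<in>(UNIV :: 'p uprod set). e)" by (intro sum_mono abs_vech_nth_le assms)
  finally show ?thesis by simp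
qed

lemma nth_le_norm_vech:
  assumes "transpose A = A" shows "\<bar>A $ a $ b\<bar> \<le> norm (vech A)"
  using component_le_norm_cart[of "vech A" "Upair a b"] vech_Upair[OF assms, of a b] by simp

lemma norm_le_norm_vech:
  fixes A :: "real^('p::finite)^'p"
  assumes "transpose A = A" shows "norm A \<le> (real CARD('p))\<^sup>2 * norm (vech A)"
proof -
  have "norm (A $ a) \<le> real CARD('p) * norm (vech A)" for a
  proof -
    have "norm (A $ a) \<le> (\<Sum>b\<in>UNIV. \<bar>A $ a $ b\<bar>)" by (rule norm_le_l1_cart)
    also have "\<dots> \<le> (\<Sum>b\<in>(UNIV::'p set). norm (vech A))" by (intro sum_mono nth_le_norm_vech assms)
    finally show ?thesis by simp
  qed
  moreover have "norm A \<le> (\<Sum>a\<in>UNIV. norm (A $ a))"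
    unfolding norm_vec_def[of A] by (rule L2_set_le_sum) simp
  ultimately have "norm A \<le> (\<Sum>a\<in>(UNIV::'p set). real CARD('p) * norm (vech A))"
    by (meson order_trans sum_mono)
  then show ?thesis by (simp add: power2_eq_square)
qed

lemma outer_nth [simp]: "outer x y $ a $ b = x $ a * y $ b"
  by (simp add: outer_def)

subsection \<open>The realized covariance and its minimum contrast estimator\<close>

lemma realized_cov_nth:
  "realized_cov T n x $ a $ b = (1 / T) * (\<Sum>i<n.
     (x (real (Suc i) * (T / real n)) - x (real i * (T / real n))) $ a *
     (x (real (Suc i) * (T / real n)) - x (real i * (T / real n))) $ b)"
  unfolding realized_cov_def Let_def One_nat_def sum.atLeast1_atMost_eq by simp

lemma transpose_realized_cov: "transpose (realized_cov T n x) = realized_cov T n x"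
  by (simp add: transpose_def vec_eq_iff realized_cov_nth mult.commute)

lemma borel_measurable_vec_nth': "f \<in> borel_measurable M \<Longrightarrow> (\<lambda>\<omega>. (f \<omega> :: real^'n) $ i) \<in> borel_measurable M"
  by (rule measurable_compose[of _ _ borel]) (auto intro!: borel_measurable_continuous_onI continuous_intros)

text \<open>\<open>Z n\<close> is the normalized error of the realized covariance of the Gaussian
  part \<open>G\<close>, and the last claim says that the drift does not move it in the limit.
  Convergence is given in two forms: convergence in distribution yields tightness, and the limit of
  the characteristic functions is what linear images of \<open>Z\<close> are computed from.\<close>

lemma realized_cov_clt:
  fixes X :: "real \<Rightarrow> 'w \<Rightarrow> real^('p::finite)" and V :: "nat \<Rightarrow> real \<Rightarrow> 'w \<Rightarrow> real^'p"
  assumes M: "prob_space M" and T: "T > 0" and k: "k > 0"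
    and V: "\<And>j. j < k \<Longrightarrow> gaussian_increments M T (Gs j) (V j) (C j)"
    and ind: "prob_space.indep_sets M Gs {..<k}"
    and S: "S = (\<Sum>j<k. C j)" and pd: "pos_def S"
    and mX: "\<And>t. t \<in> {0..T} \<Longrightarrow> X t \<in> borel_measurable M"
    and dec: "AE \<omega> in M. continuous_on {0..T} (\<lambda>t. \<Sum>j<k. V j t \<omega>) \<and>
      (\<exists>b c. continuous_on {0..T} b \<and> (\<forall>t\<in>{0..T}. X t \<omega> = c + integral {0..t} b + (\<Sum>j<k. V j t \<omega>)))"
  obtains Z where "\<And>n. n > 0 \<Longrightarrow> Z n \<in> borel_measurable M"
    "converges_in_dist M Z (multi_normal 0 (W_mat S))"
    "\<And>t. (\<lambda>n. CLINT \<omega>|M. iexp (t \<bullet> Z n \<omega>)) \<longlonglongrightarrow> exp (- (t \<bullet> (W_mat S *v t)) / 2)"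
    "\<And>e. e > 0 \<Longrightarrow> whp M (\<lambda>n \<omega>. norm (sqrt (real n) *\<^sub>R (vech (realized_cov T n (\<lambda>t. X t \<omega>)) - vech S) - Z n \<omega>) \<le> e)"
proof -
  interpret prob_space M by fact
  define G where "G t \<omega> = (\<Sum>j<k. V j t \<omega>)" for t \<omega>
  define F where "F t \<omega> = X t \<omega> - G t \<omega>" for t \<omega>
  define QG where "QG n \<omega> = realized_cov T n (\<lambda>t. G t \<omega>)" for n \<omega>
  define Z where "Z n \<omega> = sqrt (real n) *\<^sub>R (vech (QG n \<omega>) - vech S)" for n \<omega>
  define h where "h n = T / real n" for n :: nat
  define g where "g n i \<omega> = (1 / sqrt (T / real n)) *\<^sub>R (\<Sum>j<k. V j (real (Suc i) * (T / real n)) \<omega> - V j (real i * (T / real n)) \<omega>)" for n i \<omega>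
  have mV: "V j t \<in> borel_measurable M" if "j < k" "t \<in> {0..T}" for j t
    using V[OF that(1)] that(2) unfolding gaussian_increments_def by blast
  have mG: "G t \<in> borel_measurable M" if "t \<in> {0..T}" for t
    unfolding G_def using mV that by (intro borel_measurable_sum) auto
  have mF: "F t \<in> borel_measurable M" if "t \<in> {0..T}" for t
    unfolding F_def using mX[OF that] mG[OF that] by (rule borel_measurable_diff)
  have grid: "real i * (T / real n) \<in> {0..T}" if "i \<le> n" "n > 0" for i n
    using grid_le[OF T that(2,1)] T by simp
  have tS: "transpose S = S" by (rule pos_def_sym[OF pd])
  have tQ: "transpose (QG n \<omega>) = QG n \<omega>" for n \<omega> unfolding QG_def by (rule transpose_realized_cov)
  \<comment> \<open>The \<open>g n i\<close> are the increments of \<open>G\<close> rescaled to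
    covariance \<open>S\<close>; the factor \<open>1 / T\<close> turns into \<open>1 / n\<close>,
    and \<open>QG\<close> becomes an empirical mean.\<close>
  have QGg: "QG n \<omega> $ a $ b = (1 / real n) * (\<Sum>i<n. g n i \<omega> $ a * g n i \<omega> $ b)" if "n > 0" for n \<omega> a b
  proof -
    have s: "sqrt (T / real n) * sqrt (T / real n) = T / real n" using T by simp
    have eq: "g n i \<omega> $ a * g n i \<omega> $ b = (real n / T) * ((G (real (Suc i) * (T / real n)) \<omega> - G (real i * (T / real n)) \<omega>) $ a *
        (G (real (Suc i) * (T / real n)) \<omega> - G (real i * (T / real n)) \<omega>) $ b)" for i
    proof -
      have "g n i \<omega> = (1 / sqrt (T / real n)) *\<^sub>R (G (real (Suc i) * (T / real n)) \<omega> - G (real i * (T / real n)) \<omega>)"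
        unfolding g_def G_def by (simp only: sum_subtractf)
      then have "g n i \<omega> $ a * g n i \<omega> $ b = (1 / (sqrt (T / real n) * sqrt (T / real n))) * ((G (real (Suc i) * (T / real n)) \<omega> - G (real i * (T / real n)) \<omega>) $ a *
        (G (real (Suc i) * (T / real n)) \<omega> - G (real i * (T / real n)) \<omega>) $ b)"
        by (simp only: vector_scaleR_component real_scaleR_def) simp
      then show ?thesis unfolding s by simp
    qed
    show ?thesis
      unfolding eq sum_distrib_left[symmetric] using that T unfolding QG_def realized_cov_nth by simp
  qed
  have mZ: "Z n \<in> borel_measurable M" if n: "n > 0" for n
  proof -
    have c: "continuous_on UNIV (\<lambda>x :: real^'p. vech (outer x x))"
      unfolding outer_def by (intro linear_continuous_on_compose[OF _ linear_vech] continuous_intros)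
    have "(\<lambda>\<omega>. \<Sum>i<n. vech (outer (G (real (Suc i) * (T / real n)) \<omega> - G (real i * (T / real n)) \<omega>) (G (real (Suc i) * (T / real n)) \<omega> - G (real i * (T / real n)) \<omega>))) \<in> borel_measurable M"
      by (intro borel_measurable_sum measurable_compose[OF _ borel_measurable_continuous_onI[OF c]] borel_measurable_diff mG grid) (use n in auto)
    moreover have "vech (QG n \<omega>) = (1 / T) *\<^sub>R (\<Sum>i<n. vech (outer (G (real (Suc i) * (T / real n)) \<omega> - G (real i * (T / real n)) \<omega>) (G (real (Suc i) * (T / real n)) \<omega> - G (real i * (T / real n)) \<omega>)))" for \<omega>
      unfolding QG_def realized_cov_def Let_def One_nat_def sum.atLeast1_atMost_eq
      by (simp add: linear_cmul[OF linear_vech] linear_sum[OF linear_vech])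
    ultimately show ?thesis unfolding Z_def by (simp add: borel_measurable_scaleR borel_measurable_diff)
  qed
  have ch: "(\<lambda>n. CLINT \<omega>|M. iexp (u \<bullet> Z n \<omega>)) \<longlonglongrightarrow> exp (- (u \<bullet> (W_mat S *v u)) / 2)" for u
  proof -
    \<comment> \<open>With these coefficients \<open>u \<bullet> vech A\<close> is a weighted sum of
      the entries of a symmetric \<open>A\<close>, so \<open>u \<bullet> Z n\<close> is a normalized
      sum of the centred quadratic forms \<open>U (g n i \<omega>) - m\<close>.\<close>
    define c where "c a b = (transpose dup_inv *v u) $ (a, b)" for a b
    have cs: "c a b = c b a" for a b unfolding c_def by (rule transpose_dup_inv_sym)
    define U where "U g = (\<Sum>a\<in>UNIV. \<Sum>b\<in>UNIV. c a b * (g $ a * g $ b))" for g :: "real^'p"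
    define m where "m = (\<Sum>a\<in>UNIV. \<Sum>b\<in>UNIV. c a b * S $ a $ b)"
    note mq = multi_normal_quadratic_form[OF pd, of c, OF cs, folded U_def m_def]
    have s2: "(\<integral>g. (U g - m)\<^sup>2 \<partial>multi_normal 0 S) = u \<bullet> (W_mat S *v u)"
      unfolding mq(4) W_mat_quadratic c_def ..
    have cU: "continuous_on UNIV U" unfolding U_def by (intro continuous_intros)
    have "(\<lambda>n. CLINT \<omega>|M. iexp ((\<Sum>i<n. U (g n i \<omega>) - m) / sqrt (real n))) \<longlonglongrightarrow> exp (- (u \<bullet> (W_mat S *v u)) / 2)"
    proof (rule triangular_array_clt[OF M prob_space_multi_normal[OF pd] sets_multi_normal _ _ cU mq(1,2,3) s2])
      show "indep_vars (\<lambda>_. borel) (g n) {..<n}" if "n > 0" for n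
        unfolding g_def by (rule sum_gaussian_increments(1)[OF M T k V ind that])
      show "(CLINT \<omega>|M. iexp (t \<bullet> g n i \<omega>)) = (CLINT x|multi_normal 0 S. iexp (t \<bullet> x))" if i: "i < n" for n i t
      proof -
        have n: "0 < n" using i by simp
        show ?thesis unfolding char_multi_normal[OF pd] unfolding g_def S
          by (rule sum_gaussian_increments(2)[OF M T k V ind n i])
      qed
    qed
    moreover have "u \<bullet> Z n \<omega> = (\<Sum>i<n. U (g n i \<omega>) - m) / sqrt (real n)" if n: "n > 0" for n \<omega>
    proof -
      have "u \<bullet> vech (QG n \<omega>) = (\<Sum>a\<in>UNIV. \<Sum>b\<in>UNIV. c a b * ((1 / real n) * (\<Sum>i<n. g n i \<omega> $ a * g n i \<omega> $ b)))"
        unfolding vech_inner[OF tQ] c_def QGg[OF n] ..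
      also have "\<dots> = (1 / real n) * (\<Sum>i<n. U (g n i \<omega>))"
      proof -
        have "(\<Sum>i<n. U (g n i \<omega>)) = (\<Sum>a\<in>UNIV. \<Sum>b\<in>UNIV. \<Sum>i<n. c a b * (g n i \<omega> $ a * g n i \<omega> $ b))"
          unfolding U_def by (subst sum.swap) (intro sum.cong refl sum.swap)
        then show ?thesis by (simp add: sum_distrib_left mult_ac)
      qed
      finally have "u \<bullet> (vech (QG n \<omega>) - vech S) = (1 / real n) * (\<Sum>i<n. U (g n i \<omega>)) - m"
        unfolding inner_diff_right vech_inner[OF tS] m_def c_def by simp
      also have "\<dots> = (1 / real n) * (\<Sum>i<n. U (g n i \<omega>) - m)"
        using n by (simp add: sum_subtractf right_diff_distrib)
      finally have "u \<bullet> Z n \<omega> = (sqrt (real n) / real n) * (\<Sum>i<n. U (g n i \<omega>) - m)"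
        by (simp add: Z_def)
      also have "sqrt (real n) / real n = 1 / sqrt (real n)" using n by (simp add: field_simps)
      finally show ?thesis by simp
    qed
    then have "\<forall>\<^sub>F n in sequentially. (CLINT \<omega>|M. iexp ((\<Sum>i<n. U (g n i \<omega>) - m) / sqrt (real n))) = (CLINT \<omega>|M. iexp (u \<bullet> Z n \<omega>))"
      by (intro eventually_mono[OF eventually_gt_at_top[of 0]]) (simp only:)
    ultimately show ?thesis by (rule Lim_transform_eventually)
  qed
  note W = W_mat_inverse[OF pd]
  have cd: "converges_in_dist M Z (multi_normal 0 (W_mat S))"
    by (rule levy_continuity_vec[OF M mZ prob_space_multi_normal[OF W(2)] sets_multi_normal])
      (simp_all only: char_multi_normal[OF W(2)] ch)
  have tight: "tight_seq M (\<lambda>n \<omega>. norm (Z n \<omega>))"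
    by (rule tight_seq_of_dist[OF M mZ prob_space_multi_normal[OF W(2)] sets_multi_normal cd])
  define dF where "dF n i a \<omega> = F (real (Suc i) * (T / real n)) \<omega> $ a - F (real i * (T / real n)) \<omega> $ a" for n i a \<omega>
  define dG where "dG n i a \<omega> = G (real (Suc i) * (T / real n)) \<omega> $ a - G (real i * (T / real n)) \<omega> $ a" for n i a \<omega>
  have mdF: "dF n i a \<in> borel_measurable M" and mdG: "dG n i a \<in> borel_measurable M" if "i < n" for n i a
    unfolding dF_def dG_def using that
    by (intro borel_measurable_diff borel_measurable_vec_nth' mF mG grid; simp)+
  have ae1: "AE \<omega> in M. (\<lambda>n. sqrt (real n) * (\<Sum>i<n. dF n i a \<omega> * dG n i b \<omega>) / (1 + sqrt (\<Sum>i<n. (dG n i b \<omega>)\<^sup>2))) \<longlonglongrightarrow> 0" for a b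
    using dec
  proof eventually_elim
    case (elim \<omega>)
    then obtain bb c where bc: "continuous_on {0..T} bb" "\<And>t. t \<in> {0..T} \<Longrightarrow> X t \<omega> = c + integral {0..t} bb + (\<Sum>j<k. V j t \<omega>)" by blast
    show ?case unfolding dF_def dG_def
    proof (rule drift_cross_variation_tendsto_0[OF T])
      show "continuous_on {0..T} (\<lambda>t. bb t $ a)" by (intro continuous_intros bc)
      show "continuous_on {0..T} (\<lambda>t. G t \<omega> $ b)" 
      proof -
        have "continuous_on {0..T} (\<lambda>t. G t \<omega>)" unfolding G_def using elim by blast
        then show ?thesis by (intro continuous_intros)
      qed
      show "F t \<omega> $ a = c $ a + integral {0..t} (\<lambda>t. bb t $ a)" if t: "t \<in> {0..T}" for t
      proof -
        have "bb integrable_on {0..t}" using t by (intro integrable_continuous_real continuous_on_subset[OF bc(1)]) auto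
        then have "integral {0..t} bb $ a = integral {0..t} (\<lambda>t. bb t $ a)" by (rule integral_component_eq_cart[symmetric])
        then show ?thesis using bc(2)[OF t] by (simp add: F_def G_def)
      qed
    qed
  qed
  have ae2: "AE \<omega> in M. (\<lambda>n. sqrt (real n) * (\<Sum>i<n. dF n i a \<omega> * dF n i b \<omega>)) \<longlonglongrightarrow> 0" for a b
    using dec
  proof eventually_elim
    case (elim \<omega>)
    then obtain bb c where bc: "continuous_on {0..T} bb" "\<And>t. t \<in> {0..T} \<Longrightarrow> X t \<omega> = c + integral {0..t} bb + (\<Sum>j<k. V j t \<omega>)" by blast
    have Fc: "F t \<omega> $ a = c $ a + integral {0..t} (\<lambda>t. bb t $ a)" if t: "t \<in> {0..T}" for t a
    proof -
      have "bb integrable_on {0..t}" using t by (intro integrable_continuous_real continuous_on_subset[OF bc(1)]) auto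
      then have "integral {0..t} bb $ a = integral {0..t} (\<lambda>t. bb t $ a)" by (rule integral_component_eq_cart[symmetric])
      then show ?thesis using bc(2)[OF t] by (simp add: F_def G_def)
    qed
    show ?case unfolding dF_def
      by (rule drift_variation_tendsto_0[OF T _ _ Fc Fc]) (intro continuous_intros bc)+
  qed
  \<comment> \<open>The quadratic variation of coordinate \<open>b\<close> is \<open>T\<close> times
    the diagonal entry of \<open>QG\<close>, and \<open>vech QG\<close> differs from
    \<open>vech S\<close> by \<open>Z n\<close> over \<open>sqrt (real n)\<close>. Its bound in
    probability thus comes from the limit theorem for the Gaussian part itself.\<close>
  have tY: "tight_seq M (\<lambda>n \<omega>. 1 + sqrt (\<Sum>i<n. (dG n i b \<omega>)\<^sup>2))" for b
  proof (rule tight_seq_mono[OF tight])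
    fix K :: real assume K: "K > 0"
    show "\<exists>K'>0. \<forall>\<^sub>F n in sequentially. \<forall>\<omega>\<in>space M. \<bar>norm (Z n \<omega>)\<bar> \<le> K \<longrightarrow> \<bar>1 + sqrt (\<Sum>i<n. (dG n i b \<omega>)\<^sup>2)\<bar> \<le> K'"
    proof (intro exI[of _ "1 + sqrt (T * (\<bar>S $ b $ b\<bar> + K))"] conjI eventually_mono[OF eventually_gt_at_top[of 0]] ballI impI)
      show "0 < 1 + sqrt (T * (\<bar>S $ b $ b\<bar> + K))" using T K by (intro add_pos_nonneg) auto
      fix n :: nat and \<omega> assume n: "n > 0" and z: "\<bar>norm (Z n \<omega>)\<bar> \<le> K"
      have q: "(\<Sum>i<n. (dG n i b \<omega>)\<^sup>2) = T * QG n \<omega> $ b $ b"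
        using T unfolding QG_def realized_cov_nth dG_def by (simp add: power2_eq_square)
      have "norm (vech (QG n \<omega>) - vech S) \<le> K"
      proof -
        have "norm (vech (QG n \<omega>) - vech S) = norm (Z n \<omega>) / sqrt (real n)" using n by (simp add: Z_def)
        also have "\<dots> \<le> norm (Z n \<omega>)"
        proof -
          have "norm (Z n \<omega>) * 1 \<le> norm (Z n \<omega>) * sqrt (real n)" using n by (intro mult_left_mono) auto
          then show ?thesis using n by (simp add: divide_le_eq)
        qed
        finally show ?thesis using z by simp
      qed
      moreover have "\<bar>(QG n \<omega> - S) $ b $ b\<bar> \<le> norm (vech (QG n \<omega> - S))"
        by (rule nth_le_norm_vech) (use tQ[of n \<omega>] tS in \<open>simp add: transpose_def vec_eq_iff\<close>)
      ultimately have "QG n \<omega> $ b $ b \<le> \<bar>S $ b $ b\<bar> + K" by (simp add: linear_diff[OF linear_vech])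
      then have "sqrt (T * QG n \<omega> $ b $ b) \<le> sqrt (T * (\<bar>S $ b $ b\<bar> + K))" using T by simp
      moreover have "0 \<le> sqrt (T * QG n \<omega> $ b $ b)" unfolding q[symmetric] by (simp add: sum_nonneg)
      ultimately show "\<bar>1 + sqrt (\<Sum>i<n. (dG n i b \<omega>)\<^sup>2)\<bar> \<le> 1 + sqrt (T * (\<bar>S $ b $ b\<bar> + K))"
        unfolding q by linarith
    qed
  qed
  \<comment> \<open>The pathwise limit carries the random denominator; multiplying back by this
    tight quantity keeps smallness in probability.\<close>
  have w1: "whp M (\<lambda>n \<omega>. \<bar>sqrt (real n) * (\<Sum>i<n. dF n i a \<omega> * dG n i b \<omega>)\<bar> \<le> e)" if e: "e > 0" for a b e
  proof (rule whp_tight_scale[OF M _ tY[of b] e])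
    fix r :: real assume r: "r > 0"
    have "whp M (\<lambda>n \<omega>. \<bar>sqrt (real n) * (\<Sum>i<n. dF n i a \<omega> * dG n i b \<omega>) / (1 + sqrt (\<Sum>i<n. (dG n i b \<omega>)\<^sup>2))\<bar> \<le> r)"
      by (rule whp_of_AE_tendsto[OF M _ ae1 r])
        (intro borel_measurable_divide borel_measurable_times borel_measurable_const borel_measurable_add borel_measurable_sum
          borel_measurable_sqrt[THEN measurable_compose[rotated]] borel_measurable_power mdF mdG; simp)
    then show "whp M (\<lambda>n \<omega>. \<bar>sqrt (real n) * (\<Sum>i<n. dF n i a \<omega> * dG n i b \<omega>)\<bar> \<le> r * \<bar>1 + sqrt (\<Sum>i<n. (dG n i b \<omega>)\<^sup>2)\<bar>)"
    proof (rule whp_mono, intro always_eventually allI ballI impI)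
      fix n \<omega>
      let ?y = "1 + sqrt (\<Sum>i<n. (dG n i b \<omega>)\<^sup>2)"
      have "0 \<le> sqrt (\<Sum>i<n. (dG n i b \<omega>)\<^sup>2)" by (simp add: sum_nonneg)
      then have y: "\<bar>?y\<bar> > 0" by linarith
      assume "\<bar>sqrt (real n) * (\<Sum>i<n. dF n i a \<omega> * dG n i b \<omega>) / ?y\<bar> \<le> r"
      then show "\<bar>sqrt (real n) * (\<Sum>i<n. dF n i a \<omega> * dG n i b \<omega>)\<bar> \<le> r * \<bar>?y\<bar>"
        by (simp only: abs_divide pos_divide_le_eq[OF y])
    qed
  qed
  have w2: "whp M (\<lambda>n \<omega>. \<bar>sqrt (real n) * (\<Sum>i<n. dF n i a \<omega> * dF n i b \<omega>)\<bar> \<le> e)" if e: "e > 0" for a b e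
    by (rule whp_of_AE_tendsto[OF M _ ae2 e])
      (intro borel_measurable_times borel_measurable_const borel_measurable_sum mdF; simp)
  \<comment> \<open>Expansion of the products of increments of \<open>X = F + G\<close>: after
    subtracting the Gaussian part, two cross terms and one pure drift term are left.\<close>
  have diff: "realized_cov T n (\<lambda>t. X t \<omega>) $ a $ b - QG n \<omega> $ a $ b =
      (1 / T) * ((\<Sum>i<n. dF n i a \<omega> * dG n i b \<omega>) + (\<Sum>i<n. dF n i b \<omega> * dG n i a \<omega>) + (\<Sum>i<n. dF n i a \<omega> * dF n i b \<omega>))" for n \<omega> a b
    unfolding QG_def realized_cov_nth right_diff_distrib[symmetric] sum_subtractf[symmetric] sum.distrib[symmetric]
    by (intro arg_cong2[where f="(*)"] refl sum.cong) (simp add: dF_def dG_def F_def algebra_simps)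
  have w: "whp M (\<lambda>n \<omega>. norm (sqrt (real n) *\<^sub>R (vech (realized_cov T n (\<lambda>t. X t \<omega>)) - vech S) - Z n \<omega>) \<le> e)" if e: "e > 0" for e
  proof -
    \<comment> \<open>Three sums of size \<open>r\<close>, divided by \<open>T\<close> and summed
      over the \<open>CARD('p uprod)\<close> coordinates of \<open>vech\<close>, add up to
      \<open>e\<close>.\<close>
    define r where "r = e * T / (3 * real CARD('p uprod))"
    have "CARD('p uprod) > 0" by simp
    then have r: "r > 0" using e T by (simp add: r_def)
    have "whp M (\<lambda>n \<omega>. \<forall>p\<in>UNIV \<times> UNIV. \<bar>sqrt (real n) * (\<Sum>i<n. dF n i (fst p) \<omega> * dG n i (snd p) \<omega>)\<bar> \<le> r \<and>
       \<bar>sqrt (real n) * (\<Sum>i<n. dF n i (fst p) \<omega> * dF n i (snd p) \<omega>)\<bar> \<le> r)"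
      by (intro whp_finite_all[OF M] whp_conj[OF M] w1 w2 r) simp
    then show ?thesis
    proof (rule whp_mono, intro always_eventually allI ballI impI)
      fix n \<omega>
      assume "\<forall>p\<in>UNIV \<times> UNIV. \<bar>sqrt (real n) * (\<Sum>i<n. dF n i (fst p) \<omega> * dG n i (snd p) \<omega>)\<bar> \<le> r \<and>
       \<bar>sqrt (real n) * (\<Sum>i<n. dF n i (fst p) \<omega> * dF n i (snd p) \<omega>)\<bar> \<le> r"
      then have p: "\<bar>sqrt (real n) * (\<Sum>i<n. dF n i a \<omega> * dG n i b \<omega>)\<bar> \<le> r"
        "\<bar>sqrt (real n) * (\<Sum>i<n. dF n i a \<omega> * dF n i b \<omega>)\<bar> \<le> r" for a b by auto
      let ?Q = "realized_cov T n (\<lambda>t. X t \<omega>)"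
      have ent: "\<bar>(sqrt (real n) *\<^sub>R (?Q - QG n \<omega>)) $ a $ b\<bar> \<le> 3 * r / T" for a b
      proof -
        have "(sqrt (real n) *\<^sub>R (?Q - QG n \<omega>)) $ a $ b = (sqrt (real n) * (\<Sum>i<n. dF n i a \<omega> * dG n i b \<omega>) +
           sqrt (real n) * (\<Sum>i<n. dF n i b \<omega> * dG n i a \<omega>) + sqrt (real n) * (\<Sum>i<n. dF n i a \<omega> * dF n i b \<omega>)) / T"
          using diff[of n \<omega> a b] by (simp add: distrib_left add_divide_distrib)
        also have "\<bar>\<dots>\<bar> \<le> 3 * r / T"
        proof -
          have "\<bar>x + y + z\<bar> \<le> 3 * r" if "\<bar>x\<bar> \<le> r" "\<bar>y\<bar> \<le> r" "\<bar>z\<bar> \<le> r" for x y z :: real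
            using that by linarith
          from divide_right_mono[OF this[OF p(1)[of a b] p(1)[of b a] p(2)[of a b]], of T] T
          show ?thesis by (simp only: abs_divide abs_of_pos less_imp_le)
        qed
        finally show ?thesis .
      qed
      have "sqrt (real n) *\<^sub>R (vech ?Q - vech S) - Z n \<omega> = vech (sqrt (real n) *\<^sub>R (?Q - QG n \<omega>))"
        by (simp add: Z_def linear_cmul[OF linear_vech] linear_diff[OF linear_vech] algebra_simps)
      also have "norm \<dots> \<le> real CARD('p uprod) * (3 * r / T)" by (rule norm_vech_le[OF ent])
      also have "\<dots> = e" using T by (simp add: r_def)
      finally show "norm (sqrt (real n) *\<^sub>R (vech ?Q - vech S) - Z n \<omega>) \<le> e" .
    qed
  qed
  show ?thesis by (rule that[OF mZ cd ch w])
qed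

text \<open>The data enter only through the symmetric \<open>Q\<close> and its coupling with
  \<open>Z\<close>. With the weighted least squares map \<open>J\<close>, the normalized error of
  the estimator is \<open>J *v Z n\<close> up to a term tending to 0 in probability. Since the
  limiting weight is the inverse of the limit covariance of \<open>Z\<close>, the covariance of this
  linear image reduces to one inverse.\<close>

theorem minimum_contrast_estimator:
  fixes \<Sigma> :: "real^'q \<Rightarrow> real^('p::finite)^'p" and \<Delta> :: "real^'q^('p uprod)"
    and Q :: "nat \<Rightarrow> 'w \<Rightarrow> real^'p^'p" and Z :: "nat \<Rightarrow> 'w \<Rightarrow> real^('p uprod)"
  assumes M: "prob_space M" and \<Theta>: "compact \<Theta>" "\<theta>0 \<in> \<Theta>" and c\<Sigma>: "continuous_on \<Theta> \<Sigma>" and pd: "\<And>\<theta>. \<theta> \<in> \<Theta> \<Longrightarrow> pos_def (\<Sigma> \<theta>)"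
    and inj: "inj_on \<Sigma> \<Theta>" and D: "((\<lambda>\<theta>. vech (\<Sigma> \<theta>)) has_derivative ((*v) \<Delta>)) (at \<theta>0)" and injD: "inj ((*v) \<Delta>)"
    and Z: "\<And>n. n > 0 \<Longrightarrow> Z n \<in> borel_measurable M"
    and cd: "converges_in_dist M Z (multi_normal 0 (W_mat (\<Sigma> \<theta>0)))"
    and ch: "\<And>t. (\<lambda>n. CLINT \<omega>|M. iexp (t \<bullet> Z n \<omega>)) \<longlonglongrightarrow> exp (- (t \<bullet> (W_mat (\<Sigma> \<theta>0) *v t)) / 2)"
    and sQ: "\<And>n \<omega>. transpose (Q n \<omega>) = Q n \<omega>"
    and QZ: "\<And>e. e > 0 \<Longrightarrow> whp M (\<lambda>n \<omega>. norm (sqrt (real n) *\<^sub>R (vech (Q n \<omega>) - vech (\<Sigma> \<theta>0)) - Z n \<omega>) \<le> e)"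
    and mh: "\<And>n. n > 0 \<Longrightarrow> \<theta>hat n \<in> borel_measurable M"
    and est: "\<And>n \<omega>. n > 0 \<Longrightarrow> \<omega> \<in> space M \<Longrightarrow> \<theta>hat n \<omega> \<in> \<Theta> \<and>
       contrast (Q n \<omega>) (\<Sigma> (\<theta>hat n \<omega>)) = (INF \<theta>\<in>\<Theta>. contrast (Q n \<omega>) (\<Sigma> \<theta>))"
  shows "converges_in_prob M \<theta>hat \<theta>0"
    and "\<theta>0 \<in> interior \<Theta> \<Longrightarrow> converges_in_dist M (\<lambda>n \<omega>. sqrt (real n) *\<^sub>R (\<theta>hat n \<omega> - \<theta>0))
        (multi_normal 0 (matrix_inv (transpose \<Delta> ** matrix_inv (W_mat (\<Sigma> \<theta>0)) ** \<Delta>)))"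
proof -
  interpret prob_space M by fact
  let ?S = "\<Sigma> \<theta>0"
  have pd0: "pos_def ?S" by (rule pd[OF \<Theta>(2)])
  have tS: "transpose ?S = ?S" by (rule pos_def_sym[OF pd0])
  note W = W_mat_inverse[OF pd0]
  define x where "x n \<omega> = vech (Q n \<omega>) - vech ?S" for n \<omega>
  have tight: "tight_seq M (\<lambda>n \<omega>. norm (Z n \<omega>))"
    by (rule tight_seq_of_dist[OF M Z prob_space_multi_normal[OF W(2)] sets_multi_normal cd])
  have tx: "tight_seq M (\<lambda>n \<omega>. norm (sqrt (real n) *\<^sub>R x n \<omega>))"
  proof (rule tight_seq_add_whp[OF M tight whp_mono[OF QZ[of 1]]])
    show "\<forall>\<^sub>F n in sequentially. \<forall>\<omega>\<in>space M. norm (sqrt (real n) *\<^sub>R (vech (Q n \<omega>) - vech ?S) - Z n \<omega>) \<le> 1 \<longrightarrow>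
       \<bar>norm (sqrt (real n) *\<^sub>R x n \<omega>)\<bar> \<le> \<bar>norm (Z n \<omega>)\<bar> + 1"
    proof (intro always_eventually allI ballI impI)
      fix n \<omega> assume "norm (sqrt (real n) *\<^sub>R (vech (Q n \<omega>) - vech ?S) - Z n \<omega>) \<le> 1"
      then show "\<bar>norm (sqrt (real n) *\<^sub>R x n \<omega>)\<bar> \<le> \<bar>norm (Z n \<omega>)\<bar> + 1"
        using norm_triangle_sub[of "sqrt (real n) *\<^sub>R x n \<omega>" "Z n \<omega>"] unfolding x_def abs_norm_cancel by linarith
    qed
  qed simp
  \<comment> \<open>A tight sequence divided by \<open>sqrt (real n)\<close> tends to 0 in
    probability; \<open>K\<close> compares the norm of a symmetric matrix with that of its
    half-vectorization.\<close>
  have wQ: "whp M (\<lambda>n \<omega>. norm (Q n \<omega> - ?S) < d)" if d: "d > 0" for d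
  proof -
    define K where "K = (real CARD('p))\<^sup>2"
    have K: "K > 0" by (simp add: K_def)
    have "whp M (\<lambda>n \<omega>. \<bar>norm (x n \<omega>)\<bar> \<le> d / (2 * K))"
    proof (rule whp_tight_scale[OF M _ tx])
      show "d / (2 * K) > 0" using d K by simp
      fix e :: real assume e: "e > 0"
      have "\<forall>\<^sub>F n in sequentially. 1 / e \<le> sqrt (real n)"
        using filterlim_compose[OF sqrt_at_top filterlim_real_sequentially] unfolding filterlim_at_top by blast
      then have "\<forall>\<^sub>F n in sequentially. \<forall>\<omega>\<in>space M. \<bar>norm (x n \<omega>)\<bar> \<le> e * \<bar>norm (sqrt (real n) *\<^sub>R x n \<omega>)\<bar>"
      proof eventually_elim
        case (elim n)
        have "1 \<le> e * sqrt (real n)" using elim e by (simp add: divide_le_eq mult.commute)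
        then have "1 * norm (x n \<omega>) \<le> (e * sqrt (real n)) * norm (x n \<omega>)" for \<omega> by (rule mult_right_mono) simp
        then show ?case by (simp add: mult.assoc)
      qed
      then show "whp M (\<lambda>n \<omega>. \<bar>norm (x n \<omega>)\<bar> \<le> e * \<bar>norm (sqrt (real n) *\<^sub>R x n \<omega>)\<bar>)"
        by (intro whp_mono[OF QZ[OF e]]) (auto elim: eventually_mono)
    qed
    then show ?thesis
    proof (rule whp_mono, intro always_eventually allI ballI impI)
      fix n \<omega> assume "\<bar>norm (x n \<omega>)\<bar> \<le> d / (2 * K)"
      then have nx: "norm (x n \<omega>) \<le> d / (2 * K)" by simp
      have "transpose (Q n \<omega> - ?S) = Q n \<omega> - ?S"
        using sQ[of n \<omega>] tS by (simp add: transpose_def vec_eq_iff)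
      then have "norm (Q n \<omega> - ?S) \<le> K * norm (vech (Q n \<omega> - ?S))" unfolding K_def by (rule norm_le_norm_vech)
      also have "vech (Q n \<omega> - ?S) = x n \<omega>" by (simp add: x_def linear_diff[OF linear_vech])
      also have "K * norm (x n \<omega>) \<le> K * (d / (2 * K))" using K by (intro mult_left_mono nx) simp
      also have "\<dots> < d" using K d by simp
      finally show "norm (Q n \<omega> - ?S) < d" .
    qed
  qed
  obtain R d1 where Rd: "R \<ge> 0" "d1 > 0"
    "\<And>Q. transpose Q = Q \<Longrightarrow> norm (Q - ?S) < d1 \<Longrightarrow> pos_def Q"
    "\<And>Q \<theta>. transpose Q = Q \<Longrightarrow> norm (Q - ?S) < d1 \<Longrightarrow> \<theta> \<in> \<Theta> \<Longrightarrow> contrast Q (\<Sigma> \<theta>) \<ge> 0"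
    "\<And>Q \<theta>. transpose Q = Q \<Longrightarrow> norm (Q - ?S) < d1 \<Longrightarrow> \<theta> \<in> \<Theta> \<Longrightarrow> contrast Q (\<Sigma> \<theta>) \<le> contrast Q ?S \<Longrightarrow>
       norm (vech (\<Sigma> \<theta>) - vech ?S) \<le> R * norm (vech Q - vech ?S)"
    using contrast_minimizer_rate[OF \<Theta> c\<Sigma> pd] by blast
  have min: "contrast (Q n \<omega>) (\<Sigma> (\<theta>hat n \<omega>)) \<le> contrast (Q n \<omega>) (\<Sigma> \<theta>)"
    if "n > 0" "\<omega> \<in> space M" "norm (Q n \<omega> - ?S) < d1" "\<theta> \<in> \<Theta>" for n \<omega> \<theta>
  proof -
    \<comment> \<open>A real infimum is a lower bound only for sets bounded below. Nonnegativity of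
      the contrast for \<open>Q\<close> near \<open>\<Sigma> \<theta>0\<close> provides
      this.\<close>
    have "bdd_below ((\<lambda>\<theta>. contrast (Q n \<omega>) (\<Sigma> \<theta>)) ` \<Theta>)"
      by (rule bdd_belowI2[of _ 0]) (rule Rd(4)[OF sQ that(3)])
    then have "(INF \<theta>\<in>\<Theta>. contrast (Q n \<omega>) (\<Sigma> \<theta>)) \<le> contrast (Q n \<omega>) (\<Sigma> \<theta>)"
      using that(4) by (rule cINF_lower)
    then show ?thesis using est[OF that(1,2)] by simp
  qed
  have cons: "whp M (\<lambda>n \<omega>. norm (\<theta>hat n \<omega> - \<theta>0) < e)" if e: "e > 0" for e
  proof (rule contrast_minimizer_consistent[OF \<Theta> c\<Sigma> pd inj e])
    fix d assume d: "d > 0" and dd: "\<And>Q \<theta>. transpose Q = Q \<Longrightarrow> norm (Q - ?S) < d \<Longrightarrow> \<theta> \<in> \<Theta> \<Longrightarrow> contrast Q (\<Sigma> \<theta>) \<le> contrast Q ?S \<Longrightarrow>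
       norm (\<theta> - \<theta>0) < e"
    have "min d d1 > 0" using d Rd by simp
    from wQ[OF this] show ?thesis
    proof (rule whp_mono, intro eventually_mono[OF eventually_gt_at_top[of 0]] ballI impI)
      fix n :: nat and \<omega> assume n: "0 < n" and w: "\<omega> \<in> space M" and q: "norm (Q n \<omega> - ?S) < min d d1"
      show "norm (\<theta>hat n \<omega> - \<theta>0) < e"
        by (rule dd[OF sQ[of n \<omega>]]) (use q est[OF n w] min[OF n w _ \<Theta>(2)] in auto)
    qed
  qed
  show "converges_in_prob M \<theta>hat \<theta>0"
    unfolding converges_in_prob_def
  proof (intro allI impI)
    fix e :: real assume e: "e > 0"
    have "whp M (\<lambda>n \<omega>. \<not> dist (\<theta>hat n \<omega>) \<theta>0 > e)"
      by (rule whp_mono[OF cons[OF e]]) (auto simp: dist_norm)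
    from whp_imp_measure_tendsto[OF M this]
    show "(\<lambda>n. measure M {\<omega> \<in> space M. dist (\<theta>hat n \<omega>) \<theta>0 > e}) \<longlonglongrightarrow> 0" by simp
  qed
  assume int: "\<theta>0 \<in> interior \<Theta>"
  define J where "J = matrix_inv (transpose \<Delta> ** V0_mat ?S ** \<Delta>) ** transpose \<Delta> ** V0_mat ?S"
  define G where "G = transpose \<Delta> ** V0_mat ?S ** \<Delta>"
  note wls = weighted_least_squares[OF pos_def_V0_mat[OF pd0] injD, folded J_def G_def]
  have piG: "pos_def (matrix_inv G)" by (rule pos_def_matrix_inv[OF wls(1)])
  have wlin: "whp M (\<lambda>n \<omega>. \<bar>norm (sqrt (real n) *\<^sub>R (\<theta>hat n \<omega> - \<theta>0 - J *v x n \<omega>))\<bar> \<le> e)" if e: "e > 0" for e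
  proof (rule whp_tight_scale[OF M _ tx e])
    fix r :: real assume r: "r > 0"
    show "whp M (\<lambda>n \<omega>. \<bar>norm (sqrt (real n) *\<^sub>R (\<theta>hat n \<omega> - \<theta>0 - J *v x n \<omega>))\<bar> \<le> r * \<bar>norm (sqrt (real n) *\<^sub>R x n \<omega>)\<bar>)"
    proof (rule contrast_minimizer_expansion[OF \<Theta>(1) int c\<Sigma> pd inj D injD r, folded J_def])
      fix d assume d: "d > 0" and dd: "\<And>Q \<theta>. transpose Q = Q \<Longrightarrow> norm (Q - ?S) < d \<Longrightarrow> \<theta> \<in> \<Theta> \<Longrightarrow>
       (\<And>\<theta>'. \<theta>' \<in> \<Theta> \<Longrightarrow> contrast Q (\<Sigma> \<theta>) \<le> contrast Q (\<Sigma> \<theta>')) \<Longrightarrow>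
       norm (\<theta> - \<theta>0 - J *v (vech Q - vech ?S)) \<le> r * norm (vech Q - vech ?S)"
      have "min d d1 > 0" using d Rd by simp
      from wQ[OF this] show ?thesis
      proof (rule whp_mono, intro eventually_mono[OF eventually_gt_at_top[of 0]] ballI impI)
        fix n :: nat and \<omega> assume n: "0 < n" and w: "\<omega> \<in> space M" and q: "norm (Q n \<omega> - ?S) < min d d1"
        have q12: "norm (Q n \<omega> - ?S) < d" "norm (Q n \<omega> - ?S) < d1" using q by simp_all
        have "norm (\<theta>hat n \<omega> - \<theta>0 - J *v x n \<omega>) \<le> r * norm (x n \<omega>)"
          unfolding x_def by (rule dd[OF sQ[of n \<omega>] q12(1) conjunct1[OF est[OF n w]] min[OF n w q12(2)]])
        then have "sqrt (real n) * norm (\<theta>hat n \<omega> - \<theta>0 - J *v x n \<omega>) \<le> sqrt (real n) * (r * norm (x n \<omega>))"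
          by (rule mult_left_mono) simp
        then show "\<bar>norm (sqrt (real n) *\<^sub>R (\<theta>hat n \<omega> - \<theta>0 - J *v x n \<omega>))\<bar> \<le> r * \<bar>norm (sqrt (real n) *\<^sub>R x n \<omega>)\<bar>"
          by (simp add: mult.left_commute)
      qed
    qed
  qed
  show "converges_in_dist M (\<lambda>n \<omega>. sqrt (real n) *\<^sub>R (\<theta>hat n \<omega> - \<theta>0))
        (multi_normal 0 (matrix_inv (transpose \<Delta> ** matrix_inv (W_mat ?S) ** \<Delta>)))"
    unfolding W(1) G_def[symmetric]
  proof (rule levy_continuity_vec[OF M _ prob_space_multi_normal[OF piG] sets_multi_normal])
    show mA: "(\<lambda>\<omega>. sqrt (real n) *\<^sub>R (\<theta>hat n \<omega> - \<theta>0)) \<in> borel_measurable M" if "n > 0" for n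
      using mh[OF that] by simp
    fix s :: "real^'q"
    have "(\<lambda>n. CLINT \<omega>|M. iexp (s \<bullet> (sqrt (real n) *\<^sub>R (\<theta>hat n \<omega> - \<theta>0)))) \<longlonglongrightarrow>
        exp (- ((transpose J *v s) \<bullet> (W_mat ?S *v (transpose J *v s))) / 2)"
    proof (rule iexp_slutsky[OF M _ _ _ ch])
      show "(\<lambda>\<omega>. s \<bullet> (sqrt (real n) *\<^sub>R (\<theta>hat n \<omega> - \<theta>0))) \<in> borel_measurable M" if "n > 0" for n
        by (intro borel_measurable_inner borel_measurable_const mA that)
      show "(\<lambda>\<omega>. (transpose J *v s) \<bullet> Z n \<omega>) \<in> borel_measurable M" if "n > 0" for n
        by (intro borel_measurable_inner borel_measurable_const Z that)
      fix e :: real assume e: "e > 0"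
      \<comment> \<open>The linearization error and the coupling error contribute
        \<open>e / 2\<close> each; adding 1 to the norms avoids division by 0.\<close>
      define e1 where "e1 = e / (2 * (norm s + 1))"
      define e2 where "e2 = e / (2 * (norm (transpose J *v s) + 1))"
      have e12: "e1 > 0" "e2 > 0" using e by (auto simp: e1_def e2_def add_nonneg_pos)
      from whp_conj[OF M wlin[OF e12(1)] QZ[OF e12(2)]]
      show "whp M (\<lambda>n \<omega>. \<bar>s \<bullet> (sqrt (real n) *\<^sub>R (\<theta>hat n \<omega> - \<theta>0)) - (transpose J *v s) \<bullet> Z n \<omega>\<bar> \<le> e)"
      proof (rule whp_mono, intro always_eventually allI ballI impI)
        fix n \<omega>
        assume a: "\<bar>norm (sqrt (real n) *\<^sub>R (\<theta>hat n \<omega> - \<theta>0 - J *v x n \<omega>))\<bar> \<le> e1 \<and> norm (sqrt (real n) *\<^sub>R (vech (Q n \<omega>) - vech ?S) - Z n \<omega>) \<le> e2"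
        let ?a = "sqrt (real n) *\<^sub>R (\<theta>hat n \<omega> - \<theta>0 - J *v x n \<omega>)" and ?b = "sqrt (real n) *\<^sub>R x n \<omega> - Z n \<omega>"
        have "s \<bullet> (sqrt (real n) *\<^sub>R (\<theta>hat n \<omega> - \<theta>0)) - (transpose J *v s) \<bullet> Z n \<omega> = s \<bullet> ?a + (transpose J *v s) \<bullet> ?b"
          unfolding inner_matrix_transpose[symmetric]
          by (simp add: matrix_vector_mult_diff_distrib matrix_vector_mult_scaleR inner_diff_right algebra_simps)
        also have "\<bar>\<dots>\<bar> \<le> norm s * norm ?a + norm (transpose J *v s) * norm ?b"
          by (rule order_trans[OF abs_triangle_ineq add_mono[OF Cauchy_Schwarz_ineq2 Cauchy_Schwarz_ineq2]])
        also have "\<dots> \<le> (norm s + 1) * e1 + (norm (transpose J *v s) + 1) * e2"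
          using a unfolding x_def by (intro add_mono mult_mono) auto
        also have "\<dots> = e"
        proof -
          have p: "norm s + 1 > 0" "norm (transpose J *v s) + 1 > 0" by (simp_all add: add_nonneg_pos)
          have "(norm s + 1) * e1 = e / 2" "(norm (transpose J *v s) + 1) * e2 = e / 2"
            using p unfolding e1_def e2_def by (simp_all add: field_simps)
          then show ?thesis by simp
        qed
        finally show "\<bar>s \<bullet> (sqrt (real n) *\<^sub>R (\<theta>hat n \<omega> - \<theta>0)) - (transpose J *v s) \<bullet> Z n \<omega>\<bar> \<le> e" .
      qed
    qed
    moreover have "(transpose J *v s) \<bullet> (W_mat ?S *v (transpose J *v s)) = s \<bullet> (matrix_inv G *v s)"
    proof -
      have "s \<bullet> (matrix_inv G *v s) = s \<bullet> (J *v (W_mat ?S *v (transpose J *v s)))"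
        unfolding wls(3)[symmetric] W(3) by (simp only: matrix_vector_mul_assoc[symmetric])
      then show ?thesis by (simp only: inner_matrix_transpose[of s])
    qed
    ultimately show "(\<lambda>n. CLINT \<omega>|M. iexp (s \<bullet> (sqrt (real n) *\<^sub>R (\<theta>hat n \<omega> - \<theta>0)))) \<longlonglongrightarrow>
        (CLINT x|multi_normal 0 (matrix_inv G). iexp (s \<bullet> x))"
      unfolding char_multi_normal[OF piG] by simp
  qed
qed

subsection \<open>Covariance structure\<close>

lemma differentiable_vec:
  fixes f :: "'a::real_normed_vector \<Rightarrow> 'b::euclidean_space^'n"
  assumes "\<And>i. (\<lambda>x. f x $ i) differentiable at a"
  shows "f differentiable at a"
proof -
  have "(\<lambda>x. f x \<bullet> u) differentiable at a" if uB: "u \<in> Basis" for u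
  proof -
    obtain i b where u: "u = axis i b" using uB unfolding Basis_vec_def by blast
    obtain D where "((\<lambda>x. f x $ i) has_derivative D) (at a)" using assms[of i] unfolding differentiable_def by blast
    then have "((\<lambda>x. f x $ i \<bullet> b) has_derivative (\<lambda>h. D h \<bullet> b)) (at a)" by (rule has_derivative_inner_left)
    then show ?thesis unfolding u inner_axis differentiable_def by blast
  qed
  then show ?thesis using differentiable_componentwise_within[of f a UNIV] by blast
qed

lemma differentiable_vec_nth:
  fixes f :: "'a::real_normed_vector \<Rightarrow> 'b::real_normed_vector^'n"
  assumes "f differentiable at a"
  shows "(\<lambda>x. f x $ i) differentiable at a"
proof -
  obtain D where "(f has_derivative D) (at a)" using assms unfolding differentiable_def by blast
  from bounded_linear.has_derivative[OF bounded_linear_vec_nth this] show ?thesis unfolding differentiable_def by blast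
qed

lemma differentiable_matrix_nth:
  fixes F :: "'a::real_normed_vector \<Rightarrow> real^'n^'m"
  shows "F differentiable at a \<Longrightarrow> (\<lambda>x. F x $ i $ j) differentiable at a"
  by (intro differentiable_vec_nth)

lemma differentiable_matrixI:
  fixes F :: "'a::real_normed_vector \<Rightarrow> real^'n^'m"
  shows "(\<And>i j. (\<lambda>x. F x $ i $ j) differentiable at a) \<Longrightarrow> F differentiable at a"
  by (intro differentiable_vec)

lemma differentiable_matrix_mult:
  fixes F :: "'a::real_normed_vector \<Rightarrow> real^'n^'m" and G :: "'a \<Rightarrow> real^'k^'n"
  assumes "F differentiable at a" "G differentiable at a"
  shows "(\<lambda>x. F x ** G x) differentiable at a"
proof (rule differentiable_matrixI)
  fix i j
  show "(\<lambda>x. (F x ** G x) $ i $ j) differentiable at a"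
    unfolding matrix_matrix_mult_def vec_lambda_beta
    by (intro differentiable_sum ballI differentiable_mult differentiable_matrix_nth assms) simp
qed

lemma differentiable_transpose:
  fixes F :: "'a::real_normed_vector \<Rightarrow> real^'n^'m"
  assumes "F differentiable at a"
  shows "(\<lambda>x. transpose (F x)) differentiable at a"
  by (rule differentiable_matrixI) (simp add: transpose_def differentiable_matrix_nth assms)

lemma differentiable_prod:
  fixes f :: "'i \<Rightarrow> 'a::real_normed_vector \<Rightarrow> real"
  assumes "\<And>i. i \<in> I \<Longrightarrow> f i differentiable at a"
  shows "(\<lambda>x. \<Prod>i\<in>I. f i x) differentiable at a"
proof -
  define D where "D i = (SOME D. (f i has_derivative D) (at a))" for i
  have D: "(f i has_derivative D i) (at a)" if "i \<in> I" for i
    using someI_ex[OF assms[OF that, unfolded differentiable_def]] unfolding D_def .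
  have "((\<lambda>x. \<Prod>i\<in>I. f i x) has_derivative (\<lambda>y. \<Sum>i\<in>I. D i y * (\<Prod>j\<in>I - {i}. f j a))) (at a)"
    by (rule has_derivative_prod[OF D])
  from exI[of "\<lambda>D. (_ has_derivative D) _", OF this] show ?thesis unfolding differentiable_def .
qed

lemma differentiable_det:
  fixes F :: "'a::real_normed_vector \<Rightarrow> real^'n^'n"
  assumes "\<And>i j. (\<lambda>x. F x $ i $ j) differentiable at a"
  shows "(\<lambda>x. det (F x)) differentiable at a"
  unfolding det_def by (intro differentiable_sum ballI differentiable_mult differentiable_prod assms differentiable_const) simp

text \<open>Cramer's rule holds on the set where the determinant of \<open>F x\<close> does not
  vanish, which is open by continuity of \<open>F\<close>; the entries of the inverse inherit the
  derivative of the quotient there.\<close>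

lemma differentiable_matrix_inv:
  fixes F :: "'a::real_normed_vector \<Rightarrow> real^'n^'n"
  assumes F: "F differentiable at a" and c: "continuous_on UNIV F" and inv: "invertible (F a)"
  shows "(\<lambda>x. matrix_inv (F x)) differentiable at a"
proof (rule differentiable_matrixI)
  fix i j
  let ?U = "{x. det (F x) \<noteq> 0}"
  let ?g = "\<lambda>x. det (\<chi> r c. if c = i then (if r = j then 1 else 0) else F x $ r $ c) / det (F x)"
  have U: "open ?U" by (intro open_Collect_neq continuous_intros c)
  have aU: "a \<in> ?U" using inv invertible_det_nz by auto
  have "?g differentiable at a"
  proof (intro differentiable_divide differentiable_det)
    show "(\<lambda>x. (\<chi> r c. if c = i then (if r = j then 1 else 0) else F x $ r $ c) $ r $ c) differentiable at a" for r c
      by (cases "c = i") (simp_all add: differentiable_matrix_nth F)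
    show "(\<lambda>x. F x $ r $ c) differentiable at a" for r c by (rule differentiable_matrix_nth[OF F])
  qed (use aU in auto)
  then obtain D where "(?g has_derivative D) (at a)" unfolding differentiable_def by blast
  then have "((\<lambda>x. matrix_inv (F x) $ i $ j) has_derivative D) (at a)"
    by (rule has_derivative_transform_within_open[OF _ U aU]) (simp add: matrix_inv_nth invertible_det_nz)
  then show "(\<lambda>x. matrix_inv (F x) $ i $ j) differentiable at a" unfolding differentiable_def by blast
qed

lemma param_matrix_differentiable:
  fixes A :: "real^'q \<Rightarrow> real^'n^'m"
  assumes "param_matrix A" shows "A differentiable at \<theta>"
proof (rule differentiable_matrixI)
  fix i j
  consider c where "\<And>\<theta>. A \<theta> $ i $ j = c" | l where "\<And>\<theta>. A \<theta> $ i $ j = \<theta> $ l"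
    using assms unfolding param_matrix_def by blast
  then show "(\<lambda>\<theta>. A \<theta> $ i $ j) differentiable at \<theta>"
    by cases (simp_all add: differentiable_vec_nth)
qed

lemma param_matrix_continuous:
  fixes A :: "real^'q \<Rightarrow> real^'n^'m"
  assumes "param_matrix A" shows "continuous_on UNIV A"
  by (intro continuous_at_imp_continuous_on ballI differentiable_imp_continuous_within param_matrix_differentiable assms)

section \<open>Block form of the model and of its covariance\<close>

definition vstack :: "real^'k^'m \<Rightarrow> real^'k^'n \<Rightarrow> real^'k^('m + 'n)" where
  "vstack A B = (\<chi> i. case i of Inl a \<Rightarrow> A $ a | Inr b \<Rightarrow> B $ b)"

lemma vstack_mult_vec: "vstack A B *v x = stack (A *v x) (B *v x)"
  by (simp add: vstack_def stack_def matrix_vector_mult_def vec_eq_iff split: sum.split)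

lemma vstack_mult: "vstack A B ** C = vstack (A ** C) (B ** C)"
  by (simp add: vstack_def matrix_matrix_mult_def vec_eq_iff split: sum.split)

lemma vstack_mult_transpose:
  "vstack A B ** transpose (vstack C D) = block_matrix (A ** transpose C) (A ** transpose D) (B ** transpose C) (B ** transpose D)"
  by (simp add: vstack_def block_matrix_def matrix_matrix_mult_def transpose_def vec_eq_iff split: sum.split)

lemma block_matrix_add: "block_matrix A B C D + block_matrix A' B' C' D' = block_matrix (A + A') (B + B') (C + C') (D + D')"
  by (simp add: block_matrix_def vec_eq_iff split: sum.split)

lemma stack_add: "stack a b + stack c d = stack (a + c) (b + d)"
  by (simp add: stack_def vec_eq_iff split: sum.split)

lemma sum_lessThan_4: "(\<Sum>j<4::nat. f j) = f 0 + f 1 + f 2 + (f 3 :: 'a::comm_monoid_add)"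
  by (simp add: eval_nat_numeral lessThan_Suc ac_simps)

lemma matrix_add_mult_distrib: "(A + B) ** C = A ** C + B ** (C :: real^'k^'n)"
  by (simp add: matrix_matrix_mult_def vec_eq_iff sum.distrib ring_distribs)

lemma matrix_mult_zero: "(0 :: real^'n^'m) ** (B :: real^'k^'n) = 0" "(A :: real^'n^'m) ** (0 :: real^'k^'n) = 0"
  by (simp_all add: matrix_matrix_mult_def vec_eq_iff)

lemma transpose_zero: "transpose (0 :: real^'n^'m) = 0"
  by (simp add: transpose_def vec_eq_iff)

lemma vstack_gram:
  "(vstack A B ** S) ** transpose (vstack A B ** S) =
    block_matrix (A ** (S ** transpose S) ** transpose A) (A ** (S ** transpose S) ** transpose B)
      (B ** (S ** transpose S) ** transpose A) (B ** (S ** transpose S) ** transpose B)"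
  by (simp only: vstack_mult[of A B S] vstack_mult_transpose matrix_transpose_mul matrix_mul_assoc)

text \<open>The four terms belong to the four noise sources: the one of \<open>\<xi>\<close> reaches
  the observation through \<open>L1\<close> and through
  \<open>L2 ** matrix_inv \<Psi> ** \<Gamma>\<close>, the one of \<open>\<zeta>\<close> through
  \<open>L2 ** matrix_inv \<Psi>\<close>, and the two measurement errors enter one block
  each.\<close>

lemma covariance_structure_factorization:
  fixes L1 :: "real^'k1^'p1" and L2 :: "real^'k2^'p2" and \<Gamma> :: "real^'k1^'k2" and \<Psi> :: "real^'k2^'k2"
    and S1 :: "real^'r1^'k1" and S2 :: "real^'r2^'p1" and S3 :: "real^'r3^'p2" and S4 :: "real^'r4^'k2"
  defines "A1 \<equiv> vstack L1 (L2 ** matrix_inv \<Psi> ** \<Gamma>) ** S1" and "A2 \<equiv> vstack (mat 1) 0 ** S2"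
    and "A3 \<equiv> vstack 0 (mat 1) ** S3" and "A4 \<equiv> vstack 0 (L2 ** matrix_inv \<Psi>) ** S4"
  shows "covariance_structure L1 L2 \<Gamma> \<Psi> (S1 ** transpose S1) (S2 ** transpose S2) (S3 ** transpose S3) (S4 ** transpose S4) =
    A1 ** transpose A1 + A2 ** transpose A2 + A3 ** transpose A3 + A4 ** transpose A4"
proof -
  show ?thesis
    unfolding assms vstack_gram block_matrix_add covariance_structure_def Let_def
    by (simp only: matrix_transpose_mul transpose_transpose matrix_mul_assoc matrix_add_ldistrib matrix_add_mult_distrib
        matrix_mul_lid matrix_mul_rid matrix_mult_zero transpose_zero transpose_mat add_0_left add_0_right add_ac)
qed

text \<open>The second and the third term act on the two blocks of \<open>x\<close> as the
  covariances of the measurement errors, so they cannot both vanish at a nonzero \<open>x\<close>;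
  the other terms are nonnegative.\<close>

lemma pos_def_sum_gram:
  fixes S2 :: "real^'r2^'p1" and S3 :: "real^'r3^'p2"
    and A1 :: "real^'r1^('p1 + 'p2)" and A4 :: "real^'r4^('p1 + 'p2)"
  assumes "pos_def (S2 ** transpose S2)" "pos_def (S3 ** transpose S3)"
  shows "pos_def (A1 ** transpose A1 + (vstack (mat 1) 0 ** S2) ** transpose (vstack (mat 1) 0 ** S2) +
    (vstack 0 (mat 1) ** S3) ** transpose (vstack 0 (mat 1) ** S3) + A4 ** transpose A4)"
proof -
  have q: "x \<bullet> ((A ** transpose A) *v x) = (norm (transpose A *v x))\<^sup>2" for A :: "real^'r^'m" and x
    by (simp only: matrix_vector_mul_assoc[symmetric] inner_matrix_transpose[of x A] power2_norm_eq_inner)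
  have tg: "transpose (A ** transpose A) = A ** transpose A" for A :: "real^'r^'m"
    by (simp only: matrix_transpose_mul transpose_transpose)
  have ta: "transpose (A + B) = transpose A + transpose B" for A B :: "real^'r^'m" by (simp add: transpose_def vec_eq_iff)
  define A2 where "A2 = (vstack (mat 1) 0 :: real^'p1^('p1 + 'p2)) ** S2"
  define A3 where "A3 = (vstack 0 (mat 1) :: real^'p2^('p1 + 'p2)) ** S3"
  have n2: "transpose A2 *v x = transpose S2 *v (\<chi> a. x $ Inl a)" for x
  proof -
    have "A2 $ i $ j = (case i of Inl a \<Rightarrow> S2 $ a $ j | Inr b \<Rightarrow> 0)" for i j
      unfolding A2_def vstack_mult matrix_mul_lid by (simp add: vstack_def matrix_matrix_mult_def split: sum.split)
    then show ?thesis
      by (simp add: vec_eq_iff matrix_vector_mult_def transpose_def UNIV_Plus_UNIV[symmetric] sum.Plus del: UNIV_Plus_UNIV)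
  qed
  have n3: "transpose A3 *v x = transpose S3 *v (\<chi> a. x $ Inr a)" for x
  proof -
    have "A3 $ i $ j = (case i of Inl a \<Rightarrow> 0 | Inr b \<Rightarrow> S3 $ b $ j)" for i j
      unfolding A3_def vstack_mult matrix_mul_lid by (simp add: vstack_def matrix_matrix_mult_def split: sum.split)
    then show ?thesis
      by (simp add: vec_eq_iff matrix_vector_mult_def transpose_def UNIV_Plus_UNIV[symmetric] sum.Plus del: UNIV_Plus_UNIV)
  qed
  show ?thesis
    unfolding A2_def[symmetric] A3_def[symmetric] pos_def_def
  proof (intro conjI allI impI)
    show "transpose (A1 ** transpose A1 + A2 ** transpose A2 + A3 ** transpose A3 + A4 ** transpose A4) =
      A1 ** transpose A1 + A2 ** transpose A2 + A3 ** transpose A3 + A4 ** transpose A4"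
      by (simp only: ta tg)
    fix x :: "real^('p1 + 'p2)" assume x: "x \<noteq> 0"
    have e: "x \<bullet> ((A1 ** transpose A1 + A2 ** transpose A2 + A3 ** transpose A3 + A4 ** transpose A4) *v x) =
       (norm (transpose A1 *v x))\<^sup>2 + (norm (transpose A2 *v x))\<^sup>2 + (norm (transpose A3 *v x))\<^sup>2 + (norm (transpose A4 *v x))\<^sup>2"
      by (simp only: matrix_vector_mult_add_rdistrib inner_add_right q)
    have "(\<chi> a. x $ Inl a) \<noteq> (0 :: real^'p1) \<or> (\<chi> a. x $ Inr a) \<noteq> (0 :: real^'p2)"
    proof (rule ccontr)
      assume "\<not> ?thesis"
      then have "x $ Inl a = 0" "x $ Inr b = 0" for a b by (simp_all add: vec_eq_iff)
      then have "x $ i = 0" for i by (cases i) simp_all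
      then show False using x by (simp add: vec_eq_iff)
    qed
    then have "(norm (transpose A2 *v x))\<^sup>2 > 0 \<or> (norm (transpose A3 *v x))\<^sup>2 > 0"
      unfolding n2 n3 q[symmetric] using assms unfolding pos_def_def by blast
    then show "x \<bullet> ((A1 ** transpose A1 + A2 ** transpose A2 + A3 ** transpose A3 + A4 ** transpose A4) *v x) > 0"
      unfolding e using zero_le_power2[of "norm (transpose A1 *v x)"] zero_le_power2[of "norm (transpose A2 *v x)"]
        zero_le_power2[of "norm (transpose A3 *v x)"] zero_le_power2[of "norm (transpose A4 *v x)"] by linarith
  qed
qed

lemma covariance_structure_differentiable:
  fixes L1 :: "real^'q \<Rightarrow> real^'k1^'p1" and L2 :: "real^'q \<Rightarrow> real^'k2^'p2"
    and \<Gamma> :: "real^'q \<Rightarrow> real^'k1^'k2" and \<Psi> :: "real^'q \<Rightarrow> real^'k2^'k2"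
    and Sxi :: "real^'q \<Rightarrow> real^'k1^'k1" and Sdelta :: "real^'q \<Rightarrow> real^'p1^'p1"
    and Seps :: "real^'q \<Rightarrow> real^'p2^'p2" and Szeta :: "real^'q \<Rightarrow> real^'k2^'k2"
  assumes p: "param_matrix L1" "param_matrix L2" "param_matrix \<Gamma>" "param_matrix \<Psi>"
      "param_matrix Sxi" "param_matrix Sdelta" "param_matrix Seps" "param_matrix Szeta"
    and inv: "invertible (\<Psi> \<theta>)"
  shows "(\<lambda>\<theta>. covariance_structure (L1 \<theta>) (L2 \<theta>) (\<Gamma> \<theta>) (\<Psi> \<theta>) (Sxi \<theta>) (Sdelta \<theta>) (Seps \<theta>) (Szeta \<theta>)) differentiable at \<theta>"
proof (rule differentiable_matrixI)
  fix i j
  note d = param_matrix_differentiable[OF p(1)] param_matrix_differentiable[OF p(2)] param_matrix_differentiable[OF p(3)]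
    param_matrix_differentiable[OF p(5)] param_matrix_differentiable[OF p(6)] param_matrix_differentiable[OF p(7)]
    param_matrix_differentiable[OF p(8)]
    differentiable_matrix_inv[OF param_matrix_differentiable[OF p(4)] param_matrix_continuous[OF p(4)] inv]
  have S12: "(\<lambda>\<theta>. L1 \<theta> ** Sxi \<theta> ** transpose (\<Gamma> \<theta>) ** transpose (matrix_inv (\<Psi> \<theta>)) ** transpose (L2 \<theta>)) differentiable at \<theta>"
    by (intro differentiable_matrix_mult differentiable_transpose d)
  have S11: "(\<lambda>\<theta>. L1 \<theta> ** Sxi \<theta> ** transpose (L1 \<theta>) + Sdelta \<theta>) differentiable at \<theta>"
    by (intro differentiable_add differentiable_matrix_mult differentiable_transpose d)
  have S22: "(\<lambda>\<theta>. L2 \<theta> ** matrix_inv (\<Psi> \<theta>) ** (\<Gamma> \<theta> ** Sxi \<theta> ** transpose (\<Gamma> \<theta>) + Szeta \<theta>)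
      ** transpose (matrix_inv (\<Psi> \<theta>)) ** transpose (L2 \<theta>) + Seps \<theta>) differentiable at \<theta>"
    by (intro differentiable_add differentiable_matrix_mult differentiable_transpose d)
  show "(\<lambda>\<theta>. covariance_structure (L1 \<theta>) (L2 \<theta>) (\<Gamma> \<theta>) (\<Psi> \<theta>) (Sxi \<theta>) (Sdelta \<theta>) (Seps \<theta>) (Szeta \<theta>) $ i $ j) differentiable at \<theta>"
    unfolding covariance_structure_def Let_def block_matrix_def
    by (cases i; cases j)
      (simp_all only: vec_lambda_beta sum.case,
       intro differentiable_matrix_nth S11 S12 S22 differentiable_transpose[OF S12] | (intro differentiable_matrix_nth differentiable_transpose S11 S12 S22))+
qed

text \<open>A continuous drift makes the density \<open>b (Y s \<omega>)\<close> continuous along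
  almost every path, and the matrix \<open>P\<close> passes through the integral.\<close>

lemma sde_drift_decomposition:
  fixes P :: "real^'d^'p" and S :: "real^'r^'d"
  assumes sde: "sde_solution M T b S W y0 Y" and b: "continuous_on UNIV b"
  shows "AE \<omega> in M. \<exists>\<beta>. continuous_on {0..T} \<beta> \<and> (\<forall>t\<in>{0..T}. P *v Y t \<omega> = P *v y0 + integral {0..t} \<beta> + (P ** S) *v W t \<omega>)"
proof -
  have "AE \<omega> in M. continuous_on {0..T} (\<lambda>t. Y t \<omega>) \<and>
        (\<forall>t\<in>{0..T}. Y t \<omega> = y0 + integral {0..t} (\<lambda>s. b (Y s \<omega>)) + S *v W t \<omega>)"
    using sde unfolding sde_solution_def by blast
  then show ?thesis
  proof eventually_elim
    case (elim \<omega>)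
    have c: "continuous_on {0..T} (\<lambda>s. b (Y s \<omega>))"
      using continuous_on_compose2[OF b conjunct1[OF elim]] by simp
    have bl: "bounded_linear ((*v) P)" by (rule matrix_vector_mul_bounded_linear)
    show ?case
    proof (intro exI[of _ "\<lambda>s. P *v b (Y s \<omega>)"] conjI ballI)
      show "continuous_on {0..T} (\<lambda>s. P *v b (Y s \<omega>))" by (rule bounded_linear.continuous_on[OF bl c])
      fix t assume t: "t \<in> {0..T}"
      have "(\<lambda>s. b (Y s \<omega>)) integrable_on {0..t}"
        using t by (intro integrable_continuous_real continuous_on_subset[OF c]) auto
      from integral_linear[OF this bl] have i: "integral {0..t} (\<lambda>s. P *v b (Y s \<omega>)) = P *v integral {0..t} (\<lambda>s. b (Y s \<omega>))"
        by (simp add: o_def)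
      have "Y t \<omega> = y0 + integral {0..t} (\<lambda>s. b (Y s \<omega>)) + S *v W t \<omega>" using elim t by blast
      then show "P *v Y t \<omega> = P *v y0 + integral {0..t} (\<lambda>s. P *v b (Y s \<omega>)) + (P ** S) *v W t \<omega>"
        unfolding i by (simp only: matrix_vector_right_distrib matrix_vector_mul_assoc)
    qed
  qed
qed

lemma standard_wiener_continuous:
  "standard_wiener M T W \<Longrightarrow> AE \<omega> in M. continuous_on {0..T} (\<lambda>t. W t \<omega>)"
  unfolding standard_wiener_def by (elim conjE, elim eventually_mono) simp

text \<open>Solving the structural equation for \<open>\<eta>\<close> by the inverse of
  \<open>\<Psi>\<close> writes \<open>X\<close> as a sum of matrix images of the latent processes.
  The matrices \<open>P1\<close> to \<open>P4\<close> are those in the factorization of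
  \<open>\<Sigma> \<theta>0\<close>, so the Gaussian part of \<open>X\<close> has this matrix as its
  covariance per unit of time.\<close>

theorem theorem6:
  fixes M :: "'w measure"
    and T :: real
    and \<Theta> :: "(real^'q) set" and \<theta>0 :: "real^'q"
    and L1 :: "real^'q \<Rightarrow> real^'k1^'p1" and L2 :: "real^'q \<Rightarrow> real^'k2^'p2"
    and \<Gamma> :: "real^'q \<Rightarrow> real^'k1^'k2" and B0 \<Psi> :: "real^'q \<Rightarrow> real^'k2^'k2"
    and Sxi :: "real^'q \<Rightarrow> real^'k1^'k1" and Sdelta :: "real^'q \<Rightarrow> real^'p1^'p1"
    and Seps :: "real^'q \<Rightarrow> real^'p2^'p2" and Szeta :: "real^'q \<Rightarrow> real^'k2^'k2"
    and S1 :: "real^'q \<Rightarrow> real^'r1^'k1" and S2 :: "real^'q \<Rightarrow> real^'r2^'p1"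
    and S3 :: "real^'q \<Rightarrow> real^'r3^'p2" and S4 :: "real^'q \<Rightarrow> real^'r4^'k2"
    and \<Sigma> :: "real^'q \<Rightarrow> real^('p1 + 'p2)^('p1 + 'p2)"
    and \<Delta> :: "real^'q^(('p1::finite + 'p2::finite) uprod)"
    and W1 :: "real \<Rightarrow> 'w \<Rightarrow> real^'r1" and W2 :: "real \<Rightarrow> 'w \<Rightarrow> real^'r2"
    and W3 :: "real \<Rightarrow> 'w \<Rightarrow> real^'r3" and W4 :: "real \<Rightarrow> 'w \<Rightarrow> real^'r4"
    and B1 :: "real^'k1 \<Rightarrow> real^'k1" and B2 :: "real^'p1 \<Rightarrow> real^'p1"
    and B3 :: "real^'p2 \<Rightarrow> real^'p2" and B4 :: "real^'k2 \<Rightarrow> real^'k2"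
    and xi0 :: "real^'k1" and delta0 :: "real^'p1" and eps0 :: "real^'p2" and zeta0 :: "real^'k2"
    and \<xi> :: "real \<Rightarrow> 'w \<Rightarrow> real^'k1" and \<delta> :: "real \<Rightarrow> 'w \<Rightarrow> real^'p1"
    and \<epsilon> :: "real \<Rightarrow> 'w \<Rightarrow> real^'p2" and \<zeta> \<eta> :: "real \<Rightarrow> 'w \<Rightarrow> real^'k2"
    and X :: "real \<Rightarrow> 'w \<Rightarrow> real^('p1 + 'p2)"
    and \<theta>hat :: "nat \<Rightarrow> 'w \<Rightarrow> real^'q"
  assumes dims: "CARD('k1) \<le> CARD('p1)" "CARD('k2) \<le> CARD('p2)"
    and Theta: "convex \<Theta>" "compact \<Theta>" "\<theta>0 \<in> \<Theta>"
    and param: "param_matrix L1" "param_matrix L2" "param_matrix \<Gamma>" "param_matrix \<Psi>"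
      "param_matrix Sxi" "param_matrix Sdelta" "param_matrix Seps" "param_matrix Szeta"
    and collects: "free_coords L1 \<union> free_coords L2 \<union> free_coords \<Gamma> \<union> free_coords \<Psi> \<union>
      free_coords Sxi \<union> free_coords Sdelta \<union> free_coords Seps \<union> free_coords Szeta = UNIV"
    and Psi: "\<forall>\<theta>. \<Psi> \<theta> = mat 1 - B0 \<theta>" "\<forall>\<theta> i. B0 \<theta> $ i $ i = 0"
    and sym: "\<forall>\<theta>. transpose (Sxi \<theta>) = Sxi \<theta>" "\<forall>\<theta>. transpose (Sdelta \<theta>) = Sdelta \<theta>"
      "\<forall>\<theta>. transpose (Seps \<theta>) = Seps \<theta>" "\<forall>\<theta>. transpose (Szeta \<theta>) = Szeta \<theta>"
    and vol: "\<forall>\<theta>\<in>\<Theta>. Sxi \<theta> = S1 \<theta> ** transpose (S1 \<theta>)"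
      "\<forall>\<theta>\<in>\<Theta>. Sdelta \<theta> = S2 \<theta> ** transpose (S2 \<theta>)"
      "\<forall>\<theta>\<in>\<Theta>. Seps \<theta> = S3 \<theta> ** transpose (S3 \<theta>)"
      "\<forall>\<theta>\<in>\<Theta>. Szeta \<theta> = S4 \<theta> ** transpose (S4 \<theta>)"
    and Sigma: "\<forall>\<theta>. \<Sigma> \<theta> = covariance_structure (L1 \<theta>) (L2 \<theta>) (\<Gamma> \<theta>) (\<Psi> \<theta>)
      (Sxi \<theta>) (Sdelta \<theta>) (Seps \<theta>) (Szeta \<theta>)"
    and Delta: "\<Delta> = jacobian (\<lambda>\<theta>. vech (\<Sigma> \<theta>)) (at \<theta>0)"
    and T: "T > 0"
    and prob: "prob_space M"
    and wiener: "standard_wiener M T W1" "standard_wiener M T W2"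
      "standard_wiener M T W3" "standard_wiener M T W4"
    and indep: "prob_space.indep_sets M
      (\<lambda>i. [generated_events M W1 {0..T}, generated_events M W2 {0..T},
            generated_events M W3 {0..T}, generated_events M W4 {0..T}] ! i) {..<4}"
    and sde: "sde_solution M T B1 (S1 \<theta>0) W1 xi0 \<xi>" "sde_solution M T B2 (S2 \<theta>0) W2 delta0 \<delta>"
      "sde_solution M T B3 (S3 \<theta>0) W3 eps0 \<epsilon>" "sde_solution M T B4 (S4 \<theta>0) W4 zeta0 \<zeta>"
    and eta: "\<forall>\<omega>\<in>space M. \<forall>t\<in>{0..T}. \<eta> t \<omega> = B0 \<theta>0 *v \<eta> t \<omega> + \<Gamma> \<theta>0 *v \<xi> t \<omega> + \<zeta> t \<omega>"
    and obs: "\<forall>\<omega>\<in>space M. \<forall>t\<in>{0..T}.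
      X t \<omega> = stack (L1 \<theta>0 *v \<xi> t \<omega> + \<delta> t \<omega>) (L2 \<theta>0 *v \<eta> t \<omega> + \<epsilon> t \<omega>)"
    and estimator: "\<forall>n>0. \<theta>hat n \<in> borel_measurable M"
      "\<forall>n>0. \<forall>\<omega>\<in>space M. \<theta>hat n \<omega> \<in> \<Theta> \<and>
         contrast (realized_cov T n (\<lambda>t. X t \<omega>)) (\<Sigma> (\<theta>hat n \<omega>)) =
         (INF \<theta>\<in>\<Theta>. contrast (realized_cov T n (\<lambda>t. X t \<omega>)) (\<Sigma> \<theta>))"
    and drift_lipschitz: "\<exists>L. L-lipschitz_on UNIV B1" "\<exists>L. L-lipschitz_on UNIV B2"
      "\<exists>L. L-lipschitz_on UNIV B3" "\<exists>L. L-lipschitz_on UNIV B4"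
    and drift_C4: "C_up 4 B1" "C_up 4 B2" "C_up 4 B3" "C_up 4 B4"
    and moments: "bounded_moments M T \<xi>" "bounded_moments M T \<delta>"
      "bounded_moments M T \<epsilon>" "bounded_moments M T \<zeta>"
    and nondegenerate: "\<forall>\<theta>\<in>\<Theta>. pos_def (Sdelta \<theta>)" "\<forall>\<theta>\<in>\<Theta>. pos_def (Seps \<theta>)"
      "\<forall>\<theta>\<in>\<Theta>. invertible (\<Psi> \<theta>)" "\<forall>\<theta>\<in>\<Theta>. rank (L1 \<theta>) = CARD('k1)"
    and identifiable: "\<forall>\<theta>\<in>\<Theta>. \<forall>\<theta>'\<in>\<Theta>. \<Sigma> \<theta> = \<Sigma> \<theta>' \<longrightarrow> \<theta> = \<theta>'"
    and full_rank: "rank \<Delta> = CARD('q)"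
  shows "converges_in_prob M \<theta>hat \<theta>0 \<and>
    (\<theta>0 \<in> interior \<Theta> \<longrightarrow>
      converges_in_dist M (\<lambda>n \<omega>. sqrt (real n) *\<^sub>R (\<theta>hat n \<omega> - \<theta>0))
        (multi_normal 0 (matrix_inv (transpose \<Delta> ** matrix_inv (W_mat (\<Sigma> \<theta>0)) ** \<Delta>))))"
proof -
  interpret prob_space M by (rule prob)
  let ?K = "L2 \<theta>0 ** matrix_inv (\<Psi> \<theta>0)"
  define P1 where "P1 = vstack (L1 \<theta>0) (?K ** \<Gamma> \<theta>0)"
  define P2 where "P2 = (vstack (mat 1) 0 :: real^'p1^('p1 + 'p2))"
  define P3 where "P3 = (vstack 0 (mat 1) :: real^'p2^('p1 + 'p2))"
  define P4 where "P4 = (vstack 0 ?K :: real^'k2^('p1 + 'p2))"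
  define A1 where "A1 = P1 ** S1 \<theta>0"
  define A2 where "A2 = P2 ** S2 \<theta>0"
  define A3 where "A3 = P3 ** S3 \<theta>0"
  define A4 where "A4 = P4 ** S4 \<theta>0"
  have invP: "invertible (\<Psi> \<theta>)" if "\<theta> \<in> \<Theta>" for \<theta> using nondegenerate(3) that by blast
  have t0: "\<theta>0 \<in> \<Theta>" by (rule Theta(3))
  have fac: "\<Sigma> \<theta> = (vstack (L1 \<theta>) (L2 \<theta> ** matrix_inv (\<Psi> \<theta>) ** \<Gamma> \<theta>) ** S1 \<theta>) ** transpose (vstack (L1 \<theta>) (L2 \<theta> ** matrix_inv (\<Psi> \<theta>) ** \<Gamma> \<theta>) ** S1 \<theta>)
     + (vstack (mat 1) 0 ** S2 \<theta>) ** transpose (vstack (mat 1) 0 ** S2 \<theta>) + (vstack 0 (mat 1) ** S3 \<theta>) ** transpose (vstack 0 (mat 1) ** S3 \<theta>)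
     + (vstack 0 (L2 \<theta> ** matrix_inv (\<Psi> \<theta>)) ** S4 \<theta>) ** transpose (vstack 0 (L2 \<theta> ** matrix_inv (\<Psi> \<theta>)) ** S4 \<theta>)"
    if t: "\<theta> \<in> \<Theta>" for \<theta>
  proof -
    have "Sxi \<theta> = S1 \<theta> ** transpose (S1 \<theta>)" "Sdelta \<theta> = S2 \<theta> ** transpose (S2 \<theta>)"
      "Seps \<theta> = S3 \<theta> ** transpose (S3 \<theta>)" "Szeta \<theta> = S4 \<theta> ** transpose (S4 \<theta>)"
      using vol t by blast+
    then show ?thesis
      using Sigma by (simp only: covariance_structure_factorization)
  qed
  have pd: "pos_def (\<Sigma> \<theta>)" if t: "\<theta> \<in> \<Theta>" for \<theta>
  proof -
    have "Sdelta \<theta> = S2 \<theta> ** transpose (S2 \<theta>)" "Seps \<theta> = S3 \<theta> ** transpose (S3 \<theta>)"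
      "pos_def (Sdelta \<theta>)" "pos_def (Seps \<theta>)"
      using vol nondegenerate t by blast+
    then have "pos_def (S2 \<theta> ** transpose (S2 \<theta>))" "pos_def (S3 \<theta> ** transpose (S3 \<theta>))" by (simp_all only:)
    then show ?thesis unfolding fac[OF t] by (rule pos_def_sum_gram)
  qed
  have S0: "\<Sigma> \<theta>0 = A1 ** transpose A1 + A2 ** transpose A2 + A3 ** transpose A3 + A4 ** transpose A4"
    unfolding fac[OF t0] A1_def A2_def A3_def A4_def P1_def P2_def P3_def P4_def ..
  \<comment> \<open>The model matrices are functions on the whole parameter space and the
    determinant of \<open>\<Psi>\<close> stays nonzero near a point of \<open>\<Theta>\<close>, so
    this is a full derivative also at boundary points of \<open>\<Theta>\<close>.\<close>
  have dS: "\<Sigma> differentiable at \<theta>" if "\<theta> \<in> \<Theta>" for \<theta>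
  proof -
    have "\<Sigma> = (\<lambda>\<theta>. covariance_structure (L1 \<theta>) (L2 \<theta>) (\<Gamma> \<theta>) (\<Psi> \<theta>) (Sxi \<theta>) (Sdelta \<theta>) (Seps \<theta>) (Szeta \<theta>))"
      using Sigma by blast
    then show ?thesis using covariance_structure_differentiable[OF param invP[OF that]] by simp
  qed
  have cS: "continuous_on \<Theta> \<Sigma>"
    by (intro continuous_at_imp_continuous_on ballI differentiable_imp_continuous_within dS)
  have D: "((\<lambda>\<theta>. vech (\<Sigma> \<theta>)) has_derivative ((*v) \<Delta>)) (at \<theta>0)"
  proof -
    obtain D where "(\<Sigma> has_derivative D) (at \<theta>0)" using dS[OF t0] unfolding differentiable_def by blast
    then have "((\<lambda>\<theta>. vech (\<Sigma> \<theta>)) has_derivative (\<lambda>h. vech (D h))) (at \<theta>0)"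
      by (rule bounded_linear.has_derivative[OF linear_conv_bounded_linear[THEN iffD1, OF linear_vech]])
    then have "(\<lambda>\<theta>. vech (\<Sigma> \<theta>)) differentiable at \<theta>0" unfolding differentiable_def by blast
    then show ?thesis unfolding jacobian_works Delta .
  qed
  have injD: "inj ((*v) \<Delta>)" using full_rank by (simp add: full_rank_injective)
  have inj: "inj_on \<Sigma> \<Theta>" using identifiable by (intro inj_onI) blast
  \<comment> \<open>The Wiener processes have different dimensions and form no family of one type;
    after multiplication by \<open>A1\<close> to \<open>A4\<close> they all take values in the
    observation space and can be indexed.\<close>
  define V where "V = (\<lambda>j. [\<lambda>t \<omega>. A1 *v W1 t \<omega>, \<lambda>t \<omega>. A2 *v W2 t \<omega>, \<lambda>t \<omega>. A3 *v W3 t \<omega>, \<lambda>t \<omega>. A4 *v W4 t \<omega>] ! j)"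
  define C where "C = (\<lambda>j. [A1 ** transpose A1, A2 ** transpose A2, A3 ** transpose A3, A4 ** transpose A4] ! j)"
  define Gs where "Gs = (\<lambda>j. [generated_events M W1 {0..T}, generated_events M W2 {0..T}, generated_events M W3 {0..T}, generated_events M W4 {0..T}] ! j)"
  have V4: "(\<Sum>j<4. V j t \<omega>) = A1 *v W1 t \<omega> + A2 *v W2 t \<omega> + A3 *v W3 t \<omega> + A4 *v W4 t \<omega>" for t \<omega>
    unfolding sum_lessThan_4 V_def by simp
  have gi: "gaussian_increments M T (Gs j) (V j) (C j)" if "j < 4" for j
  proof -
    from that consider "j = 0" | "j = 1" | "j = 2" | "j = 3" by linarith
    then show ?thesis
      by cases (simp_all add: Gs_def V_def C_def wiener_gaussian_increments[OF prob _ T] wiener)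
  qed
  have SC: "\<Sigma> \<theta>0 = (\<Sum>j<4. C j)" unfolding sum_lessThan_4 S0 C_def by simp
  have X: "X t \<omega> = P1 *v \<xi> t \<omega> + P2 *v \<delta> t \<omega> + P3 *v \<epsilon> t \<omega> + P4 *v \<zeta> t \<omega>" if w: "\<omega> \<in> space M" and t: "t \<in> {0..T}" for \<omega> t
  proof -
    have "\<Psi> \<theta>0 *v \<eta> t \<omega> = \<eta> t \<omega> - B0 \<theta>0 *v \<eta> t \<omega>"
      using Psi(1) by (simp add: matrix_vector_mult_diff_rdistrib)
    also have "\<dots> = \<Gamma> \<theta>0 *v \<xi> t \<omega> + \<zeta> t \<omega>"
    proof -
      have "\<eta> t \<omega> = B0 \<theta>0 *v \<eta> t \<omega> + \<Gamma> \<theta>0 *v \<xi> t \<omega> + \<zeta> t \<omega>" using eta w t by blast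
      then have "\<eta> t \<omega> - B0 \<theta>0 *v \<eta> t \<omega> = (B0 \<theta>0 *v \<eta> t \<omega> + \<Gamma> \<theta>0 *v \<xi> t \<omega> + \<zeta> t \<omega>) - B0 \<theta>0 *v \<eta> t \<omega>" by (rule arg_cong)
      then show ?thesis by simp
    qed
    finally have "matrix_inv (\<Psi> \<theta>0) *v (\<Psi> \<theta>0 *v \<eta> t \<omega>) = matrix_inv (\<Psi> \<theta>0) *v (\<Gamma> \<theta>0 *v \<xi> t \<omega> + \<zeta> t \<omega>)" by (rule arg_cong)
    then have e: "\<eta> t \<omega> = matrix_inv (\<Psi> \<theta>0) *v (\<Gamma> \<theta>0 *v \<xi> t \<omega> + \<zeta> t \<omega>)"
      by (simp only: matrix_vector_mul_assoc invertible_matrix_inv[OF invP[OF t0]] matrix_vector_mul_lid)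
    have L: "L2 \<theta>0 *v \<eta> t \<omega> = (?K ** \<Gamma> \<theta>0) *v \<xi> t \<omega> + ?K *v \<zeta> t \<omega>"
      unfolding e by (simp only: matrix_vector_right_distrib matrix_vector_mul_assoc matrix_mul_assoc)
    have "X t \<omega> = stack (L1 \<theta>0 *v \<xi> t \<omega> + \<delta> t \<omega>) (L2 \<theta>0 *v \<eta> t \<omega> + \<epsilon> t \<omega>)" using obs w t by blast
    then show ?thesis
      unfolding P1_def P2_def P3_def P4_def vstack_mult_vec stack_add L by (simp add: add_ac)
  qed
  have mY: "\<xi> t \<in> borel_measurable M" "\<delta> t \<in> borel_measurable M" "\<epsilon> t \<in> borel_measurable M" "\<zeta> t \<in> borel_measurable M"
    if "t \<in> {0..T}" for t
    using sde that unfolding sde_solution_def by blast+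
  have mX: "X t \<in> borel_measurable M" if t: "t \<in> {0..T}" for t
  proof -
    have "(\<lambda>\<omega>. P1 *v \<xi> t \<omega> + P2 *v \<delta> t \<omega> + P3 *v \<epsilon> t \<omega> + P4 *v \<zeta> t \<omega>) \<in> borel_measurable M"
      by (intro borel_measurable_add measurable_compose[OF _ borel_measurable_matrix_vector_mult] mY t)
    then show ?thesis by (subst measurable_cong[OF X[OF _ t]])
  qed
  have cB: "continuous_on UNIV B1" "continuous_on UNIV B2" "continuous_on UNIV B3" "continuous_on UNIV B4"
    using drift_lipschitz lipschitz_on_continuous_on by blast+
  have dec: "AE \<omega> in M. continuous_on {0..T} (\<lambda>t. \<Sum>j<4. V j t \<omega>) \<and>
      (\<exists>b c. continuous_on {0..T} b \<and> (\<forall>t\<in>{0..T}. X t \<omega> = c + integral {0..t} b + (\<Sum>j<4. V j t \<omega>)))"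
    using sde_drift_decomposition[OF sde(1) cB(1), of P1] sde_drift_decomposition[OF sde(2) cB(2), of P2]
      sde_drift_decomposition[OF sde(3) cB(3), of P3] sde_drift_decomposition[OF sde(4) cB(4), of P4]
      standard_wiener_continuous[OF wiener(1)] standard_wiener_continuous[OF wiener(2)]
      standard_wiener_continuous[OF wiener(3)] standard_wiener_continuous[OF wiener(4)] AE_space
    unfolding A1_def[symmetric] A2_def[symmetric] A3_def[symmetric] A4_def[symmetric]
  proof eventually_elim
    case (elim \<omega>)
    obtain \<beta>1 where b1: "continuous_on {0..T} \<beta>1" "\<And>t. t \<in> {0..T} \<Longrightarrow> P1 *v \<xi> t \<omega> = P1 *v xi0 + integral {0..t} \<beta>1 + A1 *v W1 t \<omega>"
      using elim(1) by blast
    obtain \<beta>2 where b2: "continuous_on {0..T} \<beta>2" "\<And>t. t \<in> {0..T} \<Longrightarrow> P2 *v \<delta> t \<omega> = P2 *v delta0 + integral {0..t} \<beta>2 + A2 *v W2 t \<omega>"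
      using elim(2) by blast
    obtain \<beta>3 where b3: "continuous_on {0..T} \<beta>3" "\<And>t. t \<in> {0..T} \<Longrightarrow> P3 *v \<epsilon> t \<omega> = P3 *v eps0 + integral {0..t} \<beta>3 + A3 *v W3 t \<omega>"
      using elim(3) by blast
    obtain \<beta>4 where b4: "continuous_on {0..T} \<beta>4" "\<And>t. t \<in> {0..T} \<Longrightarrow> P4 *v \<zeta> t \<omega> = P4 *v zeta0 + integral {0..t} \<beta>4 + A4 *v W4 t \<omega>"
      using elim(4) by blast
    show ?case
    proof (intro conjI exI ballI)
      show "continuous_on {0..T} (\<lambda>t. \<Sum>j<4. V j t \<omega>)"
        unfolding V4 by (intro continuous_on_add bounded_linear.continuous_on[OF matrix_vector_mul_bounded_linear] elim)
      show "continuous_on {0..T} (\<lambda>s. \<beta>1 s + \<beta>2 s + \<beta>3 s + \<beta>4 s)" by (intro continuous_on_add b1 b2 b3 b4)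
      fix t assume t: "t \<in> {0..T}"
      have i: "\<beta>1 integrable_on {0..t}" "\<beta>2 integrable_on {0..t}" "\<beta>3 integrable_on {0..t}" "\<beta>4 integrable_on {0..t}"
        by (rule integrable_continuous_real, rule continuous_on_subset, rule b1 b2 b3 b4, use t in simp)+
      have "integral {0..t} (\<lambda>s. \<beta>1 s + \<beta>2 s + \<beta>3 s + \<beta>4 s) = integral {0..t} \<beta>1 + integral {0..t} \<beta>2 + integral {0..t} \<beta>3 + integral {0..t} \<beta>4"
        by (simp add: Henstock_Kurzweil_Integration.integral_add integrable_add i)
      then show "X t \<omega> = (P1 *v xi0 + P2 *v delta0 + P3 *v eps0 + P4 *v zeta0) +
          integral {0..t} (\<lambda>s. \<beta>1 s + \<beta>2 s + \<beta>3 s + \<beta>4 s) + (\<Sum>j<4. V j t \<omega>)"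
        unfolding X[OF elim(9) t] V4 b1(2)[OF t] b2(2)[OF t] b3(2)[OF t] b4(2)[OF t] by (simp add: add_ac)
    qed
  qed
  have ind: "indep_sets Gs {..<4}" using indep unfolding Gs_def .
  obtain Z where Z: "\<And>n. n > 0 \<Longrightarrow> Z n \<in> borel_measurable M"
    "converges_in_dist M Z (multi_normal 0 (W_mat (\<Sigma> \<theta>0)))"
    "\<And>t. (\<lambda>n. CLINT \<omega>|M. iexp (t \<bullet> Z n \<omega>)) \<longlonglongrightarrow> exp (- (t \<bullet> (W_mat (\<Sigma> \<theta>0) *v t)) / 2)"
    "\<And>e. e > 0 \<Longrightarrow> whp M (\<lambda>n \<omega>. norm (sqrt (real n) *\<^sub>R (vech (realized_cov T n (\<lambda>t. X t \<omega>)) - vech (\<Sigma> \<theta>0)) - Z n \<omega>) \<le> e)"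
    using realized_cov_clt[OF prob T zero_less_numeral gi ind SC pd[OF t0] mX dec] by blast
  have mh: "\<theta>hat n \<in> borel_measurable M" if "n > 0" for n using estimator(1) that by blast
  have est: "\<theta>hat n \<omega> \<in> \<Theta> \<and> contrast (realized_cov T n (\<lambda>t. X t \<omega>)) (\<Sigma> (\<theta>hat n \<omega>)) =
         (INF \<theta>\<in>\<Theta>. contrast (realized_cov T n (\<lambda>t. X t \<omega>)) (\<Sigma> \<theta>))" if "n > 0" "\<omega> \<in> space M" for n \<omega>
    using estimator(2) that by blast
  note mce = minimum_contrast_estimator[where Q="\<lambda>n \<omega>. realized_cov T n (\<lambda>t. X t \<omega>)" and \<theta>hat=\<theta>hat and Z=Z and \<Sigma>=\<Sigma> and \<Delta>=\<Delta>,
      OF prob Theta(2) t0 cS _ inj D injD _ Z(2,3) transpose_realized_cov]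
  show ?thesis
  proof (intro conjI impI)
    show "converges_in_prob M \<theta>hat \<theta>0"
      by (rule mce(1)) (erule pd Z(1) Z(4) mh | erule (1) est)+
    assume "\<theta>0 \<in> interior \<Theta>"
    then show "converges_in_dist M (\<lambda>n \<omega>. sqrt (real n) *\<^sub>R (\<theta>hat n \<omega> - \<theta>0))
        (multi_normal 0 (matrix_inv (transpose \<Delta> ** matrix_inv (W_mat (\<Sigma> \<theta>0)) ** \<Delta>)))"
      by (rule mce(2)[rotated -1]) (erule pd Z(1) Z(4) mh | erule (1) est)+
  qed
qed

end
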